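(* For every $\lambda\in[0,1]$, the expected number $E_\lambda$ of real lines on the zero set $Z(P_\lambda)\subset\mathbb{R}\mathrm{P}^3$ of the random cubic polynomial $P_\lambda$ equals $$E_\lambda=\frac{9\left(8\lambda^2+(1-\lambda)^2\right)}{2\lambda^2+(1-\lambda)^2}\left(\frac{2\lambda^2}{8\lambda^2+(1-\lambda)^2}-\frac{1}{3}+\frac{2}{3}\sqrt{\frac{8\lambda^2+(1-\lambda)^2}{20\lambda^2+(1-\lambda)^2}}\right).$$
   Context: Let $W=\mathbb{R}[x_0,\ldots,x_3]_{(3)}$ be the space of real homogeneous polynomials of degree $3$ in $x=(x_0,\ldots,x_3)$. Let $\mathcal{H}_d$ be the space of real homogeneous harmonic polynomials of degree $d$ in $x_0,\ldots,x_3$ (those $H$ with $\Delta H=0$, $\Delta$ the Euclidean Laplacian on $\mathbb{R}^4$), so that $W=\mathcal{H}_3\oplus\|x\|^2\mathcal{H}_1$, with $\dim\mathcal{H}_3=16$, $\dim\mathcal{H}_1=4$. Endow $W$ with the $L^2$ scalar product $$(f,g)_{L^2}=\frac{1}{2\pi^2}\int_{\mathbb{R}^4}f(x)g(x)e^{-\|x\|^2/2}\,dx .$$ Fix a basis $\{H_{3,j}\}_{j=1}^{16}$ of $\mathcal{H}_3$ and a basis $\{H_{1,j}\}_{j=1}^4$ of $\mathcal{H}_1$ such that $\{H_{3,j}\}_{j}$ and $\{\|x\|^2H_{1,j}\}_{j}$ are orthonormal for $(\cdot,\cdot)_{L^2}$. For $\lambda\in[0,1]$ (the limit cases $\lambda=0$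 and $\lambda=1$ of pure harmonics of degree $1$ and $3$ are included) define the random polynomial $$P_\lambda(x)=\lambda\sum_{j=1}^{16}\xi_{3,j}H_{3,j}(x)+(1-\lambda)\sum_{j=1}^{4}\xi_{1,j}\|x\|^2H_{1,j}(x),$$ where all $\xi_{3,j},\xi_{1,j}$ are independent standard Gaussian random variables. For $P\in W$, $Z(P)\subset\mathbb{R}\mathrm{P}^3$ denotes its real projective zero set. A real line on $Z(P)$ is a real projective line contained in $Z(P)$, equivalently a $2$-dimensional linear subspace of $\mathbb{R}^4$ on which $P$ vanishes identically.
   Formalization: The equality is stated for λ in (0,1]; at λ=0, P_0 is ‖x‖² times a linear form, so its zero set contains a plane and infinitely many lines (E_0 is infinite, not 3), and instead E_λ is shown to tend to the formula's value 3 as λ→0+. *)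

theory Defs
  imports "HOL-Probability.Probability"
begin

text \<open>Polynomials on \<open>\<real>\<^sup>4\<close> are represented by their polynomial functions; the indices
  \<open>0, 1, 2, 3\<close> of the coordinates are the elements of the type \<^typ>\<open>4\<close>.\<close>

definition hom_poly :: "nat \<Rightarrow> (real ^ 4 \<Rightarrow> real) set" where
  "hom_poly d = {f. \<exists>c :: (4 \<Rightarrow> nat) \<Rightarrow> real.
     \<forall>x. f x = (\<Sum>\<alpha> | (\<Sum>i\<in>UNIV. \<alpha> i) = d. c \<alpha> * (\<Prod>i\<in>UNIV. (x $ i) ^ \<alpha> i))}"

definition partial_deriv :: "4 \<Rightarrow> (real ^ 4 \<Rightarrow> real) \<Rightarrow> real ^ 4 \<Rightarrow> real" where
  "partial_deriv i f x = deriv (\<lambda>t. f (x + t *\<^sub>R axis i 1)) 0"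

definition laplacian :: "(real ^ 4 \<Rightarrow> real) \<Rightarrow> real ^ 4 \<Rightarrow> real" where
  "laplacian f x = (\<Sum>i\<in>UNIV. partial_deriv i (partial_deriv i f) x)"

definition harmonic_poly :: "nat \<Rightarrow> (real ^ 4 \<Rightarrow> real) set" where
  "harmonic_poly d = {H \<in> hom_poly d. \<forall>x. laplacian H x = 0}"

definition L2_prod :: "(real ^ 4 \<Rightarrow> real) \<Rightarrow> (real ^ 4 \<Rightarrow> real) \<Rightarrow> real" where
  "L2_prod f g =
     1 / (2 * pi\<^sup>2) * (\<integral>x. f x * g x * exp (- (norm x)\<^sup>2 / 2) \<partial>lborel)"

definition fun_basis :: "('a \<Rightarrow> real) set \<Rightarrow> ('i::finite \<Rightarrow> 'a \<Rightarrow> real) \<Rightarrow> bool" where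
  "fun_basis V b \<longleftrightarrow> (\<forall>j. b j \<in> V) \<and>
     (\<forall>f\<in>V. \<exists>!c :: 'i \<Rightarrow> real. f = (\<lambda>x. \<Sum>j\<in>UNIV. c j * b j x))"

definition L2_orthonormal :: "('i \<Rightarrow> real ^ 4 \<Rightarrow> real) \<Rightarrow> bool" where
  "L2_orthonormal b \<longleftrightarrow> (\<forall>i j. L2_prod (b i) (b j) = (if i = j then 1 else 0))"

definition random_cubic ::
  "(16 \<Rightarrow> real ^ 4 \<Rightarrow> real) \<Rightarrow> (4 \<Rightarrow> real ^ 4 \<Rightarrow> real) \<Rightarrow>
   (16 \<Rightarrow> 'w \<Rightarrow> real) \<Rightarrow> (4 \<Rightarrow> 'w \<Rightarrow> real) \<Rightarrow> real \<Rightarrow> 'w \<Rightarrow> real ^ 4 \<Rightarrow> real" where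
  "random_cubic H3 H1 \<xi>3 \<xi>1 l \<omega> x =
     l * (\<Sum>j\<in>UNIV. \<xi>3 j \<omega> * H3 j x) +
     (1 - l) * (\<Sum>j\<in>UNIV. \<xi>1 j \<omega> * ((norm x)\<^sup>2 * H1 j x))"

text \<open>Points of \<open>\<real>P\<^sup>3\<close> are the one-dimensional subspaces of \<open>\<real>\<^sup>4\<close>.\<close>

definition RP3 :: "(real ^ 4) set set" where
  "RP3 = {p. subspace p \<and> dim p = 1}"

definition proj_zero_set :: "(real ^ 4 \<Rightarrow> real) \<Rightarrow> (real ^ 4) set set" where
  "proj_zero_set P = {p \<in> RP3. \<forall>x\<in>p. P x = 0}"

definition proj_lines :: "(real ^ 4) set set set" where
  "proj_lines = {{p \<in> RP3. p \<subseteq> V} | V. subspace V \<and> dim V = 2}"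

definition num_lines :: "(real ^ 4 \<Rightarrow> real) \<Rightarrow> ennreal" where
  "num_lines P = emeasure (count_space UNIV) {L \<in> proj_lines. L \<subseteq> proj_zero_set P}"

definition expected_lines :: "'w measure \<Rightarrow> ('w \<Rightarrow> real ^ 4 \<Rightarrow> real) \<Rightarrow> ennreal" where
  "expected_lines M P = (\<integral>\<^sup>+ \<omega>. num_lines (P \<omega>) \<partial>M)"

text \<open>The case \<open>l = 0\<close> of the count is a limit case only: there the random cubic is
  \<open>\<parallel>x\<parallel>\<^sup>2\<close> times a linear form, so its real zero set contains a projective plane, and
  \<^const>\<open>num_lines\<close> is infinite for every outcome, whereas \<open>lines_formula 0 = 3\<close>.\<close>

definition lines_formula :: "real \<Rightarrow> real" where
  "lines_formula l =
     9 * (8 * l\<^sup>2 + (1 - l)\<^sup>2) / (2 * l\<^sup>2 + (1 - l)\<^sup>2) *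
     (2 * l\<^sup>2 / (8 * l\<^sup>2 + (1 - l)\<^sup>2) - 1 / 3 +
      2 / 3 * sqrt ((8 * l\<^sup>2 + (1 - l)\<^sup>2) / (20 * l\<^sup>2 + (1 - l)\<^sup>2)))"

end

theory Submission
  imports Defs "HOL-Real_Asymp.Real_Asymp"
begin

text \<open>The random cubic is \<open>P(x) = \<eta> \<bullet> b(x)\<close> with a standard Gaussian vector \<open>\<eta>\<close> in \<open>\<real>\<^sup>2\<^sup>0\<close>; since the harmonics
  are orthonormal, \<open>b(x) \<bullet> b(y)\<close> is a combination of \<open>(x \<bullet> y)\<^sup>3\<close> and \<open>\<bar>x\<bar>\<^sup>2 \<bar>y\<bar>\<^sup>2 (x \<bullet> y)\<close>. Feature maps with the
  same Gram kernel differ by an isometry of the coefficient space, which preserves the Gaussian law, so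
  \<open>b\<close> may be replaced by an explicit map \<open>e\<close> and may be precomposed with rotations of \<open>\<real>\<^sup>4\<close>.
  A plane has a unique row reduced basis, and the generic such bases form a chart \<open>A \<in> \<real>\<^sup>4\<close> of the
  Grassmannian. A cubic form vanishes on a plane iff it vanishes at four suitable points of it, so
  the lines in the chart are the zeros \<open>A\<close> of a system of four equations linear in \<open>\<eta>\<close>.
  Solving it for four coordinates of \<open>\<eta>\<close> and applying the area formula to the solution as a function
  of \<open>A\<close> gives the expected number of zeros as the integral of a density (Kac-Rice). By
  rotation invariance this density is a constant times the invariant density of
  the Grassmannian, of mass \<open>2\<pi>\<^sup>2\<close>, and the constant, computed on a coordinate
  plane, is the Gaussian mean of the absolute resultant of two binary quadratic forms. The other Schubert cells
  lie in null sets of rotated charts and contribute nothing.\<close>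

section \<open>Counting measures and the area formula\<close>

text \<open>Two difficulties shape the proof. Solving the system for four fixed coordinates of
  \<eta> breaks down where \<open>det (M A)\<close> vanishes. The chart is therefore cut into
  pieces, each with its own splitting of the coefficient space coming from a rotation, and the
  density must not depend on the splitting; writing it as an integral over the kernel of the system
  shows this. The absolute value of the resultant has a computable mean because the two quadratic
  forms, as vectors of \<real>^3, have a common normal \<open>(1, n)\<close>, and the resultant is a
  square times \<open>a^2 * |n|^2 - s^2\<close>. After the other variables are integrated out,
  \<open>t = |n|^2\<close> remains with weight \<open>(1 + t) powr (-5/2)\<close>; the sign change
  at \<open>s^2 / a^2\<close> produces the square root. With \<open>L = \<lambda>^2\<close> and
  \<open>m = (1 - \<lambda>)^2\<close> one has \<open>a^2 = 8 * L + m\<close> and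
  \<open>a^2 + s^2 = 20 * L + m\<close>, and \<open>2 * L + m = k^2\<close> comes from the
  determinant of the system. For \<lambda> = 0 the parameter \<open>c\<close> is zero and the system
  is singular under every rotation, hence the limit statement there.\<close>

definition ecard :: "'a set \<Rightarrow> ennreal" where
  "ecard X = emeasure (count_space UNIV) X"

lemma ecard_empty [simp]: "ecard {} = 0"
  by (simp add: ecard_def)

lemma ecard_singleton [simp]: "ecard {x} = 1"
  by (simp add: ecard_def)

lemma ecard_mono: "X \<subseteq> Y \<Longrightarrow> ecard X \<le> ecard Y"
  unfolding ecard_def by (intro emeasure_mono) auto

lemma ecard_finite: "finite X \<Longrightarrow> ecard X = of_nat (card X)"
  by (simp add: ecard_def emeasure_count_space_finite)

lemma ecard_infinite: "infinite X \<Longrightarrow> ecard X = \<infinity>"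
  by (simp add: ecard_def)

lemma ecard_bij_betw:
  assumes "bij_betw f X Y" shows "ecard X = ecard Y"
proof (cases "finite X")
  case True
  then have "finite Y" using assms bij_betw_finite by blast
  with True show ?thesis by (simp add: ecard_finite bij_betw_same_card[OF assms])
next
  case False
  then have "infinite Y" using assms bij_betw_finite by blast
  with False show ?thesis by (simp add: ecard_infinite)
qed

lemma ecard_image_inj: "inj_on f X \<Longrightarrow> ecard (f ` X) = ecard X"
  using ecard_bij_betw[OF inj_on_imp_bij_betw[of f X]] by simp

lemma ecard_UN_disjoint:
  fixes X :: "nat \<Rightarrow> 'a set"
  assumes "disjoint_family X"
  shows "ecard (\<Union>i. X i) = (\<Sum>i. ecard (X i))"
  unfolding ecard_def by (rule suminf_emeasure[symmetric]) (use assms in auto)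

text \<open>A dictionary between absolute integrability on a set, the language of
  \<open>has_absolute_integral_change_of_variables\<close>, and nonnegative integrals. The
  equivalence lets infinite integrals be transformed as well.\<close>

lemma nn_integral_set_abs_integrable:
  fixes f :: "'a::euclidean_space \<Rightarrow> real"
  assumes m: "(\<lambda>x. indicator S x * f x) \<in> borel_measurable borel"
    and nonneg: "\<And>x. 0 \<le> f x"
  shows "f absolutely_integrable_on S \<longleftrightarrow> (\<integral>\<^sup>+x. ennreal (indicator S x * f x) \<partial>lborel) < \<infinity>"
    and "f absolutely_integrable_on S \<Longrightarrow>
      (\<integral>\<^sup>+x. ennreal (indicator S x * f x) \<partial>lborel) = ennreal (integral S f)"
proof -
  define h where "h x = indicator S x * f x" for x
  have hm: "h \<in> borel_measurable lborel" using m by (simp add: h_def[abs_def])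
  have h0: "0 \<le> h x" for x using nonneg by (simp add: h_def)
  have he: "(\<lambda>x. indicator S x *\<^sub>R f x) = h" by (simp add: h_def fun_eq_iff)
  have i: "f absolutely_integrable_on S \<longleftrightarrow> integrable lborel h"
    unfolding set_integrable_def he using hm by (rule integrable_completion)
  have "integrable lborel h \<longleftrightarrow> (\<integral>\<^sup>+x. ennreal (h x) \<partial>lborel) < \<infinity>"
    unfolding integrable_iff_bounded using hm h0 by simp
  then show "f absolutely_integrable_on S \<longleftrightarrow> (\<integral>\<^sup>+x. ennreal (indicator S x * f x) \<partial>lborel) < \<infinity>"
    unfolding i h_def .
  assume a: "f absolutely_integrable_on S"
  have "(\<integral>\<^sup>+x. ennreal (h x) \<partial>lborel) = ennreal (integral\<^sup>L lborel h)"
    using a i h0 by (intro nn_integral_eq_integral) auto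
  also have "integral\<^sup>L lborel h = integral S f"
    using set_lebesgue_integral_eq_integral(2)[OF a] integral_completion[OF hm]
    unfolding set_lebesgue_integral_def he by simp
  finally show "(\<integral>\<^sup>+x. ennreal (indicator S x * f x) \<partial>lborel) = ennreal (integral S f)"
    unfolding h_def .
qed

section \<open>F-sigma sets and measurability of counts\<close>

lemma fsigma_sets_borel: "fsigma S \<Longrightarrow> S \<in> sets borel"
  by (induction rule: fsigma.induct) auto

text \<open>In Euclidean space an F-sigma set is a countable union of compact sets, and these have
  compact images. This is the reason for working with F-sigma sets: a continuous image of a Borel
  set need not be Borel.\<close>

lemma fsigma_image:
  fixes F :: "'a::euclidean_space \<Rightarrow> 'b::euclidean_space"
  assumes "fsigma S" "continuous_on S F"
  shows "fsigma (F ` S)"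
proof -
  obtain K :: "nat \<Rightarrow> 'a set" where K: "range K \<subseteq> Collect compact" "S = \<Union>(range K)"
    using assms fsigma_Union_compact by blast
  have "F ` S = \<Union>(range (\<lambda>n. F ` K n))" using K by auto
  moreover have "compact (F ` K n)" for n
    using K assms(2) by (intro compact_continuous_image) (auto intro: continuous_on_subset)
  ultimately show ?thesis unfolding fsigma_Union_compact
    by (intro exI[of _ "\<lambda>n. F ` K n"] conjI) (auto simp: image_subset_iff)
qed

lemma fsigma_closed: "closed (S :: 'a::topological_space set) \<Longrightarrow> fsigma S"
  using fsigma.intros[of "\<lambda>_::nat. S"] by auto

lemma fsigma_Int_closed:
  assumes "fsigma (S :: 'a::euclidean_space set)" "closed T"
  shows "fsigma (S \<inter> T)"
proof -
  obtain K :: "nat \<Rightarrow> 'a set" where K: "range K \<subseteq> Collect compact" "S = \<Union>(range K)"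
    using assms fsigma_Union_compact by blast
  have "S \<inter> T = \<Union>(range (\<lambda>n. K n \<inter> T))" using K by auto
  then show ?thesis unfolding fsigma_Union_compact
    using K(1) assms(2)
    by (intro exI[of _ "\<lambda>n. K n \<inter> T"] conjI) (auto intro!: compact_Int_closed simp: image_subset_iff)
qed

lemma fsigma_Int:
  assumes "fsigma (S :: 'a::euclidean_space set)" "fsigma T"
  shows "fsigma (S \<inter> T)"
proof -
  obtain K L :: "nat \<Rightarrow> 'a set" where K: "range K \<subseteq> Collect compact" "S = \<Union>(range K)"
    and L: "range L \<subseteq> Collect compact" "T = \<Union>(range L)"
    using assms fsigma_Union_compact by metis
  let ?F = "\<lambda>n. K (fst (prod_decode n)) \<inter> L (snd (prod_decode n))"
  have "S \<inter> T \<subseteq> \<Union>(range ?F)"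
  proof
    fix x assume "x \<in> S \<inter> T"
    then obtain i j where "x \<in> K i" "x \<in> L j" using K L by auto
    then have "x \<in> ?F (prod_encode (i, j))" by simp
    then show "x \<in> \<Union>(range ?F)" by blast
  qed
  moreover have "\<Union>(range ?F) \<subseteq> S \<inter> T" using K L by auto
  ultimately have "S \<inter> T = \<Union>(range ?F)" by blast
  then show ?thesis unfolding fsigma_Union_compact
    using K(1) L(1) by (intro exI[of _ ?F] conjI) (auto intro!: compact_Int simp: image_subset_iff)
qed

lemma fsigma_open: "open (S :: 'a::euclidean_space set) \<Longrightarrow> fsigma S"
  by (rule open_Union_compact_subsets[of S]) (auto intro!: fsigma.intros compact_imp_closed)

text \<open>The Lindeloef property gives a countable subcover, made disjoint by removing from each
  member its predecessors. Removing open sets amounts to intersecting with a closed set, so the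
  pieces stay F-sigma. \<open>P {}\<close> serves the case of empty \<open>S\<close>.\<close>

lemma fsigma_disjoint_cover:
  fixes S :: "'a::euclidean_space set"
  assumes "fsigma S" and cover: "\<And>x. x \<in> S \<Longrightarrow> \<exists>U. open U \<and> x \<in> U \<and> P U"
    and empty: "P {}" and sub: "\<And>U V. P U \<Longrightarrow> V \<subseteq> U \<Longrightarrow> P V"
  obtains C :: "nat \<Rightarrow> 'a set" where "\<And>i. fsigma (C i)" "disjoint_family C" "S = (\<Union>i. C i)" "\<And>i. P (C i)"
proof (cases "S = {}")
  case True
  then show ?thesis using that[of "\<lambda>_. {}"] empty by (auto simp: disjoint_family_on_def fsigma_closed)
next
  case False
  obtain U where U: "\<And>x. x \<in> S \<Longrightarrow> open (U x) \<and> x \<in> U x \<and> P (U x)"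
    using cover by metis
  obtain \<F> where \<F>: "\<F> \<subseteq> U ` S" "countable \<F>" "\<Union>\<F> = \<Union>(U ` S)"
    using Lindelof[of "U ` S"] U by blast
  have ne: "\<F> \<noteq> {}" using \<F>(3) False U by auto
  define G where "G = from_nat_into \<F>"
  have rG: "range G = \<F>" unfolding G_def using ne \<F>(2) by (rule range_from_nat_into)
  have G: "open (G i)" "P (G i)" for i
    using rG \<F>(1) U by (metis image_iff rangeI subsetD)+
  define C where "C i = S \<inter> (G i - (\<Union>j<i. G j))" for i
  show ?thesis
  proof (rule that[of C])
    show "fsigma (C i)" for i
    proof -
      have "closed (- (\<Union>j<i. G j))"
        using G(1) by (intro closed_Compl open_UN) auto
      from fsigma_Int_closed[OF fsigma_Int[OF assms(1) fsigma_open[OF G(1)[of i]]] this]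
      have "fsigma ((S \<inter> G i) \<inter> (- (\<Union>j<i. G j)))" .
      then show ?thesis by (simp only: C_def Diff_eq Int_assoc)
    qed
    have "C i \<subseteq> G i" for i unfolding C_def by blast
    then show "P (C i)" for i using sub[OF G(2)[of i]] by blast
    show "disjoint_family C"
      unfolding C_def disjoint_family_on_def
    proof (intro ballI impI)
      fix m n :: nat assume "m \<noteq> n"
      then have "m < n \<or> n < m" by linarith
      then show "S \<inter> (G m - \<Union> (G ` {..<m})) \<inter> (S \<inter> (G n - \<Union> (G ` {..<n}))) = {}"
        by blast
    qed
    have "S \<subseteq> (\<Union>i. C i)"
    proof
      fix x assume x: "x \<in> S"
      then have "x \<in> \<Union>(range G)" using rG \<F>(3) U by blast
      then have ex: "\<exists>i. x \<in> G i" by blast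
      define i where "i = (LEAST i. x \<in> G i)"
      have "x \<in> G i" unfolding i_def using ex by (rule LeastI_ex)
      moreover have "x \<notin> G j" if "j < i" for j using that not_less_Least unfolding i_def by blast
      ultimately have "x \<in> C i" unfolding C_def using x by blast
      then show "x \<in> (\<Union>i. C i)" by blast
    qed
    moreover have "(\<Union>i. C i) \<subseteq> S" unfolding C_def by blast
    ultimately show "S = (\<Union>i. C i)" by (rule subset_antisym)
  qed
qed

lemma ecard_leI:
  assumes "\<And>T. finite T \<Longrightarrow> T \<subseteq> X \<Longrightarrow> of_nat (card T) \<le> c"
  shows "ecard X \<le> c"
proof (cases "finite X")
  case True
  then show ?thesis using assms[of X] by (simp add: ecard_finite)
next
  case False
  have "of_nat n \<le> c" for n
  proof -
    obtain T where "finite T" "card T = n" "T \<subseteq> X"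
      using infinite_arbitrarily_large[OF False] by blast
    then show ?thesis using assms[of T] by simp
  qed
  then have "c = \<infinity>"
    using ennreal_Ex_less_of_nat[of c] by (metis infinity_ennreal_def leD top.not_eq_extremum)
  then show ?thesis by simp
qed

lemma separating_compacts:
  fixes T :: "'a::euclidean_space set"
  assumes "finite T" "topological_basis \<B>"
  obtains b where "\<And>x. x \<in> T \<Longrightarrow> b x \<in> \<B> \<and> x \<in> b x"
    "\<And>x y. x \<in> T \<Longrightarrow> y \<in> T \<Longrightarrow> x \<noteq> y \<Longrightarrow> closure (b x) \<inter> closure (b y) = {}"
proof -
  obtain d where d: "d > 0" "\<And>x y. x \<in> T \<Longrightarrow> y \<in> T \<Longrightarrow> x \<noteq> y \<Longrightarrow> d \<le> dist x y"
  proof -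
    let ?D = "(\<lambda>(x, y). dist x y) ` {(x, y). x \<in> T \<and> y \<in> T \<and> x \<noteq> y}"
    have "finite ?D"
      by (rule finite_imageI, rule finite_subset[of _ "T \<times> T"]) (use assms in auto)
    \<comment> \<open>The extra element 1 provides a minimum when \<open>T\<close> has at most one
      point.\<close>
    then have "finite (insert 1 ?D)" by simp
    then have "Min (insert 1 ?D) > 0" by (subst Min_gr_iff) auto
    moreover have "Min (insert 1 ?D) \<le> dist x y" if "x \<in> T" "y \<in> T" "x \<noteq> y" for x y
      by (rule Min_le[OF \<open>finite (insert 1 ?D)\<close>]) (use that in force)
    ultimately show ?thesis by (rule that)
  qed
  have "\<exists>b\<in>\<B>. x \<in> b \<and> b \<subseteq> ball x (d/3)" for x
    using assms(2) d(1) by (metis centre_in_ball divide_pos_pos open_ball topological_basisE zero_less_numeral)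
  then obtain b where b: "\<And>x. b x \<in> \<B> \<and> x \<in> b x \<and> b x \<subseteq> ball x (d/3)" by metis
  have c: "closure (b x) \<subseteq> cball x (d/3)" for x
    by (rule closure_minimal) (use b[of x] in \<open>auto simp: less_imp_le subset_iff\<close>)
  show ?thesis
  proof (rule that[of b])
    fix x y assume "x \<in> T" "y \<in> T" "x \<noteq> y"
    then have "d \<le> dist x y" using d by blast
    show "closure (b x) \<inter> closure (b y) = {}"
    proof (rule ccontr)
      assume "closure (b x) \<inter> closure (b y) \<noteq> {}"
      then obtain z where "dist x z \<le> d/3" "dist y z \<le> d/3" using c by force
      then have "dist x y \<le> d/3 + d/3" using dist_triangle2[of x y z] by linarith
      with \<open>d \<le> dist x y\<close> d(1) show False by linarith
    qed
  qed (use b in auto)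
qed

text \<open>The number of points of a section is the supremum, over finite disjoint families of
  compact pieces of \<open>S\<close>, of the number of pieces that meet it. Countably many pieces
  suffice, namely a compact exhaustion cut with closures of basis sets. The set of \<open>y\<close>
  whose section meets a given piece is closed, being the projection of a closed set along a compact
  one.\<close>

lemma borel_measurable_ecard_section:
  fixes S :: "'a::euclidean_space set" and Z :: "('a \<times> 'b::euclidean_space) set"
  assumes S: "fsigma S" and Z: "closed Z"
  shows "(\<lambda>y. ecard {x \<in> S. (x, y) \<in> Z}) \<in> borel_measurable borel"
proof -
  obtain K :: "nat \<Rightarrow> 'a set" where K: "range K \<subseteq> Collect compact" "S = \<Union>(range K)"
    using S fsigma_Union_compact by blast
  obtain \<B> :: "'a set set" where \<B>: "countable \<B>" "topological_basis \<B>"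
    using ex_countable_basis by blast
  define \<D> where "\<D> = (\<lambda>(n, b). K n \<inter> closure b) ` (UNIV \<times> \<B>)"
  have \<D>: "countable \<D>" unfolding \<D>_def using \<B> by auto
  have \<D>c: "compact D" if "D \<in> \<D>" for D
    using that K(1) unfolding \<D>_def by (auto intro!: compact_Int_closed simp: image_subset_iff)
  have \<D>S: "D \<subseteq> S" if "D \<in> \<D>" for D using that K(2) unfolding \<D>_def by auto
  define pr where "pr D = {y. \<exists>x. x \<in> D \<and> (x, y) \<in> Z}" for D
  have pr: "pr D \<in> sets borel" if "D \<in> \<D>" for D
    unfolding pr_def using closed_compact_projection[OF \<D>c[OF that] Z] by simp
  define I where "I = {F. finite F \<and> F \<subseteq> \<D>} \<inter> {F. disjoint F}"
  have I: "countable I" unfolding I_def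
    using countable_Collect_finite_subset[OF \<D>] by (rule countable_Int1)
  define f :: "'b \<Rightarrow> ennreal" where "f y = (SUP F\<in>I. \<Sum>D\<in>F. indicator (pr D) y)" for y
  have "f \<in> borel_measurable borel"
    unfolding f_def
    by (intro borel_measurable_SUP I borel_measurable_sum borel_measurable_indicator pr) (auto simp: I_def)
  moreover have "f y = ecard {x \<in> S. (x, y) \<in> Z}" for y
  proof (rule antisym)
    show "f y \<le> ecard {x \<in> S. (x, y) \<in> Z}" unfolding f_def
    proof (rule SUP_least)
      fix F assume F: "F \<in> I"
      define F' where "F' = {D \<in> F. y \<in> pr D}"
      have fin: "finite F" "finite F'" using F by (auto simp: I_def F'_def)
      have "\<forall>D\<in>F'. \<exists>x. x \<in> D \<and> (x, y) \<in> Z" by (auto simp: F'_def pr_def)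
      then obtain p where p: "\<And>D. D \<in> F' \<Longrightarrow> p D \<in> D \<and> (p D, y) \<in> Z" by metis
      have "inj_on p F'"
      proof (rule inj_onI)
        fix D E assume DE: "D \<in> F'" "E \<in> F'" "p D = p E"
        then have "p D \<in> D \<inter> E" using p by (metis IntI)
        then show "D = E" using F DE unfolding I_def F'_def disjoint_def by blast
      qed
      have "(\<Sum>D\<in>F. indicator (pr D) y) = (\<Sum>D\<in>F'. 1 :: ennreal)"
        by (rule sum.mono_neutral_cong_right) (use fin in \<open>auto simp: F'_def indicator_def\<close>)
      also have "\<dots> = ecard (p ` F')"
        using fin \<open>inj_on p F'\<close> by (simp add: ecard_finite card_image)
      also have "\<dots> \<le> ecard {x \<in> S. (x, y) \<in> Z}"
      proof (rule ecard_mono, rule image_subsetI)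
        fix D assume D: "D \<in> F'"
        then have "D \<in> \<D>" using F by (auto simp: I_def F'_def)
        then show "p D \<in> {x \<in> S. (x, y) \<in> Z}" using p[OF D] \<D>S by blast
      qed
      finally show "(\<Sum>D\<in>F. indicator (pr D) y) \<le> ecard {x \<in> S. (x, y) \<in> Z}" .
    qed
    show "ecard {x \<in> S. (x, y) \<in> Z} \<le> f y"
    proof (rule ecard_leI)
      fix T assume T: "finite T" "T \<subseteq> {x \<in> S. (x, y) \<in> Z}"
      obtain b where b: "\<And>x. x \<in> T \<Longrightarrow> b x \<in> \<B> \<and> x \<in> b x"
        "\<And>x y. x \<in> T \<Longrightarrow> y \<in> T \<Longrightarrow> x \<noteq> y \<Longrightarrow> closure (b x) \<inter> closure (b y) = {}"
        using separating_compacts[OF T(1) \<B>(2)] by blast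
      have "\<forall>x\<in>T. \<exists>n. x \<in> K n" using T K by auto
      then obtain n where n: "\<And>x. x \<in> T \<Longrightarrow> x \<in> K (n x)" by metis
      define D where "D x = K (n x) \<inter> closure (b x)" for x
      have xD: "x \<in> D x" if "x \<in> T" for x
        using that b(1) n closure_subset unfolding D_def by blast
      have dis: "D x \<inter> D x' = {}" if "x \<in> T" "x' \<in> T" "x \<noteq> x'" for x x'
        using b(2)[OF that] unfolding D_def by blast
      have inj: "inj_on D T"
        by (rule inj_onI) (use xD dis in blast)
      have "D ` T \<in> I"
        unfolding I_def disjoint_def \<D>_def using T(1) dis b(1) by (auto simp: D_def)
      then have "(\<Sum>E\<in>D ` T. indicator (pr E) y) \<le> f y" unfolding f_def by (rule SUP_upper)
      moreover have "(\<Sum>E\<in>D ` T. indicator (pr E) y) = (\<Sum>x\<in>T. 1::ennreal)"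
        unfolding sum.reindex[OF inj] using T(2) xD
        by (intro sum.cong) (auto simp: indicator_def pr_def)
      ultimately show "of_nat (card T) \<le> f y" by simp
    qed
  qed
  ultimately show ?thesis by (simp add: fun_eq_iff[symmetric, of f] cong: measurable_cong)
qed

section \<open>Change of variables and the area formula\<close>

lemma nn_integral_inj_change_of_variables:
  fixes g :: "real^'n::{finite,wellorder} \<Rightarrow> real^'n::_" and k :: "real^'n::_ \<Rightarrow> real"
    and D :: "real^'n::_ \<Rightarrow> real^'n::_^'n::_"
  assumes S: "fsigma S" and der: "\<And>x. x \<in> S \<Longrightarrow> (g has_derivative (*v) (D x)) (at x within S)"
    and D: "continuous_on S D" and inj: "inj_on g S"
    and k: "k \<in> borel_measurable borel" "\<And>y. 0 \<le> k y"
  shows "(\<integral>\<^sup>+y. ennreal (indicator (g ` S) y * k y) \<partial>lborel)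
       = (\<integral>\<^sup>+x. ennreal (indicator S x * (\<bar>det (D x)\<bar> * k (g x))) \<partial>lborel)"
proof -
  have g: "continuous_on S g"
    using der by (meson continuous_on_eq_continuous_within has_derivative_continuous)
  have Sb: "S \<in> sets borel" using S by (rule fsigma_sets_borel)
  have gS: "g ` S \<in> sets borel" using fsigma_image[OF S g] by (rule fsigma_sets_borel)
  have m1: "(\<lambda>y. indicator (g ` S) y * k y) \<in> borel_measurable borel"
    using gS k(1) by measurable
  have c: "continuous_on S (\<lambda>x. \<bar>det (D x)\<bar>)"
    unfolding det_def by (intro continuous_intros D)
  have gi: "(\<lambda>x. indicator S x *\<^sub>R g x) \<in> borel_measurable borel"
    by (rule borel_measurable_continuous_on_indicator[OF Sb g])
  have ci: "(\<lambda>x. indicator S x *\<^sub>R \<bar>det (D x)\<bar>) \<in> borel_measurable borel"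
    by (rule borel_measurable_continuous_on_indicator[OF Sb c])
  \<comment> \<open>\<open>g\<close> and the determinant are controlled on \<open>S\<close> only;
    extended by zero they become measurable everywhere.\<close>
  have "(\<lambda>x. indicator S x * (indicator S x *\<^sub>R \<bar>det (D x)\<bar> * k (indicator S x *\<^sub>R g x))) \<in> borel_measurable borel"
    using gi ci Sb k(1) by measurable
  also have "(\<lambda>x. indicator S x * (indicator S x *\<^sub>R \<bar>det (D x)\<bar> * k (indicator S x *\<^sub>R g x)))
     = (\<lambda>x. indicator S x * (\<bar>det (D x)\<bar> * k (g x)))"
    by (auto simp: indicator_def fun_eq_iff)
  finally have m2: "(\<lambda>x. indicator S x * (\<bar>det (D x)\<bar> * k (g x))) \<in> borel_measurable borel" .
  note i1 = nn_integral_set_abs_integrable[OF m1 k(2)]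
  have nn: "0 \<le> \<bar>det (D x)\<bar> * k (g x)" for x using k(2) by simp
  note i2 = nn_integral_set_abs_integrable[OF m2 nn]
  have Sl: "S \<in> sets lebesgue" using Sb by simp
  \<comment> \<open>The transformation theorem concerns vector-valued integrands, hence the passage
    through \<open>real^1\<close>.\<close>
  have cov: "(\<lambda>x. \<bar>det (D x)\<bar> * k (g x)) absolutely_integrable_on S \<and>
           integral S (\<lambda>x. \<bar>det (D x)\<bar> * k (g x)) = b
     \<longleftrightarrow> k absolutely_integrable_on (g ` S) \<and> integral (g ` S) k = b" for b
    using has_absolute_integral_change_of_variables[OF Sl der inj, of "vec \<circ> k :: _ \<Rightarrow> real^1" "vec b"]
    by (simp add: absolutely_integrable_on_1_iff integral_on_1_eq o_def vec_eq_iff)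
  show ?thesis
  proof (cases "k absolutely_integrable_on (g ` S)")
    case True
    then have "(\<lambda>x. \<bar>det (D x)\<bar> * k (g x)) absolutely_integrable_on S"
      "integral S (\<lambda>x. \<bar>det (D x)\<bar> * k (g x)) = integral (g ` S) k"
      using cov by blast+
    then show ?thesis using i1(2)[OF True] i2(2) by simp
  next
    \<comment> \<open>Neither function is integrable, so both nonnegative integrals are
      infinite.\<close>
    case False
    then have "\<not> (\<lambda>x. \<bar>det (D x)\<bar> * k (g x)) absolutely_integrable_on S" using cov by blast
    then show ?thesis using False i1(1) i2(1) by (simp add: not_less top_unique)
  qed
qed

lemma continuous_matrix_locally_injective:
  fixes g :: "real^'n::finite \<Rightarrow> real^'n" and D :: "real^'n::_ \<Rightarrow> real^'n^'n"
  assumes "open U" "a \<in> U" and der: "\<And>x. x \<in> U \<Longrightarrow> (g has_derivative (*v) (D x)) (at x)"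
    and D: "continuous_on U D" and nz: "det (D a) \<noteq> 0"
  obtains r where "r > 0" "ball a r \<subseteq> U" "inj_on g (ball a r)"
proof -
  obtain B where B: "B ** D a = mat 1"
    using nz invertible_det_nz[of "D a"] unfolding invertible_def by blast
  show ?thesis
  proof (rule has_derivative_locally_injective[OF assms(2,1), of "(*v) B" "\<lambda>x. (*v) (D x)" g])
    show "bounded_linear ((*v) B)" by simp
    show "(*v) B \<circ> (*v) (D a) = id"
      by (simp add: fun_eq_iff matrix_vector_mul_assoc B)
    show "(g has_derivative (*v) (D x)) (at x)" if "x \<in> U" for x by (rule der[OF that])
    fix e :: real assume "e > 0"
    define N where "N = real CARD('n)"
    have N: "N > 0" by (simp add: N_def)
    have "isCont D a" using D assms(1,2) continuous_on_eq_continuous_at by blast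
    \<comment> \<open>Each of the \<open>N * N\<close> entries changes by at most
      \<open>e / (2 * N * N)\<close>, so the operator norm changes by at most
      \<open>e / 2\<close>.\<close>
    then obtain d where d: "d > 0" "\<And>x. dist x a < d \<Longrightarrow> dist (D x) (D a) < e / (2 * N * N)"
      using \<open>e > 0\<close> N unfolding continuous_at_eps_delta dist_norm
      by (metis divide_pos_pos mult_pos_pos zero_less_numeral)
    have "onorm (\<lambda>v. D x *v v - D a *v v) < e" if "dist a x < d" for x
    proof -
      have "\<bar>(D x - D a) $ i $ j\<bar> \<le> e / (2 * N * N)" for i j
      proof -
        have "\<bar>(D x - D a) $ i $ j\<bar> \<le> norm (D x - D a)"
          using Finite_Cartesian_Product.norm_nth_le[of "(D x - D a) $ i" j]
            Finite_Cartesian_Product.norm_nth_le[of "D x - D a" i] by simp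
        then show ?thesis using d(2)[of x] that
          by (simp add: dist_norm norm_minus_commute)
      qed
      then have "onorm ((*v) (D x - D a)) \<le> real CARD('n) * real CARD('n) * (e / (2 * N * N))"
        by (rule onorm_le_matrix_component)
      also have "\<dots> = e / 2" using N by (simp add: N_def)
      also have "(*v) (D x - D a) = (\<lambda>v. D x *v v - D a *v v)"
        by (simp add: fun_eq_iff matrix_vector_mult_diff_rdistrib)
      finally show ?thesis using \<open>e > 0\<close> by simp
    qed
    then show "\<exists>d>0. \<forall>x. dist a x < d \<longrightarrow> onorm (\<lambda>v. D x *v v - D a *v v) < e"
      using d(1) by blast
  qed (use that in auto)
qed

text \<open>The critical points of \<open>S\<close> have a null image by Sard's theorem and do not
  contribute. The regular points are cut into countably many F-sigma pieces on which
  \<open>g\<close> is injective; the number of preimages of \<open>y\<close> is then the number of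
  pieces whose image contains \<open>y\<close>.\<close>

theorem area_formula:
  fixes g :: "real^'n::{finite,wellorder} \<Rightarrow> real^'n::_" and k :: "real^'n::_ \<Rightarrow> real"
    and D :: "real^'n::_ \<Rightarrow> real^'n::_^'n::_"
  assumes U: "open U" and S: "fsigma S" "S \<subseteq> U"
    and der: "\<And>x. x \<in> U \<Longrightarrow> (g has_derivative (*v) (D x)) (at x)"
    and D: "continuous_on U D"
    and k: "k \<in> borel_measurable borel" "\<And>y. 0 \<le> k y"
  shows "(\<integral>\<^sup>+y. ecard {x \<in> S. g x = y} * ennreal (k y) \<partial>lborel)
       = (\<integral>\<^sup>+x. ennreal (indicator S x * (\<bar>det (D x)\<bar> * k (g x))) \<partial>lborel)"
proof -
  have cdet: "continuous_on U (\<lambda>x. det (D x))"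
    unfolding det_def by (intro continuous_intros D)
  have g: "continuous_on U g"
    using der U by (meson continuous_on_eq_continuous_at has_derivative_continuous)
  define R where "R = U \<inter> (\<lambda>x. det (D x)) -` (-{0})"
  have R: "open R" unfolding R_def by (rule continuous_open_preimage[OF cdet U]) auto
  have RU: "R \<subseteq> U" by (auto simp: R_def)
  have fs: "fsigma (S \<inter> R)" using fsigma_Int[OF S(1) fsigma_open[OF R]] .
  obtain C :: "nat \<Rightarrow> (real^'n::_) set" where C: "\<And>i. fsigma (C i)" "disjoint_family C" "S \<inter> R = (\<Union>i. C i)"
    "\<And>i. inj_on g (C i)"
  proof (rule fsigma_disjoint_cover[OF fs, of "inj_on g"])
    fix x assume "x \<in> S \<inter> R"
    then have "x \<in> U" "det (D x) \<noteq> 0" by (auto simp: R_def)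
    then obtain r where "r > 0" "inj_on g (ball x r)"
      using continuous_matrix_locally_injective[OF U _ der D] by metis
    then show "\<exists>W. open W \<and> x \<in> W \<and> inj_on g W" by (intro exI[of _ "ball x r"]) auto
  qed (auto intro: inj_on_subset)
  have CU: "C i \<subseteq> U" for i using C(3) RU by blast
  define N where "N = S - R"
  have "negligible (g ` N)"
  proof (rule baby_Sard[of N g "\<lambda>x. (*v) (D x)"])
    fix x assume x: "x \<in> N"
    then have "x \<in> U" "det (D x) = 0" using S by (auto simp: N_def R_def)
    then show "(g has_derivative (*v) (D x)) (at x within N)"
      using der has_derivative_at_withinI by blast
    show "rank (matrix ((*v) (D x))) < CARD('n)"
      using \<open>det (D x) = 0\<close> by (simp add: less_rank_noninjective det_nz_iff_inj[symmetric])
  qed simp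
  have N: "fsigma N"
  proof -
    have "N = S \<inter> (- R)" by (auto simp: N_def)
    then show ?thesis using fsigma_Int_closed[OF S(1), of "- R"] R by (simp add: closed_Compl)
  qed
  have NU: "N \<subseteq> U" using S by (auto simp: N_def)
  have "g ` N \<in> sets borel"
    using fsigma_image[OF N continuous_on_subset[OF g NU]] by (rule fsigma_sets_borel)
  with \<open>negligible (g ` N)\<close> have null: "g ` N \<in> null_sets lborel"
    by (simp add: negligible_iff_null_sets null_sets_completion_iff)
  have gC: "g ` C i \<in> sets borel" for i
    using fsigma_image[OF C(1) continuous_on_subset[OF g CU]] by (rule fsigma_sets_borel)
  have count: "ecard {x \<in> S. g x = y} = (\<Sum>i. indicator (g ` C i) y)" if "y \<notin> g ` N" for y
  proof -
    have piece: "ecard {x \<in> C i. g x = y} = indicator (g ` C i) y" for i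
    proof (cases "y \<in> g ` C i")
      case True
      then obtain x where "x \<in> C i" "g x = y" by blast
      then have "{x \<in> C i. g x = y} = {x}" using C(4)[of i] by (auto simp: inj_on_def)
      then show ?thesis using True by simp
    next
      case False
      then have "{x \<in> C i. g x = y} = {}" by blast
      then have "ecard {x \<in> C i. g x = y} = 0" by (simp only: ecard_empty)
      then show ?thesis using False by simp
    qed
    have "{x \<in> S. g x = y} = (\<Union>i. {x \<in> C i. g x = y})"
      using that C(3) by (auto simp: N_def)
    also have "ecard \<dots> = (\<Sum>i. ecard {x \<in> C i. g x = y})"
      by (rule ecard_UN_disjoint) (use C(2) in \<open>unfold disjoint_family_on_def, blast\<close>)
    also have "\<dots> = (\<Sum>i. indicator (g ` C i) y)" by (simp only: piece)
    finally show ?thesis .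
  qed
  have "(\<integral>\<^sup>+y. ecard {x \<in> S. g x = y} * ennreal (k y) \<partial>lborel)
      = (\<integral>\<^sup>+y. (\<Sum>i. ennreal (indicator (g ` C i) y * k y)) \<partial>lborel)"
  proof (rule nn_integral_cong_AE, rule AE_I'[OF null], rule subsetI)
    fix y
    have "ecard {x \<in> S. g x = y} * ennreal (k y) = (\<Sum>i. ennreal (indicator (g ` C i) y * k y))"
      if "y \<notin> g ` N"
    proof -
      have "ecard {x \<in> S. g x = y} * ennreal (k y) = (\<Sum>i. indicator (g ` C i) y * ennreal (k y))"
        unfolding count[OF that] by (rule ennreal_suminf_multc[symmetric])
      also have "\<dots> = (\<Sum>i. ennreal (indicator (g ` C i) y * k y))"
        by (intro suminf_cong) (auto simp: indicator_def)
      finally show ?thesis .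
    qed
    moreover assume "y \<in> {y \<in> space lborel. ecard {x \<in> S. g x = y} * ennreal (k y) \<noteq> (\<Sum>i. ennreal (indicator (g ` C i) y * k y))}"
    ultimately show "y \<in> g ` N" by blast
  qed
  also have "\<dots> = (\<Sum>i. \<integral>\<^sup>+y. ennreal (indicator (g ` C i) y * k y) \<partial>lborel)"
  proof (rule nn_integral_suminf)
    fix i
    note gC[of i, measurable] k(1)[measurable]
    show "(\<lambda>y. ennreal (indicator (g ` C i) y * k y)) \<in> borel_measurable lborel" by measurable
  qed
  also have "\<dots> = (\<Sum>i. \<integral>\<^sup>+x. ennreal (indicator (C i) x * (\<bar>det (D x)\<bar> * k (g x))) \<partial>lborel)"
  proof (rule suminf_cong, rule nn_integral_inj_change_of_variables[OF C(1) _ _ C(4) k])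
    fix i
    show "continuous_on (C i) D" using D CU by (rule continuous_on_subset)
    show "(g has_derivative (*v) (D x)) (at x within C i)" if "x \<in> C i" for x
      using der[of x] CU that has_derivative_at_withinI by blast
  qed
  also have "\<dots> = (\<integral>\<^sup>+x. (\<Sum>i. ennreal (indicator (C i) x * (\<bar>det (D x)\<bar> * k (g x)))) \<partial>lborel)"
  proof (rule nn_integral_suminf[symmetric])
    fix i
    have Cb: "C i \<in> sets borel" using C(1) by (rule fsigma_sets_borel)
    have "(\<lambda>x. indicator (C i) x *\<^sub>R g x) \<in> borel_measurable borel"
      "(\<lambda>x. indicator (C i) x *\<^sub>R det (D x)) \<in> borel_measurable borel"
      using borel_measurable_continuous_on_indicator[OF Cb continuous_on_subset[OF g CU]]
        borel_measurable_continuous_on_indicator[OF Cb continuous_on_subset[OF cdet CU]] by simp_all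
    then have "(\<lambda>x. ennreal (indicator (C i) x * (\<bar>indicator (C i) x *\<^sub>R det (D x)\<bar> * k (indicator (C i) x *\<^sub>R g x)))) \<in> borel_measurable lborel"
      using Cb k(1) by measurable
    also have "(\<lambda>x. ennreal (indicator (C i) x * (\<bar>indicator (C i) x *\<^sub>R det (D x)\<bar> * k (indicator (C i) x *\<^sub>R g x))))
       = (\<lambda>x. ennreal (indicator (C i) x * (\<bar>det (D x)\<bar> * k (g x))))"
      by (auto simp: indicator_def fun_eq_iff)
    finally show "(\<lambda>x. ennreal (indicator (C i) x * (\<bar>det (D x)\<bar> * k (g x)))) \<in> borel_measurable lborel" .
  qed
  also have "\<dots> = (\<integral>\<^sup>+x. ennreal (indicator S x * (\<bar>det (D x)\<bar> * k (g x))) \<partial>lborel)"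
  proof (rule nn_integral_cong)
    fix x
    have "(\<Sum>i. ennreal (indicator (C i) x * (\<bar>det (D x)\<bar> * k (g x))))
       = (\<Sum>i. indicator (C i) x * ennreal (\<bar>det (D x)\<bar> * k (g x)))"
      by (intro suminf_cong) (auto simp: indicator_def)
    also have "\<dots> = (\<Sum>i. indicator (C i) x) * ennreal (\<bar>det (D x)\<bar> * k (g x))"
      by (rule ennreal_suminf_multc)
    also have "(\<Sum>i. indicator (C i) x :: ennreal) = indicator (S \<inter> R) x"
      unfolding C(3) by (rule suminf_indicator[OF C(2)])
    also have "indicator (S \<inter> R) x * ennreal (\<bar>det (D x)\<bar> * k (g x)) = ennreal (indicator S x * (\<bar>det (D x)\<bar> * k (g x)))"
      using S(2) by (auto simp: indicator_def R_def)
    finally show "(\<Sum>i. ennreal (indicator (C i) x * (\<bar>det (D x)\<bar> * k (g x)))) = ennreal (indicator S x * (\<bar>det (D x)\<bar> * k (g x)))" .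
  qed
  finally show ?thesis .
qed

section \<open>Lebesgue measure under linear maps and isometries\<close>

lemma borel_measurable_linear:
  fixes T :: "'a::euclidean_space \<Rightarrow> 'b::euclidean_space"
  shows "linear T \<Longrightarrow> T \<in> borel_measurable borel"
  by (intro borel_measurable_continuous_onI linear_continuous_on) (simp add: linear_conv_bounded_linear)

lemma lborel_linear_change:
  fixes T :: "real^'n::{finite,wellorder}^'n::_"
  assumes nz: "det T \<noteq> 0"
  shows "lborel = density (distr lborel borel ((*v) T)) (\<lambda>_. ennreal \<bar>det T\<bar>)"
proof (rule measure_eqI)
  have inj: "inj ((*v) T)" using nz by (metis det_nz_iff_inj matrix_of_matrix_vector_mul matrix_vector_mul_linear)
  have sur: "surj ((*v) T)" using inj linear_injective_imp_surjective matrix_vector_mul_linear by blast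
  have m[measurable]: "(*v) T \<in> borel_measurable borel"
    by (intro borel_measurable_continuous_onI matrix_vector_mult_linear_continuous_on)
  fix A :: "(real^'n::_) set" assume "A \<in> sets lborel"
  then have A[measurable]: "A \<in> sets borel" by simp
  have "emeasure lborel A = (\<integral>\<^sup>+y. ennreal (indicator ((*v) T ` UNIV) y * indicator A y) \<partial>lborel)"
    using sur by (simp add: ennreal_indicator)
  also have "\<dots> = (\<integral>\<^sup>+x. ennreal (indicator UNIV x * (\<bar>det T\<bar> * indicator A (T *v x))) \<partial>lborel)"
    by (rule nn_integral_inj_change_of_variables)
       (use inj in \<open>auto intro: bounded_linear_imp_has_derivative fsigma_closed\<close>)
  also have "\<dots> = emeasure (density (distr lborel borel ((*v) T)) (\<lambda>_. ennreal \<bar>det T\<bar>)) A"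
    by (simp add: emeasure_density nn_integral_distr ennreal_mult ennreal_indicator)
  finally show "emeasure lborel A = emeasure (density (distr lborel borel ((*v) T)) (\<lambda>_. ennreal \<bar>det T\<bar>)) A" .
qed simp

corollary nn_integral_linear_change:
  fixes T :: "real^'n::{finite,wellorder}^'n::_" and k :: "real^'n::_ \<Rightarrow> ennreal"
  assumes nz: "det T \<noteq> 0" and k[measurable]: "k \<in> borel_measurable borel"
  shows "(\<integral>\<^sup>+y. k y \<partial>lborel) = ennreal \<bar>det T\<bar> * (\<integral>\<^sup>+x. k (T *v x) \<partial>lborel)"
proof -
  have m[measurable]: "(*v) T \<in> borel_measurable borel"
    by (intro borel_measurable_continuous_onI matrix_vector_mult_linear_continuous_on)
  show ?thesis
    by (subst lborel_linear_change[OF nz]) (simp add: nn_integral_density nn_integral_distr nn_integral_cmult)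
qed

lemma inner_basis_change:
  assumes \<beta>: "bij_betw \<beta> Basis Basis" and b: "b \<in> Basis"
  shows "(\<Sum>b\<in>Basis. (x \<bullet> b) *\<^sub>R \<beta> b) \<bullet> \<beta> b = x \<bullet> b"
proof -
  have "(\<Sum>b\<in>Basis. (x \<bullet> b) *\<^sub>R \<beta> b) \<bullet> \<beta> b = (\<Sum>c\<in>Basis. (x \<bullet> c) * (\<beta> c \<bullet> \<beta> b))"
    by (simp add: inner_sum_left)
  also have "\<dots> = (\<Sum>c\<in>Basis. if c = b then x \<bullet> c else 0)"
  proof (rule sum.cong[OF refl])
    fix c :: 'a assume c: "c \<in> Basis"
    have "\<beta> c = \<beta> b \<longleftrightarrow> c = b" using \<beta> b c by (meson bij_betw_imp_inj_on inj_on_eq_iff)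
    then show "(x \<bullet> c) * (\<beta> c \<bullet> \<beta> b) = (if c = b then x \<bullet> c else 0)"
      using bij_betwE[OF \<beta>] b c by (simp add: inner_Basis)
  qed
  also have "\<dots> = x \<bullet> b" using b by simp
  finally show ?thesis .
qed

lemma norm_basis_change:
  assumes \<beta>: "bij_betw \<beta> Basis Basis"
  shows "norm (\<Sum>b\<in>Basis. (x \<bullet> b) *\<^sub>R \<beta> b) = norm x"
proof -
  let ?s = "\<Sum>b\<in>Basis. (x \<bullet> b) *\<^sub>R \<beta> b"
  have "?s \<bullet> ?s = (\<Sum>b\<in>Basis. (x \<bullet> b) * (?s \<bullet> \<beta> b))"
    by (subst inner_sum_right) simp
  also have "\<dots> = x \<bullet> x"
    by (simp add: inner_basis_change[OF \<beta>] euclidean_inner[of x x])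
  finally show ?thesis by (simp add: norm_eq_sqrt_inner)
qed

lemma lborel_distr_basis_change:
  fixes \<beta> :: "'a::euclidean_space \<Rightarrow> 'b::euclidean_space"
  assumes \<beta>: "bij_betw \<beta> Basis Basis"
  shows "distr lborel borel (\<lambda>x. \<Sum>b\<in>Basis. (x \<bullet> b) *\<^sub>R \<beta> b) = lborel" (is "distr lborel borel ?i = lborel")
proof (rule lborel_eqI[symmetric])
  have \<beta>B: "\<beta> b \<in> Basis" if "b \<in> Basis" for b using bij_betwE[OF \<beta>] that by blast
  note ip = inner_basis_change[OF \<beta>]
  have [measurable]: "?i \<in> borel_measurable borel" by measurable
  fix l u :: 'b assume le: "\<And>b. b \<in> Basis \<Longrightarrow> l \<bullet> b \<le> u \<bullet> b"
  define l' where "l' = (\<Sum>b\<in>Basis. (l \<bullet> \<beta> b) *\<^sub>R b)"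
  define u' where "u' = (\<Sum>b\<in>Basis. (u \<bullet> \<beta> b) *\<^sub>R b)"
  have Bim: "Basis = \<beta> ` Basis" using \<beta> by (simp add: bij_betw_imp_surj_on)
  have "?i -` box l u = box l' u'"
    unfolding box_def by (subst Bim) (auto simp: ip l'_def u'_def)
  then have "emeasure (distr lborel borel ?i) (box l u) = emeasure lborel (box l' u')"
    by (simp add: emeasure_distr)
  also have "\<dots> = (\<Prod>b\<in>Basis. (u' - l') \<bullet> b)"
    by (subst emeasure_lborel_box) (use le \<beta>B in \<open>auto simp: l'_def u'_def\<close>)
  also have "(\<Prod>b\<in>Basis. (u' - l') \<bullet> b) = (\<Prod>b\<in>Basis. (u - l) \<bullet> \<beta> b)"
    by (intro prod.cong) (auto simp: l'_def u'_def inner_diff_left)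
  also have "\<dots> = (\<Prod>b\<in>Basis. (u - l) \<bullet> b)"
    by (rule prod.reindex_bij_betw[OF \<beta>])
  finally show "emeasure (distr lborel borel ?i) (box l u) = (\<Prod>b\<in>Basis. (u - l) \<bullet> b)" .
qed simp

lemma lborel_distr_orthogonal_cart:
  fixes T :: "real^'n::{finite,wellorder} \<Rightarrow> real^'n::_"
  assumes "linear T" "\<And>x. norm (T x) = norm x"
  shows "distr lborel borel T = lborel"
proof -
  have o: "orthogonal_transformation T" using assms by (simp add: orthogonal_transformation)
  have "\<bar>det (matrix T)\<bar> = 1" using orthogonal_transformation_det[OF o] by simp
  then have "lborel = density (distr lborel borel ((*v) (matrix T))) (\<lambda>_. 1)"
    using lborel_linear_change[of "matrix T"] by fastforce
  also have "(*v) (matrix T) = T" using assms(1) by (simp add: fun_eq_iff)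
  finally show ?thesis by (simp add: density_1)
qed

text \<open>The transformation formula is available for \<open>real ^ 'n\<close> only; coordinates transport it to product types.\<close>

theorem lborel_distr_isometry:
  fixes T :: "'a::euclidean_space \<Rightarrow> 'b::euclidean_space"
  assumes T: "linear T" "\<And>x. norm (T x) = norm x"
    and dim: "DIM('a) = CARD('n::{finite,wellorder})" "DIM('b) = CARD('n)"
  shows "distr lborel borel T = lborel"
proof -
  obtain \<beta> :: "real^'n::_ \<Rightarrow> 'a" where \<beta>: "bij_betw \<beta> Basis Basis"
    using finite_same_card_bij[of "Basis :: (real^'n::_) set" "Basis :: 'a set"] dim by auto
  obtain \<gamma> :: "real^'n::_ \<Rightarrow> 'b" where \<gamma>: "bij_betw \<gamma> Basis Basis"
    using finite_same_card_bij[of "Basis :: (real^'n::_) set" "Basis :: 'b set"] dim by auto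
  define i where "i = (\<lambda>x::real^'n::_. \<Sum>b\<in>Basis. (x \<bullet> b) *\<^sub>R \<beta> b)"
  define j where "j = (\<lambda>x::real^'n::_. \<Sum>b\<in>Basis. (x \<bullet> b) *\<^sub>R \<gamma> b)"
  define j' where "j' = (\<lambda>y::'b. \<Sum>b\<in>Basis. (y \<bullet> \<gamma> b) *\<^sub>R b)"
  have di: "distr lborel borel i = lborel" and dj: "distr lborel borel j = lborel"
    unfolding i_def j_def by (rule lborel_distr_basis_change[OF \<beta>], rule lborel_distr_basis_change[OF \<gamma>])
  have ni: "norm (i x) = norm x" and nj: "norm (j x) = norm x" for x
    unfolding i_def j_def by (rule norm_basis_change[OF \<beta>], rule norm_basis_change[OF \<gamma>])
  have jj': "j (j' y) = y" for y
  proof -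
    have "j (j' y) = (\<Sum>b\<in>Basis. (y \<bullet> \<gamma> b) *\<^sub>R \<gamma> b)" by (simp add: j_def j'_def)
    also have "\<dots> = (\<Sum>b\<in>Basis. (y \<bullet> b) *\<^sub>R b)" by (rule sum.reindex_bij_betw[OF \<gamma>])
    finally show ?thesis by (simp add: euclidean_representation)
  qed
  have lin: "linear i" "linear j'"
    unfolding i_def j'_def
    by (auto intro!: linearI simp: inner_add_left scaleR_add_left sum.distrib scaleR_sum_right)
  define U where "U x = j' (T (i x))" for x
  have jU: "j (U x) = T (i x)" for x by (simp add: U_def jj')
  have "linear U" unfolding U_def using linear_compose[OF linear_compose[OF lin(1) T(1)] lin(2)]
    by (simp add: o_def)
  moreover have "norm (U x) = norm x" for x using nj[of "U x"] T(2) ni by (simp add: jU)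
  ultimately have dU: "distr lborel borel U = lborel" by (rule lborel_distr_orthogonal_cart)
  have m[measurable]: "i \<in> borel_measurable borel" "j \<in> borel_measurable borel" "T \<in> borel_measurable borel" "U \<in> borel_measurable borel"
    using borel_measurable_linear[OF \<open>linear U\<close>] borel_measurable_linear[OF T(1)]
    unfolding i_def j_def by measurable
  have "distr lborel borel T = distr (distr lborel borel i) borel T" by (simp add: di)
  also have "\<dots> = distr lborel borel (T \<circ> i)" by (rule distr_distr) auto
  also have "T \<circ> i = j \<circ> U" using jU by (simp add: fun_eq_iff)
  also have "distr lborel borel (j \<circ> U) = distr (distr lborel borel U) borel j"
    by (rule distr_distr[symmetric]) auto
  also have "\<dots> = lborel" by (simp add: dU dj)
  finally show ?thesis .
qed

section \<open>Cubic forms on planes\<close>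

text \<open>Index triples replace exponent vectors. The coefficients need not be symmetric and are
  not unique, but restrictions to planes and Gaussian moments become plain sums over
  triples.\<close>

definition cubic_form :: "(real ^ 'n \<Rightarrow> real) \<Rightarrow> bool" where
  "cubic_form P \<longleftrightarrow> (\<exists>T. \<forall>x. P x = (\<Sum>i\<in>UNIV. \<Sum>j\<in>UNIV. \<Sum>k\<in>UNIV. T i j k * (x $ i * x $ j * x $ k)))"

lemma cubic_form_zero: "cubic_form (\<lambda>x :: real ^ 'n. 0)"
  unfolding cubic_form_def
proof (intro exI allI)
  show "0 = (\<Sum>i\<in>UNIV. \<Sum>j\<in>UNIV. \<Sum>k\<in>UNIV. 0 * (x $ i * x $ j * x $ k))" for x :: "real ^ 'n"
    by (simp only: mult_zero_left sum.neutral_const)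
qed

lemma cubic_form_add:
  assumes "cubic_form P" "cubic_form Q" shows "cubic_form (\<lambda>x. P x + Q x)"
proof -
  obtain T U where "\<And>x. P x = (\<Sum>i\<in>UNIV. \<Sum>j\<in>UNIV. \<Sum>k\<in>UNIV. T i j k * (x $ i * x $ j * x $ k))"
    "\<And>x. Q x = (\<Sum>i\<in>UNIV. \<Sum>j\<in>UNIV. \<Sum>k\<in>UNIV. U i j k * (x $ i * x $ j * x $ k))"
    using assms unfolding cubic_form_def by blast
  then show ?thesis unfolding cubic_form_def
    by (intro exI[of _ "\<lambda>i j k. T i j k + U i j k"]) (simp add: sum.distrib distrib_right)
qed

lemma cubic_form_cmult:
  assumes "cubic_form P" shows "cubic_form (\<lambda>x. c * P x)"
proof -
  obtain T where "\<And>x. P x = (\<Sum>i\<in>UNIV. \<Sum>j\<in>UNIV. \<Sum>k\<in>UNIV. T i j k * (x $ i * x $ j * x $ k))"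
    using assms unfolding cubic_form_def by blast
  then show ?thesis unfolding cubic_form_def
    by (intro exI[of _ "\<lambda>i j k. c * T i j k"]) (simp add: sum_distrib_left mult.assoc)
qed

lemma cubic_form_sum: "(\<And>a. a \<in> A \<Longrightarrow> cubic_form (f a)) \<Longrightarrow> cubic_form (\<lambda>x. \<Sum>a\<in>A. f a x)"
  by (induction A rule: infinite_finite_induct) (auto intro: cubic_form_zero cubic_form_add)

lemma cubic_form_monomial: "cubic_form (\<lambda>x :: real ^ 'n. x $ a * x $ b * x $ c)"
  unfolding cubic_form_def
proof (intro exI allI)
  fix x :: "real ^ 'n"
  have "(\<Sum>i\<in>UNIV. \<Sum>j\<in>UNIV. \<Sum>k\<in>UNIV. (if i = a then 1 else 0) * (if j = b then 1 else 0) * (if k = c then 1 else 0) * (x $ i * x $ j * x $ k))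
    = (\<Sum>i\<in>UNIV. \<Sum>j\<in>UNIV. \<Sum>k\<in>UNIV. if k = c then (if j = b then (if i = a then x $ i * x $ j * x $ k else 0) else 0) else 0)"
    by (intro sum.cong) auto
  also have "\<dots> = x $ a * x $ b * x $ c" by simp
  finally show "x $ a * x $ b * x $ c = (\<Sum>i\<in>UNIV. \<Sum>j\<in>UNIV. \<Sum>k\<in>UNIV. (if i = a then 1 else 0) * (if j = b then 1 else 0) * (if k = c then 1 else 0) * (x $ i * x $ j * x $ k))" ..
qed

text \<open>Lowering one positive exponent splits off a coordinate; three such steps turn an
  exponent vector of degree 3 into an index triple.\<close>

lemma monomial_split:
  fixes \<alpha> :: "'n::finite \<Rightarrow> nat"
  assumes "(\<Sum>i\<in>UNIV. \<alpha> i) = Suc d"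
  obtains a \<beta> where "(\<Sum>i\<in>UNIV. \<beta> i) = d"
    "\<And>x :: real ^ 'n. (\<Prod>i\<in>UNIV. x $ i ^ \<alpha> i) = x $ a * (\<Prod>i\<in>UNIV. x $ i ^ \<beta> i)"
proof -
  obtain a where a: "\<alpha> a \<noteq> 0" using assms by (metis sum.neutral nat.distinct(1))
  define \<beta> where "\<beta> = \<alpha>(a := \<alpha> a - 1)"
  have "(\<Sum>i\<in>UNIV. \<alpha> i) = \<alpha> a + (\<Sum>i\<in>UNIV - {a}. \<alpha> i)"
    "(\<Sum>i\<in>UNIV. \<beta> i) = \<beta> a + (\<Sum>i\<in>UNIV - {a}. \<beta> i)" by (simp_all add: sum.remove)
  moreover have "(\<Sum>i\<in>UNIV - {a}. \<beta> i) = (\<Sum>i\<in>UNIV - {a}. \<alpha> i)"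
    by (intro sum.cong) (auto simp: \<beta>_def)
  moreover have "\<alpha> a = Suc (\<beta> a)" using a by (simp add: \<beta>_def)
  ultimately have s: "(\<Sum>i\<in>UNIV. \<beta> i) = d" using assms by simp
  have "(\<Prod>i\<in>UNIV. x $ i ^ \<alpha> i) = x $ a * (\<Prod>i\<in>UNIV. x $ i ^ \<beta> i)" for x :: "real ^ 'n"
  proof -
    have "(\<Prod>i\<in>UNIV. x $ i ^ \<alpha> i) = x $ a ^ \<alpha> a * (\<Prod>i\<in>UNIV - {a}. x $ i ^ \<alpha> i)"
      "(\<Prod>i\<in>UNIV. x $ i ^ \<beta> i) = x $ a ^ \<beta> a * (\<Prod>i\<in>UNIV - {a}. x $ i ^ \<beta> i)" by (simp_all add: prod.remove)
    moreover have "(\<Prod>i\<in>UNIV - {a}. x $ i ^ \<beta> i) = (\<Prod>i\<in>UNIV - {a}. x $ i ^ \<alpha> i)"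
      by (intro prod.cong) (auto simp: \<beta>_def)
    ultimately show ?thesis using \<open>\<alpha> a = Suc (\<beta> a)\<close> by simp
  qed
  with s show ?thesis by (rule that)
qed

lemma monomial_zero: "(\<Sum>i\<in>UNIV. \<alpha> i) = (0::nat) \<Longrightarrow> (\<Prod>i\<in>UNIV. x $ i ^ \<alpha> i) = (1 :: real)"
  for \<alpha> :: "'n::finite \<Rightarrow> nat"
  by simp

lemma hom_poly_3_imp_cubic_form: "f \<in> hom_poly 3 \<Longrightarrow> cubic_form f"
proof -
  assume "f \<in> hom_poly 3"
  then obtain c where c: "\<And>x. f x = (\<Sum>\<alpha> | (\<Sum>i\<in>UNIV. \<alpha> i) = 3. c \<alpha> * (\<Prod>i\<in>UNIV. (x $ i) ^ \<alpha> i))"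
    unfolding hom_poly_def by blast
  have "cubic_form (\<lambda>x. \<Sum>\<alpha> | (\<Sum>i\<in>UNIV. \<alpha> i) = 3. c \<alpha> * (\<Prod>i\<in>UNIV. (x $ i) ^ \<alpha> i))"
  proof (intro cubic_form_sum cubic_form_cmult)
    fix \<alpha> :: "4 \<Rightarrow> nat" assume "\<alpha> \<in> {\<alpha>. (\<Sum>i\<in>UNIV. \<alpha> i) = 3}"
    then have "(\<Sum>i\<in>UNIV. \<alpha> i) = Suc (Suc (Suc 0))" by simp
    then obtain a \<beta> where \<beta>: "(\<Sum>i\<in>UNIV. \<beta> i) = Suc (Suc 0)"
      "\<And>x :: real ^ 4. (\<Prod>i\<in>UNIV. x $ i ^ \<alpha> i) = x $ a * (\<Prod>i\<in>UNIV. x $ i ^ \<beta> i)" by (rule monomial_split) blast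
    then obtain b \<gamma> where \<gamma>: "(\<Sum>i\<in>UNIV. \<gamma> i) = Suc 0"
      "\<And>x :: real ^ 4. (\<Prod>i\<in>UNIV. x $ i ^ \<beta> i) = x $ b * (\<Prod>i\<in>UNIV. x $ i ^ \<gamma> i)" by (elim monomial_split[of \<beta>]) blast
    then obtain c \<delta> where \<delta>: "(\<Sum>i\<in>UNIV. \<delta> i) = 0"
      "\<And>x :: real ^ 4. (\<Prod>i\<in>UNIV. x $ i ^ \<gamma> i) = x $ c * (\<Prod>i\<in>UNIV. x $ i ^ \<delta> i)" by (elim monomial_split[of \<gamma>]) blast
    have "(\<lambda>x :: real ^ 4. \<Prod>i\<in>UNIV. (x $ i) ^ \<alpha> i) = (\<lambda>x. x $ a * x $ b * x $ c)"
      unfolding fun_eq_iff \<beta>(2) \<gamma>(2) \<delta>(2) monomial_zero[OF \<delta>(1)] by simp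
    then show "cubic_form (\<lambda>x :: real ^ 4. \<Prod>i\<in>UNIV. (x $ i) ^ \<alpha> i)" by (simp only: cubic_form_monomial)
  qed
  then show ?thesis unfolding c[abs_def] .
qed

lemma hom_poly_1_imp_linear:
  assumes "f \<in> hom_poly 1" obtains a where "\<And>x. f x = a \<bullet> x"
proof -
  obtain c where c: "\<And>x. f x = (\<Sum>\<alpha> | (\<Sum>i\<in>UNIV. \<alpha> i) = 1. c \<alpha> * (\<Prod>i\<in>UNIV. (x $ i) ^ \<alpha> i))"
    using assms unfolding hom_poly_def by blast
  have "\<exists>a. \<forall>x :: real ^ 4. (\<Prod>i\<in>UNIV. (x $ i) ^ \<alpha> i) = x $ a" if s: "(\<Sum>i\<in>UNIV. \<alpha> i) = 1" for \<alpha> :: "4 \<Rightarrow> nat"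
  proof -
    obtain a \<beta> where \<beta>: "(\<Sum>i\<in>UNIV. \<beta> i) = 0"
      "\<And>x :: real ^ 4. (\<Prod>i\<in>UNIV. x $ i ^ \<alpha> i) = x $ a * (\<Prod>i\<in>UNIV. x $ i ^ \<beta> i)"
      by (rule monomial_split[OF s[unfolded One_nat_def]]) blast
    then show ?thesis using monomial_zero[OF \<beta>(1)] by auto
  qed
  then obtain h where h: "\<And>\<alpha> :: 4 \<Rightarrow> nat. \<And>x :: real ^ 4. (\<Sum>i\<in>UNIV. \<alpha> i) = 1 \<Longrightarrow> (\<Prod>i\<in>UNIV. (x $ i) ^ \<alpha> i) = x $ h \<alpha>"
    by metis
  have "f x = (\<Sum>\<alpha> | (\<Sum>i\<in>UNIV. \<alpha> i) = 1. c \<alpha> *\<^sub>R axis (h \<alpha>) 1) \<bullet> x" for x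
    unfolding c inner_sum_left by (intro sum.cong) (auto simp: h inner_axis')
  then show ?thesis by (rule that)
qed

lemma finite_exponents: "finite {\<alpha> :: 'n::finite \<Rightarrow> nat. (\<Sum>i\<in>UNIV. \<alpha> i) = d}"
proof (rule finite_subset)
  show "{\<alpha> :: 'n \<Rightarrow> nat. (\<Sum>i\<in>UNIV. \<alpha> i) = d} \<subseteq> PiE UNIV (\<lambda>_. {..d})"
    by (auto simp: PiE_def intro!: member_le_sum)
qed (intro finite_PiE, auto)

lemma hom_poly_add: "f \<in> hom_poly d \<Longrightarrow> g \<in> hom_poly d \<Longrightarrow> (\<lambda>x. f x + g x) \<in> hom_poly d"
proof -
  assume "f \<in> hom_poly d" "g \<in> hom_poly d"
  then obtain a b where "\<And>x. f x = (\<Sum>\<alpha> | (\<Sum>i\<in>UNIV. \<alpha> i) = d. a \<alpha> * (\<Prod>i\<in>UNIV. (x $ i) ^ \<alpha> i))"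
    "\<And>x. g x = (\<Sum>\<alpha> | (\<Sum>i\<in>UNIV. \<alpha> i) = d. b \<alpha> * (\<Prod>i\<in>UNIV. (x $ i) ^ \<alpha> i))"
    unfolding hom_poly_def by blast
  then show ?thesis unfolding hom_poly_def
    by (intro CollectI exI[of _ "\<lambda>\<alpha>. a \<alpha> + b \<alpha>"]) (simp add: distrib_right sum.distrib)
qed

lemma hom_poly_cmult: "f \<in> hom_poly d \<Longrightarrow> (\<lambda>x. c * f x) \<in> hom_poly d"
proof -
  assume "f \<in> hom_poly d"
  then obtain a where "\<And>x. f x = (\<Sum>\<alpha> | (\<Sum>i\<in>UNIV. \<alpha> i) = d. a \<alpha> * (\<Prod>i\<in>UNIV. (x $ i) ^ \<alpha> i))"
    unfolding hom_poly_def by blast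
  then show ?thesis unfolding hom_poly_def
    by (intro CollectI exI[of _ "\<lambda>\<alpha>. c * a \<alpha>"]) (simp add: sum_distrib_left mult.assoc)
qed

lemma hom_poly_zero: "(\<lambda>x. 0) \<in> hom_poly d"
  unfolding hom_poly_def by (intro CollectI exI[of _ "\<lambda>\<alpha>. 0"] allI) (simp only: mult_zero_left sum.neutral_const)

lemma hom_poly_sum: "(\<And>a. a \<in> A \<Longrightarrow> f a \<in> hom_poly d) \<Longrightarrow> (\<lambda>x. \<Sum>a\<in>A. f a x) \<in> hom_poly d"
  by (induction A rule: infinite_finite_induct) (auto intro: hom_poly_zero hom_poly_add)

lemma monomial_in_hom_poly:
  assumes "(\<Sum>i\<in>UNIV. \<beta> i) = d"
  shows "(\<lambda>x. \<Prod>i\<in>UNIV. (x $ i) ^ \<beta> i) \<in> hom_poly d"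
  unfolding hom_poly_def
proof (intro CollectI exI allI)
  fix x :: "real ^ 4"
  have "(\<Sum>\<alpha> | (\<Sum>i\<in>UNIV. \<alpha> i) = d. (if \<alpha> = \<beta> then 1 else 0) * (\<Prod>i\<in>UNIV. (x $ i) ^ \<alpha> i))
     = (\<Sum>\<alpha> | (\<Sum>i\<in>UNIV. \<alpha> i) = d. if \<alpha> = \<beta> then (\<Prod>i\<in>UNIV. (x $ i) ^ \<alpha> i) else 0)"
    by (intro sum.cong) auto
  also have "\<dots> = (\<Prod>i\<in>UNIV. (x $ i) ^ \<beta> i)"
    using assms finite_exponents by (subst sum.delta) auto
  finally show "(\<Prod>i\<in>UNIV. (x $ i) ^ \<beta> i) = (\<Sum>\<alpha> | (\<Sum>i\<in>UNIV. \<alpha> i) = d. (if \<alpha> = \<beta> then 1 else 0) * (\<Prod>i\<in>UNIV. (x $ i) ^ \<alpha> i))" ..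
qed

lemma prod_power_delta: "(\<Prod>l\<in>UNIV. x $ l ^ (if l = i then 1 else 0)) = (x $ i :: real)"
  for x :: "real ^ 'n"
proof -
  have "(\<Prod>l\<in>UNIV. x $ l ^ (if l = i then 1 else 0)) = (\<Prod>l\<in>UNIV. if l = i then x $ l else 1)"
    by (intro prod.cong) auto
  then show ?thesis by simp
qed

lemma cubic_form_iff_hom_poly: "f \<in> hom_poly 3 \<longleftrightarrow> cubic_form f"
proof
  assume "cubic_form f"
  then obtain T where T: "\<And>x. f x = (\<Sum>i\<in>UNIV. \<Sum>j\<in>UNIV. \<Sum>k\<in>UNIV. T i j k * (x $ i * x $ j * x $ k))"
    unfolding cubic_form_def by blast
  have "(\<lambda>x :: real ^ 4. x $ i * x $ j * x $ k) \<in> hom_poly 3" for i j k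
  proof -
    define \<beta> :: "4 \<Rightarrow> nat" where "\<beta> l = (if l = i then 1 else 0) + (if l = j then 1 else 0) + (if l = k then 1 else 0)" for l
    have "(\<Sum>l\<in>UNIV. \<beta> l) = 3" by (simp add: \<beta>_def sum.distrib)
    moreover have "(\<Prod>l\<in>UNIV. (x $ l) ^ \<beta> l) = x $ i * x $ j * x $ k" for x :: "real ^ 4"
      unfolding \<beta>_def power_add prod.distrib prod_power_delta ..
    ultimately show ?thesis using monomial_in_hom_poly[of \<beta> 3] by simp
  qed
  then show "f \<in> hom_poly 3" unfolding T[abs_def]
    by (intro hom_poly_sum hom_poly_cmult)
qed (rule hom_poly_3_imp_cubic_form)

lemma linear_in_hom_poly: "(\<lambda>x. a \<bullet> x) \<in> hom_poly 1"
proof -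
  have "(\<lambda>x :: real ^ 4. x $ i) \<in> hom_poly 1" for i
    using monomial_in_hom_poly[of "\<lambda>l. if l = i then 1 else 0" 1] by (simp add: prod_power_delta)
  then have "(\<lambda>x. \<Sum>i\<in>UNIV. a $ i * x $ i) \<in> hom_poly 1"
    by (intro hom_poly_sum hom_poly_cmult)
  then show ?thesis by (simp add: inner_vec_def)
qed

section \<open>Vanishing on a plane and row reduced bases\<close>

lemma cubic_form_binary:
  assumes "cubic_form P"
  obtains \<beta> \<gamma> where "\<And>s t. P (s *\<^sub>R v + t *\<^sub>R w) = P v * s^3 + \<beta> * s^2 * t + \<gamma> * s * t^2 + P w * t^3"
proof -
  obtain T where T: "\<And>x. P x = (\<Sum>i\<in>UNIV. \<Sum>j\<in>UNIV. \<Sum>k\<in>UNIV. T i j k * (x $ i * x $ j * x $ k))"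
    using assms unfolding cubic_form_def by blast
  have "P (s *\<^sub>R v + t *\<^sub>R w) = P v * s^3
    + (\<Sum>i\<in>UNIV. \<Sum>j\<in>UNIV. \<Sum>k\<in>UNIV. T i j k * (v $ i * v $ j * w $ k + v $ i * w $ j * v $ k + w $ i * v $ j * v $ k)) * s^2 * t
    + (\<Sum>i\<in>UNIV. \<Sum>j\<in>UNIV. \<Sum>k\<in>UNIV. T i j k * (v $ i * w $ j * w $ k + w $ i * w $ j * v $ k + w $ i * v $ j * w $ k)) * s * t^2
    + P w * t^3" for s t
    unfolding T sum_distrib_right sum.distrib[symmetric]
    by (intro sum.cong refl) (simp add: algebra_simps power2_eq_square power3_eq_cube)
  then show ?thesis by (rule that)
qed

lemma span_pair_iff: "x \<in> span {v, w} \<longleftrightarrow> (\<exists>s t. x = s *\<^sub>R v + t *\<^sub>R w)"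
proof -
  have "x \<in> span {v, w} \<longleftrightarrow> (\<exists>s t. x - s *\<^sub>R v = t *\<^sub>R w)"
    by (auto simp: span_insert)
  also have "\<dots> \<longleftrightarrow> (\<exists>s t. x = s *\<^sub>R v + t *\<^sub>R w)"
    by (simp add: algebra_simps)
  finally show ?thesis .
qed

text \<open>On the plane the form is a binary cubic, and a nonzero binary cubic has at most three
  zeros on the projective line. Concretely, the zeros at \<open>v\<close> and \<open>w\<close> leave
  \<open>s * t * (\<beta> * s + \<gamma> * t)\<close>, and the other two points give \<beta> +
  \<gamma> = 0 and -\<beta> + \<gamma> = 0.\<close>

lemma cubic_form_vanishes_iff:
  assumes "cubic_form P"
  shows "(\<forall>x\<in>span {v, w}. P x = 0) \<longleftrightarrow> P v = 0 \<and> P w = 0 \<and> P (v + w) = 0 \<and> P (v - w) = 0"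
proof
  have "v \<in> span {v, w}" "w \<in> span {v, w}" by (simp_all add: span_base)
  then have "v + w \<in> span {v, w}" "v - w \<in> span {v, w}" by (simp_all add: span_add span_diff)
  moreover assume "\<forall>x\<in>span {v, w}. P x = 0"
  ultimately show "P v = 0 \<and> P w = 0 \<and> P (v + w) = 0 \<and> P (v - w) = 0"
    using span_base[of v "{v, w}"] span_base[of w "{v, w}"] by auto
next
  assume z: "P v = 0 \<and> P w = 0 \<and> P (v + w) = 0 \<and> P (v - w) = 0"
  obtain \<beta> \<gamma> where b: "\<And>s t. P (s *\<^sub>R v + t *\<^sub>R w) = P v * s^3 + \<beta> * s^2 * t + \<gamma> * s * t^2 + P w * t^3"
    using cubic_form_binary[OF assms] by metis
  have "\<beta> + \<gamma> = 0" "- \<beta> + \<gamma> = 0" using b[of 1 1] b[of 1 "-1"] z by auto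
  then have "\<beta> = 0" "\<gamma> = 0" by auto
  show "\<forall>x\<in>span {v, w}. P x = 0"
  proof
    fix x assume "x \<in> span {v, w}"
    then obtain s t where "x = s *\<^sub>R v + t *\<^sub>R w"
      using span_pair_iff by blast
    then show "P x = 0" using b[of s t] z \<open>\<beta> = 0\<close> \<open>\<gamma> = 0\<close> by simp
  qed
qed

text \<open>The pivots stand in columns \<open>i\<close> and \<open>j\<close>. The entry
  \<open>w $ i = 0\<close> of a reduced matrix is contained in the last clause, since
  \<open>i < j\<close>.\<close>

definition rref :: "'n::{finite,wellorder} \<Rightarrow> 'n \<Rightarrow> real ^ 'n::_ \<Rightarrow> real ^ 'n::_ \<Rightarrow> bool" where
  "rref i j v w \<longleftrightarrow> i < j \<and> v $ i = 1 \<and> v $ j = 0 \<and> w $ j = 1 \<and>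
     (\<forall>k<i. v $ k = 0) \<and> (\<forall>k<j. w $ k = 0)"

lemma rref_independent:
  assumes "rref i j v w" shows "independent {v, w}" "v \<noteq> w" "dim (span {v, w}) = 2"
proof -
  have vw: "v $ i = 1" "v $ j = 0" "w $ j = 1" "w $ i = 0" using assms by (auto simp: rref_def)
  then show "v \<noteq> w" by auto
  have "w \<noteq> 0" using vw by auto
  moreover have "v \<notin> span {w}" using vw by (auto simp: span_singleton)
  ultimately show "independent {v, w}"
    using \<open>v \<noteq> w\<close> independent_insert[of v "{w}"] by (simp add: insert_commute)
  then show "dim (span {v, w}) = 2" using \<open>v \<noteq> w\<close> by (simp add: dim_eq_card_independent)
qed

text \<open>The pivot \<open>i\<close> is the first coordinate not identically zero on
  \<open>V\<close>, and \<open>j\<close> is the first one not identically zero on the part of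
  \<open>V\<close> where coordinate \<open>i\<close> vanishes. Such a \<open>j\<close> exists, since
  otherwise one vector would span \<open>V\<close>.\<close>

lemma rref_exists:
  fixes V :: "(real ^ 'n::{finite,wellorder}) set"
  assumes V: "subspace V" "dim V = 2"
  obtains i j v w where "rref i j v w" "V = span {v, w}"
proof -
  define I where "I i \<longleftrightarrow> (\<exists>x\<in>V. x $ i \<noteq> 0)" for i
  have "\<exists>i. I i"
  proof (rule ccontr)
    assume "\<nexists>i. I i"
    then have "V \<subseteq> {0}" unfolding I_def by (auto simp: vec_eq_iff)
    then show False using V(2) by (metis dim_subset dim_singleton numeral_2_eq_2 dim_eq_0 zero_neq_numeral)
  qed
  define i where "i = (LEAST i. I i)"
  have "I i" unfolding i_def by (rule LeastI_ex[OF \<open>\<exists>i. I i\<close>])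
  have i0: "x $ k = 0" if "x \<in> V" "k < i" for x k
  proof -
    have "\<not> I k" using not_less_Least[of k I] that by (simp add: i_def)
    then show ?thesis using that unfolding I_def by blast
  qed
  obtain x0 where x0: "x0 \<in> V" "x0 $ i \<noteq> 0" using \<open>I i\<close> I_def by blast
  define v0 where "v0 = (1 / x0 $ i) *\<^sub>R x0"
  have v0: "v0 \<in> V" "v0 $ i = 1" using x0 V(1) by (auto simp: v0_def subspace_scale)
  define J where "J j \<longleftrightarrow> (\<exists>x\<in>V. x $ i = 0 \<and> x $ j \<noteq> 0)" for j
  have "\<exists>j. J j"
  proof (rule ccontr)
    assume "\<nexists>j. J j"
    then have *: "x = 0" if "x \<in> V" "x $ i = 0" for x using that unfolding J_def by (auto simp: vec_eq_iff)
    have "V \<subseteq> span {v0}"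
    proof
      fix x assume x: "x \<in> V"
      have "x - (x $ i) *\<^sub>R v0 = 0"
      proof (rule *)
        show "x - (x $ i) *\<^sub>R v0 \<in> V" using x v0 V(1) by (simp add: subspace_diff subspace_scale)
      qed (use v0 in simp)
      then have "x = (x $ i) *\<^sub>R v0" by simp
      then show "x \<in> span {v0}" unfolding span_singleton by blast
    qed
    then have "dim V \<le> card {v0}" by (rule dim_le_card) auto
    then show False using V(2) by simp
  qed
  define j where "j = (LEAST j. J j)"
  have "J j" unfolding j_def by (rule LeastI_ex[OF \<open>\<exists>j. J j\<close>])
  have j0: "x $ k = 0" if "x \<in> V" "x $ i = 0" "k < j" for x k
  proof -
    have "\<not> J k" using not_less_Least[of k J] that by (simp add: j_def)
    then show ?thesis using that unfolding J_def by blast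
  qed
  obtain y0 where y0: "y0 \<in> V" "y0 $ i = 0" "y0 $ j \<noteq> 0" using \<open>J j\<close> J_def by blast
  define w where "w = (1 / y0 $ j) *\<^sub>R y0"
  have w: "w \<in> V" "w $ i = 0" "w $ j = 1" using y0 V(1) by (auto simp: w_def subspace_scale)
  have "i < j"
  proof (rule ccontr)
    assume "\<not> i < j"
    then have "j = i \<or> j < i" by auto
    then show False using y0 i0 by auto
  qed
  define v where "v = v0 - (v0 $ j) *\<^sub>R w"
  have v: "v \<in> V" "v $ i = 1" "v $ j = 0"
    using v0 w V(1) by (auto simp: v_def subspace_diff subspace_scale)
  have r: "rref i j v w" unfolding rref_def using \<open>i < j\<close> v w i0 j0 by blast
  have "span {v, w} \<subseteq> V" using v w V(1) by (intro span_minimal) auto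
  moreover have "dim (span {v, w}) = dim V" using rref_independent(3)[OF r] V(2) by simp
  ultimately have "span {v, w} = V"
    using V(1) by (intro subspace_dim_equal) auto
  then show ?thesis using that r by blast
qed

text \<open>Inclusion of one span in the other bounds the pivots on one side, so both inclusions
  make them equal. Comparing pivot coordinates then forces the coefficients of each basis in terms
  of the other to be trivial.\<close>

lemma rref_unique:
  assumes r: "rref i j v w" "rref i' j' v' w'" and eq: "span {v, w} = span {v', w'}"
  shows "i = i' \<and> j = j' \<and> v = v' \<and> w = w'"
proof -
  have coord: "i' \<le> i \<and> (i = i' \<longrightarrow> j' \<le> j)" if r: "rref i j v w" "rref i' j' v' w'"
    and sub: "span {v, w} \<subseteq> span {v', w'}" for i j v w i' j' v' w'
  proof
    have "v \<in> span {v', w'}" "w \<in> span {v', w'}" using sub span_base[of _ "{v, w}"] by auto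
    then obtain s t a b where st: "v = s *\<^sub>R v' + t *\<^sub>R w'" "w = a *\<^sub>R v' + b *\<^sub>R w'"
      unfolding span_pair_iff by blast
    show "i' \<le> i"
    proof (rule ccontr)
      assume "\<not> i' \<le> i"
      then have "v' $ i = 0" "w' $ i = 0" using r unfolding rref_def by auto
      then have "v $ i = 0" using st by simp
      then show False using r by (simp add: rref_def)
    qed
    show "i = i' \<longrightarrow> j' \<le> j"
    proof (rule impI, rule ccontr)
      assume "i = i'" "\<not> j' \<le> j"
      have "w $ i = 0" "v' $ i = 1" "w' $ i = 0" using r \<open>i = i'\<close> unfolding rref_def by auto
      then have "a = 0" using st by simp
      moreover have "w' $ j = 0" using r \<open>\<not> j' \<le> j\<close> unfolding rref_def by auto
      ultimately have "w $ j = 0" using st by simp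
      then show False using r by (simp add: rref_def)
    qed
  qed
  have ii: "i = i'" using coord[OF r] coord[OF r(2,1)] eq by auto
  have jj: "j = j'" using coord[OF r] coord[OF r(2,1)] eq ii by auto
  have "v \<in> span {v', w'}" "w \<in> span {v', w'}" unfolding eq[symmetric] by (simp_all add: span_base)
  then obtain s t a b where st: "v = s *\<^sub>R v' + t *\<^sub>R w'" "w = a *\<^sub>R v' + b *\<^sub>R w'"
    unfolding span_pair_iff by blast
  have c: "v $ i = 1" "v $ j = 0" "w $ j = 1" "w $ i = 0" "v' $ i = 1" "v' $ j = 0" "w' $ j = 1" "w' $ i = 0"
    using r ii jj by (auto simp: rref_def)
  have "s = 1" "t = 0" "a = 0" "b = 1" using c st by auto
  then show ?thesis using st ii jj by simp
qed

section \<open>Projective lines as planes of \<open>real ^ 4\<close>\<close>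

lemma line_of_plane_in_zero_set_iff:
  assumes V: "subspace V" "V \<noteq> {0}"
  shows "{p \<in> RP3. p \<subseteq> V} \<subseteq> proj_zero_set P \<longleftrightarrow> (\<forall>x\<in>V. P x = 0)"
proof
  assume L: "{p \<in> RP3. p \<subseteq> V} \<subseteq> proj_zero_set P"
  show "\<forall>x\<in>V. P x = 0"
  proof
    fix x assume x: "x \<in> V"
    obtain y where y: "y \<in> V" "y \<noteq> 0" using V x by blast
    \<comment> \<open>The zero vector spans no projective point; it is reached through the span of
      some nonzero vector of \<open>V\<close>.\<close>
    let ?y = "if x = 0 then y else x"
    have "?y \<in> V" "?y \<noteq> 0" using x y by auto
    then have "span {?y} \<in> {p \<in> RP3. p \<subseteq> V}"
      using V(1) span_minimal[of "{?y}" V] by (simp add: RP3_def)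
    then have "span {?y} \<in> proj_zero_set P" using L by blast
    moreover have "x \<in> span {?y}" by (simp add: span_base span_zero)
    ultimately show "P x = 0" by (simp add: proj_zero_set_def)
  qed
next
  assume "\<forall>x\<in>V. P x = 0"
  then show "{p \<in> RP3. p \<subseteq> V} \<subseteq> proj_zero_set P" unfolding proj_zero_set_def by blast
qed

lemma plane_eq_Union_points:
  assumes V: "subspace V" "V \<noteq> {0}"
  shows "\<Union>{p \<in> RP3. p \<subseteq> V} = V"
proof
  show "V \<subseteq> \<Union>{p \<in> RP3. p \<subseteq> V}"
  proof
    fix x assume x: "x \<in> V"
    obtain y where y: "y \<in> V" "y \<noteq> 0" using V x by blast
    let ?y = "if x = 0 then y else x"
    have "?y \<in> V" "?y \<noteq> 0" using x y by auto
    then have "span {?y} \<in> {p \<in> RP3. p \<subseteq> V}"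
      using V(1) span_minimal[of "{?y}" V] by (simp add: RP3_def)
    moreover have "x \<in> span {?y}" by (simp add: span_base span_zero)
    ultimately show "x \<in> \<Union>{p \<in> RP3. p \<subseteq> V}" by blast
  qed
qed blast

lemma num_lines_eq_planes:
  "num_lines P = ecard {V. subspace V \<and> dim V = 2 \<and> (\<forall>x\<in>V. P x = 0)}"
proof -
  define L where "L V = {p \<in> RP3. p \<subseteq> V}" for V
  have ne: "V \<noteq> {0}" if "dim V = 2" for V :: "(real ^ 4) set" using that by auto
  have "inj_on L {V. subspace V \<and> dim V = 2 \<and> (\<forall>x\<in>V. P x = 0)}"
    by (rule inj_on_inverseI[of _ Union]) (use plane_eq_Union_points ne in \<open>auto simp: L_def\<close>)
  moreover have "L ` {V. subspace V \<and> dim V = 2 \<and> (\<forall>x\<in>V. P x = 0)} = {l \<in> proj_lines. l \<subseteq> proj_zero_set P}"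
    (is "L ` ?A = ?B")
  proof (rule set_eqI)
    fix l
    have "l \<in> ?B \<longleftrightarrow> (\<exists>V. subspace V \<and> dim V = 2 \<and> l = L V \<and> L V \<subseteq> proj_zero_set P)"
      unfolding proj_lines_def L_def by blast
    also have "\<dots> \<longleftrightarrow> (\<exists>V. subspace V \<and> dim V = 2 \<and> l = L V \<and> (\<forall>x\<in>V. P x = 0))"
      using line_of_plane_in_zero_set_iff ne unfolding L_def by blast
    also have "\<dots> \<longleftrightarrow> l \<in> L ` ?A" by blast
    finally show "l \<in> L ` ?A \<longleftrightarrow> l \<in> ?B" by blast
  qed
  ultimately show ?thesis
    using ecard_image_inj[of L "{V. subspace V \<and> dim V = 2 \<and> (\<forall>x\<in>V. P x = 0)}"]
    unfolding num_lines_def ecard_def[symmetric] by simp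
qed

text \<open>Six summands, one for each pair of pivots: the pivots tell which Schubert cell contains
  the plane, and inside the cell the reduced basis is a faithful coordinate.\<close>

lemma num_lines_eq_rref:
  fixes P :: "real ^ 4 \<Rightarrow> real"
  shows "num_lines P = (\<Sum>(i, j)\<in>{(i, j). i < j}. ecard {(v, w). rref i j v w \<and> (\<forall>x\<in>span {v, w}. P x = 0)})"
proof -
  define X where "X i j = {(v, w). rref i j v w \<and> (\<forall>x\<in>span {v, w}. P x = 0)}" for i j :: 4
  define \<S> where "\<S> = (\<lambda>(v, w). span {v, w :: real ^ 4})"
  define Y where "Y = (\<lambda>(i, j). \<S> ` X i j)"
  have inj: "inj_on \<S> (X i j)" for i j
  proof (rule inj_onI)
    fix p q assume pq: "p \<in> X i j" "q \<in> X i j" "\<S> p = \<S> q"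
    obtain v w v' w' where p: "p = (v, w)" and q: "q = (v', w')" by (metis surj_pair)
    have r: "rref i j v w" "rref i j v' w'" using pq(1,2) unfolding X_def p q by blast+
    have "span {v, w} = span {v', w'}" using pq(3) unfolding \<S>_def p q by (simp only: prod.case)
    from rref_unique[OF r this] show "p = q" unfolding p q by blast
  qed
  have cover: "{V. subspace V \<and> dim V = 2 \<and> (\<forall>x\<in>V. P x = 0)} = (\<Union>p\<in>{(i, j). i < j}. Y p)"
  proof (intro set_eqI iffI)
    fix V assume "V \<in> {V. subspace V \<and> dim V = 2 \<and> (\<forall>x\<in>V. P x = 0)}"
    then have V: "subspace V" "dim V = 2" "\<forall>x\<in>V. P x = 0" by auto
    obtain i j v w where r: "rref i j v w" "V = span {v, w}" using rref_exists[OF V(1,2)] by metis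
    then have "(v, w) \<in> X i j" "i < j" using V(3) by (auto simp: X_def rref_def)
    then show "V \<in> (\<Union>p\<in>{(i, j). i < j}. Y p)"
      unfolding Y_def using r(2) by (intro UN_I[of "(i, j)"]) (auto simp: \<S>_def intro!: image_eqI[of _ _ "(v, w)"])
  next
    fix V assume "V \<in> (\<Union>p\<in>{(i, j). i < j}. Y p)"
    then obtain i j v w where "rref i j v w" "\<forall>x\<in>span {v, w}. P x = 0" "V = span {v, w}"
      by (auto simp: Y_def X_def \<S>_def)
    then show "V \<in> {V. subspace V \<and> dim V = 2 \<and> (\<forall>x\<in>V. P x = 0)}"
      using rref_independent(3) by auto
  qed
  have dis: "disjoint_family_on Y {(i, j). i < j}"
    unfolding disjoint_family_on_def
  proof (intro ballI impI)
    fix p q :: "4 \<times> 4" assume "p \<noteq> q"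
    show "Y p \<inter> Y q = {}"
    proof (rule ccontr)
      assume "Y p \<inter> Y q \<noteq> {}"
      then obtain V where V: "V \<in> Y p" "V \<in> Y q" by blast
      obtain i j i' j' where p: "p = (i, j)" and q: "q = (i', j')" by (metis surj_pair)
      obtain v w where r: "rref i j v w" "V = span {v, w}"
        using V(1) unfolding Y_def X_def \<S>_def p by blast
      obtain v' w' where r': "rref i' j' v' w'" "V = span {v', w'}"
        using V(2) unfolding Y_def X_def \<S>_def q by blast
      have "p = q" using rref_unique[OF r(1) r'(1)] r(2) r'(2) unfolding p q by simp
      then show False using \<open>p \<noteq> q\<close> by simp
    qed
  qed
  have "num_lines P = (\<Sum>p\<in>{(i, j). i < j}. ecard (Y p))"
    unfolding num_lines_eq_planes cover ecard_def
    by (rule sum_emeasure[symmetric]) (use dis in auto)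
  also have "\<dots> = (\<Sum>(i, j)\<in>{(i, j). i < j}. ecard (X i j))"
    by (intro sum.cong refl) (auto simp: Y_def ecard_image_inj[OF inj])
  finally show ?thesis unfolding X_def .
qed

section \<open>Zeros of a random linear family\<close>

text \<open>Cramer's rule as an explicit quotient of determinants: continuity and differentiability
  are inherited where \<open>det M\<close> is nonzero, and measurability everywhere, because a
  quotient by zero is zero.\<close>

definition cramer_sol :: "real ^ 'n ^ 'n \<Rightarrow> real ^ 'n \<Rightarrow> real ^ 'n" where
  "cramer_sol M y = (\<chi> k. det (\<chi> i j. if j = k then y $ i else M $ i $ j) / det M)"

lemma cramer_sol_iff: "det M \<noteq> 0 \<Longrightarrow> M *v x = y \<longleftrightarrow> x = cramer_sol M y"
  unfolding cramer_sol_def by (rule cramer)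

lemma cramer_sol_works: "det M \<noteq> 0 \<Longrightarrow> M *v cramer_sol M y = y"
  by (simp add: cramer_sol_iff)

lemma continuous_on_det:
  fixes X :: "'a::topological_space \<Rightarrow> real ^ 'n ^ 'n"
  assumes "\<And>i j. continuous_on U (\<lambda>a. X a $ i $ j)"
  shows "continuous_on U (\<lambda>a. det (X a))"
  unfolding det_def by (intro continuous_intros assms)

lemma continuous_on_cramer_det:
  fixes M :: "'a::topological_space \<Rightarrow> real ^ 'n ^ 'n"
  assumes M: "continuous_on U M" and y: "continuous_on U y"
  shows "continuous_on U (\<lambda>a. det (\<chi> i j. if j = k then y a $ i else M a $ i $ j))"
proof (rule continuous_on_det)
  fix i j :: 'n
  show "continuous_on U (\<lambda>a. (\<chi> i j. if j = k then y a $ i else M a $ i $ j) $ i $ j)"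
    by (cases "j = k") (auto intro!: continuous_intros M y)
qed

lemma continuous_on_cramer_sol:
  fixes M :: "'a::topological_space \<Rightarrow> real ^ 'n ^ 'n"
  assumes M: "continuous_on U M" and y: "continuous_on U y" and nz: "\<And>a. a \<in> U \<Longrightarrow> det (M a) \<noteq> 0"
  shows "continuous_on U (\<lambda>a. cramer_sol (M a) (y a))"
  unfolding cramer_sol_def
proof (rule continuous_on_vec_lambda)
  have "continuous_on U (\<lambda>a. det (M a))" by (rule continuous_on_det) (intro continuous_intros M)
  then show "continuous_on U (\<lambda>a. det (\<chi> i j. if j = k then y a $ i else M a $ i $ j) / det (M a))" for k
    using nz by (intro continuous_on_divide continuous_on_cramer_det M y) auto
qed

lemma borel_measurable_vec_lambda:
  fixes f :: "'a \<Rightarrow> 'n::finite \<Rightarrow> real"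
  assumes "\<And>i. (\<lambda>x. f x i) \<in> borel_measurable N"
  shows "(\<lambda>x. \<chi> i. f x i) \<in> borel_measurable N"
proof (rule borel_measurable_euclidean_space[THEN iffD2], rule ballI)
  fix b :: "real ^ 'n" assume "b \<in> Basis"
  then obtain i where "b = axis i 1" by (auto simp: Basis_vec_def)
  then show "(\<lambda>x. (\<chi> i. f x i) \<bullet> b) \<in> borel_measurable N" using assms by (simp add: inner_axis)
qed

lemma borel_measurable_cramer_sol:
  fixes M :: "'a::topological_space \<Rightarrow> real ^ 'n ^ 'n"
  assumes M: "continuous_on UNIV M" and y: "continuous_on UNIV y"
  shows "(\<lambda>a. cramer_sol (M a) (y a)) \<in> borel_measurable borel"
  unfolding cramer_sol_def
proof (rule borel_measurable_vec_lambda)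
  have [measurable]: "(\<lambda>a. det (\<chi> i j. if j = k then y a $ i else M a $ i $ j)) \<in> borel_measurable borel" for k
    by (rule borel_measurable_continuous_onI[OF continuous_on_cramer_det[OF M y]])
  have [measurable]: "(\<lambda>a. det (M a)) \<in> borel_measurable borel"
    by (intro borel_measurable_continuous_onI continuous_on_det continuous_intros M)
  show "(\<lambda>a. det (\<chi> i j. if j = k then y a $ i else M a $ i $ j) / det (M a)) \<in> borel_measurable borel" for k
    by measurable
qed

lemma differentiable_prod:
  fixes f :: "'i \<Rightarrow> 'a::real_normed_vector \<Rightarrow> real"
  assumes "\<And>i. i \<in> I \<Longrightarrow> f i differentiable (at x)"
  shows "(\<lambda>x. \<Prod>i\<in>I. f i x) differentiable (at x)"
proof -
  have "\<forall>i\<in>I. \<exists>f'. (f i has_derivative f') (at x)" using assms by (auto simp: differentiable_def)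
  then obtain f' where "\<And>i. i \<in> I \<Longrightarrow> (f i has_derivative f' i) (at x)" by metis
  then have "((\<lambda>x. \<Prod>i\<in>I. f i x) has_derivative (\<lambda>y. \<Sum>i\<in>I. f' i y * (\<Prod>j\<in>I - {i}. f j x))) (at x)"
    by (rule has_derivative_prod)
  then show ?thesis unfolding differentiable_def by blast
qed

lemma differentiable_det:
  fixes X :: "'a::real_normed_vector \<Rightarrow> real ^ 'n ^ 'n"
  assumes "\<And>i j. (\<lambda>a. X a $ i $ j) differentiable (at x)"
  shows "(\<lambda>a. det (X a)) differentiable (at x)"
  unfolding det_def by (intro differentiable_sum ballI finite_permutations differentiable_mult differentiable_const differentiable_prod assms) simp

lemma differentiable_vec_lambda:
  fixes f :: "'a::real_normed_vector \<Rightarrow> 'n::finite \<Rightarrow> real"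
  assumes "\<And>i. (\<lambda>x. f x i) differentiable (at x)"
  shows "(\<lambda>x. \<chi> i. f x i) differentiable (at x)"
proof -
  have "(\<lambda>x. \<Sum>i\<in>UNIV. f x i *\<^sub>R axis i (1::real)) differentiable (at x)"
    by (intro differentiable_sum ballI differentiable_scaleR differentiable_const assms) simp
  also have "(\<lambda>x. \<Sum>i\<in>UNIV. f x i *\<^sub>R axis i (1::real)) = (\<lambda>x. \<chi> i. f x i)"
    by (simp add: fun_eq_iff vec_eq_iff axis_def if_distrib cong: if_cong)
  finally show ?thesis .
qed

lemma differentiable_cramer_sol:
  fixes M :: "'a::real_normed_vector \<Rightarrow> real ^ 'n ^ 'n"
  assumes M: "\<And>i j. (\<lambda>a. M a $ i $ j) differentiable (at x)" and y: "\<And>i. (\<lambda>a. y a $ i) differentiable (at x)"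
    and nz: "det (M x) \<noteq> 0"
  shows "(\<lambda>a. cramer_sol (M a) (y a)) differentiable (at x)"
  unfolding cramer_sol_def
proof (rule differentiable_vec_lambda)
  fix k
  have "(\<lambda>a. det (\<chi> i j. if j = k then y a $ i else M a $ i $ j)) differentiable (at x)"
  proof (rule differentiable_det)
    show "(\<lambda>a. (\<chi> i j. if j = k then y a $ i else M a $ i $ j) $ i $ j) differentiable (at x)" for i j
      using M y by (cases "j = k") auto
  qed
  moreover have "(\<lambda>a. det (M a)) differentiable (at x)" by (rule differentiable_det[OF M])
  ultimately show "(\<lambda>a. det (\<chi> i j. if j = k then y a $ i else M a $ i $ j) / det (M a)) differentiable (at x)"
    using nz by (intro differentiable_divide) auto
qed

text \<open>A family of linear systems \<open>M A u + N A v = 0\<close> in the unknown \<open>A\<close>, with random coefficients \<open>(u, v)\<close>.\<close>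

locale linear_family =
  fixes M :: "real ^ 'n::{finite,wellorder} \<Rightarrow> real ^ 'n::_ ^ 'n::_"
    and N :: "real ^ 'n::_ \<Rightarrow> 'v::euclidean_space ^ 'n::_"
    and dM :: "'n \<Rightarrow> real ^ 'n::_ \<Rightarrow> real ^ 'n::_ ^ 'n::_"
    and dN :: "'n \<Rightarrow> real ^ 'n::_ \<Rightarrow> 'v ^ 'n::_"
  assumes M_deriv: "(M has_derivative (\<lambda>h. \<Sum>r\<in>UNIV. h $ r *\<^sub>R dM r A)) (at A)"
    and N_deriv: "(N has_derivative (\<lambda>h. \<Sum>r\<in>UNIV. h $ r *\<^sub>R dN r A)) (at A)"
    and dM_cont: "continuous_on UNIV (dM r)" and dN_cont: "continuous_on UNIV (dN r)"
begin

definition lin :: "real ^ 'n::_ \<Rightarrow> (real ^ 'n::_) \<times> 'v \<Rightarrow> real ^ 'n::_" where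
  "lin A = (\<lambda>(u, v). M A *v u + (\<chi> i. v \<bullet> N A $ i))"

text \<open>The derivative of the system in the parameter \<open>A\<close>, with the coefficients
  \<open>(u, v)\<close> held fixed.\<close>

definition jac :: "real ^ 'n::_ \<Rightarrow> (real ^ 'n::_) \<times> 'v \<Rightarrow> real ^ 'n::_ ^ 'n::_" where
  "jac A = (\<lambda>(u, v). \<chi> i r. (dM r A *v u) $ i + v \<bullet> dN r A $ i)"

definition slv :: "real ^ 'n::_ \<Rightarrow> 'v \<Rightarrow> real ^ 'n::_" where
  "slv A v = cramer_sol (M A) (\<chi> i. - (v \<bullet> N A $ i))"

lemma lin_eq_0_iff: "det (M A) \<noteq> 0 \<Longrightarrow> lin A (u, v) = 0 \<longleftrightarrow> slv A v = u"
proof -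
  assume nz: "det (M A) \<noteq> 0"
  have "lin A (u, v) = 0 \<longleftrightarrow> M A *v u = (\<chi> i. - (v \<bullet> N A $ i))"
    by (simp add: lin_def vec_eq_iff eq_neg_iff_add_eq_0)
  then show ?thesis using cramer_sol_iff[OF nz] by (auto simp: slv_def)
qed

lemma M_cont: "continuous_on S M" and N_cont: "continuous_on S N"
  by (intro continuous_at_imp_continuous_on ballI has_derivative_continuous[OF M_deriv] has_derivative_continuous[OF N_deriv])+

lemma open_regular: "open {A. det (M A) \<noteq> 0}"
  by (intro open_Collect_neq continuous_on_det continuous_intros M_cont)

lemma continuous_on_matrix_vector_mult:
  fixes X :: "'a::topological_space \<Rightarrow> real ^ 'm ^ 'k"
  assumes "continuous_on S X" "continuous_on S y"
  shows "continuous_on S (\<lambda>a. X a *v y a)"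
  unfolding matrix_vector_mult_def by (intro continuous_intros assms)

lemma lin_cont: "continuous_on UNIV (\<lambda>(A, \<eta>). lin A \<eta>)"
  unfolding lin_def case_prod_beta
  by (intro continuous_intros continuous_on_matrix_vector_mult continuous_on_compose2[OF M_cont] continuous_on_compose2[OF N_cont]) auto

lemma jac_cont: "continuous_on UNIV (\<lambda>(A, \<eta>). jac A \<eta>)"
  unfolding jac_def case_prod_beta
  by (intro continuous_intros continuous_on_matrix_vector_mult continuous_on_compose2[OF dM_cont] continuous_on_compose2[OF dN_cont]) auto

text \<open>Implicit differentiation of \<open>M A *v u + N A v = 0\<close>: \<open>M A\<close>
  applied to the r-th column is minus the r-th column of \<open>jac\<close>.\<close>

definition slv_jac :: "'v \<Rightarrow> real ^ 'n::_ \<Rightarrow> real ^ 'n::_ ^ 'n::_" where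
  "slv_jac v A = (\<chi> i r. cramer_sol (M A) (\<chi> i. - jac A (slv A v, v) $ i $ r) $ i)"

text \<open>Cramer's rule makes \<open>slv\<close> differentiable. Its derivative is then read off
  from the identity \<open>lin A (slv A v, v) = 0\<close>, which holds on the open set of regular
  \<open>A\<close>, by uniqueness of derivatives.\<close>

lemma slv_deriv:
  assumes nz: "det (M A) \<noteq> 0"
  shows "((\<lambda>A. slv A v) has_derivative (*v) (slv_jac v A)) (at A)"
    and "\<bar>det (slv_jac v A)\<bar> = \<bar>det (jac A (slv A v, v))\<bar> / \<bar>det (M A)\<bar>"
proof -
  define G where "G = slv_jac v A"
  let ?J = "jac A (slv A v, v)"
  have col: "M A *v column r G = - column r ?J" for r
  proof -
    have "column r G = cramer_sol (M A) (\<chi> i. - ?J $ i $ r)"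
      by (simp add: G_def slv_jac_def column_def vec_eq_iff)
    then show ?thesis using cramer_sol_works[OF nz] by (simp add: column_def vec_eq_iff)
  qed
  have MG: "M A ** G = - ?J"
    using col by (auto simp: vec_eq_iff matrix_matrix_mult_def matrix_vector_mult_def column_def)
  have "det (M A) * det G = det (- ?J)" by (simp add: MG[symmetric] det_mul)
  moreover have "\<bar>det (- ?J)\<bar> = \<bar>det ?J\<bar>"
  proof -
    have "- ?J = (\<chi> i. (-1) *s (?J $ i))" by (simp add: vec_eq_iff)
    then have "det (- ?J) = (\<Prod>i\<in>(UNIV :: 'n set). -1) * det (\<chi> i. ?J $ i)"
      by (simp only: det_rows_mul[of "\<lambda>_. -1" "\<lambda>i. ?J $ i"])
    then show ?thesis by (simp add: abs_mult power_abs)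
  qed
  ultimately have "\<bar>det (M A)\<bar> * \<bar>det G\<bar> = \<bar>det ?J\<bar>" by (metis abs_mult)
  then show "\<bar>det (slv_jac v A)\<bar> = \<bar>det ?J\<bar> / \<bar>det (M A)\<bar>" using nz by (simp add: field_simps G_def)
  have Mc: "((\<lambda>A. M A $ i $ j) has_derivative (\<lambda>h. \<Sum>r\<in>UNIV. h $ r * dM r A $ i $ j)) (at A)" for i j
  proof -
    have "bounded_linear (\<lambda>X :: real ^ 'n::_ ^ 'n::_. X $ i $ j)"
      by (rule bounded_linear_compose[OF bounded_linear_vec_nth bounded_linear_vec_nth])
    from bounded_linear.has_derivative[OF this M_deriv[of A]] show ?thesis by simp
  qed
  have Nc: "((\<lambda>A. v \<bullet> N A $ i) has_derivative (\<lambda>h. \<Sum>r\<in>UNIV. h $ r * (v \<bullet> dN r A $ i))) (at A)" for i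
  proof -
    have "bounded_linear (\<lambda>X :: 'v ^ 'n::_. v \<bullet> X $ i)"
      by (rule bounded_linear_compose[OF bounded_linear_inner_right bounded_linear_vec_nth])
    from bounded_linear.has_derivative[OF this N_deriv[of A]] show ?thesis by (simp add: inner_sum_right)
  qed
  have "(\<lambda>A. slv A v) differentiable (at A)"
    unfolding slv_def
  proof (rule differentiable_cramer_sol)
    show "det (M A) \<noteq> 0" by (rule nz)
    show "(\<lambda>a. M a $ i $ j) differentiable (at A)" for i j using Mc unfolding differentiable_def by blast
    show "(\<lambda>a. (\<chi> i. - (v \<bullet> N a $ i)) $ i) differentiable (at A)" for i
      using has_derivative_minus[OF Nc] unfolding differentiable_def by auto
  qed
  then obtain g where g: "((\<lambda>A. slv A v) has_derivative g) (at A)" unfolding differentiable_def by blast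
  have gc: "((\<lambda>A. slv A v $ k) has_derivative (\<lambda>h. g h $ k)) (at A)" for k
    using bounded_linear.has_derivative[OF bounded_linear_vec_nth g] .
  have "g h = G *v h" for h
  proof -
    have "((\<lambda>A. (\<Sum>k\<in>UNIV. M A $ i $ k * slv A v $ k) + v \<bullet> N A $ i) has_derivative
       (\<lambda>h. (\<Sum>k\<in>UNIV. M A $ i $ k * g h $ k + (\<Sum>r\<in>UNIV. h $ r * dM r A $ i $ k) * slv A v $ k) + (\<Sum>r\<in>UNIV. h $ r * (v \<bullet> dN r A $ i)))) (at A)" for i
      by (intro has_derivative_add has_derivative_sum has_derivative_mult Mc gc Nc)
    moreover have "((\<lambda>A. (\<Sum>k\<in>UNIV. M A $ i $ k * slv A v $ k) + v \<bullet> N A $ i) has_derivative (\<lambda>h. 0)) (at A)" for i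
    proof (rule has_derivative_transform_within_open)
      show "open {A. det (M A) \<noteq> 0}" by (rule open_regular)
      fix B assume "B \<in> {A. det (M A) \<noteq> 0}"
      then have "lin B (slv B v, v) = 0" by (subst lin_eq_0_iff) auto
      then have "lin B (slv B v, v) $ i = 0" by simp
      then show "0 = (\<Sum>k\<in>UNIV. M B $ i $ k * slv B v $ k) + v \<bullet> N B $ i"
        by (simp add: lin_def matrix_vector_mult_def)
    qed (use nz in auto)
    ultimately have eq0: "(\<Sum>k\<in>UNIV. M A $ i $ k * g h $ k + (\<Sum>r\<in>UNIV. h $ r * dM r A $ i $ k) * slv A v $ k) + (\<Sum>r\<in>UNIV. h $ r * (v \<bullet> dN r A $ i)) = 0" for i
      using has_derivative_unique by (metis (no_types, lifting))
    have "M A *v g h = M A *v (G *v h)"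
    proof -
      have "(M A *v g h) $ i = - (?J *v h) $ i" for i
      proof -
        have "(?J *v h) $ i = (\<Sum>r\<in>UNIV. ((\<Sum>k\<in>UNIV. dM r A $ i $ k * slv A v $ k) + v \<bullet> dN r A $ i) * h $ r)"
          by (simp add: jac_def matrix_vector_mult_def)
        also have "\<dots> = (\<Sum>r\<in>UNIV. \<Sum>k\<in>UNIV. h $ r * dM r A $ i $ k * slv A v $ k) + (\<Sum>r\<in>UNIV. h $ r * (v \<bullet> dN r A $ i))"
          by (simp add: distrib_left distrib_right sum.distrib sum_distrib_left sum_distrib_right mult_ac)
        also have "(\<Sum>r\<in>UNIV. \<Sum>k\<in>UNIV. h $ r * dM r A $ i $ k * slv A v $ k) = (\<Sum>k\<in>UNIV. (\<Sum>r\<in>UNIV. h $ r * dM r A $ i $ k) * slv A v $ k)"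
          by (subst sum.swap) (simp add: sum_distrib_right)
        finally show ?thesis using eq0[of i] by (simp add: sum.distrib matrix_vector_mult_def)
      qed
      then have "M A *v g h = - (?J *v h)" by (simp add: vec_eq_iff)
      also have "\<dots> = (M A ** G) *v h" unfolding MG
        by (simp add: vec_eq_iff matrix_vector_mult_def sum_negf)
      finally show ?thesis by (simp add: matrix_vector_mul_assoc)
    qed
    then show ?thesis using cramer_sol_iff[OF nz] by metis
  qed
  then have "g = (*v) G" by (rule ext)
  then show "((\<lambda>A. slv A v) has_derivative (*v) (slv_jac v A)) (at A)" using g by (simp add: G_def)
qed

lemma measurable_count:
  assumes "fsigma B"
  shows "(\<lambda>\<eta>. ecard {A \<in> B. lin A \<eta> = 0}) \<in> borel_measurable borel"
proof -
  have "closed {p. (\<lambda>(A, \<eta>). lin A \<eta>) p = 0}"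
    by (intro closed_Collect_eq lin_cont continuous_on_const)
  from borel_measurable_ecard_section[OF assms this] show ?thesis by simp
qed

lemma measurable_slv: "(\<lambda>(A, v). slv A v) \<in> borel_measurable borel"
  unfolding slv_def case_prod_beta
  by (intro borel_measurable_cramer_sol continuous_intros continuous_on_compose2[OF M_cont] continuous_on_compose2[OF N_cont]) auto

text \<open>The Kac-Rice formula for a linear family. For fixed \<open>v\<close>, the zeros
  belonging to \<open>u\<close> are the points \<open>A\<close> with \<open>slv A v = u\<close>, so
  integrating over \<open>u\<close> is the area formula for \<open>slv\<close>; Tonelli then
  exchanges \<open>A\<close> and \<open>v\<close>.\<close>

theorem expected_count:
  fixes \<rho> :: "(real ^ 'n::_) \<times> 'v \<Rightarrow> real"
  assumes B: "fsigma B" "B \<subseteq> {A. det (M A) \<noteq> 0}"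
    and \<rho>[measurable]: "\<rho> \<in> borel_measurable borel" and \<rho>0: "\<And>\<eta>. 0 \<le> \<rho> \<eta>"
  shows "(\<integral>\<^sup>+\<eta>. ecard {A \<in> B. lin A \<eta> = 0} * ennreal (\<rho> \<eta>) \<partial>lborel)
    = (\<integral>\<^sup>+A. indicator B A * (\<integral>\<^sup>+v. ennreal (\<bar>det (jac A (slv A v, v))\<bar> / \<bar>det (M A)\<bar> * \<rho> (slv A v, v)) \<partial>lborel) \<partial>lborel)"
proof -
  note measurable_count[OF B(1), measurable]
  have Bm[measurable]: "B \<in> sets borel" using B(1) by (rule fsigma_sets_borel)
  have "(\<integral>\<^sup>+\<eta>. ecard {A \<in> B. lin A \<eta> = 0} * ennreal (\<rho> \<eta>) \<partial>lborel)
    = (\<integral>\<^sup>+\<eta>. ecard {A \<in> B. lin A \<eta> = 0} * ennreal (\<rho> \<eta>) \<partial>(lborel \<Otimes>\<^sub>M lborel))"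
    by (simp add: lborel_prod)
  also have "\<dots> = (\<integral>\<^sup>+v. \<integral>\<^sup>+u. ecard {A \<in> B. lin A (u, v) = 0} * ennreal (\<rho> (u, v)) \<partial>lborel \<partial>lborel)"
    by (rule lborel_pair.nn_integral_snd[symmetric]) (simp add: lborel_prod)
  also have "\<dots> = (\<integral>\<^sup>+v. \<integral>\<^sup>+A. ennreal (indicator B A * (\<bar>det (slv_jac v A)\<bar> * \<rho> (slv A v, v))) \<partial>lborel \<partial>lborel)"
  proof (rule nn_integral_cong)
    fix v :: 'v
    have "{A \<in> B. lin A (u, v) = 0} = {A \<in> B. slv A v = u}" for u
      using B(2) lin_eq_0_iff by blast
    then have "(\<integral>\<^sup>+u. ecard {A \<in> B. lin A (u, v) = 0} * ennreal (\<rho> (u, v)) \<partial>lborel)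
      = (\<integral>\<^sup>+u. ecard {A \<in> B. slv A v = u} * ennreal (\<rho> (u, v)) \<partial>lborel)" by simp
    also have "\<dots> = (\<integral>\<^sup>+A. ennreal (indicator B A * (\<bar>det (slv_jac v A)\<bar> * \<rho> (slv A v, v))) \<partial>lborel)"
    proof (rule area_formula[OF open_regular B])
      show "((\<lambda>A. slv A v) has_derivative (*v) (slv_jac v A)) (at A)" if "A \<in> {A. det (M A) \<noteq> 0}" for A
        using slv_deriv(1) that by blast
      show "(\<lambda>y. \<rho> (y, v)) \<in> borel_measurable borel" by measurable
      have slvc: "continuous_on {A. det (M A) \<noteq> 0} (\<lambda>A. slv A v)"
        unfolding slv_def
        by (intro continuous_on_cramer_sol continuous_intros M_cont N_cont) auto
      have "continuous_on {A. det (M A) \<noteq> 0} (\<lambda>A. jac A (slv A v, v))"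
      proof -
        have "continuous_on {A. det (M A) \<noteq> 0} (\<lambda>A. (A, (slv A v, v)))"
          by (intro continuous_on_Pair continuous_on_id slvc continuous_on_const)
        from continuous_on_compose2[OF jac_cont this] show ?thesis by simp
      qed
      then show "continuous_on {A. det (M A) \<noteq> 0} (slv_jac v)"
        unfolding slv_jac_def
        by (intro continuous_intros continuous_on_cramer_sol M_cont) auto
    qed (use \<rho>0 in auto)
    finally show "(\<integral>\<^sup>+u. ecard {A \<in> B. lin A (u, v) = 0} * ennreal (\<rho> (u, v)) \<partial>lborel)
      = (\<integral>\<^sup>+A. ennreal (indicator B A * (\<bar>det (slv_jac v A)\<bar> * \<rho> (slv A v, v))) \<partial>lborel)" .
  qed
  also have "\<dots> = (\<integral>\<^sup>+v. \<integral>\<^sup>+A. indicator B A * ennreal (\<bar>det (jac A (slv A v, v))\<bar> / \<bar>det (M A)\<bar> * \<rho> (slv A v, v)) \<partial>lborel \<partial>lborel)"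
    using B(2) slv_deriv(2) by (intro nn_integral_cong) (auto simp: indicator_def)
  also have "\<dots> = (\<integral>\<^sup>+A. \<integral>\<^sup>+v. indicator B A * ennreal (\<bar>det (jac A (slv A v, v))\<bar> / \<bar>det (M A)\<bar> * \<rho> (slv A v, v)) \<partial>lborel \<partial>lborel)"
  proof (rule lborel_pair.Fubini')
    have [measurable]: "(\<lambda>p. slv (fst p) (snd p)) \<in> borel_measurable borel"
      using measurable_slv by (simp add: case_prod_beta')
    have [measurable]: "(\<lambda>p. det (jac (fst p) (snd p))) \<in> borel_measurable borel"
      using jac_cont by (intro borel_measurable_continuous_onI continuous_on_det) (simp add: case_prod_beta' continuous_intros)
    have fs[measurable]: "(fst :: (real ^ 'n::_) \<times> 'v \<Rightarrow> _) \<in> borel_measurable borel"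
        "(snd :: (real ^ 'n::_) \<times> 'v \<Rightarrow> _) \<in> borel_measurable borel"
      by (intro borel_measurable_continuous_onI continuous_intros)+
    have pr[measurable]: "(\<lambda>p. (slv (fst p) (snd p), snd p)) \<in> borel_measurable borel"
      by (rule borel_measurable_Pair) measurable
    have "(\<lambda>p. (fst p, (slv (fst p) (snd p), snd p))) \<in> borel_measurable borel"
      by (rule borel_measurable_Pair[OF fs(1) pr])
    from measurable_compose[OF this \<open>(\<lambda>p. det (jac (fst p) (snd p))) \<in> borel_measurable borel\<close>]
    have [measurable]: "(\<lambda>p. det (jac (fst p) (slv (fst p) (snd p), snd p))) \<in> borel_measurable borel" by simp
    have [measurable]: "(\<lambda>A. det (M A)) \<in> borel_measurable borel"
      by (intro borel_measurable_continuous_onI continuous_on_det continuous_intros M_cont)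
    show "(\<lambda>(A, v). indicator B A * ennreal (\<bar>det (jac A (slv A v, v))\<bar> / \<bar>det (M A)\<bar> * \<rho> (slv A v, v)))
       \<in> borel_measurable (lborel \<Otimes>\<^sub>M lborel)"
      unfolding case_prod_beta' lborel_prod measurable_lborel1 by measurable
  qed
  also have "\<dots> = (\<integral>\<^sup>+A. indicator B A * (\<integral>\<^sup>+v. ennreal (\<bar>det (jac A (slv A v, v))\<bar> / \<bar>det (M A)\<bar> * \<rho> (slv A v, v)) \<partial>lborel) \<partial>lborel)"
    by (intro nn_integral_cong) (simp add: indicator_def)
  finally show ?thesis .
qed

text \<open>The fibre integral over the kernel of \<open>lin A\<close> does not depend on the splitting of the
  coefficient space: the left hand side uses the linear map only, and any right inverse of it.\<close>

lemma fibre_integral: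
  fixes h :: "(real ^ 'n::_) \<times> 'v \<Rightarrow> ennreal"
  assumes nz: "det (M A) \<noteq> 0" and h[measurable]: "h \<in> borel_measurable borel"
    and S: "linear S" "\<And>y. lin A (S y) = y"
  shows "(\<integral>\<^sup>+\<eta>. indicator (cbox 0 One) (lin A \<eta>) * h (\<eta> - S (lin A \<eta>)) \<partial>lborel)
    = ennreal (1 / \<bar>det (M A)\<bar>) * (\<integral>\<^sup>+v. h (slv A v, v) \<partial>lborel)"
proof -
  have Sc[measurable]: "S \<in> borel_measurable borel" by (rule borel_measurable_linear[OF S(1)])
  have Nm[measurable]: "(\<lambda>v. \<chi> i. v \<bullet> N A $ i) \<in> borel_measurable borel"
    by (intro borel_measurable_vec_lambda) measurable
  have Mm[measurable]: "(\<lambda>u. M A *v u) \<in> borel_measurable borel"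
    by (intro borel_measurable_linear matrix_vector_mul_linear)
  have lm[measurable]: "lin A \<in> borel_measurable borel"
  proof (rule borel_measurable_continuous_onI)
    have "continuous_on UNIV (\<lambda>\<eta> :: (real ^ 'n::_) \<times> 'v. (A, \<eta>))" by (intro continuous_intros)
    from continuous_on_compose2[OF lin_cont this] show "continuous_on UNIV (lin A)" by simp
  qed
  define C where "C y = cramer_sol (M A) y" for y
  have MC: "M A *v C y = y" and CM: "C (M A *v u) = u" for y u
    unfolding C_def using cramer_sol_iff[OF nz] by metis+
  have Cd: "C (x - y) = C x - C y" for x y
    by (metis MC CM matrix_vector_mult_diff_distrib)
  have Cm[measurable]: "C \<in> borel_measurable borel"
    unfolding C_def by (intro borel_measurable_cramer_sol continuous_intros)
  define n where "n v = (\<chi> i. v \<bullet> N A $ i)" for v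
  have nd: "n (v - w) = n v - n w" for v w by (simp add: n_def vec_eq_iff inner_diff_left)
  have [measurable]: "n \<in> borel_measurable borel" unfolding n_def by (rule Nm)
  have lin: "lin A (u, v) = M A *v u + n v" for u v by (simp add: lin_def n_def)
  have slv: "slv A v = C (- n v)" for v 
  proof -
    have "(\<chi> i. - (v \<bullet> N A $ i)) = - (\<chi> i. v \<bullet> N A $ i)" by (simp add: vec_eq_iff)
    then show ?thesis by (simp add: slv_def C_def n_def)
  qed
  define F where "F \<eta> = indicator (cbox 0 One) (lin A \<eta>) * h (\<eta> - S (lin A \<eta>))" for \<eta>
  have [measurable]: "F \<in> borel_measurable borel" unfolding F_def by measurable
  have "(\<integral>\<^sup>+\<eta>. F \<eta> \<partial>lborel) = (\<integral>\<^sup>+\<eta>. F \<eta> \<partial>(lborel \<Otimes>\<^sub>M lborel))" by (simp add: lborel_prod)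
  also have "\<dots> = (\<integral>\<^sup>+v. \<integral>\<^sup>+u. F (u, v) \<partial>lborel \<partial>lborel)"
    by (rule lborel_pair.nn_integral_snd[symmetric]) (simp add: lborel_prod)
  \<comment> \<open>For fixed \<open>v\<close> the variable \<open>u\<close> is replaced by
    \<open>y = lin A (u, v)\<close>.\<close>
  also have "\<dots> = (\<integral>\<^sup>+v. ennreal (1 / \<bar>det (M A)\<bar>) * (\<integral>\<^sup>+y. indicator (cbox 0 One) y * h ((C (y - n v), v) - S y) \<partial>lborel) \<partial>lborel)"
  proof (rule nn_integral_cong)
    fix v
    define K where "K y = indicator (cbox 0 One) y * h ((C (y - n v), v) - S y)" for y :: "real ^ 'n::_"
    have [measurable]: "K \<in> borel_measurable borel" unfolding K_def by measurable
    define K' where "K' y = K (y + n v)" for y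
    have [measurable]: "K' \<in> borel_measurable borel" unfolding K'_def by measurable
    have "F (u, v) = K' (M A *v u)" for u
      by (simp add: F_def K'_def K_def lin CM)
    then have "(\<integral>\<^sup>+u. F (u, v) \<partial>lborel) = (\<integral>\<^sup>+u. K' (M A *v u) \<partial>lborel)" by simp
    moreover have "(\<integral>\<^sup>+y. K' y \<partial>lborel) = ennreal \<bar>det (M A)\<bar> * (\<integral>\<^sup>+u. K' (M A *v u) \<partial>lborel)"
      by (rule nn_integral_linear_change[OF nz]) measurable
    moreover have "(\<integral>\<^sup>+y. K' y \<partial>lborel) = (\<integral>\<^sup>+y. K y \<partial>lborel)"
      using nn_integral_distr[of "(+) (n v)" lborel borel K] by (simp add: lborel_distr_plus K'_def add.commute)
    moreover have "ennreal (1 / \<bar>det (M A)\<bar>) * (ennreal \<bar>det (M A)\<bar> * x) = x" for x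
      using nz by (simp add: mult.assoc[symmetric] ennreal_mult[symmetric])
    ultimately show "(\<integral>\<^sup>+u. F (u, v) \<partial>lborel) = ennreal (1 / \<bar>det (M A)\<bar>) * (\<integral>\<^sup>+y. indicator (cbox 0 One) y * h ((C (y - n v), v) - S y) \<partial>lborel)"
      unfolding K_def by metis
  qed
  also have "\<dots> = ennreal (1 / \<bar>det (M A)\<bar>) * (\<integral>\<^sup>+v. \<integral>\<^sup>+y. indicator (cbox 0 One) y * h ((C (y - n v), v) - S y) \<partial>lborel \<partial>lborel)"
    by (rule nn_integral_cmult) measurable
  also have "(\<integral>\<^sup>+v. \<integral>\<^sup>+y. indicator (cbox 0 One) y * h ((C (y - n v), v) - S y) \<partial>lborel \<partial>lborel)
     = (\<integral>\<^sup>+y. \<integral>\<^sup>+v. indicator (cbox 0 One) y * h ((C (y - n v), v) - S y) \<partial>lborel \<partial>lborel)"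
  proof (rule lborel_pair.Fubini')
    have fs[measurable]: "(fst :: (real ^ 'n::_) \<times> 'v \<Rightarrow> _) \<in> borel_measurable borel"
        "(snd :: (real ^ 'n::_) \<times> 'v \<Rightarrow> _) \<in> borel_measurable borel"
      by (intro borel_measurable_continuous_onI continuous_intros)+
    have [measurable]: "(\<lambda>p. (C (fst p - n (snd p)), snd p)) \<in> borel_measurable borel"
      by (rule borel_measurable_Pair) measurable
    show "(\<lambda>(y, v). indicator (cbox 0 One) y * h ((C (y - n v), v) - S y)) \<in> borel_measurable (lborel \<Otimes>\<^sub>M lborel)"
      unfolding case_prod_beta' lborel_prod measurable_lborel1 by measurable
  qed
  also have "\<dots> = (\<integral>\<^sup>+(y :: real ^ 'n::_). indicator (cbox 0 One) y * (\<integral>\<^sup>+v. h (slv A v, v) \<partial>lborel) \<partial>lborel)"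
  proof (rule nn_integral_cong)
    fix y :: "real ^ 'n::_"
    define H where "H v = h (slv A v, v)" for v
    have [measurable]: "H \<in> borel_measurable borel" unfolding H_def slv by measurable
    \<comment> \<open>\<open>lin A\<close> sends both \<open>(C (y - n v), v)\<close> and
      \<open>S y\<close> to \<open>y\<close>, so their difference lies in the kernel, which is the
      graph of \<open>slv A\<close>. Only a translation of \<open>v\<close> remains, and Lebesgue
      measure absorbs it.\<close>
    have "(C (y - n v), v) - S y = (slv A (v - snd (S y)), v - snd (S y))" for v
    proof -
      have "M A *v fst (S y) + n (snd (S y)) = y" using S(2)[of y] lin[of "fst (S y)" "snd (S y)"] by simp
      then have "y - n (snd (S y)) = M A *v fst (S y)" by (metis add_diff_cancel_right')
      then have "C (y - n (snd (S y))) = fst (S y)" using CM[of "fst (S y)"] by simp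
      moreover have "slv A (v - snd (S y)) = C ((y - n v) - (y - n (snd (S y))))"
        by (simp add: slv nd)
      ultimately show ?thesis unfolding Cd by (simp add: prod_eq_iff)
    qed
    then have "(\<integral>\<^sup>+v. h ((C (y - n v), v) - S y) \<partial>lborel) = (\<integral>\<^sup>+v. H (v - snd (S y)) \<partial>lborel)"
      by (simp add: H_def)
    also have "\<dots> = (\<integral>\<^sup>+v. H v \<partial>lborel)"
      using nn_integral_distr[of "(+) (- snd (S y))" lborel borel H] by (simp add: lborel_distr_plus)
    finally have "(\<integral>\<^sup>+v. h ((C (y - n v), v) - S y) \<partial>lborel) = (\<integral>\<^sup>+v. h (slv A v, v) \<partial>lborel)"
      unfolding H_def .
    then show "(\<integral>\<^sup>+v. indicator (cbox 0 One) y * h ((C (y - n v), v) - S y) \<partial>lborel)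
      = indicator (cbox 0 One) y * (\<integral>\<^sup>+v. h (slv A v, v) \<partial>lborel)"
      by (simp add: indicator_def)
  qed
  \<comment> \<open>The unit cube has volume one.\<close>
  also have "\<dots> = (\<integral>\<^sup>+v. h (slv A v, v) \<partial>lborel)"
    by (simp add: nn_integral_multc)
  finally show ?thesis unfolding F_def .
qed

end

text \<open>On the span of the \<open>a i\<close> the map is fixed by a basis chosen among them;
  equality of the Gram kernels gives \<open>f (a i) - b i\<close> norm zero. The orthogonal
  complements of the two spans have equal dimension and are matched by an isometry.\<close>

lemma isometry_of_gram:
  fixes a :: "'i \<Rightarrow> 'a::euclidean_space" and b :: "'i \<Rightarrow> 'b::euclidean_space"
  assumes gram: "\<And>x y. a x \<bullet> a y = b x \<bullet> b y" and dim: "DIM('a) = DIM('b)"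
  obtains T where "linear T" "\<And>x. norm (T x) = norm x" "\<And>i. T (a i) = b i"
proof -
  define S where "S = span (range a)"
  obtain B where B: "B \<subseteq> range a" "independent B" "range a \<subseteq> span B"
    using maximal_independent_subset[of "range a"] by metis
  have finB: "finite B" using B(2) by (rule independent_imp_finite)
  have SB: "S = span B"
    unfolding S_def using B span_mono[OF B(1)] span_minimal[OF B(3)] by blast
  have "\<exists>i. a i = \<beta>" if "\<beta> \<in> B" for \<beta> using B(1) that by blast
  then obtain j where j: "\<And>\<beta>. \<beta> \<in> B \<Longrightarrow> a (j \<beta>) = \<beta>" by metis
  obtain f where f: "linear f" "\<And>\<beta>. \<beta> \<in> B \<Longrightarrow> f \<beta> = b (j \<beta>)"
    using linear_independent_extend[OF B(2), of "\<lambda>\<beta>. b (j \<beta>)"] by blast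
  interpret f: linear f by (rule f(1))
  have fb: "f u \<bullet> b i = u \<bullet> a i" if "u \<in> span B" for u i
    using that
  proof (induction rule: span_induct)
    case base show ?case by (auto simp: subspace_def f.add f.scale f.zero inner_add_left)
  next
    case (step \<beta>) 
    then show ?case using gram[of "j \<beta>" i] by (simp add: f(2) j)
  qed
  have fa: "f (a i) = b i" for i
  proof -
    have ai: "a i \<in> span B" using B(3) by blast
    have "f u \<bullet> f (a i) = u \<bullet> a i" if "u \<in> span B" for u
      using ai
    proof (induction rule: span_induct)
      case base show ?case by (auto simp: subspace_def f.add f.scale f.zero inner_add_right)
    next
      case (step \<beta>) then show ?case using fb[OF that, of "j \<beta>"] by (simp add: f(2) j)
    qed
    then have "f (a i) \<bullet> f (a i) = a i \<bullet> a i" using ai by blast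
    moreover have "f (a i) \<bullet> b i = a i \<bullet> a i" by (rule fb[OF ai])
    ultimately have "(f (a i) - b i) \<bullet> (f (a i) - b i) = 0"
      using gram[of i i] by (simp add: inner_diff_left inner_diff_right inner_commute)
    then show ?thesis by simp
  qed
  have fS: "f u \<bullet> f w = u \<bullet> w" if u: "u \<in> S" and w: "w \<in> S" for u w
    using w unfolding S_def
  proof (induction rule: span_induct)
    case base show ?case by (auto simp: subspace_def f.add f.scale f.zero inner_add_right)
  next
    case (step y)
    then obtain i where "y = a i" by blast
    then show ?case using fb[of u i] u fa SB by simp
  qed
  have norm_f: "norm (f u) = norm u" if "u \<in> S" for u
    using fS[OF that that] by (simp add: norm_eq_sqrt_inner)
  define S' where "S' = f ` S"
  have sub: "subspace S" "subspace S'"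
    unfolding S'_def S_def by (simp_all add: linear_subspace_image[OF f(1)])
  have "inj_on f S"
  proof (rule inj_onI)
    fix u w assume uw: "u \<in> S" "w \<in> S" "f u = f w"
    then have "norm (f (u - w)) = 0" by (simp add: f.diff)
    then have "norm (u - w) = 0" using norm_f[of "u - w"] uw sub(1) by (simp add: subspace_diff)
    then show "u = w" by simp
  qed
  then have dimS: "dim S' = dim S"
    unfolding S'_def using sub(1) f(1) dim_image_eq by (metis span_eq_iff)
  define C where "C = {y. \<forall>x\<in>S. orthogonal x y}"
  define C' where "C' = {y. \<forall>x\<in>S'. orthogonal x y}"
  have subC: "subspace C" "subspace C'"
    unfolding C_def C'_def by (auto intro: subspace_orthogonal_to_vectors)
  have "dim C + dim S = DIM('a)" "dim C' + dim S' = DIM('b)"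
    using dim_subspace_orthogonal_to_vectors[OF sub(1) subspace_UNIV] dim_subspace_orthogonal_to_vectors[OF sub(2) subspace_UNIV]
    by (simp_all add: C_def C'_def)
  then have dimC: "dim C = dim C'" using dimS dim by simp
  obtain h where h: "linear h" "h ` C = C'" "\<And>x. x \<in> C \<Longrightarrow> norm (h x) = norm x"
    using isometries_subspaces[OF subC dimC] by metis
  interpret h: linear h by (rule h(1))
  have decomp: "\<exists>y z. y \<in> S \<and> z \<in> C \<and> x = y + z" for x
  proof -
    obtain y z where "y \<in> span S" "\<And>w. w \<in> span S \<Longrightarrow> orthogonal z w" "x = y + z"
      using orthogonal_subspace_decomp_exists[of S x] by metis
    moreover have "span S = S" using sub(1) by (simp add: span_eq_iff)
    ultimately have "y \<in> S" "z \<in> C" unfolding C_def by (simp_all add: orthogonal_commute)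
    with \<open>x = y + z\<close> show ?thesis by blast
  qed
  then obtain y z where yz: "\<And>x. y x \<in> S" "\<And>x. z x \<in> C" "\<And>x. x = y x + z x" by metis
  have uniq: "y x = u \<and> z x = w" if "u \<in> S" "w \<in> C" "x = u + w" for x u w
  proof -
    have "y x - u = w - z x" using yz(3)[of x] that(3) by (simp add: algebra_simps)
    moreover have "y x - u \<in> S" using yz(1) that(1) sub(1) by (simp add: subspace_diff)
    moreover have "w - z x \<in> C" using yz(2) that(2) subC(1) by (simp add: subspace_diff)
    ultimately have "(y x - u) \<bullet> (y x - u) = 0" unfolding C_def orthogonal_def by auto
    then show ?thesis using \<open>y x - u = w - z x\<close> by simp
  qed
  define T where "T x = f (y x) + h (z x)" for x
  have "linear T"
  proof (rule linearI)
    fix p q :: 'a and r :: real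
    have "y (p + q) = y p + y q \<and> z (p + q) = z p + z q"
    proof (rule uniq)
      show "p + q = y p + y q + (z p + z q)" using yz(3)[of p] yz(3)[of q] by (simp add: algebra_simps)
    qed (use yz sub subC in \<open>auto intro: subspace_add\<close>)
    then show "T (p + q) = T p + T q" by (simp add: T_def f.add h.add)
    have "y (r *\<^sub>R p) = r *\<^sub>R y p \<and> z (r *\<^sub>R p) = r *\<^sub>R z p"
    proof (rule uniq)
      show "r *\<^sub>R p = r *\<^sub>R y p + r *\<^sub>R z p" using yz(3)[of p] by (metis scaleR_add_right)
    qed (use yz sub subC in \<open>auto intro: subspace_scale\<close>)
    then show "T (r *\<^sub>R p) = r *\<^sub>R T p" by (simp add: T_def f.scale h.scale scaleR_add_right)
  qed
  moreover have "norm (T x) = norm x" for x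
  proof -
    have "f (y x) \<in> S'" "h (z x) \<in> C'" using yz h(2) by (auto simp: S'_def)
    then have "f (y x) \<bullet> h (z x) = 0" by (auto simp: C'_def orthogonal_def)
    moreover have "y x \<bullet> z x = 0" using yz(1,2) by (auto simp: C_def orthogonal_def)
    moreover have "norm (f (y x)) = norm (y x)" "norm (h (z x)) = norm (z x)" using yz norm_f h(3) by auto
    ultimately have "(norm (T x))\<^sup>2 = (norm (y x + z x))\<^sup>2"
      unfolding T_def by (simp add: power2_norm_eq_inner inner_add_left inner_add_right inner_commute norm_eq_sqrt_inner)
    then show ?thesis using yz(3)[of x] by simp
  qed
  moreover have "T (a i) = b i" for i
  proof -
    have "y (a i) = a i \<and> z (a i) = 0"
      by (rule uniq) (use subC in \<open>auto simp: S_def span_base subspace_0\<close>)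
    then show ?thesis by (simp add: T_def fa h.zero)
  qed
  ultimately show ?thesis by (rule that)
qed

lemma UNIV_4': "(UNIV :: 4 set) = {0, 1, 2, 3}"
proof -
  have "card {0, 1, 2, 3 :: 4} = 4" by simp
  then show ?thesis by (intro card_eq_UNIV_imp_eq_UNIV[symmetric]) simp_all
qed

lemma sum_4': "sum f (UNIV :: 4 set) = f 0 + f 1 + f 2 + f 3"
  unfolding UNIV_4' by (simp add: add.assoc)

lemma forall_4': "(\<forall>i :: 4. P i) \<longleftrightarrow> P 0 \<and> P 1 \<and> P 2 \<and> P 3"
  using UNIV_4' by (metis UNIV_I empty_iff insert_iff)

text \<open>Laplace expansion along the first two rows into complementary minors of size
  two.\<close>

lemma det_4:
  fixes A :: "'a::comm_ring_1 ^ 4 ^ 4"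
  shows "det A =
      (A$0$0 * A$1$1 - A$0$1 * A$1$0) * (A$2$2 * A$3$3 - A$2$3 * A$3$2)
    - (A$0$0 * A$1$2 - A$0$2 * A$1$0) * (A$2$1 * A$3$3 - A$2$3 * A$3$1)
    + (A$0$0 * A$1$3 - A$0$3 * A$1$0) * (A$2$1 * A$3$2 - A$2$2 * A$3$1)
    + (A$0$1 * A$1$2 - A$0$2 * A$1$1) * (A$2$0 * A$3$3 - A$2$3 * A$3$0)
    - (A$0$1 * A$1$3 - A$0$3 * A$1$1) * (A$2$0 * A$3$2 - A$2$2 * A$3$0)
    + (A$0$2 * A$1$3 - A$0$3 * A$1$2) * (A$2$0 * A$3$1 - A$2$1 * A$3$0)"
proof -
  have f0: "finite {1::4, 2, 3}" "0 \<notin> {1::4, 2, 3}" by auto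
  have f1: "finite {2::4, 3}" "1 \<notin> {2::4, 3}" by auto
  have f2: "finite {3::4}" "2 \<notin> {3::4}" by auto
  show ?thesis
    unfolding det_def UNIV_4'
    unfolding sum_over_permutations_insert[OF f0]
    unfolding sum_over_permutations_insert[OF f1]
    unfolding sum_over_permutations_insert[OF f2]
    unfolding permutes_sing
    by (simp add: sign_swap_id permutation_swap_id permutation_compose sign_compose sign_id swap_id_eq algebra_simps)
qed

section \<open>An explicit feature map\<close>

text \<open>Built from axis vectors, so that derivatives and continuity reduce to sums and
  scalings.\<close>

definition vec2 :: "real \<Rightarrow> real \<Rightarrow> real ^ 2" where
  "vec2 a b = a *\<^sub>R axis 0 1 + b *\<^sub>R axis 1 1"

definition vec4 :: "real \<Rightarrow> real \<Rightarrow> real \<Rightarrow> real \<Rightarrow> real ^ 4" where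
  "vec4 a b c d = a *\<^sub>R axis 0 1 + b *\<^sub>R axis 1 1 + c *\<^sub>R axis 2 1 + d *\<^sub>R axis 3 1"

lemma UNIV_2': "(UNIV :: 2 set) = {0, 1}"
proof -
  have "card {0, 1 :: 2} = 2" by simp
  then show ?thesis by (intro card_eq_UNIV_imp_eq_UNIV[symmetric]) simp_all
qed

lemma sum_2': "sum f (UNIV :: 2 set) = f 0 + f 1"
  unfolding UNIV_2' by simp

lemma forall_2': "(\<forall>i :: 2. P i) \<longleftrightarrow> P 0 \<and> P 1"
  using UNIV_2' by (metis UNIV_I empty_iff insert_iff)

lemma vec2_nth [simp]: "vec2 a b $ 0 = a" "vec2 a b $ 1 = b"
  by (simp_all add: vec2_def axis_def)

lemma vec4_nth [simp]: "vec4 a b c d $ 0 = a" "vec4 a b c d $ 1 = b" "vec4 a b c d $ 2 = c" "vec4 a b c d $ 3 = d"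
  by (simp_all add: vec4_def axis_def)

lemma inner_2': "x \<bullet> y = x $ 0 * y $ 0 + x $ 1 * y $ 1" for x y :: "real ^ 2"
  by (simp add: inner_vec_def sum_2')

lemma inner_4': "x \<bullet> y = x $ 0 * y $ 0 + x $ 1 * y $ 1 + x $ 2 * y $ 2 + x $ 3 * y $ 3" for x y :: "real ^ 4"
  by (simp add: inner_vec_def sum_4')

lemma vec_eq_4': "x = y \<longleftrightarrow> x $ 0 = y $ 0 \<and> x $ 1 = y $ 1 \<and> x $ 2 = y $ 2 \<and> x $ 3 = y $ 3" for x y :: "'a ^ 4"
  by (simp add: vec_eq_iff forall_4')

lemma has_derivative_nth [derivative_intros]:
  "((\<lambda>x. x $ i) has_derivative (\<lambda>y. y $ i)) F"
  by (rule bounded_linear_imp_has_derivative) (rule bounded_linear_vec_nth)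

lemma has_derivative_vec2 [derivative_intros]:
  assumes "(f has_derivative f') F" "(g has_derivative g') F"
  shows "((\<lambda>x. vec2 (f x) (g x)) has_derivative (\<lambda>y. vec2 (f' y) (g' y))) F"
  unfolding vec2_def by (intro derivative_intros assms)

lemma has_derivative_vec4 [derivative_intros]:
  assumes "(f has_derivative f') F" "(g has_derivative g') F" "(h has_derivative h') F" "(i has_derivative i') F"
  shows "((\<lambda>x. vec4 (f x) (g x) (h x) (i x)) has_derivative (\<lambda>y. vec4 (f' y) (g' y) (h' y) (i' y))) F"
  unfolding vec4_def by (intro derivative_intros assms)

lemma continuous_on_vec2 [continuous_intros]:
  "continuous_on S f \<Longrightarrow> continuous_on S g \<Longrightarrow> continuous_on S (\<lambda>x. vec2 (f x) (g x))"
  unfolding vec2_def by (intro continuous_intros)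

lemma continuous_on_vec4 [continuous_intros]:
  "continuous_on S f \<Longrightarrow> continuous_on S g \<Longrightarrow> continuous_on S h \<Longrightarrow> continuous_on S i \<Longrightarrow>
    continuous_on S (\<lambda>x. vec4 (f x) (g x) (h x) (i x))"
  unfolding vec4_def by (intro continuous_intros)

lemma has_derivative_vec_lambda:
  fixes f :: "'n::finite \<Rightarrow> 'a::real_normed_vector \<Rightarrow> 'b::real_normed_vector"
  assumes "\<And>i. (f i has_derivative f' i) (at x)"
  shows "((\<lambda>x. \<chi> i. f i x) has_derivative (\<lambda>h. \<chi> i. f' i h)) (at x)"
proof -
  have bl: "bounded_linear (\<lambda>y :: 'b. axis i y)" for i :: 'n
  proof (rule bounded_linear_intro[of _ 1])
    show "norm (axis i y) \<le> norm y * 1" for y :: 'b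
    proof -
      have "(\<Sum>j\<in>UNIV. (norm (axis i y $ j))\<^sup>2) = (\<Sum>j\<in>UNIV. if j = i then (norm y)\<^sup>2 else 0)"
        by (intro sum.cong) (auto simp: axis_def)
      then show ?thesis by (simp add: norm_vec_def L2_set_def)
    qed
  qed (auto simp: axis_def vec_eq_iff)
  have eq: "(\<Sum>i\<in>UNIV. axis i (g i)) = (\<chi> i. g i)" for g :: "'n \<Rightarrow> 'b"
    by (simp add: vec_eq_iff axis_def)
  have "((\<lambda>x. \<Sum>i\<in>UNIV. axis i (f i x)) has_derivative (\<lambda>h. \<Sum>i\<in>UNIV. axis i (f' i h))) (at x)"
    by (intro has_derivative_sum bounded_linear.has_derivative[OF bl] assms)
  then show ?thesis by (simp only: eq)
qed

text \<open>The first triple collects the components with a nonzero normal derivative along the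
  plane of the first two coordinates, and the second those whose value and derivative vanish there.
  Together with the four components of \<open>eu\<close> this makes dimension 20.\<close>

type_synonym coeffs = "((real ^ 2) \<times> (real ^ 2) \<times> (real ^ 2)) \<times>
  ((real ^ 2) \<times> (real ^ 2) \<times> (real ^ 2) \<times> (real ^ 2) \<times> (real ^ 2))"

text \<open>For \<open>z = x$0 + i x$1\<close> and \<open>w = x$2 + i x$3\<close>, the functions
  \<open>qX\<close>, \<open>qC\<close>, \<open>qS\<close> are \<open>|z|^2\<close>,
  \<open>Re z^2\<close>, \<open>Im z^2\<close>, and \<open>qY\<close>, \<open>qD\<close>,
  \<open>qT\<close> are the same for \<open>w\<close>. The functions beginning with \<open>d\<close>
  are their differentials.\<close>

definition "qX x = x$0 * x$0 + x$1 * x$1" for x :: "real ^ 4"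
definition "qC x = x$0 * x$0 - x$1 * x$1" for x :: "real ^ 4"
definition "qS x = 2 * (x$0 * x$1)" for x :: "real ^ 4"
definition "qY x = x$2 * x$2 + x$3 * x$3" for x :: "real ^ 4"
definition "qD x = x$2 * x$2 - x$3 * x$3" for x :: "real ^ 4"
definition "qT x = 2 * (x$2 * x$3)" for x :: "real ^ 4"
definition "dX x y = 2 * (x$0 * y$0 + x$1 * y$1)" for x y :: "real ^ 4"
definition "dC x y = 2 * (x$0 * y$0 - x$1 * y$1)" for x y :: "real ^ 4"
definition "dS x y = 2 * (x$0 * y$1 + x$1 * y$0)" for x y :: "real ^ 4"
definition "dY x y = 2 * (x$2 * y$2 + x$3 * y$3)" for x y :: "real ^ 4"
definition "dD x y = 2 * (x$2 * y$2 - x$3 * y$3)" for x y :: "real ^ 4"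
definition "dT x y = 2 * (x$2 * y$3 + x$3 * y$2)" for x y :: "real ^ 4"

lemma quadric_deriv [derivative_intros]:
  "(qX has_derivative dX x) (at x)" "(qC has_derivative dC x) (at x)" "(qS has_derivative dS x) (at x)"
  "(qY has_derivative dY x) (at x)" "(qD has_derivative dD x) (at x)" "(qT has_derivative dT x) (at x)"
  unfolding qX_def qC_def qS_def qY_def qD_def qT_def
  by (auto intro!: derivative_eq_intros simp: dX_def dC_def dS_def dY_def dD_def dT_def fun_eq_iff algebra_simps)

lemma quadric_cont [continuous_intros]:
  "continuous_on S qX" "continuous_on S qC" "continuous_on S qS"
  "continuous_on S qY" "continuous_on S qD" "continuous_on S qT"
  "continuous_on S (\<lambda>x. dX x y)" "continuous_on S (\<lambda>x. dC x y)" "continuous_on S (\<lambda>x. dS x y)"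
  "continuous_on S (\<lambda>x. dY x y)" "continuous_on S (\<lambda>x. dD x y)" "continuous_on S (\<lambda>x. dT x y)"
  unfolding qX_def qC_def qS_def qY_def qD_def qT_def dX_def dC_def dS_def dY_def dD_def dT_def
  by (intro continuous_intros)+

text \<open>With \<open>z = x$0 + \<i> x$1\<close> and \<open>w = x$2 + \<i> x$3\<close>, the components of the feature map are
  multiples of the real and imaginary parts of \<open>z\<^sup>3\<close>, \<open>z \<bar>z\<bar>\<^sup>2\<close>, \<open>w \<bar>z\<bar>\<^sup>2\<close>, \<open>z\<^sup>2\<close> times a coordinate of \<open>w\<close>, and so on.
  Only the first four do not vanish on the plane \<open>w = 0\<close>.\<close>

locale feature_map =
  fixes c k n p a b q s :: real
begin

definition eu :: "real ^ 4 \<Rightarrow> real ^ 4" where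
  "eu x = vec4 (c * (qC x * x$0 - qS x * x$1)) (c * (qC x * x$1 + qS x * x$0))
     ((k * qX x + n * qY x) * x$0) ((k * qX x + n * qY x) * x$1)"

definition ev :: "real ^ 4 \<Rightarrow> coeffs" where
  "ev x = ((vec2 ((a * qX x + b * qY x) * x$2) ((a * qX x + b * qY x) * x$3),
      vec2 (s * (qC x * x$2)) (s * (qS x * x$2)), vec2 (s * (qC x * x$3)) (s * (qS x * x$3))),
    (vec2 (p * (qY x * x$0)) (p * (qY x * x$1)), vec2 (q * (qY x * x$2)) (q * (qY x * x$3)),
     vec2 (s * (qD x * x$0)) (s * (qT x * x$0)), vec2 (s * (qD x * x$1)) (s * (qT x * x$1)),
     vec2 (c * (qD x * x$2 - qT x * x$3)) (c * (qD x * x$3 + qT x * x$2))))"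

definition deu :: "real ^ 4 \<Rightarrow> real ^ 4 \<Rightarrow> real ^ 4" where
  "deu x y = vec4 (c * (dC x y * x$0 + qC x * y$0 - (dS x y * x$1 + qS x * y$1)))
     (c * (dC x y * x$1 + qC x * y$1 + (dS x y * x$0 + qS x * y$0)))
     ((k * dX x y + n * dY x y) * x$0 + (k * qX x + n * qY x) * y$0)
     ((k * dX x y + n * dY x y) * x$1 + (k * qX x + n * qY x) * y$1)"

definition dev :: "real ^ 4 \<Rightarrow> real ^ 4 \<Rightarrow> coeffs" where
  "dev x y = ((vec2 ((a * dX x y + b * dY x y) * x$2 + (a * qX x + b * qY x) * y$2)
        ((a * dX x y + b * dY x y) * x$3 + (a * qX x + b * qY x) * y$3),
      vec2 (s * (dC x y * x$2 + qC x * y$2)) (s * (dS x y * x$2 + qS x * y$2)),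
      vec2 (s * (dC x y * x$3 + qC x * y$3)) (s * (dS x y * x$3 + qS x * y$3))),
    (vec2 (p * (dY x y * x$0 + qY x * y$0)) (p * (dY x y * x$1 + qY x * y$1)),
     vec2 (q * (dY x y * x$2 + qY x * y$2)) (q * (dY x y * x$3 + qY x * y$3)),
     vec2 (s * (dD x y * x$0 + qD x * y$0)) (s * (dT x y * x$0 + qT x * y$0)),
     vec2 (s * (dD x y * x$1 + qD x * y$1)) (s * (dT x y * x$1 + qT x * y$1)),
     vec2 (c * (dD x y * x$2 + qD x * y$2 - (dT x y * x$3 + qT x * y$3)))
       (c * (dD x y * x$3 + qD x * y$3 + (dT x y * x$2 + qT x * y$2)))))"

lemma eu_deriv: "(eu has_derivative deu x) (at x)"
  unfolding eu_def[abs_def] deu_def[abs_def]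
  by (rule has_derivative_vec4) (auto intro!: derivative_eq_intros simp: fun_eq_iff algebra_simps)

lemma ev_deriv: "(ev has_derivative dev x) (at x)"
  unfolding ev_def[abs_def] dev_def[abs_def]
  by (intro has_derivative_Pair has_derivative_vec2) (auto intro!: derivative_eq_intros simp: fun_eq_iff algebra_simps)

lemma deu_cont: "continuous_on S (\<lambda>x. deu x y)" and dev_cont: "continuous_on S (\<lambda>x. dev x y)"
  unfolding deu_def dev_def by (intro continuous_intros)+

text \<open>Each group of components pairs to a polynomial in \<open>Z\<close>, \<open>W\<close> and
  the squared lengths: \<open>Z\<close> is the real part of \<open>z\<close> times the conjugate of
  the other \<open>z\<close>, so squares and cubes of complex numbers pair by the double and triple
  angle formulas. The relations compare the coefficients with those of the expansion in
  \<open>Z + W\<close>.\<close>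

lemma feature_gram:
  assumes rel: "c\<^sup>2 = 2 * L" "k\<^sup>2 = 2 * L + m" "k * n = m - 4 * L" "n\<^sup>2 + p\<^sup>2 = 8 * L + m"
    "a\<^sup>2 = 8 * L + m" "a * b = m - 4 * L" "b\<^sup>2 + q\<^sup>2 = 2 * L + m" "s\<^sup>2 = 12 * L"
  shows "(eu x, ev x) \<bullet> (eu y, ev y) = 8 * L * (x \<bullet> y) ^ 3 + (m - 4 * L) * (x \<bullet> x) * (y \<bullet> y) * (x \<bullet> y)"
proof -
  define Z where "Z = x$0 * y$0 + x$1 * y$1"
  define W where "W = x$2 * y$2 + x$3 * y$3"
  have e: "(eu x, ev x) \<bullet> (eu y, ev y) =
      c\<^sup>2 * ((qC x * x$0 - qS x * x$1) * (qC y * y$0 - qS y * y$1) + (qC x * x$1 + qS x * x$0) * (qC y * y$1 + qS y * y$0))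
    + (k\<^sup>2 * (qX x * qX y) + (k * n) * (qX x * qY y + qY x * qX y) + (n\<^sup>2 + p\<^sup>2) * (qY x * qY y)) * Z
    + (a\<^sup>2 * (qX x * qX y) + (a * b) * (qX x * qY y + qY x * qX y) + (b\<^sup>2 + q\<^sup>2) * (qY x * qY y)) * W
    + s\<^sup>2 * ((qC x * qC y + qS x * qS y) * W + (qD x * qD y + qT x * qT y) * Z)
    + c\<^sup>2 * ((qD x * x$2 - qT x * x$3) * (qD y * y$2 - qT y * y$3) + (qD x * x$3 + qT x * x$2) * (qD y * y$3 + qT y * y$2))"
    unfolding eu_def ev_def inner_Pair inner_2' inner_4' vec2_nth vec4_nth Z_def W_def
    by (simp add: algebra_simps power2_eq_square)
  have z3: "(qC x * x$0 - qS x * x$1) * (qC y * y$0 - qS y * y$1) + (qC x * x$1 + qS x * x$0) * (qC y * y$1 + qS y * y$0)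
      = 4 * Z ^ 3 - 3 * (qX x * qX y) * Z"
    unfolding qC_def qS_def qX_def Z_def by (simp add: algebra_simps power3_eq_cube)
  have w3: "(qD x * x$2 - qT x * x$3) * (qD y * y$2 - qT y * y$3) + (qD x * x$3 + qT x * x$2) * (qD y * y$3 + qT y * y$2)
      = 4 * W ^ 3 - 3 * (qY x * qY y) * W"
    unfolding qD_def qT_def qY_def W_def by (simp add: algebra_simps power3_eq_cube)
  have z2: "qC x * qC y + qS x * qS y = 2 * Z\<^sup>2 - qX x * qX y"
    unfolding qC_def qS_def qX_def Z_def by (simp add: algebra_simps power2_eq_square)
  have w2: "qD x * qD y + qT x * qT y = 2 * W\<^sup>2 - qY x * qY y"
    unfolding qD_def qT_def qY_def W_def by (simp add: algebra_simps power2_eq_square)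
  have "(eu x, ev x) \<bullet> (eu y, ev y) = 8 * L * (Z + W) ^ 3 + (m - 4 * L) * (qX x + qY x) * (qX y + qY y) * (Z + W)"
    unfolding e z3 w3 z2 w2 rel by (simp add: algebra_simps power2_eq_square power3_eq_cube)
  then show ?thesis
    by (simp add: inner_4' Z_def W_def qX_def qY_def add.assoc)
qed

end

text \<open>The points \<open>v\<close>, \<open>w\<close>, \<open>v + w\<close>, \<open>v - w\<close> at which a cubic form on the span of \<open>v\<close> and \<open>w\<close> is tested.\<close>

definition cs :: "4 \<Rightarrow> real" where "cs i = (if i = 1 then 0 else 1)"
definition ct :: "4 \<Rightarrow> real" where "ct i = (if i = 0 then 0 else if i = 3 then - 1 else 1)"

section \<open>An affine chart of the Grassmannian and rotations adapted to its points\<close>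

definition row1 :: "real ^ 4 \<Rightarrow> real ^ 4" where "row1 A = vec4 1 0 (A $ 0) (A $ 2)"
definition row2 :: "real ^ 4 \<Rightarrow> real ^ 4" where "row2 A = vec4 0 1 (A $ 1) (A $ 3)"

definition pt :: "4 \<Rightarrow> real ^ 4 \<Rightarrow> real ^ 4" where
  "pt i A = cs i *\<^sub>R row1 A + ct i *\<^sub>R row2 A"

definition dpt :: "4 \<Rightarrow> 4 \<Rightarrow> real ^ 4" where
  "dpt i r = (if r = 0 then cs i *\<^sub>R axis 2 1 else if r = 1 then ct i *\<^sub>R axis 2 1
     else if r = 2 then cs i *\<^sub>R axis 3 1 else ct i *\<^sub>R axis 3 1)"

text \<open>The Gram determinant of the basis. Its power with exponent -2, minus half the dimension
  of the ambient space, is the rotation invariant density of the Grassmannian in this chart.\<close>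

definition chart_gram :: "real ^ 4 \<Rightarrow> real" where
  "chart_gram A = (row1 A \<bullet> row1 A) * (row2 A \<bullet> row2 A) - (row1 A \<bullet> row2 A)\<^sup>2"

lemma pt_deriv: "(pt i has_derivative (\<lambda>h. \<Sum>r\<in>UNIV. h $ r *\<^sub>R dpt i r)) (at A)"
proof -
  have d: "(pt i has_derivative (\<lambda>h. cs i *\<^sub>R vec4 0 0 (h $ 0) (h $ 2) + ct i *\<^sub>R vec4 0 0 (h $ 1) (h $ 3))) (at A)"
    unfolding pt_def[abs_def] row1_def row2_def by (intro derivative_intros)
  have "(\<lambda>h. cs i *\<^sub>R vec4 0 0 (h $ 0) (h $ 2) + ct i *\<^sub>R vec4 0 0 (h $ 1) (h $ 3))
     = (\<lambda>h. \<Sum>r\<in>UNIV. h $ r *\<^sub>R dpt i r)"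
    by (rule ext) (simp add: sum_4' dpt_def vec4_def algebra_simps)
  with d show ?thesis by simp
qed

definition isometry :: "(real ^ 4 \<Rightarrow> real ^ 4) \<Rightarrow> bool" where
  "isometry g \<longleftrightarrow> linear g \<and> (\<forall>x. norm (g x) = norm x)"

lemma isometry_inner: "isometry g \<Longrightarrow> g x \<bullet> g y = x \<bullet> y"
  unfolding isometry_def using orthogonal_transformation orthogonal_transformation_def by blast

text \<open>By Lagrange's identity the Gram determinant is the sum of the squares of the six minors
  of size two, one of which is 1.\<close>

lemma chart_gram_pos: "chart_gram A > 0"
proof -
  have "chart_gram A = (1 + (A$0)\<^sup>2 + (A$2)\<^sup>2) * (1 + (A$1)\<^sup>2 + (A$3)\<^sup>2) - (A$0 * A$1 + A$2 * A$3)\<^sup>2"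
    by (simp add: chart_gram_def row1_def row2_def inner_4' power2_eq_square)
  also have "\<dots> = 1 + (A$0)\<^sup>2 + (A$2)\<^sup>2 + (A$1)\<^sup>2 + (A$3)\<^sup>2 + (A$0 * A$3 - A$1 * A$2)\<^sup>2"
    by (simp add: algebra_simps power2_eq_square)
  also have "\<dots> > 0" by (intro add_pos_nonneg) auto
  finally show ?thesis .
qed

text \<open>Orthogonal-triangular decomposition: \<open>r\<close>, \<open>t\<close>,
  \<open>u\<close> are the Gram-Schmidt coefficients of the two rows, and the rotation exists
  because the triangular vectors have the same Gram matrix as the rows.\<close>

lemma chart_rotation:
  obtains g r t u where "isometry g" "g (row1 A) = vec4 r 0 0 0" "g (row2 A) = vec4 t u 0 0"
    "r \<noteq> 0" "u \<noteq> 0" "(r * u)\<^sup>2 = chart_gram A"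
proof -
  define r where "r = sqrt (row1 A \<bullet> row1 A)"
  have r2: "r\<^sup>2 = row1 A \<bullet> row1 A" by (simp add: r_def)
  have "row1 A \<bullet> row1 A > 0" by (simp add: row1_def inner_4' add_pos_nonneg)
  then have r: "r \<noteq> 0" by (auto simp: r_def)
  define t where "t = (row1 A \<bullet> row2 A) / r"
  define u where "u = sqrt (chart_gram A) / r"
  have ru: "(r * u)\<^sup>2 = chart_gram A" using r chart_gram_pos[of A] by (simp add: u_def)
  then have u: "u \<noteq> 0" using chart_gram_pos[of A] by auto
  have tu: "t\<^sup>2 + u\<^sup>2 = row2 A \<bullet> row2 A"
  proof -
    have "r\<^sup>2 * (t\<^sup>2 + u\<^sup>2) = (row1 A \<bullet> row2 A)\<^sup>2 + chart_gram A"
      using r ru by (simp add: t_def algebra_simps power2_eq_square)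
    also have "\<dots> = r\<^sup>2 * (row2 A \<bullet> row2 A)" by (simp add: r2 chart_gram_def)
    finally show ?thesis using r by simp
  qed
  have rt: "r * t = row1 A \<bullet> row2 A" using r by (simp add: t_def)
  \<comment> \<open>The two vectors are indexed by \<open>bool\<close>, to present them as families
    with equal Gram kernel.\<close>
  define f where "f i = (if i then row1 A else row2 A)" for i
  define h where "h i = (if i then vec4 r 0 0 0 else vec4 t u 0 0)" for i
  have "f i \<bullet> f j = h i \<bullet> h j" for i j
    using r2 tu rt unfolding f_def h_def
    by (cases i; cases j) (simp_all add: inner_4'[of "vec4 _ _ _ _"] power2_eq_square inner_commute mult.commute)
  then obtain g where g: "linear g" "\<And>x. norm (g x) = norm x" "\<And>i. g (f i) = h i"
    using isometry_of_gram[of f h] by auto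
  have "g (row1 A) = vec4 r 0 0 0" "g (row2 A) = vec4 t u 0 0"
    using g(3)[of True] g(3)[of False] by (simp_all add: f_def h_def)
  then show ?thesis using that g(1,2) r u ru unfolding isometry_def by blast
qed

text \<open>The matrix with columns \<open>row1 A\<close>, \<open>row2 A\<close> and the last two
  axis vectors has determinant 1. Its image under \<open>g\<close> is block triangular with diagonal
  blocks of determinant \<open>r * u\<close> and the bracketed minor, and the determinant of
  \<open>g\<close> has absolute value 1.\<close>

lemma chart_rotation_normal:
  assumes g: "isometry g" "g (row1 A) = vec4 r 0 0 0" "g (row2 A) = vec4 t u 0 0"
  shows "(r * u * (g (axis 2 1) $ 2 * g (axis 3 1) $ 3 - g (axis 2 1) $ 3 * g (axis 3 1) $ 2))\<^sup>2 = 1"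
proof -
  have lin: "linear g" and ot: "orthogonal_transformation g"
    using g(1) by (auto simp: isometry_def orthogonal_transformation)
  define F :: "real ^ 4 ^ 4" where "F = (\<chi> i j. if j = 0 then row1 A $ i else if j = 1 then row2 A $ i else axis j 1 $ i)"
  have "det F = 1" by (simp add: det_4 F_def row1_def row2_def axis_def)
  then have "\<bar>det (matrix g ** F)\<bar> = 1"
    using orthogonal_transformation_det[OF ot] by (simp add: det_mul)
  moreover have col: "(matrix g ** F) $ i $ j = g (column j F) $ i" for i j
  proof -
    have "(matrix g ** F) $ i $ j = (matrix g *v column j F) $ i"
      by (simp add: matrix_matrix_mult_def matrix_vector_mult_def column_def)
    then show ?thesis using lin by simp
  qed
  have c: "column 0 F = row1 A" "column 1 F = row2 A" "column 2 F = axis 2 1" "column 3 F = axis 3 1"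
    by (simp_all add: column_def F_def vec_eq_iff)
  have "det (matrix g ** F) = r * u * (g (axis 2 1) $ 2 * g (axis 3 1) $ 3 - g (axis 2 1) $ 3 * g (axis 3 1) $ 2)"
    unfolding det_4 col c g(2,3) by simp
  ultimately show ?thesis by (metis power2_abs power_one)
qed

section \<open>Rotated systems and their zero densities\<close>

context feature_map
begin

definition e :: "real ^ 4 \<Rightarrow> (real ^ 4) \<times> coeffs" where "e x = (eu x, ev x)"
definition de :: "real ^ 4 \<Rightarrow> real ^ 4 \<Rightarrow> (real ^ 4) \<times> coeffs" where "de x y = (deu x y, dev x y)"

lemma e_deriv: "(e has_derivative de x) (at x)"
  unfolding e_def[abs_def] de_def[abs_def] by (intro has_derivative_Pair eu_deriv ev_deriv)

text \<open>The system with \<open>e\<close> evaluated at rotated test points. At a point where the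
  system for the identity is singular, a suitable \<open>g\<close> gives a regular one, and the
  isometry of \<open>rotation_lift\<close> relates the two systems.\<close>

definition Mg :: "(real ^ 4 \<Rightarrow> real ^ 4) \<Rightarrow> real ^ 4 \<Rightarrow> real ^ 4 ^ 4" where "Mg g A = (\<chi> i. eu (g (pt i A)))"
definition Ng :: "(real ^ 4 \<Rightarrow> real ^ 4) \<Rightarrow> real ^ 4 \<Rightarrow> coeffs ^ 4" where "Ng g A = (\<chi> i. ev (g (pt i A)))"
definition dMg :: "(real ^ 4 \<Rightarrow> real ^ 4) \<Rightarrow> 4 \<Rightarrow> real ^ 4 \<Rightarrow> real ^ 4 ^ 4"
  where "dMg g r A = (\<chi> i. deu (g (pt i A)) (g (dpt i r)))"
definition dNg :: "(real ^ 4 \<Rightarrow> real ^ 4) \<Rightarrow> 4 \<Rightarrow> real ^ 4 \<Rightarrow> coeffs ^ 4"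
  where "dNg g r A = (\<chi> i. dev (g (pt i A)) (g (dpt i r)))"

lemma linear_family_rot:
  assumes "linear g" shows "linear_family (Mg g) (Ng g) (dMg g) (dNg g)"
proof
  interpret g: linear g by (rule assms)
  have bl: "bounded_linear g" using assms by (simp add: linear_conv_bounded_linear)
  have gd: "((\<lambda>A. g (pt i A)) has_derivative (\<lambda>h. g (\<Sum>r\<in>UNIV. h $ r *\<^sub>R dpt i r))) (at A)" for i A
    by (rule bounded_linear.has_derivative[OF bl pt_deriv])
  have gp: "continuous_on S (\<lambda>A. g (pt i A))" for S i
    by (intro continuous_at_imp_continuous_on ballI has_derivative_continuous[OF gd])
  fix A r
  have le: "linear (deu x)" "linear (dev x)" for x
    using eu_deriv ev_deriv has_derivative_linear by blast+
  have "(Mg g has_derivative (\<lambda>h. \<chi> i. deu (g (pt i A)) (g (\<Sum>r\<in>UNIV. h $ r *\<^sub>R dpt i r)))) (at A)"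
    unfolding Mg_def[abs_def] by (intro has_derivative_vec_lambda has_derivative_compose[OF gd eu_deriv])
  also have "(\<lambda>h. \<chi> i. deu (g (pt i A)) (g (\<Sum>r\<in>UNIV. h $ r *\<^sub>R dpt i r))) = (\<lambda>h. \<Sum>r\<in>UNIV. h $ r *\<^sub>R dMg g r A)"
    by (simp add: fun_eq_iff vec_eq_iff dMg_def g.sum g.scale linear_sum[OF le(1)] linear_scale[OF le(1)])
  finally show "(Mg g has_derivative (\<lambda>h. \<Sum>r\<in>UNIV. h $ r *\<^sub>R dMg g r A)) (at A)" .
  have "(Ng g has_derivative (\<lambda>h. \<chi> i. dev (g (pt i A)) (g (\<Sum>r\<in>UNIV. h $ r *\<^sub>R dpt i r)))) (at A)"
    unfolding Ng_def[abs_def] by (intro has_derivative_vec_lambda has_derivative_compose[OF gd ev_deriv])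
  also have "(\<lambda>h. \<chi> i. dev (g (pt i A)) (g (\<Sum>r\<in>UNIV. h $ r *\<^sub>R dpt i r))) = (\<lambda>h. \<Sum>r\<in>UNIV. h $ r *\<^sub>R dNg g r A)"
    by (simp add: fun_eq_iff vec_eq_iff dNg_def g.sum g.scale linear_sum[OF le(2)] linear_scale[OF le(2)])
  finally show "(Ng g has_derivative (\<lambda>h. \<Sum>r\<in>UNIV. h $ r *\<^sub>R dNg g r A)) (at A)" .
  show "continuous_on UNIV (dMg g r)"
    unfolding dMg_def[abs_def]
    by (rule continuous_on_vec_lambda) (rule continuous_on_compose2[OF deu_cont gp subset_UNIV])
  show "continuous_on UNIV (dNg g r)"
    unfolding dNg_def[abs_def]
    by (rule continuous_on_vec_lambda) (rule continuous_on_compose2[OF dev_cont gp subset_UNIV])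
qed

definition lin where "lin g A \<eta> = (\<chi> i. \<eta> \<bullet> e (g (pt i A)))"
definition jac where "jac g A \<eta> = (\<chi> i r. \<eta> \<bullet> de (g (pt i A)) (g (dpt i r)))"

lemma lin_eq: "linear g \<Longrightarrow> linear_family.lin (Mg g) (Ng g) = lin g"
  by (simp add: fun_eq_iff linear_family.lin_def[OF linear_family_rot] lin_def vec_eq_iff e_def Mg_def Ng_def
      matrix_vector_mult_def inner_vec_def mult.commute split_paired_all)

lemma jac_eq: "linear g \<Longrightarrow> linear_family.jac (dMg g) (dNg g) = jac g"
  by (simp add: fun_eq_iff linear_family.jac_def[OF linear_family_rot] jac_def vec_eq_iff de_def dMg_def dNg_def
      matrix_vector_mult_def inner_vec_def mult.commute split_paired_all)

definition slv where "slv g = linear_family.slv (Mg g) (Ng g)"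

text \<open>The inner integral of \<open>expected_count\<close> for the system rotated by
  \<open>g\<close>; that it is the same for all admissible \<open>g\<close> is the content of
  \<open>density_at_indep\<close>.\<close>

definition density_at :: "((real ^ 4) \<times> coeffs \<Rightarrow> real) \<Rightarrow> (real ^ 4 \<Rightarrow> real ^ 4) \<Rightarrow> real ^ 4 \<Rightarrow> ennreal" where
  "density_at \<rho> g A = (\<integral>\<^sup>+v. ennreal (\<bar>det (jac g A (slv g A v, v))\<bar> / \<bar>det (Mg g A)\<bar> * \<rho> (slv g A v, v)) \<partial>lborel)"

lemma DIM_coeffs: "DIM((real ^ 4) \<times> coeffs) = CARD(20)"
  by simp

end

text \<open>The relations make the Gram kernel of the feature map a function of scalar products; for the
  random cubic \<open>P\<^sub>\<lambda>\<close> the parameters are \<open>L = \<lambda>\<^sup>2\<close> and \<open>m = (1 - \<lambda>)\<^sup>2\<close>.\<close>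

locale invariant_feature_map = feature_map +
  fixes L m :: real
  assumes rel: "c\<^sup>2 = 2 * L" "k\<^sup>2 = 2 * L + m" "k * n = m - 4 * L" "n\<^sup>2 + p\<^sup>2 = 8 * L + m"
    "a\<^sup>2 = 8 * L + m" "a * b = m - 4 * L" "b\<^sup>2 + q\<^sup>2 = 2 * L + m" "s\<^sup>2 = 12 * L"
    and nonzero: "c \<noteq> 0" "k \<noteq> 0"
begin

lemma e_gram: "e x \<bullet> e y = 8 * L * (x \<bullet> y) ^ 3 + (m - 4 * L) * (x \<bullet> x) * (y \<bullet> y) * (x \<bullet> y)"
  unfolding e_def by (rule feature_gram[OF rel])

lemma rotation_lift:
  assumes "isometry g" "isometry g'"
  obtains T where "linear T" "\<And>\<eta>. norm (T \<eta>) = norm \<eta>" "\<And>x. e (g' x) = T (e (g x))"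
    "distr lborel borel T = lborel"
proof -
  obtain T :: "(real ^ 4) \<times> coeffs \<Rightarrow> (real ^ 4) \<times> coeffs"
    where T: "linear T" "\<And>\<eta>. norm (T \<eta>) = norm \<eta>" "\<And>x. T (e (g x)) = e (g' x)"
    using isometry_of_gram[of "\<lambda>x. e (g x)" "\<lambda>x. e (g' x)"]
    by (auto simp: e_gram isometry_inner[OF assms(1)] isometry_inner[OF assms(2)])
  have "distr lborel borel T = lborel"
    by (rule lborel_distr_isometry[where 'n = 20]) (use T in simp_all)
  with T show ?thesis by (metis that)
qed

lemma nn_integral_rotation:
  fixes T :: "(real ^ 4) \<times> coeffs \<Rightarrow> (real ^ 4) \<times> coeffs"
  assumes "distr lborel borel T = lborel" "linear T" "F \<in> borel_measurable borel"
  shows "(\<integral>\<^sup>+\<eta>. F \<eta> \<partial>lborel) = (\<integral>\<^sup>+\<eta>. F (T \<eta>) \<partial>lborel)"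
proof -
  have "(\<integral>\<^sup>+\<eta>. F \<eta> \<partial>lborel) = (\<integral>\<^sup>+\<eta>. F \<eta> \<partial>distr lborel borel T)" by (simp add: assms(1))
  also have "\<dots> = (\<integral>\<^sup>+\<eta>. F (T \<eta>) \<partial>lborel)"
    using assms(2,3) by (intro nn_integral_distr) (auto intro: borel_measurable_linear)
  finally show ?thesis .
qed

text \<open>The derivatives are intertwined by \<open>T\<close> as well, because the two sides of
  \<open>e (g' x) = T (e (g x))\<close> have only one derivative.\<close>

lemma lift_lin_jac:
  assumes iso: "isometry g" "isometry g'" and T: "linear T" "\<And>\<eta>. norm (T \<eta>) = norm \<eta>" "\<And>x. e (g' x) = T (e (g x))"
  shows "lin g' A (T \<eta>) = lin g A \<eta>" "jac g' A (T \<eta>) = jac g A \<eta>"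
proof -
  have inn: "T x \<bullet> T y = x \<bullet> y" for x y
    using T(1,2) orthogonal_transformation orthogonal_transformation_def by blast
  show "lin g' A (T \<eta>) = lin g A \<eta>" by (simp add: lin_def T(3) inn)
  have bl: "bounded_linear g" "bounded_linear g'" "bounded_linear T"
    using iso T(1) by (simp_all add: isometry_def linear_conv_bounded_linear)
  have "de (g' x) (g' y) = T (de (g x) (g y))" for x y
  proof -
    have "((\<lambda>x. e (g' x)) has_derivative (\<lambda>y. de (g' x) (g' y))) (at x)"
      by (rule has_derivative_compose[OF bounded_linear_imp_has_derivative[OF bl(2)] e_deriv])
    moreover have "((\<lambda>x. T (e (g x))) has_derivative (\<lambda>y. T (de (g x) (g y)))) (at x)"
      by (rule bounded_linear.has_derivative[OF bl(3)], rule has_derivative_compose[OF bounded_linear_imp_has_derivative[OF bl(1)] e_deriv])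
    ultimately have "(\<lambda>y. de (g' x) (g' y)) = (\<lambda>y. T (de (g x) (g y)))"
      unfolding T(3) by (rule has_derivative_unique)
    then show ?thesis by (rule fun_cong)
  qed
  then show "jac g' A (T \<eta>) = jac g A \<eta>" by (simp add: jac_def inn)
qed

lemma measurable_jac [measurable]: "linear g \<Longrightarrow> (\<lambda>\<eta>. det (jac g A \<eta>)) \<in> borel_measurable borel"
  unfolding jac_def by (intro borel_measurable_continuous_onI continuous_on_det) (auto intro!: continuous_intros)

lemma density_at_fibre:
  assumes g: "isometry g" and nz: "det (Mg g A) \<noteq> 0"
    and \<rho>[measurable]: "\<rho> \<in> borel_measurable borel" "\<And>\<eta>. 0 \<le> \<rho> \<eta>"
    and S: "linear S" "\<And>y. lin g A (S y) = y"
  shows "(\<integral>\<^sup>+\<eta>. indicator (cbox 0 One) (lin g A \<eta>) * (\<lambda>\<eta>. ennreal (\<bar>det (jac g A \<eta>)\<bar> * \<rho> \<eta>)) (\<eta> - S (lin g A \<eta>)) \<partial>lborel)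
     = density_at \<rho> g A"
proof -
  have lg: "linear g" using g by (simp add: isometry_def)
  interpret F: linear_family "Mg g" "Ng g" "dMg g" "dNg g" by (rule linear_family_rot[OF lg])
  have [measurable]: "(\<lambda>v. (slv g A v, v)) \<in> borel_measurable borel"
  proof -
    have "(\<lambda>v. (A, v)) \<in> borel_measurable borel" by (intro borel_measurable_continuous_onI continuous_intros)
    from measurable_compose[OF this F.measurable_slv] have "(\<lambda>v. slv g A v) \<in> borel_measurable borel"
      by (simp add: slv_def)
    then show ?thesis by (intro borel_measurable_Pair) simp_all
  qed
  define h where "h \<eta> = ennreal (\<bar>det (jac g A \<eta>)\<bar> * \<rho> \<eta>)" for \<eta>
  have hm[measurable]: "h \<in> borel_measurable borel" unfolding h_def using measurable_jac[OF lg] by measurable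
  have "(\<integral>\<^sup>+\<eta>. indicator (cbox 0 One) (lin g A \<eta>) * h (\<eta> - S (lin g A \<eta>)) \<partial>lborel)
    = ennreal (1 / \<bar>det (Mg g A)\<bar>) * (\<integral>\<^sup>+v. h (slv g A v, v) \<partial>lborel)"
    using F.fibre_integral[OF nz hm S(1)] S(2) unfolding lin_eq[OF lg] slv_def by blast
  also have "\<dots> = (\<integral>\<^sup>+v. ennreal (1 / \<bar>det (Mg g A)\<bar>) * h (slv g A v, v) \<partial>lborel)"
    by (rule nn_integral_cmult[symmetric]) measurable
  also have "\<dots> = density_at \<rho> g A"
    unfolding density_at_def h_def
    by (intro nn_integral_cong) (simp add: ennreal_mult[symmetric] \<rho>(2))
  finally show ?thesis unfolding h_def .
qed

text \<open>By \<open>density_at_fibre\<close> the density is determined by \<open>lin\<close>,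
  \<open>jac\<close> and a right inverse of \<open>lin\<close>, without reference to the splitting
  of the coefficients. The isometry \<open>T\<close> carries these data from \<open>g\<close> to
  \<open>g'\<close>, and both Lebesgue measure and the radial \<rho> are invariant under it.\<close>

lemma density_at_indep:
  assumes g: "isometry g" "det (Mg g A) \<noteq> 0" and g': "isometry g'" "det (Mg g' A) \<noteq> 0"
    and \<rho>: "\<rho> \<in> borel_measurable borel" "\<And>\<eta>. 0 \<le> \<rho> \<eta>" "\<And>\<eta> \<zeta>. norm \<eta> = norm \<zeta> \<Longrightarrow> \<rho> \<eta> = \<rho> \<zeta>"
  shows "density_at \<rho> g A = density_at \<rho> g' A"
proof -
  have lg: "linear g" "linear g'" using g g' by (simp_all add: isometry_def)
  interpret F: linear_family "Mg g" "Ng g" "dMg g" "dNg g" by (rule linear_family_rot[OF lg(1)])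
  interpret F': linear_family "Mg g'" "Ng g'" "dMg g'" "dNg g'" by (rule linear_family_rot[OF lg(2)])
  obtain T where T: "linear T" "\<And>\<eta>. norm (T \<eta>) = norm \<eta>" "\<And>x. e (g' x) = T (e (g x))"
    "distr lborel borel T = lborel" using rotation_lift[OF g(1) g'(1)] by metis
  note tr = lift_lin_jac[OF g(1) g'(1) T(1-3)]
  interpret T: linear T by (rule T(1))
  obtain W where inv: "Mg g A ** W = mat 1"
    using g(2) invertible_det_nz[of "Mg g A"] unfolding invertible_def by blast
  define S where "S y = (W *v y, 0 :: coeffs)" for y
  have "lin g A (S y) = y" for y
    unfolding lin_eq[OF lg(1), symmetric] F.lin_def S_def
    by (simp add: matrix_vector_mul_assoc inv vec_eq_iff)
  then have S: "lin g A (S y) = y" "lin g' A (T (S y)) = y" for y by (simp_all add: tr)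
  have lS: "linear S" unfolding S_def
    by (rule linearI) (simp_all add: matrix_vector_right_distrib matrix_vector_mult_scaleR)
  have lTS: "linear (\<lambda>y. T (S y))" using linear_compose[OF lS T(1)] by (simp add: o_def)
  define G where "G \<eta> = indicator (cbox 0 One) (lin g' A \<eta>) * ennreal (\<bar>det (jac g' A (\<eta> - T (S (lin g' A \<eta>))))\<bar> * \<rho> (\<eta> - T (S (lin g' A \<eta>))))" for \<eta>
  have "density_at \<rho> g' A = (\<integral>\<^sup>+\<eta>. G \<eta> \<partial>lborel)"
    unfolding G_def using density_at_fibre[OF g' \<rho>(1,2) lTS S(2)] by simp
  also have "\<dots> = (\<integral>\<^sup>+\<eta>. G (T \<eta>) \<partial>lborel)"
  proof (rule nn_integral_rotation[OF T(4,1)])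
    have "linear (lin g' A)"
      unfolding lin_def by (rule linearI) (simp_all add: vec_eq_iff inner_add_left)
    then have [measurable]: "lin g' A \<in> borel_measurable borel" by (rule borel_measurable_linear)
    have [measurable]: "(\<lambda>y. T (S y)) \<in> borel_measurable borel" by (rule borel_measurable_linear[OF lTS])
    note measurable_jac[OF lg(2), measurable] \<rho>(1)[measurable]
    have d[measurable]: "(\<lambda>\<eta>. \<eta> - T (S (lin g' A \<eta>))) \<in> borel_measurable borel" by measurable
    have [measurable]: "(\<lambda>\<eta>. det (jac g' A (\<eta> - T (S (lin g' A \<eta>))))) \<in> borel_measurable borel"
      by (rule measurable_compose[OF d measurable_jac[OF lg(2)]])
    show "G \<in> borel_measurable borel" unfolding G_def by measurable
  qed
  also have "\<dots> = density_at \<rho> g A"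
  proof -
    have "G (T \<eta>) = indicator (cbox 0 One) (lin g A \<eta>) * ennreal (\<bar>det (jac g A (\<eta> - S (lin g A \<eta>)))\<bar> * \<rho> (\<eta> - S (lin g A \<eta>)))" for \<eta>
    proof -
      have "T \<eta> - T (S (lin g' A (T \<eta>))) = T (\<eta> - S (lin g A \<eta>))" by (simp add: tr T.diff)
      moreover have "\<rho> (T (\<eta> - S (lin g A \<eta>))) = \<rho> (\<eta> - S (lin g A \<eta>))" by (rule \<rho>(3)) (rule T(2))
      ultimately show ?thesis by (simp add: G_def tr)
    qed
    then show ?thesis using density_at_fibre[OF g \<rho>(1,2) lS S(1)] by simp
  qed
  finally show ?thesis ..
qed

end

section \<open>The density at an adapted rotation\<close>

context feature_map
begin

text \<open>The resultant of the binary quadratic forms with coefficients \<open>(A, B, C)\<close> and \<open>(A', B', C')\<close>.\<close>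

definition res :: "coeffs \<Rightarrow> real" where
  "res v = (case v of ((v1, v2, v3), _) \<Rightarrow>
     (let A = a * v1$0 + s * v2$0; B = 2 * s * v2$1; C = a * v1$0 - s * v2$0;
          A' = a * v1$1 + s * v3$0; B' = 2 * s * v3$1; C' = a * v1$1 - s * v3$0
      in (A * C' - C * A')\<^sup>2 - (A * B' - B * A') * (B * C' - C * B')))"

lemma ev_base: "ev (vec4 x y 0 0) = 0"
  by (simp add: ev_def qY_def qD_def qT_def vec2_def zero_prod_def)

text \<open>Along the plane of the first two coordinates, the derivatives of the cubic in the two
  normal directions are binary quadratic forms; \<open>res\<close> is their resultant.\<close>

lemma inner_dev_base:
  "((v1, v2, v3), w) \<bullet> dev (vec4 x y 0 0) z =
     z$2 * ((a * v1$0 + s * v2$0) * x\<^sup>2 + 2 * s * v2$1 * x * y + (a * v1$0 - s * v2$0) * y\<^sup>2) +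
     z$3 * ((a * v1$1 + s * v3$0) * x\<^sup>2 + 2 * s * v3$1 * x * y + (a * v1$1 - s * v3$0) * y\<^sup>2)"
  by (cases w) (simp add: dev_def qX_def qC_def qS_def qY_def qD_def qT_def dY_def dD_def dT_def inner_2' inner_Pair 
      algebra_simps power2_eq_square)

text \<open>After the rotation the plane is the coordinate plane, and both matrices factor through
  the cubic monomials at the test points: \<open>Mg g A = V ** U\<close> and
  \<open>jac g A (0, v) = V ** (Y ** K)\<close>. The factor \<open>V\<close> cancels in the ratio,
  \<open>U\<close> contributes \<open>16 * c^2 * k^2\<close>, \<open>Y\<close> the resultant, and
  \<open>K\<close> the chart factor.\<close>

lemma density_explicit:
  assumes g: "isometry g" "g (row1 A) = vec4 r 0 0 0" "g (row2 A) = vec4 t u 0 0"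
    and r: "r \<noteq> 0" and u: "u \<noteq> 0" and ru: "(r * u)\<^sup>2 = chart_gram A" and nz: "c \<noteq> 0" "k \<noteq> 0"
  shows "det (Mg g A) \<noteq> 0"
    and "density_at \<rho> g A = (\<integral>\<^sup>+v. ennreal (\<bar>res v\<bar> / (16 * c\<^sup>2 * k\<^sup>2) / (chart_gram A)\<^sup>2 * \<rho> (0, v)) \<partial>lborel)"
proof -
  have lg: "linear g" using g by (simp add: isometry_def)
  interpret g: linear g by (rule lg)
  interpret F: linear_family "Mg g" "Ng g" "dMg g" "dNg g" by (rule linear_family_rot[OF lg])
  define x where "x i = r * cs i + t * ct i" for i
  define y where "y i = u * ct i" for i
  have gp: "g (pt i A) = vec4 (x i) (y i) 0 0" for i
    by (simp add: pt_def g.add g.scale g(2,3) x_def y_def vec_eq_4' mult.commute)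
  \<comment> \<open>The change from chart parameters to rotated coordinates is triangular; this is
    its inverse.\<close>
  have cst: "cs i = x i / r - t * y i / (r * u)" "ct i = y i / u" for i
    using r u by (simp_all add: x_def y_def field_simps)
  \<comment> \<open>Row \<open>i\<close> lists the four cubic monomials at the i-th test
    point.\<close>
  define V :: "real ^ 4 ^ 4" where "V = (\<chi> i m. if m = 0 then x i ^ 3 else if m = 1 then (x i)\<^sup>2 * y i else if m = 2 then x i * (y i)\<^sup>2 else y i ^ 3)"
  define U :: "real ^ 4 ^ 4" where "U = (\<chi> m j. vec4 (vec4 c 0 k 0 $ j) (vec4 0 (3 * c) 0 k $ j) (vec4 (- 3 * c) 0 k 0 $ j) (vec4 0 (- c) 0 k $ j) $ m)"
  have MVU: "Mg g A = V ** U"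
    unfolding vec_eq_iff
  proof (intro allI)
    fix i j
    show "Mg g A $ i $ j = (V ** U) $ i $ j"
      unfolding Mg_def gp eu_def matrix_matrix_mult_def V_def U_def
      by (cases "j = 0 \<or> j = 1 \<or> j = 2 \<or> j = 3")
         (use UNIV_4' in \<open>auto simp: sum_4' qX_def qC_def qS_def qY_def algebra_simps power2_eq_square power3_eq_cube\<close>)
  qed
  have "\<bar>det V\<bar> = \<bar>2 * (r * u) ^ 6\<bar>"
  proof -
    have "det V = 2 * (r * u) ^ 6 \<or> det V = - (2 * (r * u) ^ 6)"
      unfolding det_4 V_def x_def y_def cs_def ct_def
      by (simp add: algebra_simps power2_eq_square power3_eq_cube power_mult_distrib eval_nat_numeral)
    then show ?thesis by auto
  qed
  then have detV: "det V \<noteq> 0" using r u by auto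
  have "det U = 16 * c\<^sup>2 * k\<^sup>2 \<or> det U = - (16 * c\<^sup>2 * k\<^sup>2)"
    unfolding det_4 U_def by (simp add: algebra_simps power2_eq_square)
  then have detU: "\<bar>det U\<bar> = 16 * c\<^sup>2 * k\<^sup>2" by auto
  then have "det U \<noteq> 0" using nz by auto
  have detM: "\<bar>det (Mg g A)\<bar> = \<bar>det V\<bar> * (16 * c\<^sup>2 * k\<^sup>2)"
    unfolding MVU det_mul abs_mult detU ..
  show M: "det (Mg g A) \<noteq> 0"
    unfolding MVU det_mul using detV \<open>det U \<noteq> 0\<close> by simp
  \<comment> \<open>The components \<open>ev\<close> vanish on the coordinate plane, so the kernel
    of the system is exactly \<open>u = 0\<close>.\<close>
  have slv0: "slv g A v = 0" for v
  proof -
    have "Ng g A $ i = 0" for i by (simp add: Ng_def gp ev_base)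
    then have "slv g A v = cramer_sol (Mg g A) 0"
      unfolding slv_def F.slv_def by (simp add: vec_eq_iff zero_vec_def[symmetric])
    then show ?thesis using cramer_sol_iff[OF M, of 0 0] by simp
  qed
  define n1 where "n1 = g (axis 2 1)"
  define n2 where "n2 = g (axis 3 1)"
  define D where "D = n1 $ 2 * n2 $ 3 - n1 $ 3 * n2 $ 2"
  have D: "(r * u * D)\<^sup>2 = 1"
    using chart_rotation_normal[OF g] by (simp add: D_def n1_def n2_def)
  \<comment> \<open>The Kronecker product of the normal components of \<open>n1\<close>,
    \<open>n2\<close>, with determinant \<open>D\<close>, and the triangular matrix of
    \<open>cst\<close>, with determinant \<open>1 / (r * u)\<close>; each of these determinants
    enters squared.\<close>
  define K :: "real ^ 4 ^ 4" where "K = (\<chi> m j. vec4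
      (vec4 (n1$2 / r) 0 (n2$2 / r) 0 $ j) (vec4 (- (n1$2 * t / (r * u))) (n1$2 / u) (- (n2$2 * t / (r * u))) (n2$2 / u) $ j)
      (vec4 (n1$3 / r) 0 (n2$3 / r) 0 $ j) (vec4 (- (n1$3 * t / (r * u))) (n1$3 / u) (- (n2$3 * t / (r * u))) (n2$3 / u) $ j) $ m)"
  have detK: "\<bar>det K\<bar> = 1 / (chart_gram A)\<^sup>2"
  proof -
    have "det K = - (D / (r * u))\<^sup>2 \<or> det K = (D / (r * u))\<^sup>2"
      unfolding det_4 K_def D_def using r u
      by (simp add: field_simps power2_eq_square)
    then have "\<bar>det K\<bar> = (D / (r * u))\<^sup>2" by auto
    also have "\<dots> = (r * u * D)\<^sup>2 / ((r * u)\<^sup>2)\<^sup>2" using r u by (simp add: field_simps power2_eq_square)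
    finally show ?thesis by (simp only: D ru)
  qed
  have ratio: "\<bar>det (jac g A (0, v))\<bar> / \<bar>det (Mg g A)\<bar> = \<bar>res v\<bar> / (16 * c\<^sup>2 * k\<^sup>2) / (chart_gram A)\<^sup>2" for v
  proof -
    obtain v1 v2 v3 w where v: "v = ((v1, v2, v3), w)" by (metis surj_pair)
    define a1 b1 c1 a2 b2 c2 where abc: "a1 = a * v1$0 + s * v2$0" "b1 = 2 * s * v2$1" "c1 = a * v1$0 - s * v2$0"
      "a2 = a * v1$1 + s * v3$0" "b2 = 2 * s * v3$1" "c2 = a * v1$1 - s * v3$0"
    \<comment> \<open>The Sylvester matrix of the two quadratic forms: its columns are each form
      multiplied by \<open>x\<close> and by \<open>y\<close>, expanded in cubic monomials.\<close>
    define Y :: "real ^ 4 ^ 4" where "Y = (\<chi> m j. vec4 (vec4 a1 0 a2 0 $ j) (vec4 b1 a1 b2 a2 $ j) (vec4 c1 b1 c2 b2 $ j) (vec4 0 c1 0 c2 $ j) $ m)"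
    have res: "res v = (a1 * c2 - c1 * a2)\<^sup>2 - (a1 * b2 - b1 * a2) * (b1 * c2 - c1 * b2)"
      unfolding v res_def by (simp add: Let_def abc)
    have "det Y = res v \<or> det Y = - res v"
      unfolding res det_4 Y_def by (simp add: algebra_simps power2_eq_square)
    then have detY: "\<bar>det Y\<bar> = \<bar>res v\<bar>" by auto
    have ent: "jac g A (0, v) $ i $ j = g (dpt i j) $ 2 * (a1 * (x i)\<^sup>2 + b1 * x i * y i + c1 * (y i)\<^sup>2)
       + g (dpt i j) $ 3 * (a2 * (x i)\<^sup>2 + b2 * x i * y i + c2 * (y i)\<^sup>2)" for i j
      unfolding jac_def gp de_def v by (simp add: inner_dev_base abc del: inner_Pair) (simp add: inner_Pair inner_dev_base abc)
    have gd: "g (dpt i 0) = cs i *\<^sub>R n1" "g (dpt i 1) = ct i *\<^sub>R n1" "g (dpt i 2) = cs i *\<^sub>R n2" "g (dpt i 3) = ct i *\<^sub>R n2" for i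
      by (simp_all add: dpt_def g.scale n1_def n2_def)
    have "jac g A (0, v) = V ** (Y ** K)"
    proof -
      have "jac g A (0, v) $ i $ j = (V ** (Y ** K)) $ i $ j" for i j
      proof -
        have YK: "(Y ** K) $ m $ j = Y $ m $ 0 * K $ 0 $ j + Y $ m $ 1 * K $ 1 $ j + Y $ m $ 2 * K $ 2 $ j + Y $ m $ 3 * K $ 3 $ j" for m j
          by (simp add: matrix_matrix_mult_def sum_4')
        have VYK: "(V ** (Y ** K)) $ i $ j = x i ^ 3 * (Y ** K) $ 0 $ j + (x i)\<^sup>2 * y i * (Y ** K) $ 1 $ j
            + x i * (y i)\<^sup>2 * (Y ** K) $ 2 $ j + y i ^ 3 * (Y ** K) $ 3 $ j" for j
        proof -
          have "(V ** (Y ** K)) $ i $ j = (\<Sum>m\<in>UNIV. V $ i $ m * (Y ** K) $ m $ j)"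
            by (subst matrix_matrix_mult_def) simp
          then show ?thesis by (simp add: sum_4' V_def)
        qed
        have "\<forall>j. jac g A (0, v) $ i $ j = (V ** (Y ** K)) $ i $ j"
          unfolding forall_4' VYK YK ent gd
          by (simp add: Y_def K_def cst) (use r u in \<open>simp add: field_simps power2_eq_square power3_eq_cube\<close>)
        then show ?thesis by blast
      qed
      then show ?thesis by (simp add: vec_eq_iff)
    qed
    then have "\<bar>det (jac g A (0, v))\<bar> = \<bar>det V\<bar> * (\<bar>res v\<bar> * (1 / (chart_gram A)\<^sup>2))"
      by (simp add: det_mul abs_mult detY detK)
    then show ?thesis unfolding detM using detV by simp
  qed
  show "density_at \<rho> g A = (\<integral>\<^sup>+v. ennreal (\<bar>res v\<bar> / (16 * c\<^sup>2 * k\<^sup>2) / (chart_gram A)\<^sup>2 * \<rho> (0, v)) \<partial>lborel)"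
    unfolding density_at_def slv0 ratio ..
qed

end

section \<open>Zeros over the whole chart\<close>

context feature_map
begin

definition zeros :: "(real ^ 4) set \<Rightarrow> (real ^ 4) \<times> coeffs \<Rightarrow> (real ^ 4) set" where
  "zeros B \<eta> = {A \<in> B. \<forall>i. \<eta> \<bullet> e (pt i A) = 0}"

definition res_integral :: "((real ^ 4) \<times> coeffs \<Rightarrow> real) \<Rightarrow> ennreal" where
  "res_integral \<rho> = (\<integral>\<^sup>+v. ennreal (\<bar>res v\<bar> * \<rho> (0, v)) \<partial>lborel)"

lemma zeros_eq_lin: "zeros B \<eta> = {A \<in> B. lin (\<lambda>x. x) A \<eta> = 0}"
  by (simp add: zeros_def lin_def vec_eq_iff)

lemma measurable_ecard_zeros:
  assumes "fsigma B" shows "(\<lambda>\<eta>. ecard (zeros B \<eta>)) \<in> borel_measurable borel"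
proof -
  have lg: "linear (\<lambda>x :: real ^ 4. x)" by (rule linear_id[unfolded id_def])
  interpret F: linear_family "Mg (\<lambda>x. x)" "Ng (\<lambda>x. x)" "dMg (\<lambda>x. x)" "dNg (\<lambda>x. x)" by (rule linear_family_rot[OF lg])
  show ?thesis using F.measurable_count[OF assms] unfolding lin_eq[OF lg] zeros_eq_lin .
qed

lemma res_measurable [measurable]: "res \<in> borel_measurable borel"
proof (rule borel_measurable_continuous_onI)
  show "continuous_on UNIV res"
    unfolding res_def[abs_def] case_prod_beta Let_def by (intro continuous_intros)
qed

end

context invariant_feature_map
begin

text \<open>Every point of the chart has an open neighbourhood on which some rotation makes the
  system regular. On each piece of a countable disjoint refinement, \<open>expected_count\<close>
  applies after rotating the coefficients, which changes neither Lebesgue measure nor \<rho>; the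
  densities of the pieces agree by \<open>density_at_indep\<close>.\<close>

theorem expected_zeros:
  assumes B: "fsigma B"
    and \<rho>[measurable]: "\<rho> \<in> borel_measurable borel" and \<rho>0: "\<And>\<eta>. 0 \<le> \<rho> \<eta>" 
    and \<rho>r: "\<And>\<eta> \<zeta>. norm \<eta> = norm \<zeta> \<Longrightarrow> \<rho> \<eta> = \<rho> \<zeta>"
  shows "(\<integral>\<^sup>+\<eta>. ecard (zeros B \<eta>) * ennreal (\<rho> \<eta>) \<partial>lborel)
    = (\<integral>\<^sup>+A. indicator B A * ennreal (1 / (chart_gram A)\<^sup>2) \<partial>lborel) * (ennreal (1 / (16 * c\<^sup>2 * k\<^sup>2)) * res_integral \<rho>)"
proof -
  define dens where "dens A = ennreal (1 / (chart_gram A)\<^sup>2) * (ennreal (1 / (16 * c\<^sup>2 * k\<^sup>2)) * res_integral \<rho>)" for A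
  have split3: "ennreal (x * (y * z)) = ennreal x * (ennreal y * ennreal z)" if "0 \<le> x" "0 \<le> y" "0 \<le> z" for x y z
    using that by (simp add: ennreal_mult)
  have loc: "density_at \<rho> g A = dens A" if g: "isometry g" "det (Mg g A) \<noteq> 0" for g A
  proof -
    obtain h r t u where h: "isometry h" "h (row1 A) = vec4 r 0 0 0" "h (row2 A) = vec4 t u 0 0"
      "r \<noteq> 0" "u \<noteq> 0" "(r * u)\<^sup>2 = chart_gram A" using chart_rotation by metis
    note ex = density_explicit[OF h nonzero]
    have "density_at \<rho> g A = density_at \<rho> h A"
      by (rule density_at_indep[OF g h(1) ex(1) \<rho> \<rho>0 \<rho>r])
    also have "\<dots> = (\<integral>\<^sup>+v. ennreal (1 / (chart_gram A)\<^sup>2) * (ennreal (1 / (16 * c\<^sup>2 * k\<^sup>2)) * ennreal (\<bar>res v\<bar> * \<rho> (0, v))) \<partial>lborel)"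
      unfolding ex(2)
    proof (rule nn_integral_cong)
      fix v
      have "\<bar>res v\<bar> / (16 * c\<^sup>2 * k\<^sup>2) / (chart_gram A)\<^sup>2 * \<rho> (0, v)
        = 1 / (chart_gram A)\<^sup>2 * (1 / (16 * c\<^sup>2 * k\<^sup>2) * (\<bar>res v\<bar> * \<rho> (0, v)))" by simp
      then show "ennreal (\<bar>res v\<bar> / (16 * c\<^sup>2 * k\<^sup>2) / (chart_gram A)\<^sup>2 * \<rho> (0, v)) =
        ennreal (1 / (chart_gram A)\<^sup>2) * (ennreal (1 / (16 * c\<^sup>2 * k\<^sup>2)) * ennreal (\<bar>res v\<bar> * \<rho> (0, v)))"
        by (simp only:) (rule split3, use \<rho>0 in simp_all)
    qed
    also have "\<dots> = dens A"
      unfolding dens_def res_integral_def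
      by (subst nn_integral_cmult, measurable)+
    finally show ?thesis .
  qed
  have piece: "(\<integral>\<^sup>+\<eta>. ecard (zeros C \<eta>) * ennreal (\<rho> \<eta>) \<partial>lborel) = (\<integral>\<^sup>+A. indicator C A * dens A \<partial>lborel)"
    if C: "fsigma C" "isometry g" "C \<subseteq> {A. det (Mg g A) \<noteq> 0}" for C g
  proof -
    have lg: "linear g" using C(2) by (simp add: isometry_def)
    interpret F: linear_family "Mg g" "Ng g" "dMg g" "dNg g" by (rule linear_family_rot[OF lg])
    have idi: "isometry (\<lambda>x. x)" using linear_id[unfolded id_def] by (simp add: isometry_def)
    obtain T where T: "linear T" "\<And>\<eta>. norm (T \<eta>) = norm \<eta>" "\<And>x. e (g x) = T (e x)"
      "distr lborel borel T = lborel" using rotation_lift[OF idi C(2)] by metis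
    note tr = lift_lin_jac[OF idi C(2) T(1-3)]
    have [measurable]: "(\<lambda>\<eta>. ecard {A \<in> C. lin g A \<eta> = 0}) \<in> borel_measurable borel"
      using F.measurable_count[OF C(1)] unfolding lin_eq[OF lg] .
    have "ecard (zeros C \<eta>) * ennreal (\<rho> \<eta>) = ecard {A \<in> C. lin g A (T \<eta>) = 0} * ennreal (\<rho> (T \<eta>))" for \<eta>
      using \<rho>r[OF T(2)] by (simp add: zeros_eq_lin tr)
    then have "(\<integral>\<^sup>+\<eta>. ecard (zeros C \<eta>) * ennreal (\<rho> \<eta>) \<partial>lborel)
      = (\<integral>\<^sup>+\<eta>. ecard {A \<in> C. lin g A \<eta> = 0} * ennreal (\<rho> \<eta>) \<partial>lborel)"
      by (subst nn_integral_rotation[OF T(4,1)]) (simp_all)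
    also have "\<dots> = (\<integral>\<^sup>+A. indicator C A * density_at \<rho> g A \<partial>lborel)"
      using F.expected_count[OF C(1,3) \<rho> \<rho>0]
      unfolding lin_eq[OF lg] jac_eq[OF lg] slv_def[symmetric] density_at_def .
    also have "\<dots> = (\<integral>\<^sup>+A. indicator C A * dens A \<partial>lborel)"
    proof (rule nn_integral_cong)
      fix A
      show "indicator C A * density_at \<rho> g A = indicator C A * dens A"
        using C(3) loc[OF C(2), of A] by (cases "A \<in> C") auto
    qed
    finally show ?thesis .
  qed
  obtain C :: "nat \<Rightarrow> (real ^ 4) set" where C: "\<And>i. fsigma (C i)" "disjoint_family C" "B = (\<Union>i. C i)"
    "\<And>i. \<exists>g. isometry g \<and> C i \<subseteq> {A. det (Mg g A) \<noteq> 0}"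
  proof (rule fsigma_disjoint_cover[OF B, of "\<lambda>C. \<exists>g. isometry g \<and> C \<subseteq> {A. det (Mg g A) \<noteq> 0}"])
    fix A assume "A \<in> B"
    obtain h r t u where h: "isometry h" "h (row1 A) = vec4 r 0 0 0" "h (row2 A) = vec4 t u 0 0"
      "r \<noteq> 0" "u \<noteq> 0" "(r * u)\<^sup>2 = chart_gram A" using chart_rotation by metis
    have lg: "linear h" using h(1) by (simp add: isometry_def)
    interpret F: linear_family "Mg h" "Ng h" "dMg h" "dNg h" by (rule linear_family_rot[OF lg])
    show "\<exists>U. open U \<and> A \<in> U \<and> (\<exists>g. isometry g \<and> U \<subseteq> {A. det (Mg g A) \<noteq> 0})"
      using F.open_regular density_explicit(1)[OF h nonzero] h(1)
      by (intro exI[of _ "{A. det (Mg h A) \<noteq> 0}"]) blast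
  next
    have "isometry (\<lambda>x. x)" using linear_id[unfolded id_def] by (simp add: isometry_def)
    then show "\<exists>g. isometry g \<and> {} \<subseteq> {A. det (Mg g A) \<noteq> 0}" by blast
  next
    show "\<exists>g. isometry g \<and> V \<subseteq> {A. det (Mg g A) \<noteq> 0}" if "\<exists>g. isometry g \<and> U \<subseteq> {A. det (Mg g A) \<noteq> 0}" "V \<subseteq> U" for U V
      using that by blast
  qed (rule that)
  have Cb[measurable]: "C i \<in> sets borel" for i using C(1) by (rule fsigma_sets_borel)
  have [measurable]: "(\<lambda>\<eta>. ecard (zeros (C i) \<eta>)) \<in> borel_measurable borel" for i by (rule measurable_ecard_zeros[OF C(1)])
  have gm[measurable]: "chart_gram \<in> borel_measurable borel"
    unfolding chart_gram_def[abs_def] row1_def row2_def by (intro borel_measurable_continuous_onI continuous_intros)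
  have dm[measurable]: "dens \<in> borel_measurable borel" unfolding dens_def[abs_def] by measurable
  have "ecard (zeros B \<eta>) = (\<Sum>i. ecard (zeros (C i) \<eta>))" for \<eta>
  proof -
    have "zeros B \<eta> = (\<Union>i. zeros (C i) \<eta>)" unfolding zeros_def C(3) by blast
    moreover have "disjoint_family (\<lambda>i. zeros (C i) \<eta>)"
      using C(2) unfolding disjoint_family_on_def zeros_def by blast
    ultimately show ?thesis by (simp only: ecard_UN_disjoint)
  qed
  then have "(\<integral>\<^sup>+\<eta>. ecard (zeros B \<eta>) * ennreal (\<rho> \<eta>) \<partial>lborel) = (\<integral>\<^sup>+\<eta>. (\<Sum>i. ecard (zeros (C i) \<eta>) * ennreal (\<rho> \<eta>)) \<partial>lborel)"
    by (simp only: ennreal_suminf_multc)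
  also have "\<dots> = (\<Sum>i. \<integral>\<^sup>+\<eta>. ecard (zeros (C i) \<eta>) * ennreal (\<rho> \<eta>) \<partial>lborel)"
    by (rule nn_integral_suminf) measurable
  also have "\<dots> = (\<Sum>i. \<integral>\<^sup>+A. indicator (C i) A * dens A \<partial>lborel)"
  proof (rule suminf_cong)
    fix i
    obtain g where "isometry g" "C i \<subseteq> {A. det (Mg g A) \<noteq> 0}" using C(4) by blast
    then show "(\<integral>\<^sup>+\<eta>. ecard (zeros (C i) \<eta>) * ennreal (\<rho> \<eta>) \<partial>lborel) = (\<integral>\<^sup>+A. indicator (C i) A * dens A \<partial>lborel)"
      by (rule piece[OF C(1)])
  qed
  also have "\<dots> = (\<integral>\<^sup>+A. (\<Sum>i. indicator (C i) A * dens A) \<partial>lborel)"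
    by (rule nn_integral_suminf[symmetric]) measurable
  also have "\<dots> = (\<integral>\<^sup>+A. indicator B A * dens A \<partial>lborel)"
    by (simp only: ennreal_suminf_multc suminf_indicator[OF C(2)] C(3))
  also have "\<dots> = (\<integral>\<^sup>+A. (indicator B A * ennreal (1 / (chart_gram A)\<^sup>2)) * (ennreal (1 / (16 * c\<^sup>2 * k\<^sup>2)) * res_integral \<rho>) \<partial>lborel)"
    by (simp only: dens_def mult.assoc)
  also have "\<dots> = (\<integral>\<^sup>+A. indicator B A * ennreal (1 / (chart_gram A)\<^sup>2) \<partial>lborel) * (ennreal (1 / (16 * c\<^sup>2 * k\<^sup>2)) * res_integral \<rho>)"
  proof (rule nn_integral_multc)
    note fsigma_sets_borel[OF B, measurable]
    show "(\<lambda>A. indicator B A * ennreal (1 / (chart_gram A)\<^sup>2)) \<in> borel_measurable lborel" by measurable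
  qed
  finally show ?thesis .
qed

end

section \<open>Evaluation of the constants\<close>

text \<open>The disc of squared radius \<open>t\<close> has area \<open>pi * t\<close>, so the
  squared norm pushes planar Lebesgue measure forward to \<pi> times Lebesgue measure on the half
  line.\<close>

lemma nn_integral_radial_2:
  fixes F :: "real \<Rightarrow> ennreal"
  assumes [measurable]: "F \<in> borel_measurable borel"
  shows "(\<integral>\<^sup>+(x :: real ^ 2). F ((norm x)\<^sup>2) \<partial>lborel) = ennreal pi * (\<integral>\<^sup>+t. F t * indicator {0..} t \<partial>lborel)"
proof -
  let ?N = "density lborel (\<lambda>t. ennreal pi * indicator {0..} t) :: real measure"
  have nm[measurable]: "(\<lambda>x :: real ^ 2. (norm x)\<^sup>2) \<in> borel_measurable borel" by measurable
  have e1: "emeasure (distr lborel borel (\<lambda>x :: real ^ 2. (norm x)\<^sup>2)) {..t} = ennreal (pi * max 0 t)" for t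
  proof -
    have "emeasure (distr lborel borel (\<lambda>x :: real ^ 2. (norm x)\<^sup>2)) {..t} = emeasure lborel {x :: real ^ 2. (norm x)\<^sup>2 \<le> t}"
      by (subst emeasure_distr) (auto simp: vimage_def)
    also have "\<dots> = ennreal (pi * max 0 t)"
    proof (cases "t \<ge> 0")
      case True
      then have "{x :: real ^ 2. (norm x)\<^sup>2 \<le> t} = cball 0 (sqrt t)"
        by (auto simp: real_le_rsqrt sqrt_ge_absD)
      then show ?thesis using True by (simp add: emeasure_cball unit_ball_vol_2)
    next
      case False
      then have "{x :: real ^ 2. (norm x)\<^sup>2 \<le> t} = {}"
        by (auto simp: not_le) (meson order_less_le_trans zero_le_power2)
      then show ?thesis using False by simp
    qed
    finally show ?thesis .
  qed
  have e2: "emeasure ?N {..t} = ennreal (pi * max 0 t)" for t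
  proof -
    have "emeasure ?N {..t} = (\<integral>\<^sup>+x. ennreal pi * indicator {0..t} x \<partial>lborel)"
      by (subst emeasure_density) (auto intro!: nn_integral_cong simp: indicator_def)
    also have "\<dots> = ennreal (pi * max 0 t)"
      by (simp add: nn_integral_cmult emeasure_lborel_Icc_eq ennreal_mult[symmetric] max_def)
    finally show ?thesis .
  qed
  have d: "distr lborel borel (\<lambda>x :: real ^ 2. (norm x)\<^sup>2) = ?N"
  proof (rule measure_eqI_generator_eq[where E = "range atMost" and \<Omega> = UNIV and A = "\<lambda>i. {..real i}"])
    show "Int_stable (range atMost :: real set set)" by (auto simp: Int_stable_def)
    show "sets (distr lborel borel (\<lambda>x :: real ^ 2. (norm x)\<^sup>2)) = sigma_sets UNIV (range atMost)"
      "sets ?N = sigma_sets UNIV (range atMost)"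
      by (simp_all add: borel_eq_atMost)
    show "(\<Union>i. {..real i}) = UNIV" by (auto simp: real_arch_simple)
    show "emeasure (distr lborel borel (\<lambda>x :: real ^ 2. (norm x)\<^sup>2)) X = emeasure ?N X" if "X \<in> range atMost" for X
      using that e1 e2 by auto
  qed (auto simp: e1)
  have "(\<integral>\<^sup>+(x :: real ^ 2). F ((norm x)\<^sup>2) \<partial>lborel) = (\<integral>\<^sup>+t. F t \<partial>?N)"
    unfolding d[symmetric] by (simp add: nn_integral_distr)
  also have "\<dots> = (\<integral>\<^sup>+t. ennreal pi * (F t * indicator {0..} t) \<partial>lborel)"
    by (subst nn_integral_density) (auto intro!: nn_integral_cong simp: mult_ac)
  also have "\<dots> = ennreal pi * (\<integral>\<^sup>+t. F t * indicator {0..} t \<partial>lborel)"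
    by (rule nn_integral_cmult) measurable
  finally show ?thesis .
qed

text \<open>A square root of the quadratic form \<open>y \<mapsto> \<bar>y\<bar>\<^sup>2 + (n \<bullet> y)\<^sup>2\<close>.\<close>

definition chol :: "real ^ 2 \<Rightarrow> real ^ 2 ^ 2" where
  "chol n = (\<chi> i. if i = 0 then vec2 (sqrt (1 + (n$0)\<^sup>2)) (n$0 * n$1 / sqrt (1 + (n$0)\<^sup>2))
     else vec2 0 (sqrt (1 + (norm n)\<^sup>2) / sqrt (1 + (n$0)\<^sup>2)))"

lemma norm_2': "(norm x)\<^sup>2 = (x$0)\<^sup>2 + (x$1)\<^sup>2" for x :: "real ^ 2"
  unfolding power2_norm_eq_inner inner_2' by (simp add: power2_eq_square)

lemma det_2': "det A = A$0$0 * A$1$1 - A$0$1 * A$1$0" for A :: "real ^ 2 ^ 2"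
proof -
  have f: "finite {1::2}" "0 \<notin> {1::2}" by auto
  show ?thesis
    unfolding det_def UNIV_2'
    unfolding sum_over_permutations_insert[OF f]
    unfolding permutes_sing
    by (simp add: sign_swap_id sign_id swap_id_eq)
qed

lemma matrix_vector_2': "A *v x = vec2 (A$0$0 * x$0 + A$0$1 * x$1) (A$1$0 * x$0 + A$1$1 * x$1)" for A :: "real ^ 2 ^ 2"
  by (simp add: vec_eq_iff forall_2' matrix_vector_mult_def sum_2')

lemma det_chol: "det (chol n) = sqrt (1 + (norm n)\<^sup>2)"
proof -
  have "sqrt (1 + (n$0)\<^sup>2) > 0" by (simp add: add_pos_nonneg)
  then show ?thesis by (simp add: det_2' chol_def)
qed

lemma norm_chol: "(norm (chol n *v y))\<^sup>2 = (norm y)\<^sup>2 + (n \<bullet> y)\<^sup>2"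
proof -
  define h where "h = sqrt (1 + (n$0)\<^sup>2)"
  define w where "w = sqrt (1 + (norm n)\<^sup>2)"
  have h: "h > 0" "h\<^sup>2 = 1 + (n$0)\<^sup>2" by (simp_all add: h_def add_pos_nonneg)
  have w: "w\<^sup>2 = 1 + (n$0)\<^sup>2 + (n$1)\<^sup>2" by (simp add: w_def norm_2' add_nonneg_nonneg)
  have "(norm (chol n *v y))\<^sup>2 = (h * y$0 + n$0 * n$1 / h * y$1)\<^sup>2 + (w / h * y$1)\<^sup>2"
    by (simp add: norm_2' matrix_vector_2' chol_def h_def w_def)
  also have "\<dots> = h\<^sup>2 * (y$0)\<^sup>2 + 2 * (n$0 * n$1 * y$0 * y$1) + ((n$0)\<^sup>2 * (n$1)\<^sup>2 + w\<^sup>2) / h\<^sup>2 * (y$1)\<^sup>2"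
    using h(1) by (simp add: field_simps power2_eq_square)
  also have "(n$0)\<^sup>2 * (n$1)\<^sup>2 + w\<^sup>2 = h\<^sup>2 * (1 + (n$1)\<^sup>2)" by (simp add: h w algebra_simps)
  also have "h\<^sup>2 * (1 + (n$1)\<^sup>2) / h\<^sup>2 = 1 + (n$1)\<^sup>2" using h(1) by simp
  also have "h\<^sup>2 * (y$0)\<^sup>2 + 2 * (n$0 * n$1 * y$0 * y$1) + (1 + (n$1)\<^sup>2) * (y$1)\<^sup>2 = (norm y)\<^sup>2 + (n \<bullet> y)\<^sup>2"
    unfolding h(2) norm_2' inner_2' by (simp add: algebra_simps power2_eq_square)
  finally show ?thesis .
qed

lemma nn_integral_chol:
  assumes [measurable]: "G \<in> borel_measurable borel"
  shows "(\<integral>\<^sup>+y. G (chol n *v y) \<partial>lborel) = ennreal (1 / sqrt (1 + (norm n)\<^sup>2)) * (\<integral>\<^sup>+y. G y \<partial>lborel)"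
proof -
  have w: "sqrt (1 + (norm n)\<^sup>2) > 0" by (simp add: add_pos_nonneg)
  have "(\<integral>\<^sup>+y. G y \<partial>lborel) = ennreal (sqrt (1 + (norm n)\<^sup>2)) * (\<integral>\<^sup>+y. G (chol n *v y) \<partial>lborel)"
    using nn_integral_linear_change[of "chol n" G] w by (simp add: det_chol)
  moreover have "ennreal (1 / sqrt (1 + (norm n)\<^sup>2)) * (ennreal (sqrt (1 + (norm n)\<^sup>2)) * z) = z" for z
    using w by (simp add: mult.assoc[symmetric] ennreal_mult[symmetric])
  ultimately show ?thesis by simp
qed

lemma nn_integral_inverse_square:
  assumes "k > 0"
  shows "(\<integral>\<^sup>+t. ennreal (1 / (k + t)\<^sup>2) * indicator {0..} t \<partial>lborel) = ennreal (1 / k)"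
proof -
  have "(\<integral>\<^sup>+t. ennreal (1 / (k + t)\<^sup>2) * indicator {0..} t \<partial>lborel) = ennreal (0 - (- (1 / (k + 0))))"
  proof (rule nn_integral_FTC_atLeast)
    show "((\<lambda>t. - (1 / (k + t))) has_real_derivative 1 / (k + x)\<^sup>2) (at x)" if "0 \<le> x" for x
      using assms that by (auto intro!: derivative_eq_intros simp: power2_eq_square)
    show "((\<lambda>t. - (1 / (k + t))) \<longlongrightarrow> 0) at_top" by real_asymp
  qed auto
  then show ?thesis by simp
qed

lemma nn_integral_three_halves:
  "(\<integral>\<^sup>+t. ennreal ((1 + t) powr (-3/2)) * indicator {0..} t \<partial>lborel) = 2"
proof -
  have "(\<integral>\<^sup>+t. ennreal ((1 + t) powr (-3/2)) * indicator {0..} t \<partial>lborel) = ennreal (0 - (- 2 * (1 + 0) powr (-1/2)))"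
  proof (rule nn_integral_FTC_atLeast)
    show "((\<lambda>t. - 2 * (1 + t) powr (-1/2)) has_real_derivative (1 + x) powr (-3/2)) (at x)" if "0 \<le> x" for x :: real
      using that by (auto intro!: derivative_eq_intros)
    show "((\<lambda>t :: real. - 2 * (1 + t) powr (-1/2)) \<longlongrightarrow> 0) at_top" by real_asymp
  qed auto
  then show ?thesis by simp
qed

text \<open>Let \<open>p\<close> and \<open>q\<close> be the free entries of the two rows. For fixed
  \<open>p\<close> the Gram determinant is \<open>k + |q|^2\<close> plus the square of the product
  of \<open>q\<close> with the quarter turn of \<open>p\<close>, where \<open>k = 1 + |p|^2\<close>.
  The substitution \<open>chol\<close> makes this radial in \<open>q\<close>, and a radial integral
  over \<open>p\<close> remains.\<close>

lemma nn_integral_chart_gram: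
  "(\<integral>\<^sup>+A. ennreal (1 / (chart_gram A)\<^sup>2) \<partial>lborel) = ennreal (2 * pi\<^sup>2)"
proof -
  define J :: "(real ^ 2) \<times> (real ^ 2) \<Rightarrow> real ^ 4" where "J = (\<lambda>(p, q). vec4 (p$0) (q$0) (p$1) (q$1))"
  have lJ: "linear J"
    by (rule linearI) (auto simp: J_def vec_eq_4' split: prod.splits)
  have nJ: "norm (J x) = norm x" for x
    by (cases x) (simp add: J_def norm_eq_sqrt_inner inner_4' inner_2' algebra_simps)
  have dJ: "distr lborel borel J = lborel"
    by (rule lborel_distr_isometry[OF lJ nJ, where 'n = 4]) simp_all
  have Jm[measurable]: "J \<in> borel_measurable borel" by (rule borel_measurable_linear[OF lJ])
  have gm[measurable]: "chart_gram \<in> borel_measurable borel"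
    unfolding chart_gram_def[abs_def] row1_def row2_def by (intro borel_measurable_continuous_onI continuous_intros)
  have gJ: "chart_gram (J (p, q)) = (1 + (norm p)\<^sup>2) + ((norm q)\<^sup>2 + (vec2 (- p$1) (p$0) \<bullet> q)\<^sup>2)" for p q
    unfolding norm_2' J_def chart_gram_def row1_def row2_def inner_4' inner_2' prod.case vec4_nth vec2_nth
    by (simp add: algebra_simps power2_eq_square)
  have inner: "(\<integral>\<^sup>+q. ennreal (1 / (chart_gram (J (p, q)))\<^sup>2) \<partial>lborel) = ennreal pi * ennreal ((1 + (norm p)\<^sup>2) powr (-3/2))" for p
  proof -
    define k where "k = 1 + (norm p)\<^sup>2"
    have k: "k > 0" by (simp add: k_def add_pos_nonneg)
    define G :: "real ^ 2 \<Rightarrow> ennreal" where "G y = ennreal (1 / (k + (norm y)\<^sup>2)\<^sup>2)" for y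
    have [measurable]: "G \<in> borel_measurable borel" unfolding G_def by measurable
    have nn: "1 + (norm (vec2 (- p$1) (p$0)))\<^sup>2 = k" by (simp add: norm_2' k_def)
    have "(\<integral>\<^sup>+q. ennreal (1 / (chart_gram (J (p, q)))\<^sup>2) \<partial>lborel) = (\<integral>\<^sup>+q. G (chol (vec2 (- p$1) (p$0)) *v q) \<partial>lborel)"
      by (simp add: gJ G_def norm_chol k_def)
    also have "\<dots> = ennreal (1 / sqrt k) * (\<integral>\<^sup>+q. G q \<partial>lborel)"
      by (subst nn_integral_chol) (simp_all add: nn)
    also have "(\<integral>\<^sup>+q. G q \<partial>lborel) = ennreal pi * ennreal (1 / k)"
      unfolding G_def using nn_integral_radial_2[of "\<lambda>t. ennreal (1 / (k + t)\<^sup>2)"] nn_integral_inverse_square[OF k] by simp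
    also have "ennreal (1 / sqrt k) * (ennreal pi * ennreal (1 / k)) = ennreal pi * ennreal (k powr (-3/2))"
    proof -
      have "k powr (-3/2) = 1 / (sqrt k * k)"
        using k powr_add[of k "1/2" 1] by (simp add: powr_minus_divide[of k "3/2"] powr_half_sqrt)
      then show ?thesis using k by (simp add: ennreal_mult[symmetric] mult.commute)
    qed
    finally show ?thesis unfolding k_def .
  qed
  have "(\<integral>\<^sup>+A. ennreal (1 / (chart_gram A)\<^sup>2) \<partial>lborel) = (\<integral>\<^sup>+A. ennreal (1 / (chart_gram A)\<^sup>2) \<partial>distr lborel borel J)"
    by (simp add: dJ)
  also have "\<dots> = (\<integral>\<^sup>+x. ennreal (1 / (chart_gram (J x))\<^sup>2) \<partial>(lborel \<Otimes>\<^sub>M lborel))"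
    by (simp add: nn_integral_distr lborel_prod)
  also have "\<dots> = (\<integral>\<^sup>+p. \<integral>\<^sup>+q. ennreal (1 / (chart_gram (J (p, q)))\<^sup>2) \<partial>lborel \<partial>lborel)"
    by (rule lborel.nn_integral_fst[symmetric]) (simp add: lborel_prod)
  also have "\<dots> = ennreal pi * (\<integral>\<^sup>+(p :: real ^ 2). ennreal ((1 + (norm p)\<^sup>2) powr (-3/2)) \<partial>lborel)"
    unfolding inner by (rule nn_integral_cmult) measurable
  also have "\<dots> = ennreal pi * (ennreal pi * 2)"
    using nn_integral_radial_2[of "\<lambda>t. ennreal ((1 + t) powr (-3/2))"] nn_integral_three_halves by simp
  also have "\<dots> = ennreal pi * (ennreal pi * ennreal 2)" by simp
  also have "\<dots> = ennreal (pi * (pi * 2))" by (simp only: ennreal_mult[symmetric] pi_ge_zero mult_nonneg_nonneg zero_le_numeral)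
  finally show ?thesis by (simp add: power2_eq_square mult_ac)
qed

lemma nn_integral_exp_square: "(\<integral>\<^sup>+(x :: real). ennreal (exp (- x\<^sup>2 / 2)) \<partial>lborel) = ennreal (sqrt (2 * pi))"
proof -
  have "(\<integral>\<^sup>+x. ennreal (std_normal_density x) \<partial>lborel) = 1"
    using nn_integral_eq_integral[of lborel std_normal_density] integrable_normal_density[of 1 0] integral_normal_density[of 1 0] by simp
  then have "ennreal (sqrt (2 * pi)) = ennreal (sqrt (2 * pi)) * (\<integral>\<^sup>+x. ennreal (std_normal_density x) \<partial>lborel)" by simp
  also have "\<dots> = (\<integral>\<^sup>+x. ennreal (sqrt (2 * pi)) * ennreal (std_normal_density x) \<partial>lborel)"
    by (rule nn_integral_cmult[symmetric]) measurable
  also have "\<dots> = (\<integral>\<^sup>+(x :: real). ennreal (exp (- x\<^sup>2 / 2)) \<partial>lborel)"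
    by (intro nn_integral_cong) (simp add: ennreal_mult[symmetric] std_normal_density_def)
  finally show ?thesis ..
qed

lemma nn_integral_abs_cube_exp: "(\<integral>\<^sup>+(x :: real). ennreal (\<bar>x\<bar> ^ 3 * exp (- x\<^sup>2 / 2)) \<partial>lborel) = 4"
proof -
  have "(\<integral>\<^sup>+x. ennreal (std_normal_density x * \<bar>x\<bar> ^ 3) \<partial>lborel) = ennreal (2 * sqrt (2 / pi))"
    using nn_integral_eq_integral[OF integrable_std_normal_moment_abs[of 3]] integral_std_normal_moment_abs_odd[of 1]
    by (simp add: eval_nat_numeral mult.commute)
  then have "ennreal (sqrt (2 * pi)) * ennreal (2 * sqrt (2 / pi)) = ennreal (sqrt (2 * pi)) * (\<integral>\<^sup>+x. ennreal (std_normal_density x * \<bar>x\<bar> ^ 3) \<partial>lborel)" by simp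
  also have "\<dots> = (\<integral>\<^sup>+x. ennreal (sqrt (2 * pi)) * ennreal (std_normal_density x * \<bar>x\<bar> ^ 3) \<partial>lborel)"
    by (rule nn_integral_cmult[symmetric]) measurable
  also have "\<dots> = (\<integral>\<^sup>+(x :: real). ennreal (\<bar>x\<bar> ^ 3 * exp (- x\<^sup>2 / 2)) \<partial>lborel)"
    by (intro nn_integral_cong) (simp add: ennreal_mult[symmetric] std_normal_density_def)
  also have "ennreal (sqrt (2 * pi)) * ennreal (2 * sqrt (2 / pi)) = 4"
  proof -
    have "sqrt (2 * pi) * sqrt (2 / pi) = 2" by (simp add: real_sqrt_mult[symmetric])
    then have 4: "sqrt (2 * pi) * (2 * sqrt (2 / pi)) = 4" by simp
    have "ennreal (sqrt (2 * pi)) * ennreal (2 * sqrt (2 / pi)) = ennreal (sqrt (2 * pi) * (2 * sqrt (2 / pi)))"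
      by (rule ennreal_mult[symmetric]) simp_all
    also have "\<dots> = 4" unfolding 4 by simp
    finally show ?thesis .
  qed
  finally show ?thesis ..
qed

lemma nn_integral_gaussian:
  "(\<integral>\<^sup>+(x :: 'a::euclidean_space). ennreal (exp (- (norm x)\<^sup>2 / 2)) \<partial>lborel) = ennreal (sqrt (2 * pi) ^ DIM('a))"
proof -
  have "(\<integral>\<^sup>+(x :: 'a). ennreal (exp (- (norm x)\<^sup>2 / 2)) \<partial>lborel) = (\<integral>\<^sup>+(x :: 'a). (\<Prod>b\<in>Basis. ennreal (exp (- (x \<bullet> b)\<^sup>2 / 2))) \<partial>lborel)"
  proof (rule nn_integral_cong)
    fix x :: 'a
    have "(norm x)\<^sup>2 = (\<Sum>b\<in>Basis. (x \<bullet> b)\<^sup>2)"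
      unfolding power2_norm_eq_inner by (subst euclidean_inner) (simp add: power2_eq_square)
    then have "exp (- (norm x)\<^sup>2 / 2) = (\<Prod>b\<in>Basis. exp (- (x \<bullet> b)\<^sup>2 / 2))"
      by (simp add: exp_sum[symmetric] sum_negf sum_divide_distrib)
    then show "ennreal (exp (- (norm x)\<^sup>2 / 2)) = (\<Prod>b\<in>Basis. ennreal (exp (- (x \<bullet> b)\<^sup>2 / 2)))"
      by (simp add: prod_ennreal)
  qed
  also have "\<dots> = (\<Prod>b\<in>(Basis :: 'a set). (\<integral>\<^sup>+x. ennreal (exp (- x\<^sup>2 / 2)) \<partial>lborel))"
    by (rule nn_integral_lborel_prod) auto
  also have "\<dots> = ennreal (sqrt (2 * pi) ^ DIM('a))"
    unfolding nn_integral_exp_square by (simp add: ennreal_power)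
  finally show ?thesis .
qed

text \<open>Halving the variable in Euler's integral gives
  \<open>2 powr (5/2) * Gamma (5/2)\<close>.\<close>

lemma nn_integral_cube_exp_half:
  "(\<integral>\<^sup>+t. ennreal (t powr (3/2) * exp (- t / 2)) * indicator {0..} t \<partial>lborel) = ennreal (3 * sqrt 2 * sqrt pi)"
proof -
  have "x \<notin> \<int>\<^sub>\<le>\<^sub>0" if "0 < x" for x :: real using that by (force dest: nonpos_Ints_nonpos)
  then have "(3/2 :: real) \<notin> \<int>\<^sub>\<le>\<^sub>0" "(1/2 :: real) \<notin> \<int>\<^sub>\<le>\<^sub>0" by simp_all
  then have G: "Gamma (5/2 :: real) = 3 / 4 * sqrt pi"
    using Gamma_plus1[of "3/2 :: real"] Gamma_plus1[of "1/2 :: real"] by (simp add: Gamma_one_half_real)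
  have pm: "ennreal (1/2 * (1/2) powr (3/2)) = ennreal (1/2) * ennreal ((1/2) powr (3/2))"
    by (rule ennreal_mult) simp_all
  have "ennreal (Gamma (5/2)) = (\<integral>\<^sup>+t. ennreal (indicator {0..} t * t powr (3/2) / exp t) \<partial>lborel)"
    using Gamma_conv_nn_integral_real[of "5/2"] by simp
  also have "\<dots> = ennreal (1/2) * (\<integral>\<^sup>+t. ennreal (indicator {0..} (0 + 1/2 * t) * (0 + 1/2 * t) powr (3/2) / exp (0 + 1/2 * t)) \<partial>lborel)"
    by (subst nn_integral_real_affine[where c = "1/2" and t = 0]) (simp_all)
  also have "(\<integral>\<^sup>+t. ennreal (indicator {0..} (0 + 1/2 * t) * (0 + 1/2 * t) powr (3/2) / exp (0 + 1/2 * t)) \<partial>lborel)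
     = (\<integral>\<^sup>+t. ennreal ((1/2) powr (3/2)) * (ennreal (t powr (3/2) * exp (- t / 2)) * indicator {0..} t) \<partial>lborel)"
    by (intro nn_integral_cong) (auto simp: indicator_def ennreal_mult[symmetric] powr_divide exp_minus field_simps)
  also have "\<dots> = ennreal ((1/2) powr (3/2)) * (\<integral>\<^sup>+t. ennreal (t powr (3/2) * exp (- t / 2)) * indicator {0..} t \<partial>lborel)"
    by (rule nn_integral_cmult) measurable
  finally have *: "ennreal (3 / 4 * sqrt pi) = ennreal (1/2 * (1/2) powr (3/2)) * (\<integral>\<^sup>+t. ennreal (t powr (3/2) * exp (- t / 2)) * indicator {0..} t \<partial>lborel)"
    (is "_ = _ * ?I") unfolding G pm mult.assoc .
  have p: "(1/2 :: real) powr (3/2) = 1 / (2 * sqrt 2)"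
    using powr_add[of "1/2 :: real" 1 "1/2"] by (simp add: powr_half_sqrt real_sqrt_divide)
  have "?I = ennreal (4 * sqrt 2) * (ennreal (1/2 * (1/2) powr (3/2)) * ?I)"
    unfolding p by (simp add: mult.assoc[symmetric] ennreal_mult[symmetric])
  also have "\<dots> = ennreal (4 * sqrt 2) * ennreal (3 / 4 * sqrt pi)" by (simp only: *[symmetric])
  also have "\<dots> = ennreal (3 * sqrt 2 * sqrt pi)" by (simp add: ennreal_mult[symmetric])
  finally show ?thesis .
qed

section \<open>The mean absolute resultant\<close>

definition crs :: "real ^ 2 \<Rightarrow> real ^ 2 \<Rightarrow> real" where "crs y z = y$0 * z$1 - y$1 * z$0"

lemma crs_matrix: "crs (T *v y) (T *v z) = det T * crs y z"
  by (simp add: crs_def matrix_vector_2' det_2' algebra_simps)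

lemma crs_measurable [measurable]: "(\<lambda>z. crs y z) \<in> borel_measurable borel" "(\<lambda>p. crs (fst p) (snd p)) \<in> borel_measurable borel"
  unfolding crs_def by (intro borel_measurable_continuous_onI continuous_intros)+

text \<open>Rotating \<open>z\<close> into the frame along \<open>y\<close> turns
  \<open>crs y z\<close> into \<open>norm y\<close> times a single coordinate, and the integral
  becomes a product of one-dimensional ones.\<close>

lemma nn_integral_crs_inner:
  "(\<integral>\<^sup>+z. ennreal (\<bar>crs y z\<bar> ^ 3 * exp (- (norm z)\<^sup>2 / 2)) \<partial>lborel) = ennreal (4 * sqrt (2 * pi) * norm y ^ 3)"
proof (cases "y = 0")
  case True
  then show ?thesis by (simp add: crs_def)
next
  case False
  then have n: "norm y > 0" by simp
  have n2: "(y$0)\<^sup>2 + (y$1)\<^sup>2 = (norm y)\<^sup>2" by (simp add: norm_2')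
  define R :: "real ^ 2 ^ 2" where "R = (\<chi> i. if i = 0 then vec2 (y$0 / norm y) (- y$1 / norm y) else vec2 (y$1 / norm y) (y$0 / norm y))"
  have dR: "det R = 1"
    using n2 n by (simp add: R_def det_2' power2_eq_square add_divide_distrib[symmetric])
  have cR: "crs y (R *v z) = norm y * z$1" for z
  proof -
    have "crs y (R *v z) = ((y$0)\<^sup>2 + (y$1)\<^sup>2) / norm y * z$1"
      by (simp add: crs_def R_def matrix_vector_2' power2_eq_square algebra_simps add_divide_distrib)
    then show ?thesis using n unfolding n2 by (simp add: power2_eq_square)
  qed
  have nR: "(norm (R *v z))\<^sup>2 = (z$0)\<^sup>2 + (z$1)\<^sup>2" for z
  proof -
    have "(norm (R *v z))\<^sup>2 = ((y$0)\<^sup>2 + (y$1)\<^sup>2) / (norm y)\<^sup>2 * ((z$0)\<^sup>2 + (z$1)\<^sup>2)"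
    proof -
      have id: "(a / d * u + - b / d * v)\<^sup>2 + (b / d * u + a / d * v)\<^sup>2 = (a\<^sup>2 + b\<^sup>2) / d\<^sup>2 * (u\<^sup>2 + v\<^sup>2)"
        if "d > 0" for a b u v d :: real
        using that by (simp add: field_simps power2_eq_square)
      show ?thesis unfolding norm_2'[of "R *v z"] using id[OF n, of "y$0" "z$0" "y$1" "z$1"]
        by (simp add: R_def matrix_vector_2')
    qed
    then show ?thesis using n by (simp add: n2)
  qed
  have "(\<integral>\<^sup>+z. ennreal (\<bar>crs y z\<bar> ^ 3 * exp (- (norm z)\<^sup>2 / 2)) \<partial>lborel)
      = (\<integral>\<^sup>+z. ennreal (\<bar>crs y (R *v z)\<bar> ^ 3 * exp (- (norm (R *v z))\<^sup>2 / 2)) \<partial>lborel)"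
    by (subst nn_integral_linear_change[of R]) (simp_all add: dR)
  also have "\<dots> = (\<integral>\<^sup>+(z :: real ^ 2). ennreal (norm y ^ 3) * (\<Prod>b\<in>Basis. ennreal ((if b = axis 1 1 then \<bar>z \<bullet> b\<bar> ^ 3 else 1) * exp (- (z \<bullet> b)\<^sup>2 / 2))) \<partial>lborel)"
  proof (rule nn_integral_cong)
    fix z :: "real ^ 2"
    have B: "(Basis :: (real ^ 2) set) = {axis 0 1, axis 1 1}" by (auto simp: Basis_vec_def UNIV_2')
    have "\<bar>crs y (R *v z)\<bar> ^ 3 * exp (- (norm (R *v z))\<^sup>2 / 2) = norm y ^ 3 * (exp (- (z$0)\<^sup>2 / 2) * (\<bar>z$1\<bar> ^ 3 * exp (- (z$1)\<^sup>2 / 2)))"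
      unfolding cR nR by (simp add: abs_mult power_mult_distrib exp_add[symmetric] diff_divide_distrib add_divide_distrib)
    then show "ennreal (\<bar>crs y (R *v z)\<bar> ^ 3 * exp (- (norm (R *v z))\<^sup>2 / 2)) =
       ennreal (norm y ^ 3) * (\<Prod>b\<in>Basis. ennreal ((if b = axis 1 1 then \<bar>z \<bullet> b\<bar> ^ 3 else 1) * exp (- (z \<bullet> b)\<^sup>2 / 2)))"
      unfolding B by (simp add: axis_eq_axis inner_axis ennreal_mult[symmetric])
  qed
  also have "\<dots> = ennreal (norm y ^ 3) * (\<integral>\<^sup>+z. (\<Prod>b\<in>Basis. ennreal ((if b = axis 1 1 then \<bar>z \<bullet> b\<bar> ^ 3 else 1) * exp (- (z \<bullet> b)\<^sup>2 / 2))) \<partial>(lborel :: (real ^ 2) measure))"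
    by (rule nn_integral_cmult) measurable
  also have "(\<integral>\<^sup>+z. (\<Prod>b\<in>Basis. ennreal ((if b = axis 1 1 then \<bar>z \<bullet> b\<bar> ^ 3 else 1) * exp (- (z \<bullet> b)\<^sup>2 / 2))) \<partial>(lborel :: (real ^ 2) measure))
     = (\<Prod>b\<in>(Basis :: (real ^ 2) set). (\<integral>\<^sup>+x. ennreal ((if b = axis 1 1 then \<bar>x\<bar> ^ 3 else 1) * exp (- x\<^sup>2 / 2)) \<partial>lborel))"
    by (rule nn_integral_lborel_prod) auto
  also have "\<dots> = ennreal (sqrt (2 * pi)) * 4"
  proof -
    have B: "(Basis :: (real ^ 2) set) = {axis 0 1, axis 1 1}" by (auto simp: Basis_vec_def UNIV_2')
    show ?thesis unfolding B by (simp add: axis_eq_axis nn_integral_exp_square[simplified] nn_integral_abs_cube_exp[simplified])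
  qed
  also have "ennreal (norm y ^ 3) * (ennreal (sqrt (2 * pi)) * 4) = ennreal (4 * sqrt (2 * pi) * norm y ^ 3)"
  proof -
    have "ennreal (norm y ^ 3) * (ennreal (sqrt (2 * pi)) * ennreal 4) = ennreal (norm y ^ 3 * (sqrt (2 * pi) * 4))"
      by (subst ennreal_mult, simp, simp)+ simp
    then show ?thesis by (simp add: mult_ac)
  qed
  finally show ?thesis .
qed

lemma nn_integral_crs:
  "(\<integral>\<^sup>+y. \<integral>\<^sup>+z. ennreal (\<bar>crs y z\<bar> ^ 3 * exp (- ((norm y)\<^sup>2 + (norm z)\<^sup>2) / 2)) \<partial>lborel \<partial>lborel) = ennreal (24 * pi\<^sup>2)"
proof -
  have "(\<integral>\<^sup>+z. ennreal (\<bar>crs y z\<bar> ^ 3 * exp (- ((norm y)\<^sup>2 + (norm z)\<^sup>2) / 2)) \<partial>lborel)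
     = ennreal (4 * sqrt (2 * pi)) * ennreal (((norm y)\<^sup>2) powr (3/2) * exp (- (norm y)\<^sup>2 / 2))" for y
  proof -
    have "\<bar>crs y z\<bar> ^ 3 * exp (- ((norm y)\<^sup>2 + (norm z)\<^sup>2) / 2) = exp (- (norm y)\<^sup>2 / 2) * (\<bar>crs y z\<bar> ^ 3 * exp (- (norm z)\<^sup>2 / 2))" for z
      by (simp add: exp_add[symmetric] diff_divide_distrib add_divide_distrib)
    then have "ennreal (\<bar>crs y z\<bar> ^ 3 * exp (- ((norm y)\<^sup>2 + (norm z)\<^sup>2) / 2))
      = ennreal (exp (- (norm y)\<^sup>2 / 2)) * ennreal (\<bar>crs y z\<bar> ^ 3 * exp (- (norm z)\<^sup>2 / 2))" for z
      by (simp only:) (rule ennreal_mult, simp_all)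
    then have "(\<integral>\<^sup>+z. ennreal (\<bar>crs y z\<bar> ^ 3 * exp (- ((norm y)\<^sup>2 + (norm z)\<^sup>2) / 2)) \<partial>lborel)
      = (\<integral>\<^sup>+z. ennreal (exp (- (norm y)\<^sup>2 / 2)) * ennreal (\<bar>crs y z\<bar> ^ 3 * exp (- (norm z)\<^sup>2 / 2)) \<partial>lborel)"
      by (simp only:)
    also have "\<dots> = ennreal (exp (- (norm y)\<^sup>2 / 2)) * ennreal (4 * sqrt (2 * pi) * norm y ^ 3)"
      unfolding nn_integral_crs_inner[symmetric] by (rule nn_integral_cmult) measurable
    also have "norm y ^ 3 = ((norm y)\<^sup>2) powr (3/2)"
    proof (cases "y = 0")
      case False
      then have "((norm y)\<^sup>2) powr (3/2) = (norm y powr 2) powr (3/2)" by simp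
      also have "\<dots> = norm y powr 3" by (subst powr_powr) simp
      finally show ?thesis using False by simp
    qed simp
    finally show ?thesis by (simp add: ennreal_mult[symmetric] mult_ac)
  qed
  then have "(\<integral>\<^sup>+y. \<integral>\<^sup>+z. ennreal (\<bar>crs y z\<bar> ^ 3 * exp (- ((norm y)\<^sup>2 + (norm z)\<^sup>2) / 2)) \<partial>lborel \<partial>lborel)
    = ennreal (4 * sqrt (2 * pi)) * (\<integral>\<^sup>+(y :: real ^ 2). ennreal (((norm y)\<^sup>2) powr (3/2) * exp (- (norm y)\<^sup>2 / 2)) \<partial>lborel)"
    by (simp add: nn_integral_cmult)
  also have "\<dots> = ennreal (4 * sqrt (2 * pi)) * (ennreal pi * ennreal (3 * sqrt 2 * sqrt pi))"
    using nn_integral_radial_2[of "\<lambda>t. ennreal (t powr (3/2) * exp (- t / 2))"] nn_integral_cube_exp_half by simp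
  also have "\<dots> = ennreal ((4 * sqrt (2 * pi)) * (pi * (3 * sqrt 2 * sqrt pi)))"
    by (subst ennreal_mult, simp, simp)+ simp
  also have "(4 * sqrt (2 * pi)) * (pi * (3 * sqrt 2 * sqrt pi)) = 24 * pi\<^sup>2"
    by (simp add: real_sqrt_mult power2_eq_square) 
  finally show ?thesis .
qed

text \<open>\<open>G\<close> is an antiderivative of the integrand without the absolute value, which
  changes sign at \<open>t0\<close>. The square root in the final formula is
  \<open>(1 + t0) powr (-1/2)\<close>.\<close>

lemma nn_integral_abs_linear_powr:
  assumes \<alpha>: "\<alpha> > 0" and \<beta>: "\<beta> > 0"
  shows "(\<integral>\<^sup>+t. ennreal (\<bar>\<alpha> * t - \<beta>\<bar> * (1 + t) powr (-5/2)) * indicator {0..} t \<partial>lborel)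
    = ennreal ((8 * \<alpha> * sqrt (\<alpha> / (\<alpha> + \<beta>)) + 2 * \<beta> - 4 * \<alpha>) / 3)"
proof -
  define G where "G t = - 2 * \<alpha> * (1 + t) powr (-1/2) + 2/3 * (\<alpha> + \<beta>) * (1 + t) powr (-3/2)" for t
  define f where "f t = (\<alpha> * t - \<beta>) * (1 + t) powr (-5/2)" for t
  define t0 where "t0 = \<beta> / \<alpha>"
  have t0: "t0 > 0" "\<alpha> * t0 = \<beta>" using \<alpha> \<beta> by (simp_all add: t0_def)
  have deriv: "(G has_real_derivative f t) (at t)" if "t \<ge> 0" for t
  proof -
    have "(1 + t) powr (-3/2) = (1 + t) * (1 + t) powr (-5/2)"
      using that powr_add[of "1 + t" 1 "-5/2"] by simp
    moreover have "(G has_real_derivative \<alpha> * (1 + t) powr (-3/2) - (\<alpha> + \<beta>) * (1 + t) powr (-5/2)) (at t)"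
      unfolding G_def using that by (auto intro!: derivative_eq_intros)
    ultimately show ?thesis by (simp add: f_def algebra_simps)
  qed
  have [measurable]: "f \<in> borel_measurable borel" unfolding f_def by measurable
  have lim: "(G \<longlongrightarrow> 0) at_top" unfolding G_def by real_asymp
  have sgn1: "f t \<le> 0" if "t \<le> t0" for t
  proof -
    have "\<alpha> * t \<le> \<beta>" using that t0(2) \<alpha> mult_left_mono[of t t0 \<alpha>] by simp
    then show ?thesis by (simp add: f_def mult_nonpos_nonneg)
  qed
  have sgn2: "f t \<ge> 0" if "t \<ge> t0" for t
  proof -
    have "\<alpha> * t \<ge> \<beta>" using that t0(2) \<alpha> mult_left_mono[of t0 t \<alpha>] by simp
    then show ?thesis by (simp add: f_def)
  qed
  have abs_f: "\<bar>\<alpha> * t - \<beta>\<bar> * (1 + t) powr (-5/2) = \<bar>f t\<bar>" for t by (simp add: f_def abs_mult)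
  \<comment> \<open>Both intervals contain \<open>t0\<close>, where \<open>f\<close>
    vanishes.\<close>
  have split: "ennreal \<bar>f t\<bar> * indicator {0..} t = ennreal (- f t) * indicator {0..t0} t + ennreal (f t) * indicator {t0..} t" for t
  proof -
    consider "t < 0" | "0 \<le> t" "t < t0" | "t = t0" | "t > t0" by linarith
    then show ?thesis
    proof cases
      case 1 then show ?thesis using t0(1) by simp
    next
      case 2 then show ?thesis using sgn1[of t] by simp
    next
      case 3
      then have "f t = 0" using sgn1[of t] sgn2[of t] by simp
      then show ?thesis by simp
    next
      case 4 then show ?thesis using sgn2[of t] t0(1) by simp
    qed
  qed
  have i1: "(\<integral>\<^sup>+t. ennreal (- f t) * indicator {0..t0} t \<partial>lborel) = ennreal (- G t0 - (- G 0))"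
    by (rule nn_integral_FTC_Icc) (use t0 sgn1 DERIV_minus[OF deriv] in auto)
  have i2: "(\<integral>\<^sup>+t. ennreal (f t) * indicator {t0..} t \<partial>lborel) = ennreal (0 - G t0)"
    by (rule nn_integral_FTC_atLeast) (use deriv lim sgn2 t0 in auto)
  define z where "z = sqrt (\<alpha> / (\<alpha> + \<beta>))"
  have Gt0: "G t0 = - (4/3) * \<alpha> * z"
  proof -
    have o: "1 + t0 = (\<alpha> + \<beta>) / \<alpha>" using \<alpha> by (simp add: t0_def field_simps)
    have op: "1 + t0 > 0" using t0 by simp
    have p1: "(1 + t0) powr (-1/2) = z"
    proof -
      have "(1 + t0) powr (-1/2) = 1 / sqrt (1 + t0)"
        using op by (simp add: powr_minus_divide[of _ "1/2"] powr_half_sqrt)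
      also have "\<dots> = z" unfolding o z_def by (simp add: real_sqrt_divide)
      finally show ?thesis .
    qed
    have p3: "(1 + t0) powr (-3/2) = z / (1 + t0)"
    proof -
      have "(1 + t0) powr (-3/2) = (1 + t0) powr (-1/2) * (1 + t0) powr (-1)"
        by (subst powr_add[symmetric]) simp
      also have "(1 + t0) powr (-1) = 1 / (1 + t0)" using op by (simp add: powr_minus_divide)
      finally show ?thesis unfolding p1 by simp
    qed
    have q: "(\<alpha> + \<beta>) * (z / (1 + t0)) = \<alpha> * z" unfolding o using \<alpha> \<beta> by (simp add: field_simps)
    show ?thesis unfolding G_def p1 p3 mult.assoc q by simp
  qed
  have G0: "G 0 = - 2 * \<alpha> + 2/3 * (\<alpha> + \<beta>)" by (simp add: G_def)
  have "z \<ge> 0" using \<alpha> \<beta> by (simp add: z_def)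
  have n1: "0 \<le> - G t0 - (- G 0)" 
  proof -
    have "G t0 \<le> G 0"
      by (rule DERIV_nonpos_imp_nonincreasing[of 0 t0 G]) (use t0 deriv sgn1 in \<open>auto intro: less_imp_le\<close>)
    then show ?thesis by simp
  qed
  have n2: "0 \<le> 0 - G t0" unfolding Gt0 using \<alpha> \<open>z \<ge> 0\<close> by simp
  have "(\<integral>\<^sup>+t. ennreal (\<bar>\<alpha> * t - \<beta>\<bar> * (1 + t) powr (-5/2)) * indicator {0..} t \<partial>lborel)
     = ennreal (- G t0 - (- G 0)) + ennreal (0 - G t0)"
    unfolding abs_f split by (subst nn_integral_add) (simp_all add: i1 i2)
  also have "\<dots> = ennreal ((- G t0 - (- G 0)) + (0 - G t0))"
    using n1 n2 by (rule ennreal_plus[symmetric])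
  also have "(- G t0 - (- G 0)) + (0 - G t0) = (8 * \<alpha> * z + 2 * \<beta> - 4 * \<alpha>) / 3"
    unfolding Gt0 G0 by (simp add: field_simps)
  finally show ?thesis unfolding z_def .
qed

text \<open>The substitution \<open>chol n\<close> is applied to \<open>y\<close> and to
  \<open>z\<close>. With \<open>w\<close> its determinant, each Jacobian gives a factor
  \<open>1 / w\<close> and the cube of \<open>crs\<close> a factor \<open>1 / w^3\<close>, in total
  \<open>1 / w^5\<close>.\<close>

lemma nn_integral_crs_chol:
  "(\<integral>\<^sup>+y. \<integral>\<^sup>+z. ennreal (\<bar>crs y z\<bar> ^ 3 * exp (- ((norm y)\<^sup>2 + (n \<bullet> y)\<^sup>2 + ((norm z)\<^sup>2 + (n \<bullet> z)\<^sup>2)) / 2)) \<partial>lborel \<partial>lborel)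
     = ennreal (24 * pi\<^sup>2 * (1 + (norm n)\<^sup>2) powr (-5/2))"
proof -
  define w where "w = sqrt (1 + (norm n)\<^sup>2)"
  have w: "w > 0" by (simp add: w_def add_pos_nonneg)
  define G where "G y z = ennreal (\<bar>crs y z\<bar> ^ 3 * exp (- ((norm y)\<^sup>2 + (norm z)\<^sup>2) / 2))" for y z
  have Gm[measurable]: "(\<lambda>z. G y z) \<in> borel_measurable borel" for y unfolding G_def by measurable
  have Gm2: "(\<lambda>(y, z). G y z) \<in> borel_measurable (borel \<Otimes>\<^sub>M borel)"
    unfolding G_def case_prod_beta' borel_prod crs_def
    by (rule measurable_compose[OF _ measurable_ennreal], rule borel_measurable_continuous_onI) (auto intro!: continuous_intros)
  have [measurable]: "(\<lambda>y. \<integral>\<^sup>+z. G y z \<partial>lborel) \<in> borel_measurable borel"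
    using lborel.borel_measurable_nn_integral[of "\<lambda>y z. G y z" borel] Gm2 by simp
  have "ennreal (\<bar>crs y z\<bar> ^ 3 * exp (- ((norm y)\<^sup>2 + (n \<bullet> y)\<^sup>2 + ((norm z)\<^sup>2 + (n \<bullet> z)\<^sup>2)) / 2))
     = ennreal (1 / w ^ 3) * G (chol n *v y) (chol n *v z)" for y z
  proof -
    have "\<bar>crs (chol n *v y) (chol n *v z)\<bar> ^ 3 = w ^ 3 * \<bar>crs y z\<bar> ^ 3"
      unfolding crs_matrix det_chol w_def[symmetric] using w by (simp add: abs_mult power_mult_distrib)
    then show ?thesis using w by (simp add: G_def norm_chol ennreal_mult[symmetric])
  qed
  then have "(\<integral>\<^sup>+y. \<integral>\<^sup>+z. ennreal (\<bar>crs y z\<bar> ^ 3 * exp (- ((norm y)\<^sup>2 + (n \<bullet> y)\<^sup>2 + ((norm z)\<^sup>2 + (n \<bullet> z)\<^sup>2)) / 2)) \<partial>lborel \<partial>lborel)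
    = (\<integral>\<^sup>+y. \<integral>\<^sup>+z. ennreal (1 / w ^ 3) * G (chol n *v y) (chol n *v z) \<partial>lborel \<partial>lborel)" by simp
  also have "\<dots> = (\<integral>\<^sup>+y. ennreal (1 / w ^ 3) * (ennreal (1 / w) * (\<integral>\<^sup>+z. G (chol n *v y) z \<partial>lborel)) \<partial>lborel)"
  proof (rule nn_integral_cong)
    fix y
    have m: "(\<lambda>z. chol n *v z) \<in> borel_measurable borel" by (rule borel_measurable_linear) (rule matrix_vector_mul_linear)
    have "(\<integral>\<^sup>+z. ennreal (1 / w ^ 3) * G (chol n *v y) (chol n *v z) \<partial>lborel) = ennreal (1 / w ^ 3) * (\<integral>\<^sup>+z. G (chol n *v y) (chol n *v z) \<partial>lborel)"
      using measurable_compose[OF m Gm] by (intro nn_integral_cmult) simp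
    then show "(\<integral>\<^sup>+z. ennreal (1 / w ^ 3) * G (chol n *v y) (chol n *v z) \<partial>lborel)
      = ennreal (1 / w ^ 3) * (ennreal (1 / w) * (\<integral>\<^sup>+z. G (chol n *v y) z \<partial>lborel))"
      by (simp add: nn_integral_chol[OF Gm] w_def)
  qed
  also have "\<dots> = ennreal (1 / w ^ 3) * (ennreal (1 / w) * (ennreal (1 / w) * (\<integral>\<^sup>+y. \<integral>\<^sup>+z. G y z \<partial>lborel \<partial>lborel)))"
  proof -
    define H where "H y = (\<integral>\<^sup>+z. G y z \<partial>lborel)" for y
    have Hm: "H \<in> borel_measurable borel" unfolding H_def by measurable
    have m: "(\<lambda>z. chol n *v z) \<in> borel_measurable borel" by (rule borel_measurable_linear) (rule matrix_vector_mul_linear)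
    have Hc[measurable]: "(\<lambda>y. H (chol n *v y)) \<in> borel_measurable borel" by (rule measurable_compose[OF m Hm])
    have "(\<integral>\<^sup>+y. ennreal (1 / w ^ 3) * (ennreal (1 / w) * H (chol n *v y)) \<partial>lborel)
      = ennreal (1 / w ^ 3) * (ennreal (1 / w) * (\<integral>\<^sup>+y. H (chol n *v y) \<partial>lborel))"
      by (simp add: nn_integral_cmult)
    also have "(\<integral>\<^sup>+y. H (chol n *v y) \<partial>lborel) = ennreal (1 / w) * (\<integral>\<^sup>+y. H y \<partial>lborel)"
      unfolding w_def by (rule nn_integral_chol[OF Hm])
    finally show ?thesis unfolding H_def .
  qed
  also have "(\<integral>\<^sup>+y. \<integral>\<^sup>+z. G y z \<partial>lborel \<partial>lborel) = ennreal (24 * pi\<^sup>2)"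
    unfolding G_def by (rule nn_integral_crs)
  also have "ennreal (1 / w ^ 3) * (ennreal (1 / w) * (ennreal (1 / w) * ennreal (24 * pi\<^sup>2)))
     = ennreal (1 / w ^ 3 * (1 / w * (1 / w * (24 * pi\<^sup>2))))"
    using w by (simp only: ennreal_mult[symmetric] mult_nonneg_nonneg divide_nonneg_nonneg zero_le_power less_imp_le zero_le_one zero_le_numeral pi_ge_zero)
  also have "1 / w ^ 3 * (1 / w * (1 / w * (24 * pi\<^sup>2))) = 24 * pi\<^sup>2 * (1 + (norm n)\<^sup>2) powr (-5/2)"
  proof -
    have "(1 + (norm n)\<^sup>2) powr (-5/2) = (w powr 2) powr (-5/2)"
      using w by (simp add: w_def add_nonneg_nonneg)
    also have "\<dots> = w powr (-5)" unfolding powr_powr by simp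
    also have "\<dots> = 1 / w ^ 5" using w by (simp add: powr_minus_divide)
    finally show ?thesis by (simp add: eval_nat_numeral)
  qed
  finally show ?thesis .
qed

text \<open>For every nonzero \<open>y\<close> the exceptional \<open>z\<close> form a line.\<close>

lemma AE_crs_nonzero: "AE p in (lborel :: ((real ^ 2) \<times> (real ^ 2)) measure). crs (fst p) (snd p) \<noteq> 0"
proof -
  have "AE p in (lborel \<Otimes>\<^sub>M lborel :: ((real ^ 2) \<times> (real ^ 2)) measure). crs (fst p) (snd p) \<noteq> 0"
  proof (rule lborel_pair.AE_pair_measure)
    have "open {p. crs (fst p) (snd p) \<noteq> 0}"
      unfolding crs_def by (intro open_Collect_neq continuous_intros)
    then show "{p \<in> space (lborel \<Otimes>\<^sub>M lborel). crs (fst p) (snd p) \<noteq> 0} \<in> sets (lborel \<Otimes>\<^sub>M lborel)"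
      unfolding lborel_prod space_lborel sets_lborel space_borel by simp
    show "AE y in lborel. AE z in lborel. crs (fst (y, z)) (snd (y, z)) \<noteq> 0"
    proof (rule AE_mp[OF AE_lborel_singleton[of 0]], rule AE_I2, rule impI)
      fix y :: "real ^ 2" assume "y \<noteq> 0"
      then have ne: "vec2 (- y$1) (y$0) \<noteq> 0" by (auto simp: vec_eq_iff forall_2')
      have eq: "{z. crs y z = 0} = {z. vec2 (- y$1) (y$0) \<bullet> z = 0}"
        by (auto simp: crs_def inner_2' algebra_simps)
      have "negligible {z. crs y z = 0}" unfolding eq using ne by (intro negligible_hyperplane) simp
      moreover have "{z. crs y z = 0} \<in> sets borel" unfolding eq by (simp add: closed_hyperplane borel_closed)
      ultimately have "{z. crs y z = 0} \<in> null_sets lborel"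
        by (simp add: negligible_iff_null_sets null_sets_completion_iff)
      then show "AE z in lborel. crs (fst (y, z)) (snd (y, z)) \<noteq> 0"
        by (rule AE_I') auto
    qed
  qed
  then show ?thesis unfolding lborel_prod .
qed

context feature_map
begin

text \<open>As vectors of \<real>^3, the coefficient triples \<open>(- (h \<bullet> y), y)\<close>
  and \<open>(- (h \<bullet> z), z)\<close> are both orthogonal to \<open>(1, h)\<close>, so their
  vector product is \<open>crs y z\<close> times \<open>(1, h)\<close>. The resultant is a quadratic
  form in this product, and its sign depends on the length of \<open>h\<close> only.\<close>

lemma res_substitution:
  "res ((vec2 (- (h \<bullet> y)) (- (h \<bullet> z)), y, z), w) = 4 * s\<^sup>2 * (crs y z)\<^sup>2 * (a\<^sup>2 * (norm h)\<^sup>2 - s\<^sup>2)"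
  unfolding res_def crs_def norm_2' inner_2' Let_def prod.case vec2_nth
  by (simp add: algebra_simps power2_eq_square)

lemma res_no_w: "res (V, w) = res (V, 0)"
  by (simp add: res_def split: prod.splits)

text \<open>The ten coordinates absent from \<open>res\<close> integrate to
  \<open>(2 * pi) ^ 5\<close>. For fixed independent \<open>y\<close> and \<open>z\<close>, the
  first pair is replaced by \<open>T *v n\<close> with Jacobian \<open>\<bar>crs y z\<bar>\<close>,
  which brings in \<open>res_substitution\<close>. Exchanging the integrals leaves
  \<open>nn_integral_crs_chol\<close> for \<open>(y, z)\<close> and a radial integral in
  \<open>n\<close>.\<close>

lemma res_integral_value:
  assumes a: "a > 0" and s: "s > 0"
  shows "res_integral (\<lambda>\<eta>. exp (- (norm \<eta>)\<^sup>2 / 2)) =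
    ennreal ((2 * pi) ^ 5 * (32 * pi ^ 3 * s\<^sup>2 * (8 * a\<^sup>2 * sqrt (a\<^sup>2 / (a\<^sup>2 + s\<^sup>2)) + 2 * s\<^sup>2 - 4 * a\<^sup>2)))"
proof -
  define f where "f V = ennreal (\<bar>res (V, 0)\<bar> * exp (- (norm V)\<^sup>2 / 2))" for V
  have rm: "(\<lambda>V. res (V, 0)) \<in> borel_measurable borel"
  proof -
    have "(\<lambda>V :: (real ^ 2) \<times> (real ^ 2) \<times> (real ^ 2). (V, 0 :: (real ^ 2) \<times> (real ^ 2) \<times> (real ^ 2) \<times> (real ^ 2) \<times> (real ^ 2))) \<in> borel_measurable borel"
      by (intro borel_measurable_continuous_onI continuous_intros)
    from measurable_compose[OF this res_measurable] show ?thesis .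
  qed
  have fm[measurable]: "f \<in> borel_measurable borel" unfolding f_def using rm by measurable
  have "res_integral (\<lambda>\<eta>. exp (- (norm \<eta>)\<^sup>2 / 2)) = (\<integral>\<^sup>+(v :: coeffs). f (fst v) * ennreal (exp (- (norm (snd v))\<^sup>2 / 2)) \<partial>(lborel \<Otimes>\<^sub>M lborel))"
    unfolding res_integral_def lborel_prod
  proof (rule nn_integral_cong)
    fix v :: coeffs
    obtain V w where v: "v = (V, w)" by (metis surj_pair)
    have "norm (0 :: real ^ 4, v) ^ 2 = (norm V)\<^sup>2 + (norm w)\<^sup>2" by (simp add: v norm_Pair)
    then show "ennreal (\<bar>res v\<bar> * exp (- (norm (0 :: real ^ 4, v))\<^sup>2 / 2)) = f (fst v) * ennreal (exp (- (norm (snd v))\<^sup>2 / 2))"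
      unfolding v f_def using res_no_w[of V w]
      by (simp add: ennreal_mult[symmetric] mult.assoc exp_add[symmetric] diff_divide_distrib add_divide_distrib)
  qed
  also have "\<dots> = (\<integral>\<^sup>+V. \<integral>\<^sup>+(w :: (real ^ 2) \<times> (real ^ 2) \<times> (real ^ 2) \<times> (real ^ 2) \<times> (real ^ 2)). f (fst (V, w)) * ennreal (exp (- (norm (snd (V, w)))\<^sup>2 / 2)) \<partial>lborel \<partial>lborel)"
  proof (rule lborel.nn_integral_fst[symmetric])
    show "(\<lambda>v :: coeffs. f (fst v) * ennreal (exp (- (norm (snd v))\<^sup>2 / 2))) \<in> borel_measurable (lborel \<Otimes>\<^sub>M lborel)" by measurable
  qed
  also have "\<dots> = (\<integral>\<^sup>+V. f V * ennreal ((2 * pi) ^ 5) \<partial>lborel)"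
  proof (rule nn_integral_cong)
    fix V
    have e: "(sqrt (2 * pi)) ^ 10 = (2 * pi) ^ 5"
      using power_mult[of "sqrt (2 * pi)" 2 5] by simp
    have "(\<integral>\<^sup>+w. ennreal (exp (- (norm (w :: (real ^ 2) \<times> (real ^ 2) \<times> (real ^ 2) \<times> (real ^ 2) \<times> (real ^ 2)))\<^sup>2 / 2)) \<partial>lborel) = ennreal ((2 * pi) ^ 5)"
      unfolding nn_integral_gaussian by (simp add: e)
    then show "(\<integral>\<^sup>+w. f (fst (V, w :: (real ^ 2) \<times> (real ^ 2) \<times> (real ^ 2) \<times> (real ^ 2) \<times> (real ^ 2))) * ennreal (exp (- (norm (snd (V, w)))\<^sup>2 / 2)) \<partial>lborel) = f V * ennreal ((2 * pi) ^ 5)"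
      by (simp add: nn_integral_cmult)
  qed
  also have "\<dots> = (\<integral>\<^sup>+V. f V \<partial>lborel) * ennreal ((2 * pi) ^ 5)"
    by (rule nn_integral_multc) measurable
  also have "(\<integral>\<^sup>+V. f V \<partial>lborel) = (\<integral>\<^sup>+V. f V \<partial>(lborel \<Otimes>\<^sub>M lborel))" by (simp add: lborel_prod)
  also have "\<dots> = (\<integral>\<^sup>+p. \<integral>\<^sup>+x. f (x, p) \<partial>lborel \<partial>lborel)"
    by (rule lborel_pair.nn_integral_snd[symmetric]) (simp add: lborel_prod)
  also have "\<dots> = (\<integral>\<^sup>+p. \<integral>\<^sup>+n. ennreal (4 * s\<^sup>2 * \<bar>a\<^sup>2 * (norm n)\<^sup>2 - s\<^sup>2\<bar>) *
      ennreal (\<bar>crs (fst p) (snd p)\<bar> ^ 3 * exp (- ((norm (fst p))\<^sup>2 + (n \<bullet> fst p)\<^sup>2 + ((norm (snd p))\<^sup>2 + (n \<bullet> snd p)\<^sup>2)) / 2)) \<partial>lborel \<partial>lborel)"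
  proof (rule nn_integral_cong_AE, rule AE_mp[OF AE_crs_nonzero], rule AE_I2, rule impI)
    fix p :: "(real ^ 2) \<times> (real ^ 2)" assume nz: "crs (fst p) (snd p) \<noteq> 0"
    obtain y z where p: "p = (y, z)" by (metis surj_pair)
    define T :: "real ^ 2 ^ 2" where "T = (\<chi> i. if i = 0 then - y else - z)"
    have dT: "det T = crs y z" by (simp add: T_def det_2' crs_def algebra_simps)
    have Tn: "T *v n = vec2 (- (n \<bullet> y)) (- (n \<bullet> z))" for n
      by (simp add: T_def matrix_vector_2' inner_2' vec_eq_iff forall_2' algebra_simps)
    have [measurable]: "(\<lambda>x. (x, p)) \<in> borel_measurable borel" by (intro borel_measurable_continuous_onI continuous_intros)
    have fpm: "(\<lambda>x. f (x, p)) \<in> borel_measurable borel" by measurable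
    have Tm: "(\<lambda>n. T *v n) \<in> borel_measurable borel" by (rule borel_measurable_linear) (rule matrix_vector_mul_linear)
    have "(\<integral>\<^sup>+x. f (x, p) \<partial>lborel) = ennreal \<bar>crs y z\<bar> * (\<integral>\<^sup>+n. f (T *v n, p) \<partial>lborel)"
      using nn_integral_linear_change[of T "\<lambda>x. f (x, p)"] nz fpm by (simp add: dT p)
    also have "\<dots> = (\<integral>\<^sup>+n. ennreal \<bar>crs y z\<bar> * f (T *v n, p) \<partial>lborel)"
      using measurable_compose[OF Tm fpm] by (intro nn_integral_cmult[symmetric]) simp
    also have "\<dots> = (\<integral>\<^sup>+n. ennreal (4 * s\<^sup>2 * \<bar>a\<^sup>2 * (norm n)\<^sup>2 - s\<^sup>2\<bar>) *
      ennreal (\<bar>crs (fst p) (snd p)\<bar> ^ 3 * exp (- ((norm (fst p))\<^sup>2 + (n \<bullet> fst p)\<^sup>2 + ((norm (snd p))\<^sup>2 + (n \<bullet> snd p)\<^sup>2)) / 2)) \<partial>lborel)"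
    proof (rule nn_integral_cong)
      fix n :: "real ^ 2"
      have N: "(norm (T *v n, p))\<^sup>2 = (norm y)\<^sup>2 + (n \<bullet> y)\<^sup>2 + ((norm z)\<^sup>2 + (n \<bullet> z)\<^sup>2)"
        by (simp add: norm_Pair p Tn norm_2'[of "vec2 _ _"])
      have R: "\<bar>res ((T *v n, p), 0)\<bar> = 4 * s\<^sup>2 * \<bar>crs y z\<bar>\<^sup>2 * \<bar>a\<^sup>2 * (norm n)\<^sup>2 - s\<^sup>2\<bar>"
        unfolding p Tn res_substitution by (simp add: abs_mult)
      have reorder: "\<bar>crs y z\<bar> * (4 * s\<^sup>2 * \<bar>crs y z\<bar>\<^sup>2 * \<bar>a\<^sup>2 * (norm n)\<^sup>2 - s\<^sup>2\<bar> * E) = (4 * s\<^sup>2 * \<bar>a\<^sup>2 * (norm n)\<^sup>2 - s\<^sup>2\<bar>) * (\<bar>crs y z\<bar> ^ 3 * E)" for E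
        unfolding power2_eq_square power3_eq_cube by simp
      show "ennreal \<bar>crs y z\<bar> * f (T *v n, p) = ennreal (4 * s\<^sup>2 * \<bar>a\<^sup>2 * (norm n)\<^sup>2 - s\<^sup>2\<bar>) *
        ennreal (\<bar>crs (fst p) (snd p)\<bar> ^ 3 * exp (- ((norm (fst p))\<^sup>2 + (n \<bullet> fst p)\<^sup>2 + ((norm (snd p))\<^sup>2 + (n \<bullet> snd p)\<^sup>2)) / 2))"
      proof -
        have "ennreal \<bar>crs y z\<bar> * f (T *v n, p) = ennreal (\<bar>crs y z\<bar> * (4 * s\<^sup>2 * \<bar>crs y z\<bar>\<^sup>2 * \<bar>a\<^sup>2 * (norm n)\<^sup>2 - s\<^sup>2\<bar> * exp (- (norm (T *v n, p))\<^sup>2 / 2)))"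
          unfolding f_def R by (rule ennreal_mult[symmetric]) simp_all
        also have "\<dots> = ennreal (4 * s\<^sup>2 * \<bar>a\<^sup>2 * (norm n)\<^sup>2 - s\<^sup>2\<bar>) * ennreal (\<bar>crs y z\<bar> ^ 3 * exp (- (norm (T *v n, p))\<^sup>2 / 2))"
          unfolding reorder by (rule ennreal_mult) simp_all
        finally show ?thesis unfolding N by (simp only: p fst_conv snd_conv)
      qed
    qed
    finally show "(\<integral>\<^sup>+x. f (x, p) \<partial>lborel) = (\<integral>\<^sup>+n. ennreal (4 * s\<^sup>2 * \<bar>a\<^sup>2 * (norm n)\<^sup>2 - s\<^sup>2\<bar>) *
      ennreal (\<bar>crs (fst p) (snd p)\<bar> ^ 3 * exp (- ((norm (fst p))\<^sup>2 + (n \<bullet> fst p)\<^sup>2 + ((norm (snd p))\<^sup>2 + (n \<bullet> snd p)\<^sup>2)) / 2)) \<partial>lborel)" .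
  qed
  also have "\<dots> = (\<integral>\<^sup>+n. \<integral>\<^sup>+p. ennreal (4 * s\<^sup>2 * \<bar>a\<^sup>2 * (norm n)\<^sup>2 - s\<^sup>2\<bar>) *
      ennreal (\<bar>crs (fst p) (snd p)\<bar> ^ 3 * exp (- ((norm (fst p))\<^sup>2 + (n \<bullet> fst p)\<^sup>2 + ((norm (snd p))\<^sup>2 + (n \<bullet> snd p)\<^sup>2)) / 2)) \<partial>lborel \<partial>lborel)"
  proof (rule lborel_pair.Fubini')
    show "(\<lambda>(n, p :: (real ^ 2) \<times> (real ^ 2)). ennreal (4 * s\<^sup>2 * \<bar>a\<^sup>2 * (norm n)\<^sup>2 - s\<^sup>2\<bar>) *
      ennreal (\<bar>crs (fst p) (snd p)\<bar> ^ 3 * exp (- ((norm (fst p))\<^sup>2 + (n \<bullet> fst p)\<^sup>2 + ((norm (snd p))\<^sup>2 + (n \<bullet> snd p)\<^sup>2)) / 2)))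
      \<in> borel_measurable (lborel \<Otimes>\<^sub>M lborel)"
    proof -
      have 1: "(\<lambda>x :: (real ^ 2) \<times> ((real ^ 2) \<times> (real ^ 2)). ennreal (4 * s\<^sup>2 * \<bar>a\<^sup>2 * (norm (fst x))\<^sup>2 - s\<^sup>2\<bar>)) \<in> borel_measurable borel"
        by (rule measurable_compose[OF _ measurable_ennreal], rule borel_measurable_continuous_onI) (auto intro!: continuous_intros)
      have 2: "(\<lambda>x :: (real ^ 2) \<times> ((real ^ 2) \<times> (real ^ 2)). ennreal (\<bar>crs (fst (snd x)) (snd (snd x))\<bar> ^ 3 * exp (- ((norm (fst (snd x)))\<^sup>2 + (fst x \<bullet> fst (snd x))\<^sup>2 + ((norm (snd (snd x)))\<^sup>2 + (fst x \<bullet> snd (snd x))\<^sup>2)) / 2))) \<in> borel_measurable borel"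
        unfolding crs_def
        by (rule measurable_compose[OF _ measurable_ennreal], rule borel_measurable_continuous_onI) (auto intro!: continuous_intros)
      show ?thesis
        unfolding case_prod_beta' lborel_prod using borel_measurable_times_ennreal[OF 1 2] by simp
    qed
  qed
  also have "\<dots> = (\<integral>\<^sup>+n. ennreal (96 * s\<^sup>2 * pi\<^sup>2) * ennreal (\<bar>a\<^sup>2 * (norm n)\<^sup>2 - s\<^sup>2\<bar> * (1 + (norm n)\<^sup>2) powr (-5/2)) \<partial>(lborel :: (real ^ 2) measure))"
  proof (rule nn_integral_cong)
    fix n :: "real ^ 2"
    define h where "h p = ennreal (\<bar>crs (fst p) (snd p)\<bar> ^ 3 * exp (- ((norm (fst p))\<^sup>2 + (n \<bullet> fst p)\<^sup>2 + ((norm (snd p))\<^sup>2 + (n \<bullet> snd p)\<^sup>2)) / 2))" for p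
    have hm[measurable]: "h \<in> borel_measurable borel"
      unfolding h_def crs_def
      by (rule measurable_compose[OF _ measurable_ennreal], rule borel_measurable_continuous_onI) (auto intro!: continuous_intros)
    have "(\<integral>\<^sup>+p. h p \<partial>lborel) = (\<integral>\<^sup>+p. h p \<partial>(lborel \<Otimes>\<^sub>M lborel))" by (simp add: lborel_prod)
    also have "\<dots> = (\<integral>\<^sup>+y. \<integral>\<^sup>+z. h (y, z) \<partial>lborel \<partial>lborel)"
      by (rule lborel.nn_integral_fst[symmetric]) (simp add: lborel_prod)
    also have "\<dots> = ennreal (24 * pi\<^sup>2 * (1 + (norm n)\<^sup>2) powr (-5/2))"
      unfolding h_def fst_conv snd_conv by (rule nn_integral_crs_chol)
    finally have "(\<integral>\<^sup>+p. ennreal (4 * s\<^sup>2 * \<bar>a\<^sup>2 * (norm n)\<^sup>2 - s\<^sup>2\<bar>) * h p \<partial>lborel)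
       = ennreal (4 * s\<^sup>2 * \<bar>a\<^sup>2 * (norm n)\<^sup>2 - s\<^sup>2\<bar>) * ennreal (24 * pi\<^sup>2 * (1 + (norm n)\<^sup>2) powr (-5/2))"
      by (simp add: nn_integral_cmult)
    also have "\<dots> = ennreal (96 * s\<^sup>2 * pi\<^sup>2) * ennreal (\<bar>a\<^sup>2 * (norm n)\<^sup>2 - s\<^sup>2\<bar> * (1 + (norm n)\<^sup>2) powr (-5/2))"
      by (subst (1 2) ennreal_mult[symmetric]) (simp_all add: mult_ac)
    finally show "(\<integral>\<^sup>+p. ennreal (4 * s\<^sup>2 * \<bar>a\<^sup>2 * (norm n)\<^sup>2 - s\<^sup>2\<bar>) *
      ennreal (\<bar>crs (fst p) (snd p)\<bar> ^ 3 * exp (- ((norm (fst p))\<^sup>2 + (n \<bullet> fst p)\<^sup>2 + ((norm (snd p))\<^sup>2 + (n \<bullet> snd p)\<^sup>2)) / 2)) \<partial>lborel)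
      = ennreal (96 * s\<^sup>2 * pi\<^sup>2) * ennreal (\<bar>a\<^sup>2 * (norm n)\<^sup>2 - s\<^sup>2\<bar> * (1 + (norm n)\<^sup>2) powr (-5/2))"
      unfolding h_def .
  qed
  also have "\<dots> = ennreal (96 * s\<^sup>2 * pi\<^sup>2) * (\<integral>\<^sup>+(n :: real ^ 2). ennreal (\<bar>a\<^sup>2 * (norm n)\<^sup>2 - s\<^sup>2\<bar> * (1 + (norm n)\<^sup>2) powr (-5/2)) \<partial>lborel)"
    by (rule nn_integral_cmult) measurable
  also have "(\<integral>\<^sup>+(n :: real ^ 2). ennreal (\<bar>a\<^sup>2 * (norm n)\<^sup>2 - s\<^sup>2\<bar> * (1 + (norm n)\<^sup>2) powr (-5/2)) \<partial>lborel)
     = ennreal pi * ennreal ((8 * a\<^sup>2 * sqrt (a\<^sup>2 / (a\<^sup>2 + s\<^sup>2)) + 2 * s\<^sup>2 - 4 * a\<^sup>2) / 3)"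
    using nn_integral_radial_2[of "\<lambda>t. ennreal (\<bar>a\<^sup>2 * t - s\<^sup>2\<bar> * (1 + t) powr (-5/2))"]
    by (subst nn_integral_abs_linear_powr[symmetric]) (use a s in simp_all)
  finally show ?thesis
  proof -
    let ?q = "8 * a\<^sup>2 * sqrt (a\<^sup>2 / (a\<^sup>2 + s\<^sup>2)) + 2 * s\<^sup>2 - 4 * a\<^sup>2"
    assume *: "res_integral (\<lambda>\<eta>. exp (- (norm \<eta>)\<^sup>2 / 2)) = ennreal (96 * s\<^sup>2 * pi\<^sup>2) * (ennreal pi * ennreal (?q / 3)) * ennreal ((2 * pi) ^ 5)"
    have m: "ennreal x * ennreal y = ennreal (x * y)" if "0 \<le> x" for x y
      using that ennreal_mult'[of x y] by simp
    have "ennreal (96 * s\<^sup>2 * pi\<^sup>2) * (ennreal pi * ennreal (?q / 3)) * ennreal ((2 * pi) ^ 5)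
       = ennreal ((2 * pi) ^ 5) * (ennreal (96 * s\<^sup>2 * pi\<^sup>2) * (ennreal pi * ennreal (?q / 3)))"
      by (rule mult.commute)
    also have "\<dots> = ennreal ((2 * pi) ^ 5 * (96 * s\<^sup>2 * pi\<^sup>2 * (pi * (?q / 3))))"
      by (subst m, simp)+ simp
    also have "(2 * pi) ^ 5 * (96 * s\<^sup>2 * pi\<^sup>2 * (pi * (?q / 3))) = (2 * pi) ^ 5 * (32 * pi ^ 3 * s\<^sup>2 * ?q)"
      unfolding power2_eq_square power3_eq_cube by simp
    finally show ?thesis unfolding * .
  qed
qed

end

section \<open>Reproducing kernels of harmonic cubics\<close>

lemma lborel_prod_integral:
  fixes f :: "'a::euclidean_space \<Rightarrow> real \<Rightarrow> real"
  assumes f: "\<And>b. b \<in> Basis \<Longrightarrow> integrable lborel (f b)"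
  shows "integrable lborel (\<lambda>x. \<Prod>b\<in>Basis. f b (x \<bullet> b))"
    and "(\<integral>x. (\<Prod>b\<in>Basis. f b (x \<bullet> b)) \<partial>lborel) = (\<Prod>b\<in>Basis. integral\<^sup>L lborel (f b))"
proof -
  interpret P: product_sigma_finite "\<lambda>b :: 'a. lborel :: real measure" ..
  have m: "(\<lambda>x :: 'a. \<Prod>b\<in>Basis. f b (x \<bullet> b)) \<in> borel_measurable borel"
  proof (rule borel_measurable_prod)
    fix b :: 'a assume "b \<in> Basis"
    then have "f b \<in> borel_measurable borel" using borel_measurable_integrable[OF f[of b]] by simp
    then show "(\<lambda>x. f b (x \<bullet> b)) \<in> borel_measurable borel" by measurable
  qed
  have T: "(\<lambda>g. \<Sum>b\<in>Basis. g b *\<^sub>R b) \<in> (\<Pi>\<^sub>M b\<in>(Basis :: 'a set). (lborel :: real measure)) \<rightarrow>\<^sub>M borel" by measurable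
  have e: "(\<Prod>b\<in>Basis. f b ((\<Sum>b\<in>Basis. g b *\<^sub>R b) \<bullet> b)) = (\<Prod>b\<in>Basis. f b (g b))" for g :: "'a \<Rightarrow> real"
    by (intro prod.cong refl) simp
  have "integrable (\<Pi>\<^sub>M b\<in>(Basis :: 'a set). (lborel :: real measure)) (\<lambda>g. \<Prod>b\<in>Basis. f b (g b))"
    by (rule P.product_integrable_prod) (auto intro: f)
  then show "integrable lborel (\<lambda>x :: 'a. \<Prod>b\<in>Basis. f b (x \<bullet> b))"
    by (subst lborel_eq, subst integrable_distr_eq[OF T m]) (simp only: e)
  have "(\<integral>x. (\<Prod>b\<in>Basis. f b (x \<bullet> b)) \<partial>(lborel :: 'a measure)) = (\<integral>g. (\<Prod>b\<in>Basis. f b (g b)) \<partial>(\<Pi>\<^sub>M b\<in>(Basis :: 'a set). lborel))"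
    by (subst lborel_eq, subst integral_distr[OF T m]) (simp only: e)
  also have "\<dots> = (\<Prod>b\<in>Basis. integral\<^sup>L lborel (f b))"
    by (rule P.product_integral_prod) (auto intro: f)
  finally show "(\<integral>x. (\<Prod>b\<in>Basis. f b (x \<bullet> b)) \<partial>(lborel :: 'a measure)) = (\<Prod>b\<in>Basis. integral\<^sup>L lborel (f b))" .
qed

text \<open>The k-th moment of a standard normal variable, the double factorial of
  \<open>k - 1\<close> for even \<open>k\<close>.\<close>

definition mm :: "nat \<Rightarrow> real" where
  "mm k = (if even k then fact k / (2 ^ (k div 2) * fact (k div 2)) else 0)"

lemma mm_0: "mm 0 = 1" and mm_1: "mm (Suc 0) = 0"
  by (simp_all add: mm_def)

lemma mm_rec: "mm (Suc (Suc k)) = real (Suc k) * mm k"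
proof (cases "even k")
  case True
  then obtain j where k: "k = 2 * j" by blast
  have d: "Suc (Suc k) div 2 = Suc j" "k div 2 = j" by (simp_all add: k)
  define r where "r = real j + 1"
  have r: "r > 0" by (simp add: r_def)
  have "fact (Suc (Suc k)) = (2 * r) * (real (Suc k) * fact k)" by (simp add: k r_def)
  moreover have "(2 :: real) ^ Suc j * fact (Suc j) = (2 * r) * (2 ^ j * fact j)" by (simp add: r_def)
  ultimately have "mm (Suc (Suc k)) = (2 * r) * (real (Suc k) * fact k) / ((2 * r) * (2 ^ j * fact j))"
    using True by (simp only: mm_def d even_Suc not_not if_True)
  also have "\<dots> = real (Suc k) * mm k" using True r by (simp add: mm_def d del: of_nat_Suc)
  finally show ?thesis .
qed (simp add: mm_def)

lemma gaussian_power_integral: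
  "integrable lborel (\<lambda>x :: real. x ^ k * exp (- x\<^sup>2 / 2))"
  "(\<integral>x. x ^ k * exp (- x\<^sup>2 / 2) \<partial>lborel) = sqrt (2 * pi) * mm k"
proof -
  have e: "x ^ k * exp (- x\<^sup>2 / 2) = sqrt (2 * pi) * (std_normal_density x * x ^ k)" for x :: real
    by (simp add: std_normal_density_def)
  show "integrable lborel (\<lambda>x :: real. x ^ k * exp (- x\<^sup>2 / 2))"
    unfolding e by (intro integrable_mult_right integrable_std_normal_moment)
  have "(\<integral>x. std_normal_density x * x ^ k \<partial>lborel) = mm k"
  proof (cases "even k")
    case True
    then obtain j where k: "k = 2 * j" by blast
    show ?thesis unfolding k using integral_std_normal_moment_even[of j] by (simp add: mm_def)
  next
    case False
    then obtain j where k: "k = 2 * j + 1" by (metis oddE)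
    show ?thesis unfolding k using integral_std_normal_moment_odd[of j] by (simp add: mm_def)
  qed
  then show "(\<integral>x. x ^ k * exp (- x\<^sup>2 / 2) \<partial>lborel) = sqrt (2 * pi) * mm k"
    unfolding e by simp
qed

lemma gaussian_monomial_integral:
  fixes \<alpha> :: "4 \<Rightarrow> nat"
  shows "integrable lborel (\<lambda>x :: real ^ 4. (\<Prod>i\<in>UNIV. x $ i ^ \<alpha> i) * exp (- (norm x)\<^sup>2 / 2))"
    and "(\<integral>x. (\<Prod>i\<in>UNIV. x $ i ^ \<alpha> i) * exp (- (norm x)\<^sup>2 / 2) \<partial>(lborel :: (real ^ 4) measure)) = (2 * pi)\<^sup>2 * (\<Prod>i\<in>UNIV. mm (\<alpha> i))"
proof -
  define idx where "idx b = (THE i. b = axis i (1::real))" for b :: "real ^ 4"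
  have idx: "idx (axis i 1) = i" for i by (simp add: idx_def axis_eq_axis)
  have B: "(\<Prod>b\<in>Basis. g b) = (\<Prod>i\<in>UNIV. g (axis i 1))" for g :: "real ^ 4 \<Rightarrow> real"
  proof -
    have b: "(Basis :: (real ^ 4) set) = (\<lambda>i. axis i 1) ` UNIV" by (auto simp: Basis_vec_def)
    have i: "inj (\<lambda>i :: 4. axis i (1::real))" by (auto simp: inj_def axis_eq_axis)
    show ?thesis unfolding b prod.reindex[OF i] by (simp add: o_def)
  qed
  define f where "f b t = t ^ \<alpha> (idx b) * exp (- t\<^sup>2 / 2)" for b :: "real ^ 4" and t :: real
  have int: "integrable lborel (f b)" for b unfolding f_def by (rule gaussian_power_integral)
  have e: "(\<Prod>b\<in>Basis. f b (x \<bullet> b)) = (\<Prod>i\<in>UNIV. x $ i ^ \<alpha> i) * exp (- (norm x)\<^sup>2 / 2)" for x :: "real ^ 4"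
  proof -
    have "(norm x)\<^sup>2 = (\<Sum>i\<in>UNIV. (x $ i)\<^sup>2)"
      unfolding power2_norm_eq_inner by (simp add: inner_vec_def power2_eq_square)
    then have "exp (- (norm x)\<^sup>2 / 2) = (\<Prod>i\<in>UNIV. exp (- (x $ i)\<^sup>2 / 2))"
      by (simp add: exp_sum[symmetric] sum_negf sum_divide_distrib)
    then show ?thesis unfolding B by (simp add: f_def idx inner_axis prod.distrib)
  qed
  show "integrable lborel (\<lambda>x :: real ^ 4. (\<Prod>i\<in>UNIV. x $ i ^ \<alpha> i) * exp (- (norm x)\<^sup>2 / 2))"
    using lborel_prod_integral(1)[of f, OF int] unfolding e .
  have "(\<Prod>b\<in>Basis. integral\<^sup>L lborel (f b)) = (\<Prod>i\<in>UNIV. sqrt (2 * pi) * mm (\<alpha> i))"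
    unfolding B f_def idx gaussian_power_integral(2) ..
  also have "\<dots> = (2 * pi)\<^sup>2 * (\<Prod>i\<in>UNIV. mm (\<alpha> i))"
  proof -
    have "sqrt (2 * pi) ^ 4 = (2 * pi)\<^sup>2" using power_mult[of "sqrt (2 * pi)" 2 2] by simp
    then show ?thesis by (simp add: prod.distrib)
  qed
  finally show "(\<integral>x. (\<Prod>i\<in>UNIV. x $ i ^ \<alpha> i) * exp (- (norm x)\<^sup>2 / 2) \<partial>(lborel :: (real ^ 4) measure)) = (2 * pi)\<^sup>2 * (\<Prod>i\<in>UNIV. mm (\<alpha> i))"
    using lborel_prod_integral(2)[of f, OF int] unfolding e by simp
qed

definition dl :: "4 \<Rightarrow> 4 \<Rightarrow> nat" where "dl i = (\<lambda>l. if l = i then 1 else 0)"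
definition mom :: "(4 \<Rightarrow> nat) \<Rightarrow> real" where "mom \<alpha> = (\<Prod>i\<in>UNIV. mm (\<alpha> i))"

text \<open>Gaussian integration by parts in the variable \<open>i\<close>. The truncated
  subtraction is harmless, since the factor \<open>\<beta> i\<close> is zero when it
  truncates.\<close>

lemma mom_rec: "mom (\<lambda>l. dl i l + \<beta> l) = real (\<beta> i) * mom (\<lambda>l. \<beta> l - dl i l)"
proof -
  have "mom (\<lambda>l. dl i l + \<beta> l) = mm (Suc (\<beta> i)) * (\<Prod>l\<in>UNIV - {i}. mm (\<beta> l))"
    unfolding mom_def by (subst prod.remove[of _ i]) (auto simp: dl_def intro!: prod.cong)
  moreover have "mom (\<lambda>l. \<beta> l - dl i l) = mm (\<beta> i - 1) * (\<Prod>l\<in>UNIV - {i}. mm (\<beta> l))"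
    unfolding mom_def by (subst prod.remove[of _ i]) (auto simp: dl_def intro!: prod.cong)
  moreover have "mm (Suc (\<beta> i)) = real (\<beta> i) * mm (\<beta> i - 1)"
  proof (cases "\<beta> i")
    case 0 then show ?thesis by (simp add: mm_1)
  next
    case (Suc j) then show ?thesis by (simp add: mm_rec)
  qed
  ultimately show ?thesis by simp
qed

text \<open>The first index stands apart in the sum so that \<open>mom_rec\<close> applies to it;
  iterating yields Wick's formula.\<close>

definition mom2 where "mom2 i j = mom (\<lambda>x. dl i x + dl j x)"
definition mom4 where "mom4 i j k l = mom (\<lambda>x. dl i x + (dl j x + dl k x + dl l x))"
definition mom6 where "mom6 i j k l m n = mom (\<lambda>x. dl i x + (dl j x + dl k x + dl l x + dl m x + dl n x))"

lemma mom2: "mom2 i j = (if i = j then 1 else 0)"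
  unfolding mom2_def mom_rec by (simp add: dl_def mom_def mm_0)

lemma mom4: "mom4 i j k l = (if i = j then mom2 k l else 0) + (if i = k then mom2 j l else 0) + (if i = l then mom2 j k else 0)"
proof -
  let ?X = "mom (\<lambda>x. dl j x + dl k x + dl l x - dl i x)"
  have "mom4 i j k l = (if i = j then ?X else 0) + (if i = k then ?X else 0) + (if i = l then ?X else 0)"
    unfolding mom4_def mom_rec by (simp add: dl_def distrib_right)
  moreover have "(if i = j then ?X else 0) = (if i = j then mom2 k l else 0)"
    "(if i = k then ?X else 0) = (if i = k then mom2 j l else 0)" "(if i = l then ?X else 0) = (if i = l then mom2 j k else 0)"
    by (simp_all add: mom2_def ac_simps)
  ultimately show ?thesis by (simp only:)
qed

lemma mom6: "mom6 i j k l m n = (if i = j then mom4 k l m n else 0) + (if i = k then mom4 j l m n else 0)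
   + (if i = l then mom4 j k m n else 0) + (if i = m then mom4 j k l n else 0) + (if i = n then mom4 j k l m else 0)"
proof -
  let ?X = "mom (\<lambda>x. dl j x + dl k x + dl l x + dl m x + dl n x - dl i x)"
  have "mom6 i j k l m n = (if i = j then ?X else 0) + (if i = k then ?X else 0) + (if i = l then ?X else 0)
     + (if i = m then ?X else 0) + (if i = n then ?X else 0)"
  proof -
    have c: "real (dl j i + dl k i + dl l i + dl m i + dl n i) = (if i = j then 1 else 0) + (if i = k then 1 else 0)
      + (if i = l then 1 else 0) + (if i = m then 1 else 0) + (if i = n then 1 else 0)" by (simp add: dl_def)
    have t: "(if P then 1 else 0) * z = (if P then z else 0)" for P and z :: real by simp
    show ?thesis unfolding mom6_def mom_rec c distrib_right t ..
  qed
  moreover have "(if i = j then ?X else 0) = (if i = j then mom4 k l m n else 0)"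
    "(if i = k then ?X else 0) = (if i = k then mom4 j l m n else 0)"
    "(if i = l then ?X else 0) = (if i = l then mom4 j k m n else 0)"
    "(if i = m then ?X else 0) = (if i = m then mom4 j k l n else 0)"
    "(if i = n then ?X else 0) = (if i = n then mom4 j k l m else 0)"
    by (simp_all add: mom4_def ac_simps)
  ultimately show ?thesis by (simp only:)
qed

definition cub :: "(4 \<Rightarrow> 4 \<Rightarrow> 4 \<Rightarrow> real) \<Rightarrow> real ^ 4 \<Rightarrow> real" where
  "cub T x = (\<Sum>i\<in>UNIV. \<Sum>j\<in>UNIV. \<Sum>k\<in>UNIV. T i j k * (x $ i * x $ j * x $ k))"

lemma gaussian_sextic:
  "has_bochner_integral lborel (\<lambda>x :: real ^ 4. x $ i * x $ j * x $ k * (x $ l * x $ m * x $ n) * exp (- (norm x)\<^sup>2 / 2))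
    ((2 * pi)\<^sup>2 * mom6 l m n i j k)"
proof -
  have e: "(\<Prod>a\<in>UNIV. x $ a ^ (dl l a + (dl m a + dl n a + dl i a + dl j a + dl k a))) = x $ i * x $ j * x $ k * (x $ l * x $ m * x $ n)" for x :: "real ^ 4"
    unfolding power_add prod.distrib dl_def prod_power_delta by (simp add: mult_ac)
  show ?thesis
    using gaussian_monomial_integral[of "\<lambda>a. dl l a + (dl m a + dl n a + dl i a + dl j a + dl k a)"]
    unfolding e mom6_def mom_def by (simp add: has_bochner_integral_iff)
qed

lemma cubic_pairing:
  "has_bochner_integral lborel (\<lambda>x. cub T x * cub U x * exp (- (norm x)\<^sup>2 / 2))
     ((2 * pi)\<^sup>2 * (\<Sum>i\<in>UNIV. \<Sum>j\<in>UNIV. \<Sum>k\<in>UNIV. T i j k * (\<Sum>l\<in>UNIV. \<Sum>m\<in>UNIV. \<Sum>n\<in>UNIV. U l m n * mom6 l m n i j k)))"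
proof -
  have "has_bochner_integral lborel
    (\<lambda>x :: real ^ 4. \<Sum>i\<in>UNIV. \<Sum>j\<in>UNIV. \<Sum>k\<in>UNIV. \<Sum>l\<in>UNIV. \<Sum>m\<in>UNIV. \<Sum>n\<in>UNIV.
       T i j k * (U l m n * (x $ i * x $ j * x $ k * (x $ l * x $ m * x $ n) * exp (- (norm x)\<^sup>2 / 2))))
    (\<Sum>i\<in>UNIV. \<Sum>j\<in>UNIV. \<Sum>k\<in>UNIV. \<Sum>l\<in>UNIV. \<Sum>m\<in>UNIV. \<Sum>n\<in>UNIV. T i j k * (U l m n * ((2 * pi)\<^sup>2 * mom6 l m n i j k)))"
    by (intro has_bochner_integral_sum has_bochner_integral_mult_right gaussian_sextic)
  also have "(\<lambda>x :: real ^ 4. \<Sum>i\<in>UNIV. \<Sum>j\<in>UNIV. \<Sum>k\<in>UNIV. \<Sum>l\<in>UNIV. \<Sum>m\<in>UNIV. \<Sum>n\<in>UNIV.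
       T i j k * (U l m n * (x $ i * x $ j * x $ k * (x $ l * x $ m * x $ n) * exp (- (norm x)\<^sup>2 / 2))))
     = (\<lambda>x. cub T x * cub U x * exp (- (norm x)\<^sup>2 / 2))"
    unfolding cub_def sum_distrib_right unfolding sum_distrib_left sum_distrib_right
    by (intro ext sum.cong refl) (simp add: mult_ac)
  also have "(\<Sum>i\<in>UNIV. \<Sum>j\<in>UNIV. \<Sum>k\<in>UNIV. \<Sum>l\<in>UNIV. \<Sum>m\<in>UNIV. \<Sum>n\<in>UNIV. T i j k * (U l m n * ((2 * pi)\<^sup>2 * mom6 l m n i j k)))
     = (2 * pi)\<^sup>2 * (\<Sum>i\<in>UNIV. \<Sum>j\<in>UNIV. \<Sum>k\<in>UNIV. T i j k * (\<Sum>l\<in>UNIV. \<Sum>m\<in>UNIV. \<Sum>n\<in>UNIV. U l m n * mom6 l m n i j k))"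
    unfolding sum_distrib_left by (intro sum.cong refl) (simp add: mult_ac)
  finally show ?thesis .
qed

lemma L2_prod_cub:
  "L2_prod (cub T) (cub U) = 2 * (\<Sum>i\<in>UNIV. \<Sum>j\<in>UNIV. \<Sum>k\<in>UNIV. T i j k * (\<Sum>l\<in>UNIV. \<Sum>m\<in>UNIV. \<Sum>n\<in>UNIV. U l m n * mom6 l m n i j k))"
  unfolding L2_prod_def has_bochner_integral_integral_eq[OF cubic_pairing]
  by (simp add: power2_eq_square)

lemma sum_mult_delta: "(\<Sum>l\<in>(UNIV :: 'n::finite set). f l * (if l = m then X else 0)) = f m * (X :: real)"
proof -
  have "(\<Sum>l\<in>(UNIV :: 'n set). f l * (if l = m then X else 0)) = (\<Sum>l\<in>UNIV. if l = m then f l * X else 0)"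
    by (intro sum.cong) auto
  then show ?thesis by simp
qed

lemma sum_mult_delta': "(\<Sum>l\<in>(UNIV :: 'n::finite set). f l * (if m = l then X else 0)) = f m * (X :: real)"
  using sum_mult_delta[of f m X] by (simp add: eq_commute)

lemma mom2_sym: "mom2 i j = mom2 j i"
  by (simp add: mom2)

lemma sum_mom2: "(\<Sum>l\<in>UNIV. f l * mom2 l m) = f m"
  unfolding mom2 using sum_mult_delta[of f m 1] by simp

lemma sum_mom4: "(\<Sum>l\<in>UNIV. f l * mom4 l i j k) = f i * mom2 j k + f j * mom2 i k + f k * mom2 i j"
  unfolding mom4 distrib_left sum.distrib sum_mult_delta ..

lemma sum_mom6: "(\<Sum>l\<in>UNIV. f l * mom6 l m n i j k) = f m * mom4 n i j k + f n * mom4 m i j k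
   + f i * mom4 m n j k + f j * mom4 m n i k + f k * mom4 m n i j"
  unfolding mom6 distrib_left sum.distrib sum_mult_delta ..

lemma inner_sum_eq: "u \<bullet> u = (\<Sum>m\<in>UNIV. u $ m * u $ m)" for u :: "real ^ 4"
  by (simp add: inner_vec_def)

lemma sum_sum_mom4:
  "(\<Sum>m\<in>UNIV. \<Sum>n\<in>UNIV. u $ m * u $ n * mom4 m n j k) = (u \<bullet> u) * mom2 j k + 2 * (u $ j * u $ k)" for u :: "real ^ 4"
proof -
  have "(\<Sum>m\<in>UNIV. \<Sum>n\<in>UNIV. u $ m * u $ n * mom4 m n j k) = (\<Sum>n\<in>UNIV. u $ n * (\<Sum>m\<in>UNIV. u $ m * mom4 m n j k))"
    by (subst sum.swap) (simp add: sum_distrib_left mult_ac)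
  also have "\<dots> = (\<Sum>n\<in>UNIV. (u $ n * u $ n) * mom2 j k + u $ j * (u $ n * mom2 n k) + u $ k * (u $ n * mom2 n j))"
    unfolding sum_mom4 by (intro sum.cong refl) (simp add: algebra_simps)
  also have "\<dots> = (u \<bullet> u) * mom2 j k + u $ j * u $ k + u $ k * u $ j"
    unfolding sum.distrib sum_distrib_left[symmetric] sum_distrib_right[symmetric] sum_mom2 inner_sum_eq ..
  finally show ?thesis by simp
qed

text \<open>Of the 15 pairings in Wick's formula, 6 join every \<open>u\<close> to one of
  \<open>i\<close>, \<open>j\<close>, \<open>k\<close>; the other 9 pair two of the \<open>u\<close>
  with each other.\<close>

lemma cube_moment:
  "(\<Sum>l\<in>UNIV. \<Sum>m\<in>UNIV. \<Sum>n\<in>UNIV. u $ l * u $ m * u $ n * mom6 l m n i j k)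
     = 6 * (u $ i * u $ j * u $ k) + 3 * (u \<bullet> u) * (u $ i * mom2 j k + u $ j * mom2 i k + u $ k * mom2 i j)" for u :: "real ^ 4"
proof -
  have "(\<Sum>l\<in>UNIV. \<Sum>m\<in>UNIV. \<Sum>n\<in>UNIV. u $ l * u $ m * u $ n * mom6 l m n i j k)
     = (\<Sum>m\<in>UNIV. \<Sum>l\<in>UNIV. \<Sum>n\<in>UNIV. u $ l * u $ m * u $ n * mom6 l m n i j k)" by (rule sum.swap)
  also have "\<dots> = (\<Sum>m\<in>UNIV. \<Sum>n\<in>UNIV. \<Sum>l\<in>UNIV. u $ l * u $ m * u $ n * mom6 l m n i j k)"
    by (rule sum.cong[OF refl], rule sum.swap)
  also have "\<dots> = (\<Sum>m\<in>UNIV. \<Sum>n\<in>UNIV. u $ m * u $ n * (\<Sum>l\<in>UNIV. u $ l * mom6 l m n i j k))"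
    unfolding sum_distrib_left by (intro sum.cong refl) (simp add: mult_ac)
  also have "\<dots> = (\<Sum>m\<in>UNIV. \<Sum>n\<in>UNIV. (u $ m * u $ m) * (u $ n * mom4 n i j k) + (u $ n * u $ n) * (u $ m * mom4 m i j k)
     + u $ i * (u $ m * u $ n * mom4 m n j k) + u $ j * (u $ m * u $ n * mom4 m n i k) + u $ k * (u $ m * u $ n * mom4 m n i j))"
    unfolding sum_mom6 by (intro sum.cong refl) (simp add: algebra_simps)
  also have "\<dots> = (\<Sum>m\<in>UNIV. (u $ m * u $ m)) * (\<Sum>n\<in>UNIV. u $ n * mom4 n i j k) + (\<Sum>n\<in>UNIV. u $ n * u $ n) * (\<Sum>m\<in>UNIV. u $ m * mom4 m i j k)
     + u $ i * (\<Sum>m\<in>UNIV. \<Sum>n\<in>UNIV. u $ m * u $ n * mom4 m n j k) + u $ j * (\<Sum>m\<in>UNIV. \<Sum>n\<in>UNIV. u $ m * u $ n * mom4 m n i k)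
     + u $ k * (\<Sum>m\<in>UNIV. \<Sum>n\<in>UNIV. u $ m * u $ n * mom4 m n i j)"
  proof -
    have p1: "(\<Sum>m\<in>UNIV. \<Sum>n\<in>UNIV. (u $ m * u $ m) * (u $ n * mom4 n i j k)) = (\<Sum>m\<in>UNIV. u $ m * u $ m) * (\<Sum>n\<in>UNIV. u $ n * mom4 n i j k)"
      by (rule sum_product[symmetric])
    have p2: "(\<Sum>m\<in>UNIV. \<Sum>n\<in>UNIV. (u $ n * u $ n) * (u $ m * mom4 m i j k)) = (\<Sum>n\<in>UNIV. u $ n * u $ n) * (\<Sum>m\<in>UNIV. u $ m * mom4 m i j k)"
      by (subst sum.swap) (rule sum_product[symmetric])
    have p3: "(\<Sum>m\<in>UNIV. \<Sum>n\<in>UNIV. c * g m n) = c * (\<Sum>m\<in>UNIV. \<Sum>n\<in>UNIV. g m n)" for c :: real and g :: "4 \<Rightarrow> 4 \<Rightarrow> real"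
      by (simp only: sum_distrib_left)
    show ?thesis unfolding sum.distrib p1 p2 p3 ..
  qed
  finally show ?thesis
    unfolding inner_sum_eq[symmetric] sum_mom4 sum_sum_mom4 by (simp add: algebra_simps)
qed

text \<open>Contracting the first two indices gives the factor 8 = 4 + 4: the dimension, and one for
  each of the four remaining factors.\<close>

lemma radial_moment:
  "(\<Sum>l\<in>UNIV. \<Sum>m\<in>UNIV. \<Sum>n\<in>UNIV. (if l = m then u $ n else 0) * mom6 l m n i j k)
     = 8 * (u $ i * mom2 j k + u $ j * mom2 i k + u $ k * mom2 i j)" for u :: "real ^ 4"
proof -
  have "(\<Sum>l\<in>UNIV. \<Sum>m\<in>UNIV. \<Sum>n\<in>UNIV. (if l = m then u $ n else 0) * mom6 l m n i j k)
     = (\<Sum>l\<in>UNIV. \<Sum>n\<in>UNIV. \<Sum>m\<in>UNIV. (if l = m then u $ n else 0) * mom6 l m n i j k)"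
    by (rule sum.cong[OF refl], rule sum.swap)
  also have "\<dots> = (\<Sum>l\<in>UNIV. \<Sum>n\<in>UNIV. u $ n * mom6 l l n i j k)"
  proof (intro sum.cong refl)
    fix l n
    show "(\<Sum>m\<in>UNIV. (if l = m then u $ n else 0) * mom6 l m n i j k) = u $ n * mom6 l l n i j k"
      using sum_mult_delta'[of "\<lambda>m. mom6 l m n i j k" l "u $ n"] by (simp add: mult.commute)
  qed
  also have "\<dots> = (\<Sum>n\<in>UNIV. \<Sum>l\<in>UNIV. u $ n * mom6 l l n i j k)" by (rule sum.swap)
  also have "\<dots> = (\<Sum>n\<in>UNIV. u $ n * (8 * mom4 n i j k))"
  proof (intro sum.cong refl)
    fix n
    have d: "(\<Sum>l\<in>UNIV. (if l = a then f l else 0)) = f a" for a :: 4 and f :: "4 \<Rightarrow> real" by simp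
    have "(\<Sum>l\<in>UNIV. mom6 l l n i j k) = 4 * mom4 n i j k + mom4 n i j k + mom4 i n j k + mom4 j n i k + mom4 k n i j"
      unfolding mom6 sum.distrib d by simp
    also have "mom4 i n j k = mom4 n i j k" by (simp add: mom4_def ac_simps)
    also have "mom4 j n i k = mom4 n i j k" by (simp add: mom4_def ac_simps)
    also have "mom4 k n i j = mom4 n i j k" by (simp add: mom4_def ac_simps)
    finally show "(\<Sum>l\<in>UNIV. u $ n * mom6 l l n i j k) = u $ n * (8 * mom4 n i j k)"
      by (simp add: sum_distrib_left[symmetric])
  qed
  also have "\<dots> = 8 * (\<Sum>n\<in>UNIV. u $ n * mom4 n i j k)"
    unfolding sum_distrib_left by (intro sum.cong refl) simp
  finally show ?thesis unfolding sum_mom4 .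
qed

text \<open>Half the coefficient vector of the Laplacian, see \<open>laplacian_cub\<close>. All
  three contractions occur because \<open>T\<close> need not be symmetric.\<close>

definition tr :: "(4 \<Rightarrow> 4 \<Rightarrow> 4 \<Rightarrow> real) \<Rightarrow> 4 \<Rightarrow> real" where
  "tr T k = (\<Sum>i\<in>UNIV. T i i k + T i k i + T k i i)"

lemma sum_trace:
  "(\<Sum>i\<in>UNIV. \<Sum>j\<in>UNIV. \<Sum>k\<in>UNIV. T i j k * (u $ i * mom2 j k + u $ j * mom2 i k + u $ k * mom2 i j))
    = (\<Sum>k\<in>UNIV. tr T k * u $ k)" for u :: "real ^ 4"
proof -
  have "(\<Sum>i\<in>UNIV. \<Sum>j\<in>UNIV. \<Sum>k\<in>UNIV. T i j k * (u $ i * mom2 j k + u $ j * mom2 i k + u $ k * mom2 i j))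
    = (\<Sum>i\<in>UNIV. \<Sum>j\<in>UNIV. \<Sum>k\<in>UNIV. (T i j k * u $ i) * mom2 k j) + (\<Sum>i\<in>UNIV. \<Sum>j\<in>UNIV. \<Sum>k\<in>UNIV. (T i j k * u $ j) * mom2 k i)
      + (\<Sum>i\<in>UNIV. \<Sum>j\<in>UNIV. \<Sum>k\<in>UNIV. (T i j k * u $ k) * mom2 j i)"
    by (simp add: distrib_left sum.distrib mult.assoc mom2_sym[of _ _])
  also have "(\<Sum>i\<in>UNIV. \<Sum>j\<in>UNIV. \<Sum>k\<in>UNIV. (T i j k * u $ i) * mom2 k j) = (\<Sum>k\<in>UNIV. (\<Sum>i\<in>UNIV. T k i i) * u $ k)"
    unfolding sum_mom2 sum_distrib_right ..
  also have "(\<Sum>i\<in>UNIV. \<Sum>j\<in>UNIV. \<Sum>k\<in>UNIV. (T i j k * u $ j) * mom2 k i) = (\<Sum>k\<in>UNIV. (\<Sum>i\<in>UNIV. T i k i) * u $ k)"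
    unfolding sum_mom2 sum_distrib_right by (rule sum.swap)
  also have "(\<Sum>i\<in>UNIV. \<Sum>j\<in>UNIV. \<Sum>k\<in>UNIV. (T i j k * u $ k) * mom2 j i) = (\<Sum>k\<in>UNIV. (\<Sum>i\<in>UNIV. T i i k) * u $ k)"
  proof -
    have "(\<Sum>i\<in>UNIV. \<Sum>j\<in>UNIV. \<Sum>k\<in>UNIV. (T i j k * u $ k) * mom2 j i) = (\<Sum>i\<in>UNIV. \<Sum>k\<in>UNIV. \<Sum>j\<in>UNIV. (T i j k * u $ k) * mom2 j i)"
      by (rule sum.cong[OF refl], rule sum.swap)
    also have "\<dots> = (\<Sum>i\<in>UNIV. \<Sum>k\<in>UNIV. T i i k * u $ k)" unfolding sum_mom2 ..
    also have "\<dots> = (\<Sum>k\<in>UNIV. (\<Sum>i\<in>UNIV. T i i k) * u $ k)"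
      unfolding sum_distrib_right by (rule sum.swap)
    finally show ?thesis .
  qed
  finally show ?thesis
    by (simp add: tr_def sum.distrib distrib_right)
qed

lemma cub_cube: "cub (\<lambda>i j k. u $ i * u $ j * u $ k) x = (u \<bullet> x) ^ 3"
  unfolding cub_def inner_vec_def power3_eq_cube sum_product inner_real_def
  by (simp add: sum_distrib_left sum_distrib_right mult_ac)

lemma cub_radial: "cub (\<lambda>i j k. if i = j then u $ k else 0) x = (norm x)\<^sup>2 * (u \<bullet> x)"
proof -
  have "cub (\<lambda>i j k. if i = j then u $ k else 0) x = (\<Sum>i\<in>UNIV. \<Sum>j\<in>UNIV. if i = j then (\<Sum>k\<in>UNIV. u $ k * (x $ i * x $ j * x $ k)) else 0)"
    unfolding cub_def by (intro sum.cong refl) auto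
  also have "\<dots> = (\<Sum>i\<in>UNIV. \<Sum>k\<in>UNIV. u $ k * (x $ i * x $ i * x $ k))" by simp
  also have "\<dots> = (\<Sum>i\<in>UNIV. x $ i * x $ i) * (\<Sum>k\<in>UNIV. u $ k * x $ k)"
    unfolding sum_product by (intro sum.cong refl) (simp add: mult_ac)
  finally show ?thesis by (simp add: power2_norm_eq_inner inner_vec_def)
qed

text \<open>For trace-free \<open>T\<close> the product is 12 times the value at \<open>u\<close>,
  so cubes of linear forms represent point evaluation on harmonic cubics. The factor 12 is the 6 of
  \<open>cube_moment\<close> times the normalisation
  \<open>(2 * pi)^2 / (2 * pi^2) = 2\<close>.\<close>

lemma L2_prod_cube:
  "L2_prod (cub T) (\<lambda>x. (u \<bullet> x) ^ 3) = 12 * cub T u + 6 * (u \<bullet> u) * (\<Sum>k\<in>UNIV. tr T k * u $ k)"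
proof -
  have "L2_prod (cub T) (\<lambda>x. (u \<bullet> x) ^ 3) = 2 * (\<Sum>i\<in>UNIV. \<Sum>j\<in>UNIV. \<Sum>k\<in>UNIV. 6 * (T i j k * (u $ i * u $ j * u $ k))
      + 3 * (u \<bullet> u) * (T i j k * (u $ i * mom2 j k + u $ j * mom2 i k + u $ k * mom2 i j)))"
    unfolding cub_cube[symmetric, abs_def] L2_prod_cub cube_moment
    by (intro arg_cong[of _ _ "\<lambda>z. 2 * z"] sum.cong refl) (simp add: algebra_simps)
  also have "\<dots> = 2 * (6 * cub T u + 3 * (u \<bullet> u) * (\<Sum>k\<in>UNIV. tr T k * u $ k))"
    unfolding sum_trace[symmetric] cub_def by (simp only: sum.distrib sum_distrib_left)
  finally show ?thesis by simp
qed

text \<open>For trace-free \<open>T\<close> this is the orthogonality of harmonic cubics to the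
  multiples of the squared norm.\<close>

lemma L2_prod_radial:
  "L2_prod (cub T) (\<lambda>x. (norm x)\<^sup>2 * (u \<bullet> x)) = 16 * (\<Sum>k\<in>UNIV. tr T k * u $ k)"
proof -
  have "L2_prod (cub T) (\<lambda>x. (norm x)\<^sup>2 * (u \<bullet> x)) = 2 * (\<Sum>i\<in>UNIV. \<Sum>j\<in>UNIV. \<Sum>k\<in>UNIV.
      8 * (T i j k * (u $ i * mom2 j k + u $ j * mom2 i k + u $ k * mom2 i j)))"
    unfolding cub_radial[symmetric, abs_def] L2_prod_cub radial_moment
    by (intro arg_cong[of _ _ "\<lambda>z. 2 * z"] sum.cong refl) simp
  also have "\<dots> = 2 * (8 * (\<Sum>k\<in>UNIV. tr T k * u $ k))"
    unfolding sum_trace[symmetric] by (simp only: sum_distrib_left)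
  finally show ?thesis by simp
qed

lemma tr_radial: "tr (\<lambda>i j k. if i = j then u $ k else 0) k = 6 * u $ k" for u :: "real ^ 4"
proof -
  have "tr (\<lambda>i j k. if i = j then u $ k else 0) k = (\<Sum>i\<in>(UNIV :: 4 set). u $ k + (if i = k then u $ i else 0) + (if k = i then u $ i else 0))"
    by (simp add: tr_def)
  also have "\<dots> = 6 * u $ k" by (simp add: sum.distrib)
  finally show ?thesis .
qed

lemma L2_prod_combination:
  assumes "finite A"
  shows "L2_prod (cub T) (\<lambda>x. \<Sum>a\<in>A. c a * cub (U a) x) = (\<Sum>a\<in>A. c a * L2_prod (cub T) (cub (U a)))"
proof -
  have "has_bochner_integral lborel (\<lambda>x. \<Sum>a\<in>A. c a * (cub T x * cub (U a) x * exp (- (norm x)\<^sup>2 / 2)))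
    (\<Sum>a\<in>A. c a * (\<integral>x. cub T x * cub (U a) x * exp (- (norm x)\<^sup>2 / 2) \<partial>lborel))"
    by (intro has_bochner_integral_sum has_bochner_integral_mult_right)
       (use cubic_pairing in \<open>simp add: has_bochner_integral_iff\<close>)
  then have "(\<integral>x. (\<Sum>a\<in>A. c a * (cub T x * cub (U a) x * exp (- (norm x)\<^sup>2 / 2))) \<partial>lborel)
    = (\<Sum>a\<in>A. c a * (\<integral>x. cub T x * cub (U a) x * exp (- (norm x)\<^sup>2 / 2) \<partial>lborel))"
    by (rule has_bochner_integral_integral_eq)
  moreover have "(\<Sum>a\<in>A. c a * (cub T x * cub (U a) x * exp (- (norm x)\<^sup>2 / 2))) = cub T x * (\<Sum>a\<in>A. c a * cub (U a) x) * exp (- (norm x)\<^sup>2 / 2)" for x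
    by (simp add: sum_distrib_left sum_distrib_right mult_ac)
  ultimately show ?thesis unfolding L2_prod_def by (simp add: sum_distrib_left mult_ac)
qed

lemma sum_axis: "(\<Sum>i\<in>UNIV. axis a 1 $ i * f i) = (f a :: real)" for f :: "'n::finite \<Rightarrow> real"
proof -
  have "(\<Sum>i\<in>UNIV. axis a 1 $ i * f i) = (\<Sum>i\<in>UNIV. if i = a then f i else 0)"
    by (intro sum.cong) (auto simp: axis_def)
  then show ?thesis by simp
qed

lemma partial_deriv_cub:
  "partial_deriv a (cub T) x = (\<Sum>j\<in>UNIV. \<Sum>k\<in>UNIV. (T a j k + T j a k + T j k a) * (x $ j * x $ k))"
proof -
  define v :: "real ^ 4" where "v = axis a 1"
  have "((\<lambda>t. \<Sum>i\<in>UNIV. \<Sum>j\<in>UNIV. \<Sum>k\<in>UNIV. T i j k * ((x $ i + t * v $ i) * (x $ j + t * v $ j) * (x $ k + t * v $ k))) has_real_derivative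
      (\<Sum>i\<in>UNIV. \<Sum>j\<in>UNIV. \<Sum>k\<in>UNIV. T i j k * (v $ i * x $ j * x $ k + x $ i * v $ j * x $ k + x $ i * x $ j * v $ k))) (at 0)"
  proof (intro DERIV_sum)
    fix i j k
    show "((\<lambda>t. T i j k * ((x $ i + t * v $ i) * (x $ j + t * v $ j) * (x $ k + t * v $ k))) has_real_derivative
       T i j k * (v $ i * x $ j * x $ k + x $ i * v $ j * x $ k + x $ i * x $ j * v $ k)) (at 0)"
      by (auto intro!: derivative_eq_intros simp: algebra_simps)
  qed
  then have "partial_deriv a (cub T) x = (\<Sum>i\<in>UNIV. \<Sum>j\<in>UNIV. \<Sum>k\<in>UNIV. T i j k * (v $ i * x $ j * x $ k + x $ i * v $ j * x $ k + x $ i * x $ j * v $ k))"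
    unfolding partial_deriv_def cub_def v_def[symmetric] by (intro DERIV_imp_deriv) simp
  also have "\<dots> = (\<Sum>i\<in>UNIV. v $ i * (\<Sum>j\<in>UNIV. \<Sum>k\<in>UNIV. T i j k * (x $ j * x $ k)))
     + (\<Sum>i\<in>UNIV. \<Sum>j\<in>UNIV. v $ j * (\<Sum>k\<in>UNIV. T i j k * (x $ i * x $ k)))
     + (\<Sum>i\<in>UNIV. \<Sum>j\<in>UNIV. \<Sum>k\<in>UNIV. v $ k * (T i j k * (x $ i * x $ j)))"
    by (simp add: sum.distrib[symmetric] sum_distrib_left algebra_simps)
  also have "\<dots> = (\<Sum>j\<in>UNIV. \<Sum>k\<in>UNIV. (T a j k + T j a k + T j k a) * (x $ j * x $ k))"
    unfolding v_def sum_axis by (simp add: sum.distrib distrib_right)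
  finally show ?thesis .
qed

lemma partial_deriv_quadratic:
  "partial_deriv a (\<lambda>x. \<Sum>j\<in>UNIV. \<Sum>k\<in>UNIV. B j k * (x $ j * x $ k)) x = (\<Sum>k\<in>UNIV. (B a k + B k a) * x $ k)"
proof -
  define v :: "real ^ 4" where "v = axis a 1"
  have "((\<lambda>t. \<Sum>j\<in>UNIV. \<Sum>k\<in>UNIV. B j k * ((x $ j + t * v $ j) * (x $ k + t * v $ k))) has_real_derivative
      (\<Sum>j\<in>UNIV. \<Sum>k\<in>UNIV. B j k * (v $ j * x $ k + x $ j * v $ k))) (at 0)"
  proof (intro DERIV_sum)
    fix j k
    show "((\<lambda>t. B j k * ((x $ j + t * v $ j) * (x $ k + t * v $ k))) has_real_derivative
       B j k * (v $ j * x $ k + x $ j * v $ k)) (at 0)"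
      by (auto intro!: derivative_eq_intros simp: algebra_simps)
  qed
  then have "partial_deriv a (\<lambda>x. \<Sum>j\<in>UNIV. \<Sum>k\<in>UNIV. B j k * (x $ j * x $ k)) x = (\<Sum>j\<in>UNIV. \<Sum>k\<in>UNIV. B j k * (v $ j * x $ k + x $ j * v $ k))"
    unfolding partial_deriv_def v_def[symmetric] by (intro DERIV_imp_deriv) simp
  also have "\<dots> = (\<Sum>j\<in>UNIV. v $ j * (\<Sum>k\<in>UNIV. B j k * x $ k)) + (\<Sum>j\<in>UNIV. \<Sum>k\<in>UNIV. v $ k * (B j k * x $ j))"
    by (simp add: sum.distrib[symmetric] sum_distrib_left algebra_simps)
  also have "\<dots> = (\<Sum>k\<in>UNIV. (B a k + B k a) * x $ k)"
    unfolding v_def sum_axis by (simp add: sum.distrib distrib_right)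
  finally show ?thesis .
qed

lemma laplacian_cub: "laplacian (cub T) x = 2 * (\<Sum>k\<in>UNIV. tr T k * x $ k)"
proof -
  have "laplacian (cub T) x = (\<Sum>a\<in>UNIV. \<Sum>k\<in>UNIV. ((T a a k + T a a k + T a k a) + (T a k a + T k a a + T k a a)) * x $ k)"
    unfolding laplacian_def partial_deriv_cub[abs_def] partial_deriv_quadratic ..
  also have "\<dots> = (\<Sum>k\<in>UNIV. \<Sum>a\<in>UNIV. 2 * ((T a a k + T a k a + T k a a) * x $ k))"
    by (subst sum.swap) (simp add: algebra_simps)
  also have "\<dots> = 2 * (\<Sum>k\<in>UNIV. tr T k * x $ k)"
    unfolding tr_def sum_distrib_left sum_distrib_right ..
  finally show ?thesis .
qed

lemma harmonic_poly_3_iff: "f \<in> harmonic_poly 3 \<longleftrightarrow> (\<exists>T. f = cub T \<and> (\<forall>k. tr T k = 0))"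
proof
  assume f: "f \<in> harmonic_poly 3"
  then have "cubic_form f" using hom_poly_3_imp_cubic_form by (simp add: harmonic_poly_def)
  then obtain T where T: "f = cub T" unfolding cubic_form_def cub_def[abs_def] by blast
  have "tr T k = 0" for k
  proof -
    have "0 = laplacian f (axis k 1)" using f by (simp add: harmonic_poly_def)
    also have "\<dots> = 2 * (\<Sum>i\<in>UNIV. axis k 1 $ i * tr T i)"
      unfolding T laplacian_cub by (simp add: mult.commute)
    finally show ?thesis by (simp add: sum_axis)
  qed
  with T show "\<exists>T. f = cub T \<and> (\<forall>k. tr T k = 0)" by blast
next
  assume "\<exists>T. f = cub T \<and> (\<forall>k. tr T k = 0)"
  then obtain T where T: "f = cub T" "\<And>k. tr T k = 0" by blast
  have "cubic_form f" unfolding T(1) cubic_form_def cub_def by blast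
  then have "f \<in> hom_poly 3" by (simp add: cubic_form_iff_hom_poly)
  then show "f \<in> harmonic_poly 3" by (simp add: harmonic_poly_def T laplacian_cub)
qed

lemma linear_in_harmonic_poly: "(\<lambda>x. a \<bullet> x) \<in> harmonic_poly 1"
proof -
  have "partial_deriv i (\<lambda>x. a \<bullet> x) = (\<lambda>x. a $ i)" for i
  proof
    fix x
    have "((\<lambda>t. a \<bullet> (x + t *\<^sub>R axis i 1)) has_real_derivative a $ i) (at 0)"
      by (auto intro!: derivative_eq_intros simp: inner_add_right inner_axis)
    then show "partial_deriv i (\<lambda>x. a \<bullet> x) x = a $ i" unfolding partial_deriv_def by (rule DERIV_imp_deriv)
  qed
  moreover have "partial_deriv i (\<lambda>x. c) x = 0" for i c x by (simp add: partial_deriv_def)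
  ultimately have "laplacian (\<lambda>x. a \<bullet> x) x = 0" for x unfolding laplacian_def by simp
  then show ?thesis
    unfolding harmonic_poly_def using linear_in_hom_poly[of a] by simp
qed

text \<open>The harmonic part \<open>cub U\<close> of a multiple of
  \<open>(x \<bullet> z) ^ 3\<close> represents evaluation at \<open>x\<close>. Its coefficients in
  the orthonormal basis are therefore the values \<open>H3 i x\<close>, and the kernel is its
  expansion.\<close>

lemma harmonic_3_kernel:
  assumes basis: "fun_basis (harmonic_poly 3) H3" and orth: "L2_orthonormal H3"
  shows "(\<Sum>j\<in>UNIV. H3 j x * H3 j y) = ((x \<bullet> y) ^ 3 - (x \<bullet> x) * (y \<bullet> y) * (x \<bullet> y) / 2) / 12"
proof -
  have "H3 j \<in> harmonic_poly 3" for j using basis by (simp add: fun_basis_def)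
  then have "\<forall>j. \<exists>T. H3 j = cub T \<and> (\<forall>k. tr T k = 0)" unfolding harmonic_poly_3_iff by blast
  then obtain T where T: "\<And>j. H3 j = cub (T j)" "\<And>j k. tr (T j) k = 0" by metis
  \<comment> \<open>1/12 inverts the factor of \<open>L2_prod_cube\<close> on trace-free tensors.
    The term with 1/24 removes the trace: the cube has trace \<open>3 * (x \<bullet> x)\<close>
    times \<open>x\<close>, the radial tensor 6 times \<open>x\<close>.\<close>
  define U where "U i j k = 1 / 12 * (x $ i * x $ j * x $ k) + (- (x \<bullet> x) / 24) * (if i = j then x $ k else 0)" for i j k
  have cU: "cub U z = ((x \<bullet> z) ^ 3 - (x \<bullet> x) * (z \<bullet> z) * (x \<bullet> z) / 2) / 12" for z
  proof -
    have "cub U z = 1 / 12 * cub (\<lambda>i j k. x $ i * x $ j * x $ k) z + (- (x \<bullet> x) / 24) * cub (\<lambda>i j k. if i = j then x $ k else 0) z"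
      unfolding cub_def U_def by (simp only: sum_distrib_left sum.distrib[symmetric] distrib_right mult.assoc)
    then show ?thesis unfolding cub_cube cub_radial by (simp add: power2_norm_eq_inner field_simps)
  qed
  have "tr U k = 0" for k
  proof -
    have "tr U k = 1 / 12 * tr (\<lambda>i j k. x $ i * x $ j * x $ k) k + (- (x \<bullet> x) / 24) * tr (\<lambda>i j k. if i = j then x $ k else 0) k"
      unfolding tr_def U_def sum_distrib_left sum.distrib[symmetric] by (intro sum.cong refl) (simp only: distrib_left add_ac)
    moreover have "tr (\<lambda>i j k. x $ i * x $ j * x $ k) k = 3 * (x \<bullet> x) * x $ k"
      unfolding tr_def inner_sum_eq sum_distrib_left sum_distrib_right by (intro sum.cong refl) simp
    ultimately show ?thesis unfolding tr_radial by simp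
  qed
  then have "cub U \<in> harmonic_poly 3" unfolding harmonic_poly_3_iff by blast
  then obtain c where c: "cub U = (\<lambda>z. \<Sum>j\<in>UNIV. c j * H3 j z)"
    using basis unfolding fun_basis_def by blast
  have "c i = H3 i x" for i
  proof -
    have "L2_prod (cub (T i)) (cub U) = (\<Sum>j\<in>UNIV. c j * L2_prod (cub (T i)) (cub (T j)))"
      unfolding c T(1) by (rule L2_prod_combination) simp
    also have "\<dots> = (\<Sum>j\<in>UNIV. if i = j then c j else 0)"
      using orth unfolding L2_orthonormal_def T(1) by (intro sum.cong refl) simp
    finally have "c i = L2_prod (cub (T i)) (cub U)" by simp
    \<comment> \<open>The combination of two tensors is written as a sum over \<open>bool\<close>,
      the form required by \<open>L2_prod_combination\<close>.\<close>
    also have "cub U = (\<lambda>z. \<Sum>b\<in>UNIV. (if b then 1 / 12 else - (x \<bullet> x) / 24) * cub (if b then (\<lambda>i j k. x $ i * x $ j * x $ k) else (\<lambda>i j k. if i = j then x $ k else 0)) z)"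
    proof
      fix z
      show "cub U z = (\<Sum>b\<in>UNIV. (if b then 1 / 12 else - (x \<bullet> x) / 24) * cub (if b then (\<lambda>i j k. x $ i * x $ j * x $ k) else (\<lambda>i j k. if i = j then x $ k else 0)) z)"
        unfolding cU by (simp only: UNIV_bool sum.insert finite.intros insert_iff empty_iff simp_thms sum.empty if_True if_False bool_simps cub_cube cub_radial power2_norm_eq_inner)
          (simp add: field_simps)
    qed
    also have "L2_prod (cub (T i)) \<dots> = (\<Sum>b\<in>UNIV. (if b then 1 / 12 else - (x \<bullet> x) / 24) * L2_prod (cub (T i)) (cub (if b then (\<lambda>i j k. x $ i * x $ j * x $ k) else (\<lambda>i j k. if i = j then x $ k else 0))))"
      by (rule L2_prod_combination) simp
    also have "\<dots> = 1 / 12 * L2_prod (cub (T i)) (\<lambda>z. (x \<bullet> z) ^ 3) + (- (x \<bullet> x) / 24) * L2_prod (cub (T i)) (\<lambda>z. (norm z)\<^sup>2 * (x \<bullet> z))"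
      unfolding UNIV_bool by (simp add: cub_cube[abs_def] cub_radial[abs_def])
    also have "\<dots> = H3 i x" unfolding L2_prod_cube L2_prod_radial by (simp add: T)
    finally show ?thesis .
  qed
  then have "cub U y = (\<Sum>j\<in>UNIV. H3 j x * H3 j y)" unfolding c by simp
  then show ?thesis unfolding cU ..
qed

text \<open>Expanding the linear form with vector \<open>x\<close> in the basis and pairing with
  \<open>H1 i\<close> after multiplication by the squared norm gives the coefficient
  \<open>96 * H1 i x\<close>. Here 96 = 16 * 6, the factor of \<open>L2_prod_radial\<close> times
  the trace of the radial tensor.\<close>

lemma harmonic_1_kernel:
  assumes basis: "fun_basis (harmonic_poly 1) H1" and orth: "L2_orthonormal (\<lambda>j x. (norm x)\<^sup>2 * H1 j x)"
  shows "(\<Sum>j\<in>UNIV. H1 j x * H1 j y) = (x \<bullet> y) / 96"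
proof -
  have "\<exists>a. \<forall>z. H1 j z = a \<bullet> z" for j
  proof -
    have "H1 j \<in> hom_poly 1" using basis by (simp add: fun_basis_def harmonic_poly_def)
    then show ?thesis by (rule hom_poly_1_imp_linear) blast
  qed
  then obtain a where a: "\<And>j z. H1 j z = a j \<bullet> z" by metis
  define R where "R u = (\<lambda>(i::4) (j::4) (k::4). if i = j then u $ k else (0 :: real))" for u :: "real ^ 4"
  have R: "(\<lambda>z. (norm z)\<^sup>2 * (u \<bullet> z)) = cub (R u)" for u
    unfolding R_def using cub_radial[of u] by (simp add: fun_eq_iff)
  obtain c where c: "(\<lambda>z. x \<bullet> z) = (\<lambda>z. \<Sum>j\<in>UNIV. c j * H1 j z)"
    using basis linear_in_harmonic_poly[of x] unfolding fun_basis_def by blast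
  have "c i = 96 * H1 i x" for i
  proof -
    have "(\<lambda>z. (norm z)\<^sup>2 * (x \<bullet> z)) = (\<lambda>z. \<Sum>j\<in>UNIV. c j * cub (R (a j)) z)"
    proof
      fix z
      have "(norm z)\<^sup>2 * (x \<bullet> z) = (\<Sum>j\<in>UNIV. c j * ((norm z)\<^sup>2 * H1 j z))"
        using fun_cong[OF c, of z] by (simp add: sum_distrib_left mult_ac)
      then show "(norm z)\<^sup>2 * (x \<bullet> z) = (\<Sum>j\<in>UNIV. c j * cub (R (a j)) z)"
        by (simp add: R[symmetric] a)
    qed
    then have "L2_prod (cub (R (a i))) (\<lambda>z. (norm z)\<^sup>2 * (x \<bullet> z)) = (\<Sum>j\<in>UNIV. c j * L2_prod (cub (R (a i))) (cub (R (a j))))"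
      by (simp add: L2_prod_combination)
    also have "\<dots> = (\<Sum>j\<in>UNIV. if i = j then c j else 0)"
      using orth unfolding L2_orthonormal_def a R by (intro sum.cong refl) simp
    finally have "c i = L2_prod (cub (R (a i))) (\<lambda>z. (norm z)\<^sup>2 * (x \<bullet> z))" by simp
    also have "\<dots> = 96 * H1 i x"
      unfolding L2_prod_radial by (simp add: R_def tr_radial a inner_vec_def sum_distrib_left)
    finally show ?thesis .
  qed
  then have "x \<bullet> y = 96 * (\<Sum>j\<in>UNIV. H1 j x * H1 j y)"
    using fun_cong[OF c, of y] by (simp add: sum_distrib_left mult_ac)
  then show ?thesis by simp
qed

section \<open>The expected number of lines\<close>

lemma gaussian_density_prod:
  fixes x :: "'a::euclidean_space"
  shows "exp (- (norm x)\<^sup>2 / 2) / sqrt (2 * pi) ^ DIM('a) = (\<Prod>b\<in>Basis. std_normal_density (x \<bullet> b))"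
proof -
  have "(norm x)\<^sup>2 = (\<Sum>b\<in>Basis. (x \<bullet> b)\<^sup>2)"
    unfolding power2_norm_eq_inner unfolding power2_eq_square by (rule euclidean_inner)
  then have "exp (- (norm x)\<^sup>2 / 2) = (\<Prod>b\<in>Basis. exp (- (x \<bullet> b)\<^sup>2 / 2))"
    by (simp add: exp_sum[symmetric] sum_negf sum_divide_distrib)
  then show ?thesis
    by (simp add: std_normal_density_def prod_dividef)
qed

text \<open>Both measures agree on boxes, where independence and the product form of the density
  give the same product of one-dimensional probabilities; boxes generate the Borel sets and are
  stable under intersection.\<close>

lemma (in prob_space) gaussian_vector_law:
  fixes X :: "'i::finite \<Rightarrow> 'a \<Rightarrow> real" and bb :: "'i \<Rightarrow> 'b::euclidean_space"
  assumes gauss: "\<And>i. distributed M lborel (X i) std_normal_density"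
    and indep: "indep_vars (\<lambda>_. borel) X UNIV"
    and bb: "bij_betw bb UNIV Basis"
  shows "(\<lambda>\<omega>. \<Sum>i\<in>UNIV. X i \<omega> *\<^sub>R bb i) \<in> borel_measurable M"
    and "distr M borel (\<lambda>\<omega>. \<Sum>i\<in>UNIV. X i \<omega> *\<^sub>R bb i)
      = density lborel (\<lambda>x. ennreal (exp (- (norm x)\<^sup>2 / 2) / sqrt (2 * pi) ^ DIM('b)))"
proof -
  define Y where "Y = (\<lambda>\<omega>. \<Sum>i\<in>UNIV. X i \<omega> *\<^sub>R bb i)"
  have X[measurable]: "X i \<in> borel_measurable M" for i
    using distributed_measurable[OF gauss[of i]] by simp
  show Ym: "(\<lambda>\<omega>. \<Sum>i\<in>UNIV. X i \<omega> *\<^sub>R bb i) \<in> borel_measurable M" by measurable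
  have Ym'[measurable]: "Y \<in> borel_measurable M" using Ym by (simp add: Y_def)
  have Yb: "Y \<omega> \<bullet> bb i = X i \<omega>" for \<omega> i
  proof -
    have "bb j \<bullet> bb i = (if j = i then 1 else 0)" for j
    proof -
      have "bb j \<in> Basis" "bb i \<in> Basis" using bb by (auto simp: bij_betw_def)
      then show ?thesis using bb by (auto simp: inner_Basis bij_betw_def inj_on_def)
    qed
    then have "Y \<omega> \<bullet> bb i = (\<Sum>j\<in>UNIV. if j = i then X j \<omega> else 0)"
      unfolding Y_def inner_sum_left inner_scaleR_left by (intro sum.cong refl) simp
    then show ?thesis by simp
  qed
  define D where "D = density lborel (\<lambda>x :: 'b. ennreal (exp (- (norm x)\<^sup>2 / 2) / sqrt (2 * pi) ^ DIM('b)))"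
  have main: "emeasure (distr M borel Y) (box l u) = emeasure D (box l u)" for l u
  proof -
    define f where "f b x = ennreal (std_normal_density x) * indicator {l \<bullet> b <..< u \<bullet> b} x" for b and x :: real
    have box: "Y -` box l u \<inter> space M = (\<Inter>i\<in>UNIV. X i -` {l \<bullet> bb i <..< u \<bullet> bb i} \<inter> space M)"
    proof -
      have "Y \<omega> \<in> box l u \<longleftrightarrow> (\<forall>i. X i \<omega> \<in> {l \<bullet> bb i <..< u \<bullet> bb i})" for \<omega>
      proof -
        have "Y \<omega> \<in> box l u \<longleftrightarrow> (\<forall>b\<in>range bb. l \<bullet> b < Y \<omega> \<bullet> b \<and> Y \<omega> \<bullet> b < u \<bullet> b)"
          using bb by (simp add: box_def bij_betw_def)
        then show ?thesis by (simp add: Yb)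
      qed
      then show ?thesis by auto
    qed
    have fi: "emeasure M (X i -` {l \<bullet> bb i <..< u \<bullet> bb i} \<inter> space M) = (\<integral>\<^sup>+x. f (bb i) x \<partial>lborel)" for i
      unfolding f_def using distributed_emeasure[OF gauss[of i], of "{l \<bullet> bb i <..< u \<bullet> bb i}"] by simp
    have "emeasure (distr M borel Y) (box l u) = emeasure M (\<Inter>i\<in>UNIV. X i -` {l \<bullet> bb i <..< u \<bullet> bb i} \<inter> space M)"
      by (simp add: emeasure_distr box)
    also have "\<dots> = ennreal (\<Prod>i\<in>UNIV. prob (X i -` {l \<bullet> bb i <..< u \<bullet> bb i} \<inter> space M))"
      using indep_varsD[OF indep, of UNIV "\<lambda>i. {l \<bullet> bb i <..< u \<bullet> bb i}"] by (simp add: emeasure_eq_measure)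
    also have "\<dots> = (\<Prod>i\<in>UNIV. \<integral>\<^sup>+x. f (bb i) x \<partial>lborel)"
      unfolding fi[symmetric] emeasure_eq_measure by (simp add: prod_ennreal)
    also have "\<dots> = (\<Prod>b\<in>Basis. \<integral>\<^sup>+x. f b x \<partial>lborel)"
      using prod.reindex_bij_betw[OF bb, of "\<lambda>b. \<integral>\<^sup>+x. f b x \<partial>lborel"] .
    also have "\<dots> = (\<integral>\<^sup>+x. (\<Prod>b\<in>Basis. f b (x \<bullet> b)) \<partial>lborel)"
      by (rule nn_integral_lborel_prod[symmetric]) (auto simp: f_def)
    also have "\<dots> = (\<integral>\<^sup>+x. ennreal (exp (- (norm x)\<^sup>2 / 2) / sqrt (2 * pi) ^ DIM('b)) * indicator (box l u) x \<partial>lborel)"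
    proof (rule nn_integral_cong)
      fix x :: 'b
      have "(\<Prod>b\<in>Basis. indicator {l \<bullet> b <..< u \<bullet> b} (x \<bullet> b) :: ennreal) = indicator (box l u) x"
      proof (cases "x \<in> box l u")
        case True
        then show ?thesis by (simp add: box_def)
      next
        case False
        then obtain b where "b \<in> Basis" "x \<bullet> b \<notin> {l \<bullet> b <..< u \<bullet> b}" by (auto simp: box_def)
        then have "(\<Prod>b\<in>Basis. indicator {l \<bullet> b <..< u \<bullet> b} (x \<bullet> b) :: ennreal) = 0"
          by (intro prod_zero bexI[of _ b]) (simp_all add: indicator_def)
        then show ?thesis using False by simp
      qed
      then show "(\<Prod>b\<in>Basis. f b (x \<bullet> b)) = ennreal (exp (- (norm x)\<^sup>2 / 2) / sqrt (2 * pi) ^ DIM('b)) * indicator (box l u) x"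
        unfolding f_def prod.distrib gaussian_density_prod by (simp add: prod_ennreal)
    qed
    also have "\<dots> = emeasure D (box l u)" unfolding D_def by (subst emeasure_density) auto
    finally show ?thesis .
  qed
  have "distr M borel Y = D"
  proof (rule measure_eqI_generator_eq)
    let ?E = "range (\<lambda>(a, b). box a b::'b set)"
    show "Int_stable ?E" by (auto simp: Int_stable_def box_Int_box)
    show "?E \<subseteq> Pow UNIV" "sets (distr M borel Y) = sigma_sets UNIV ?E" "sets D = sigma_sets UNIV ?E"
      by (simp_all add: borel_eq_box D_def)
    let ?A = "\<lambda>n::nat. box (- (real n *\<^sub>R One)) (real n *\<^sub>R One) :: 'b set"
    show "range ?A \<subseteq> ?E" "(\<Union>i. ?A i) = UNIV" unfolding UN_box_eq_UNIV by auto
    show "emeasure (distr M borel Y) (?A i) \<noteq> \<infinity>" for i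
      by (simp add: emeasure_distr emeasure_eq_measure)
    show "emeasure (distr M borel Y) Z = emeasure D Z" if "Z \<in> ?E" for Z using that main by auto
  qed
  then show "distr M borel (\<lambda>\<omega>. \<Sum>i\<in>UNIV. X i \<omega> *\<^sub>R bb i)
      = density lborel (\<lambda>x. ennreal (exp (- (norm x)\<^sup>2 / 2) / sqrt (2 * pi) ^ DIM('b)))"
    unfolding Y_def D_def .
qed

lemma (in prob_space) gaussian_pair_law:
  fixes \<xi> :: "'m::finite \<Rightarrow> 'a \<Rightarrow> real" and \<zeta> :: "'n::finite \<Rightarrow> 'a \<Rightarrow> real"
  assumes "\<And>j. distributed M lborel (\<xi> j) std_normal_density" "\<And>j. distributed M lborel (\<zeta> j) std_normal_density"
    and indep: "indep_vars (\<lambda>_. borel) (case_sum \<xi> \<zeta>) UNIV"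
  shows "(\<lambda>\<omega>. (\<chi> j. \<zeta> j \<omega>, \<chi> j. \<xi> j \<omega>)) \<in> borel_measurable M"
    and "distr M borel (\<lambda>\<omega>. (\<chi> j. \<zeta> j \<omega>, \<chi> j. \<xi> j \<omega>))
      = density lborel (\<lambda>x :: (real ^ 'n) \<times> (real ^ 'm). ennreal (exp (- (norm x)\<^sup>2 / 2) / sqrt (2 * pi) ^ DIM((real ^ 'n) \<times> (real ^ 'm))))"
proof -
  define bb :: "'m + 'n \<Rightarrow> (real ^ 'n) \<times> (real ^ 'm)" where "bb = case_sum (\<lambda>j. (0, axis j 1)) (\<lambda>j. (axis j 1, 0))"
  have "inj bb"
    by (auto simp: inj_on_def bb_def axis_eq_axis split: sum.splits)
  moreover have "range bb = Basis"
    by (auto simp: bb_def UNIV_sum image_Un image_image Basis_prod_def Basis_vec_def)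
  ultimately have bb: "bij_betw bb UNIV Basis" by (simp add: bij_betw_def)
  have eq: "(\<lambda>\<omega>. \<Sum>i\<in>UNIV. case_sum \<xi> \<zeta> i \<omega> *\<^sub>R bb i) = (\<lambda>\<omega>. (\<chi> j. \<zeta> j \<omega>, \<chi> j. \<xi> j \<omega>))"
  proof
    fix \<omega>
    have ax: "(\<Sum>j\<in>UNIV. f j *\<^sub>R axis j (1::real)) = (\<chi> j. f j)" for f :: "'k::finite \<Rightarrow> real"
    proof -
      have "(\<Sum>j\<in>UNIV. f j *\<^sub>R axis j (1::real)) $ i = (\<Sum>j\<in>UNIV. if j = i then f j else 0)" for i
        unfolding sum_component by (rule sum.cong[OF refl]) (auto simp: axis_def)
      then show ?thesis by (simp add: vec_eq_iff)
    qed
    have "(\<Sum>i\<in>UNIV. case_sum \<xi> \<zeta> i \<omega> *\<^sub>R bb i)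
      = (\<Sum>j\<in>UNIV. \<xi> j \<omega> *\<^sub>R (0, axis j 1)) + (\<Sum>j\<in>UNIV. \<zeta> j \<omega> *\<^sub>R (axis j 1, 0))"
      unfolding UNIV_sum by (subst sum.union_disjoint) (auto simp: sum.reindex bb_def)
    then show "(\<Sum>i\<in>UNIV. case_sum \<xi> \<zeta> i \<omega> *\<^sub>R bb i) = (\<chi> j. \<zeta> j \<omega>, \<chi> j. \<xi> j \<omega>)"
      by (simp add: prod_eq_iff fst_sum snd_sum ax)
  qed
  have g: "distributed M lborel (case_sum \<xi> \<zeta> i) std_normal_density" for i
    by (cases i) (simp_all add: assms)
  show "(\<lambda>\<omega>. (\<chi> j. \<zeta> j \<omega>, \<chi> j. \<xi> j \<omega>)) \<in> borel_measurable M"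
    "distr M borel (\<lambda>\<omega>. (\<chi> j. \<zeta> j \<omega>, \<chi> j. \<xi> j \<omega>))
      = density lborel (\<lambda>x :: (real ^ 'n) \<times> (real ^ 'm). ennreal (exp (- (norm x)\<^sup>2 / 2) / sqrt (2 * pi) ^ DIM((real ^ 'n) \<times> (real ^ 'm))))"
    using gaussian_vector_law[OF g indep bb] unfolding eq by blast+
qed

section \<open>Schubert cells: measurability and rotated charts\<close>

lemma less_4': "(0::4) < 1" "(1::4) < 2" "(2::4) < 3"
  by (simp_all add: less_bit0_def bit0.Rep_0 bit0.Rep_1 bit0.Rep_numeral)

text \<open>Reduced bases with given pivots form a closed set, and by the four-point criterion
  vanishing on the span is a closed condition on basis and coefficients jointly.\<close>

lemma cell_measurable:
  fixes \<phi> :: "real ^ 4 \<Rightarrow> 'b::euclidean_space"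
  assumes cub: "\<And>\<xi>. cubic_form (\<lambda>x. \<xi> \<bullet> \<phi> x)" and cont: "continuous_on UNIV \<phi>"
  shows "(\<lambda>\<xi>. ecard {(v, w). rref i j v w \<and> (\<forall>x\<in>span {v, w}. \<xi> \<bullet> \<phi> x = 0)}) \<in> borel_measurable borel"
proof -
  define S where "S = {p :: (real ^ 4) \<times> (real ^ 4). rref i j (fst p) (snd p)}"
  define Z where "Z = {q :: ((real ^ 4) \<times> (real ^ 4)) \<times> 'b. snd q \<bullet> \<phi> (fst (fst q)) = 0 \<and> snd q \<bullet> \<phi> (snd (fst q)) = 0 \<and>
    snd q \<bullet> \<phi> (fst (fst q) + snd (fst q)) = 0 \<and> snd q \<bullet> \<phi> (fst (fst q) - snd (fst q)) = 0}"
  have "closed S"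
    unfolding S_def rref_def
    by (intro closed_Collect_conj closed_Collect_all closed_Collect_imp closed_Collect_eq open_Collect_const closed_Collect_const continuous_intros)
  then have S: "fsigma S" by (rule fsigma_closed)
  have c: "continuous_on UNIV (\<lambda>q. \<phi> (f q))" if "continuous_on UNIV f" for f :: "((real ^ 4) \<times> (real ^ 4)) \<times> 'b \<Rightarrow> real ^ 4"
    by (rule continuous_on_compose2[OF cont that]) simp
  have "closed Z"
    unfolding Z_def by (intro closed_Collect_conj closed_Collect_eq continuous_intros c)
  have "{(v, w). rref i j v w \<and> (\<forall>x\<in>span {v, w}. \<xi> \<bullet> \<phi> x = 0)} = {p \<in> S. (p, \<xi>) \<in> Z}" for \<xi>
    unfolding cubic_form_vanishes_iff[OF cub] by (auto simp: S_def Z_def)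
  then show ?thesis using borel_measurable_ecard_section[OF S \<open>closed Z\<close>] by simp
qed

lemma num_lines_measurable:
  fixes \<phi> :: "real ^ 4 \<Rightarrow> 'b::euclidean_space"
  assumes cub: "\<And>\<xi>. cubic_form (\<lambda>x. \<xi> \<bullet> \<phi> x)" and cont: "continuous_on UNIV \<phi>"
  shows "(\<lambda>\<xi>. num_lines (\<lambda>x. \<xi> \<bullet> \<phi> x)) \<in> borel_measurable borel"
  unfolding num_lines_eq_rref
proof (intro borel_measurable_sum)
  fix p :: "4 \<times> 4"
  obtain i j where p: "p = (i, j)" by (metis surj_pair)
  show "(\<lambda>\<xi>. case p of (i, j) \<Rightarrow> ecard {(v, w). rref i j v w \<and> (\<forall>x\<in>span {v, w}. \<xi> \<bullet> \<phi> x = 0)}) \<in> borel_measurable borel"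
    unfolding p prod.case by (rule cell_measurable[OF cub cont])
qed

text \<open>For every pivot pair except (0, 1) some non-pivot column precedes the second pivot, and
  in that column the second row of a reduced basis must be zero.\<close>

lemma complementary_pair:
  fixes i j :: 4
  assumes "i < j"
  obtains k l where "UNIV = {i, j, k, l}" "distinct [i, j, k, l]" "(i, j) \<noteq> (0, 1) \<Longrightarrow> k < j \<or> l < j"
proof -
  have "card (UNIV - {i, j}) = 2" using assms by (simp add: card_Diff_subset)
  then obtain k l where kl: "UNIV - {i, j} = {k, l}" "k \<noteq> l" by (auto simp: card_2_iff)
  have eq: "UNIV = {i, j, k, l}" using kl(1) by blast
  have dist: "distinct [i, j, k, l]" using kl assms by auto
  have lt: "(0::4) < 2" "(1::4) < 3" "(0::4) < 3" using less_4' by (meson less_trans)+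
  have "\<forall>i j :: 4. i < j \<longrightarrow> (\<forall>x. x < j \<longrightarrow> x = i) \<longrightarrow> (i, j) = (0, 1)"
    unfolding forall_4' using less_4' lt less_asym by auto
  moreover have "\<forall>x. x < j \<longrightarrow> x = i" if "\<not> k < j" "\<not> l < j"
  proof (intro allI impI)
    fix x assume "x < j"
    moreover have "x \<in> {i, j, k, l}" unfolding eq[symmetric] by simp
    ultimately show "x = i" using that by auto
  qed
  ultimately show thesis using that[OF eq dist] assms by blast
qed

text \<open>A permutation of the coordinates moves the pivot columns to places 0 and 1, so reduced
  bases become points of the chart. The free entries of the second row are \<open>A $ 1\<close> and
  \<open>A $ 3\<close>, one of which vanishes for the lower cells.\<close>

lemma rref_rows:
  fixes i j :: 4
  assumes ij: "i < j"
  obtains g where "isometry g" "\<And>v w. rref i j v w \<Longrightarrow> \<exists>A. g (row1 A) = v \<and> g (row2 A) = w \<and> ((i, j) \<noteq> (0, 1) \<longrightarrow> A $ 1 = 0 \<or> A $ 3 = 0)"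
proof -
  obtain k l where kl: "UNIV = {i, j, k, l}" "distinct [i, j, k, l]" "(i, j) \<noteq> (0, 1) \<Longrightarrow> k < j \<or> l < j"
    using complementary_pair[OF ij] by blast
  define g :: "real ^ 4 \<Rightarrow> real ^ 4" where "g x = (\<chi> r. if r = i then x $ 0 else if r = j then x $ 1 else if r = k then x $ 2 else x $ 3)" for x
  have gn: "g x $ i = x $ 0" "g x $ j = x $ 1" "g x $ k = x $ 2" "g x $ l = x $ 3" for x
    using kl(2) by (auto simp: g_def)
  have all: "(\<forall>r. Q r) \<longleftrightarrow> Q i \<and> Q j \<and> Q k \<and> Q l" for Q
    using kl(1) by (metis UNIV_I insert_iff singletonD)
  have "linear g"
    by (rule linearI) (simp_all add: vec_eq_iff all gn)
  moreover have "norm (g x) = norm x" for x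
  proof -
    have "g x \<bullet> g x = (\<Sum>r\<in>{i, j, k, l}. g x $ r * g x $ r)"
      unfolding inner_vec_def kl(1) by simp
    also have "\<dots> = x \<bullet> x" using kl(2) by (simp add: gn inner_4')
    finally show ?thesis by (simp add: norm_eq_sqrt_inner)
  qed
  ultimately have "isometry g" by (simp add: isometry_def)
  moreover have "\<exists>A. g (row1 A) = v \<and> g (row2 A) = w \<and> ((i, j) \<noteq> (0, 1) \<longrightarrow> A $ 1 = 0 \<or> A $ 3 = 0)"
    if r: "rref i j v w" for v w
  proof (intro exI conjI)
    let ?A = "vec4 (v $ k) (w $ k) (v $ l) (w $ l)"
    have vw: "v $ i = 1" "v $ j = 0" "w $ j = 1" "w $ i = 0" using r by (auto simp: rref_def)
    show "g (row1 ?A) = v" "g (row2 ?A) = w"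
      by (simp_all add: vec_eq_iff all gn vw row1_def row2_def)
    show "(i, j) \<noteq> (0, 1) \<longrightarrow> ?A $ 1 = 0 \<or> ?A $ 3 = 0"
      using kl(3) r by (auto simp: rref_def)
  qed
  ultimately show thesis using that by blast
qed

lemma rref_0_1: "rref 0 1 v w \<longleftrightarrow> (\<exists>A. v = row1 A \<and> w = row2 A)" for v w :: "real ^ 4"
proof
  assume "rref 0 1 v w"
  then have "v $ 0 = 1" "v $ 1 = 0" "w $ 1 = 1" "w $ 0 = 0" using less_4' by (auto simp: rref_def)
  then have "v = row1 (vec4 (v $ 2) (w $ 2) (v $ 3) (w $ 3)) \<and> w = row2 (vec4 (v $ 2) (w $ 2) (v $ 3) (w $ 3))"
    by (simp add: vec_eq_4' row1_def row2_def)
  then show "\<exists>A. v = row1 A \<and> w = row2 A" by blast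
next
  assume "\<exists>A. v = row1 A \<and> w = row2 A"
  then obtain A where "v = row1 A" "w = row2 A" by blast
  moreover have "\<not> 1 < (0 :: 4)" "\<not> 2 < (1 :: 4)" "\<not> 3 < (1 :: 4)" "\<not> 2 < (0 :: 4)" "\<not> 3 < (0 :: 4)"
    using less_4' by (meson less_asym less_trans)+
  ultimately show "rref 0 1 v w"
    by (simp add: rref_def row1_def row2_def less_4' forall_4')
qed

context invariant_feature_map
begin

lemma vanishes_on_chart_plane_iff:
  assumes "cubic_form (\<lambda>x. \<eta> \<bullet> \<phi> x)" "linear g" "\<And>x. \<zeta> \<bullet> e x = \<eta> \<bullet> \<phi> (g x)"
  shows "(\<forall>x\<in>span {g (row1 A), g (row2 A)}. \<eta> \<bullet> \<phi> x = 0) \<longleftrightarrow> (\<forall>i. \<zeta> \<bullet> e (pt i A) = 0)"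
  unfolding cubic_form_vanishes_iff[OF assms(1)] forall_4' assms(3) pt_def
  by (simp add: cs_def ct_def linear_add[OF assms(2)] linear_diff[OF assms(2)]) 

text \<open>The cell with pivots 0 and 1 is the whole chart and accounts for the entire value. The
  count in any other cell is at most the number of zeros of a rotated chart in the null set
  \<open>B\<close>, whose expectation is zero.\<close>

theorem expected_num_lines:
  fixes \<phi> :: "real ^ 4 \<Rightarrow> 'v::euclidean_space"
  assumes cub: "\<And>\<xi>. cubic_form (\<lambda>x. \<xi> \<bullet> \<phi> x)" and cont: "continuous_on UNIV \<phi>"
    and dim: "DIM('v) = CARD(20)" and gram: "\<And>x y. \<phi> x \<bullet> \<phi> y = e x \<bullet> e y"
    and \<rho>[measurable]: "\<rho> \<in> borel_measurable borel" and \<rho>0: "\<And>t. 0 \<le> \<rho> t"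
  shows "(\<integral>\<^sup>+\<xi>. num_lines (\<lambda>x. \<xi> \<bullet> \<phi> x) * ennreal (\<rho> (norm \<xi>)) \<partial>lborel)
    = ennreal (2 * pi\<^sup>2) * (ennreal (1 / (16 * c\<^sup>2 * k\<^sup>2)) * res_integral (\<lambda>\<eta>. \<rho> (norm \<eta>)))"
proof -
  define cell where "cell = (\<lambda>(i, j) \<xi>. ecard {(v, w). rref i j v w \<and> (\<forall>x\<in>span {v, w}. \<xi> \<bullet> \<phi> x = 0)})"
  have cm[measurable]: "cell p \<in> borel_measurable borel" for p
    using cell_measurable[OF cub cont, of "fst p" "snd p"] by (simp add: cell_def case_prod_beta')
  define r where "r = (\<lambda>\<eta> :: (real ^ 4) \<times> coeffs. \<rho> (norm \<eta>))"
  have r: "r \<in> borel_measurable borel" "\<And>\<eta>. 0 \<le> r \<eta>" "\<And>\<eta> \<zeta>. norm \<eta> = norm \<zeta> \<Longrightarrow> r \<eta> = r \<zeta>"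
    by (simp_all add: r_def \<rho>0)
  \<comment> \<open>\<open>\<phi> \<circ> g\<close> and \<open>e\<close> have the same Gram kernel,
    so an isometry between the coefficient spaces reduces counts for \<phi> in the rotated chart to
    \<open>expected_zeros\<close>.\<close>
  have transfer: "\<exists>T :: 'v \<Rightarrow> (real ^ 4) \<times> coeffs. (\<forall>\<xi> x. T \<xi> \<bullet> e x = \<xi> \<bullet> \<phi> (g x)) \<and>
      (\<forall>B. fsigma B \<longrightarrow> (\<integral>\<^sup>+\<xi>. ecard (zeros B (T \<xi>)) * ennreal (\<rho> (norm \<xi>)) \<partial>lborel)
        = (\<integral>\<^sup>+A. indicator B A * ennreal (1 / (chart_gram A)\<^sup>2) \<partial>lborel) * (ennreal (1 / (16 * c\<^sup>2 * k\<^sup>2)) * res_integral r))"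
    if g: "isometry g" for g
  proof -
    have "\<phi> (g x) \<bullet> \<phi> (g y) = e x \<bullet> e y" for x y
      unfolding gram e_gram isometry_inner[OF g] ..
    then obtain T :: "'v \<Rightarrow> (real ^ 4) \<times> coeffs" where T: "linear T" "\<And>x. norm (T x) = norm x" "\<And>x. T (\<phi> (g x)) = e x"
      using isometry_of_gram[of "\<lambda>x. \<phi> (g x)" e] dim DIM_coeffs by metis
    have inner: "T x \<bullet> T y = x \<bullet> y" for x y
      unfolding dot_norm linear_add[OF T(1), symmetric] T(2) ..
    have distr: "distr lborel borel T = lborel"
      by (rule lborel_distr_isometry[where 'n = 20, OF T(1,2) dim DIM_coeffs])
    have [measurable]: "T \<in> borel_measurable borel" using T(1) by (rule borel_measurable_linear)
    show ?thesis
    proof (intro exI[of _ T] conjI allI impI)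
      show "T \<xi> \<bullet> e x = \<xi> \<bullet> \<phi> (g x)" for \<xi> x using inner[of \<xi> "\<phi> (g x)"] by (simp add: T(3))
      fix B :: "(real ^ 4) set" assume B: "fsigma B"
      note [measurable] = measurable_ecard_zeros[OF B] r(1)
      have "(\<integral>\<^sup>+\<xi>. ecard (zeros B (T \<xi>)) * ennreal (\<rho> (norm \<xi>)) \<partial>lborel)
        = (\<integral>\<^sup>+\<xi>. ecard (zeros B (T \<xi>)) * ennreal (r (T \<xi>)) \<partial>lborel)"
        by (simp add: r_def T(2))
      also have "\<dots> = (\<integral>\<^sup>+\<eta>. ecard (zeros B \<eta>) * ennreal (r \<eta>) \<partial>distr lborel borel T)"
        by (subst nn_integral_distr) simp_all
      also have "\<dots> = (\<integral>\<^sup>+A. indicator B A * ennreal (1 / (chart_gram A)\<^sup>2) \<partial>lborel) * (ennreal (1 / (16 * c\<^sup>2 * k\<^sup>2)) * res_integral r)"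
        unfolding distr by (rule expected_zeros[OF B r])
      finally show "(\<integral>\<^sup>+\<xi>. ecard (zeros B (T \<xi>)) * ennreal (\<rho> (norm \<xi>)) \<partial>lborel)
        = (\<integral>\<^sup>+A. indicator B A * ennreal (1 / (chart_gram A)\<^sup>2) \<partial>lborel) * (ennreal (1 / (16 * c\<^sup>2 * k\<^sup>2)) * res_integral r)" .
    qed
  qed
  have other: "(\<integral>\<^sup>+\<xi>. cell (i, j) \<xi> * ennreal (\<rho> (norm \<xi>)) \<partial>lborel) = 0"
    if ij: "i < j" "(i, j) \<noteq> (0, 1)" for i j
  proof -
    obtain g where g: "isometry g"
      "\<And>v w. rref i j v w \<Longrightarrow> \<exists>A. g (row1 A) = v \<and> g (row2 A) = w \<and> ((i, j) \<noteq> (0, 1) \<longrightarrow> A $ 1 = 0 \<or> A $ 3 = 0)"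
      using rref_rows[OF ij(1)] by metis
    obtain T :: "'v \<Rightarrow> (real ^ 4) \<times> coeffs" where T: "\<And>\<xi> x. T \<xi> \<bullet> e x = \<xi> \<bullet> \<phi> (g x)"
      "\<And>B. fsigma B \<Longrightarrow> (\<integral>\<^sup>+\<xi>. ecard (zeros B (T \<xi>)) * ennreal (\<rho> (norm \<xi>)) \<partial>lborel)
        = (\<integral>\<^sup>+A. indicator B A * ennreal (1 / (chart_gram A)\<^sup>2) \<partial>lborel) * (ennreal (1 / (16 * c\<^sup>2 * k\<^sup>2)) * res_integral r)"
      using transfer[OF g(1)] by blast
    have lg: "linear g" using g(1) by (simp add: isometry_def)
    define B where "B = {A :: real ^ 4. A $ 1 = 0 \<or> A $ 3 = 0}"
    have "closed B" unfolding B_def by (intro closed_Collect_disj closed_Collect_eq continuous_intros)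
    then have B: "fsigma B" by (rule fsigma_closed)
    have "negligible B"
    proof -
      have "negligible {A :: real ^ 4. A $ i = 0}" for i
        by (rule negligible_standard_hyperplane_cart)
      then show ?thesis unfolding B_def Collect_disj_eq by (intro negligible_Un)
    qed
    then have "B \<in> null_sets lebesgue" by (simp add: negligible_iff_null_sets)
    then have nB: "B \<in> null_sets lborel"
      using \<open>closed B\<close> by (simp add: null_sets_def)
    have i0: "(\<integral>\<^sup>+A. indicator B A * ennreal (1 / (chart_gram A)\<^sup>2) \<partial>lborel) = 0"
      using nn_integral_null_set[OF nB, of "\<lambda>A. ennreal (1 / (chart_gram A)\<^sup>2)"] by (simp add: mult.commute)
    have le: "cell (i, j) \<xi> \<le> ecard (zeros B (T \<xi>))" for \<xi>
    proof -
      let ?X = "{(v, w). rref i j v w \<and> (\<forall>x\<in>span {v, w}. \<xi> \<bullet> \<phi> x = 0)}"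
      let ?f = "\<lambda>A. (g (row1 A), g (row2 A))"
      have "?X \<subseteq> ?f ` zeros B (T \<xi>)"
      proof (clarify)
        fix v w assume vw: "rref i j v w" "\<forall>x\<in>span {v, w}. \<xi> \<bullet> \<phi> x = 0"
        obtain A where A: "g (row1 A) = v" "g (row2 A) = w" "A $ 1 = 0 \<or> A $ 3 = 0" using g(2)[OF vw(1)] ij(2) by blast
        have "\<forall>i. T \<xi> \<bullet> e (pt i A) = 0"
          using vanishes_on_chart_plane_iff[OF cub lg T(1)] vw(2) unfolding A(1,2)[symmetric] by blast
        then have "A \<in> zeros B (T \<xi>)" using A(3) by (simp add: zeros_def B_def)
        then show "(v, w) \<in> ?f ` zeros B (T \<xi>)" using A by force
      qed
      then have "ecard ?X \<le> ecard (?f ` zeros B (T \<xi>))" by (rule ecard_mono)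
      also have "\<dots> = ecard (zeros B (T \<xi>))"
      proof (rule ecard_image_inj, rule inj_onI)
        fix A A' assume eq: "?f A = ?f A'"
        have "inj g"
          using linear_injective_0[OF lg] g(1) by (metis isometry_def norm_eq_zero)
        then have "row1 A = row1 A'" "row2 A = row2 A'" using eq by (auto dest: injD)
        then show "A = A'" by (simp add: row1_def row2_def vec_eq_4')
      qed
      finally show ?thesis by (simp add: cell_def)
    qed
    have "(\<integral>\<^sup>+\<xi>. cell (i, j) \<xi> * ennreal (\<rho> (norm \<xi>)) \<partial>lborel) \<le> (\<integral>\<^sup>+\<xi>. ecard (zeros B (T \<xi>)) * ennreal (\<rho> (norm \<xi>)) \<partial>lborel)"
      by (intro nn_integral_mono mult_right_mono le) simp
    also have "\<dots> = 0" unfolding T(2)[OF B] i0 by simp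
    finally show ?thesis by simp
  qed
  have main: "(\<integral>\<^sup>+\<xi>. cell (0, 1) \<xi> * ennreal (\<rho> (norm \<xi>)) \<partial>lborel)
    = ennreal (2 * pi\<^sup>2) * (ennreal (1 / (16 * c\<^sup>2 * k\<^sup>2)) * res_integral r)"
  proof -
    have id: "isometry (\<lambda>x. x)" by (simp add: isometry_def linear_id[unfolded id_def])
    obtain T :: "'v \<Rightarrow> (real ^ 4) \<times> coeffs" where T: "\<And>\<xi> x. T \<xi> \<bullet> e x = \<xi> \<bullet> \<phi> x"
      "\<And>B. fsigma B \<Longrightarrow> (\<integral>\<^sup>+\<xi>. ecard (zeros B (T \<xi>)) * ennreal (\<rho> (norm \<xi>)) \<partial>lborel)
        = (\<integral>\<^sup>+A. indicator B A * ennreal (1 / (chart_gram A)\<^sup>2) \<partial>lborel) * (ennreal (1 / (16 * c\<^sup>2 * k\<^sup>2)) * res_integral r)"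
      using transfer[OF id] by blast
    have eq: "cell (0, 1) \<xi> = ecard (zeros UNIV (T \<xi>))" for \<xi>
    proof -
      let ?f = "\<lambda>A. (row1 A, row2 A)"
      have "{(v, w). rref 0 1 v w \<and> (\<forall>x\<in>span {v, w}. \<xi> \<bullet> \<phi> x = 0)} = ?f ` zeros UNIV (T \<xi>)"
        using vanishes_on_chart_plane_iff[OF cub linear_id[unfolded id_def] T(1)]
        unfolding rref_0_1 zeros_def by auto
      moreover have "inj_on ?f (zeros UNIV (T \<xi>))"
        by (rule inj_onI) (simp add: row1_def row2_def vec_eq_4')
      ultimately show ?thesis by (simp add: cell_def ecard_image_inj)
    qed
    have U: "fsigma (UNIV :: (real ^ 4) set)" by (rule fsigma_closed) simp
    show ?thesis using T(2)[OF U] by (simp add: eq nn_integral_chart_gram)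
  qed
  have "(\<integral>\<^sup>+\<xi>. num_lines (\<lambda>x. \<xi> \<bullet> \<phi> x) * ennreal (\<rho> (norm \<xi>)) \<partial>lborel)
    = (\<integral>\<^sup>+\<xi>. (\<Sum>p\<in>{(i, j). i < j}. cell p \<xi> * ennreal (\<rho> (norm \<xi>))) \<partial>lborel)"
  proof (rule nn_integral_cong)
    fix \<xi>
    have "num_lines (\<lambda>x. \<xi> \<bullet> \<phi> x) = (\<Sum>p\<in>{(i, j). i < j}. cell p \<xi>)"
      unfolding num_lines_eq_rref cell_def by (rule sum.cong[OF refl]) auto
    then show "num_lines (\<lambda>x. \<xi> \<bullet> \<phi> x) * ennreal (\<rho> (norm \<xi>)) = (\<Sum>p\<in>{(i, j). i < j}. cell p \<xi> * ennreal (\<rho> (norm \<xi>)))"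
      by (simp add: sum_distrib_right)
  qed
  also have "\<dots> = (\<Sum>p\<in>{(i, j). i < j}. \<integral>\<^sup>+\<xi>. cell p \<xi> * ennreal (\<rho> (norm \<xi>)) \<partial>lborel)"
    by (rule nn_integral_sum) measurable
  also have "\<dots> = (\<Sum>p\<in>{(0, 1)}. \<integral>\<^sup>+\<xi>. cell p \<xi> * ennreal (\<rho> (norm \<xi>)) \<partial>lborel)"
    using other less_4' by (intro sum.mono_neutral_right) auto
  finally show ?thesis using main by (simp add: r_def)
qed

end

text \<open>The four plain squares and the two mixed relations fix everything but \<open>p\<close>
  and \<open>q\<close>. For these,
  \<open>(2 * L + m) * (8 * L + m) - (m - 4 * L)^2 = 18 * L * m\<close> is nonnegative and supplies
  the square roots.\<close>

lemma invariant_feature_map_coefficients: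
  fixes L m :: real
  assumes "0 < L" "0 \<le> m"
  shows "invariant_feature_map (sqrt (2 * L)) (sqrt (2 * L + m)) ((m - 4 * L) / sqrt (2 * L + m)) (sqrt (18 * L * m) / sqrt (2 * L + m))
    (sqrt (8 * L + m)) ((m - 4 * L) / sqrt (8 * L + m)) (sqrt (18 * L * m) / sqrt (8 * L + m)) (sqrt (12 * L)) L m"
proof
  have pos: "0 < 2 * L + m" "0 < 8 * L + m" "0 \<le> 18 * L * m" using assms by auto
  show "(sqrt (2 * L))\<^sup>2 = 2 * L" "(sqrt (2 * L + m))\<^sup>2 = 2 * L + m" "(sqrt (8 * L + m))\<^sup>2 = 8 * L + m" "(sqrt (12 * L))\<^sup>2 = 12 * L"
    "sqrt (2 * L + m) * ((m - 4 * L) / sqrt (2 * L + m)) = m - 4 * L"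
    "sqrt (8 * L + m) * ((m - 4 * L) / sqrt (8 * L + m)) = m - 4 * L" "sqrt (2 * L) \<noteq> 0" "sqrt (2 * L + m) \<noteq> 0"
    using assms pos by auto
  have "((m - 4 * L) / sqrt r)\<^sup>2 + (sqrt (18 * L * m) / sqrt r)\<^sup>2 = ((2 * L + m) * (8 * L + m)) / r" if "0 < r" for r
    using that pos(3) by (simp add: power_divide add_divide_distrib[symmetric]) (simp add: algebra_simps power2_eq_square)
  from this[OF pos(1)] this[OF pos(2)]
  show "((m - 4 * L) / sqrt (2 * L + m))\<^sup>2 + (sqrt (18 * L * m) / sqrt (2 * L + m))\<^sup>2 = 8 * L + m"
    "((m - 4 * L) / sqrt (8 * L + m))\<^sup>2 + (sqrt (18 * L * m) / sqrt (8 * L + m))\<^sup>2 = 2 * L + m"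
    using pos by simp_all
qed

theorem expected_num_lines_gaussian:
  fixes \<phi> :: "real ^ 4 \<Rightarrow> 'v::euclidean_space"
  assumes L: "0 < L" "0 \<le> m"
    and cub: "\<And>\<xi>. cubic_form (\<lambda>x. \<xi> \<bullet> \<phi> x)" and cont: "continuous_on UNIV \<phi>" and dim: "DIM('v) = 20"
    and gram: "\<And>x y. \<phi> x \<bullet> \<phi> y = 8 * L * (x \<bullet> y) ^ 3 + (m - 4 * L) * (x \<bullet> x) * (y \<bullet> y) * (x \<bullet> y)"
  shows "(\<integral>\<^sup>+\<xi>. num_lines (\<lambda>x. \<xi> \<bullet> \<phi> x) * ennreal (exp (- (norm \<xi>)\<^sup>2 / 2) / sqrt (2 * pi) ^ 20) \<partial>lborel)
    = ennreal (9 * (8 * L + m) / (2 * L + m) * (2 * L / (8 * L + m) - 1 / 3 + 2 / 3 * sqrt ((8 * L + m) / (20 * L + m))))"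
proof -
  let ?k = "sqrt (2 * L + m)" and ?a = "sqrt (8 * L + m)" and ?s = "sqrt (12 * L)"
  interpret F: invariant_feature_map "sqrt (2 * L)" ?k "(m - 4 * L) / ?k" "sqrt (18 * L * m) / ?k"
    ?a "(m - 4 * L) / ?a" "sqrt (18 * L * m) / ?a" ?s L m
    by (rule invariant_feature_map_coefficients[OF L])
  define z where "z = sqrt ((8 * L + m) / (20 * L + m))"
  note num_lines_measurable[OF cub cont, measurable]
  have pi20: "sqrt (2 * pi) ^ 20 = (2 * pi) ^ 10"
    using power_mult[of "sqrt (2 * pi)" 2 10] by simp
  have m': "ennreal x * ennreal y = ennreal (x * y)" if "0 \<le> x" for x y
    using that ennreal_mult'[of x y] by simp
  have "(\<integral>\<^sup>+\<xi>. num_lines (\<lambda>x. \<xi> \<bullet> \<phi> x) * ennreal (exp (- (norm \<xi>)\<^sup>2 / 2) / sqrt (2 * pi) ^ 20) \<partial>lborel)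
    = (\<integral>\<^sup>+\<xi>. ennreal (1 / (2 * pi) ^ 10) * (num_lines (\<lambda>x. \<xi> \<bullet> \<phi> x) * ennreal (exp (- (norm \<xi>)\<^sup>2 / 2))) \<partial>lborel)"
  proof (rule nn_integral_cong)
    fix \<xi> :: 'v
    have "ennreal (exp (- (norm \<xi>)\<^sup>2 / 2) / sqrt (2 * pi) ^ 20) = ennreal (1 / (2 * pi) ^ 10) * ennreal (exp (- (norm \<xi>)\<^sup>2 / 2))"
      by (subst m') (simp_all add: pi20)
    then show "num_lines (\<lambda>x. \<xi> \<bullet> \<phi> x) * ennreal (exp (- (norm \<xi>)\<^sup>2 / 2) / sqrt (2 * pi) ^ 20)
      = ennreal (1 / (2 * pi) ^ 10) * (num_lines (\<lambda>x. \<xi> \<bullet> \<phi> x) * ennreal (exp (- (norm \<xi>)\<^sup>2 / 2)))"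
      by (simp only: ac_simps)
  qed
  also have "\<dots> = ennreal (1 / (2 * pi) ^ 10) * (\<integral>\<^sup>+\<xi>. num_lines (\<lambda>x. \<xi> \<bullet> \<phi> x) * ennreal (exp (- (norm \<xi>)\<^sup>2 / 2)) \<partial>lborel)"
    by (rule nn_integral_cmult) measurable
  also have "(\<integral>\<^sup>+\<xi>. num_lines (\<lambda>x. \<xi> \<bullet> \<phi> x) * ennreal (exp (- (norm \<xi>)\<^sup>2 / 2)) \<partial>lborel)
    = ennreal (2 * pi\<^sup>2) * (ennreal (1 / (16 * (sqrt (2 * L))\<^sup>2 * ?k\<^sup>2)) * F.res_integral (\<lambda>\<eta>. exp (- (norm \<eta>)\<^sup>2 / 2)))"
    by (rule F.expected_num_lines[where \<rho> = "\<lambda>t. exp (- t\<^sup>2 / 2)", OF cub cont]) (simp_all add: dim gram F.e_gram)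
  also have "F.res_integral (\<lambda>\<eta>. exp (- (norm \<eta>)\<^sup>2 / 2))
    = ennreal ((2 * pi) ^ 5 * (32 * pi ^ 3 * ?s\<^sup>2 * (8 * ?a\<^sup>2 * sqrt (?a\<^sup>2 / (?a\<^sup>2 + ?s\<^sup>2)) + 2 * ?s\<^sup>2 - 4 * ?a\<^sup>2)))"
    by (rule F.res_integral_value) (use L in auto)
  also have "\<dots> = ennreal ((2 * pi) ^ 5 * (32 * pi ^ 3 * (12 * L) * (8 * (8 * L + m) * z + 24 * L - 4 * (8 * L + m))))"
    using L by (simp add: F.rel z_def add_ac)
  also have "ennreal (1 / (2 * pi) ^ 10) * (ennreal (2 * pi\<^sup>2) * (ennreal (1 / (16 * (sqrt (2 * L))\<^sup>2 * ?k\<^sup>2)) * \<dots>))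
    = ennreal (1 / (2 * pi) ^ 10 * (2 * pi\<^sup>2 * (1 / (16 * (sqrt (2 * L))\<^sup>2 * ?k\<^sup>2) *
        ((2 * pi) ^ 5 * (32 * pi ^ 3 * (12 * L) * (8 * (8 * L + m) * z + 24 * L - 4 * (8 * L + m)))))))"
    by (simp only: m' zero_le_power2 zero_le_power zero_le_divide_1_iff mult_nonneg_nonneg pi_ge_zero zero_le_numeral)
  also have "1 / (2 * pi) ^ 10 * (2 * pi\<^sup>2 * (1 / (16 * (sqrt (2 * L))\<^sup>2 * ?k\<^sup>2) *
        ((2 * pi) ^ 5 * (32 * pi ^ 3 * (12 * L) * (8 * (8 * L + m) * z + 24 * L - 4 * (8 * L + m))))))
    = 9 * (8 * L + m) / (2 * L + m) * (2 * L / (8 * L + m) - 1 / 3 + 2 / 3 * z)"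
  proof -
    have pos: "0 < 2 * L + m" "0 < 8 * L + m" using L by auto
    \<comment> \<open>The powers of \<pi> cancel, -10 + 2 + 5 + 3 = 0, and the rational factor is 2
      * 32 * 12 / (2^5 * 32) = 3/4.\<close>
    have "1 / (2 * pi) ^ 10 * (2 * pi\<^sup>2 * (1 / (16 * (2 * L) * K) * ((2 * pi) ^ 5 * (32 * pi ^ 3 * (12 * L) * Q))))
      = 3 / 4 * Q / K" if "0 < K" for Q K
      using L that by (simp add: field_simps power2_eq_square power3_eq_cube eval_nat_numeral)
    moreover have "3 / 4 * (8 * (8 * L + m) * z + 24 * L - 4 * (8 * L + m)) / (2 * L + m)
      = 9 * (8 * L + m) / (2 * L + m) * (2 * L / (8 * L + m) - 1 / 3 + 2 / 3 * z)"
      using pos by (simp add: divide_simps) (simp add: algebra_simps)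
    ultimately show ?thesis unfolding F.rel(1,2) using pos by simp
  qed
  finally show ?thesis unfolding z_def .
qed

lemma cubic_form_continuous: "cubic_form P \<Longrightarrow> continuous_on UNIV P"
proof -
  assume "cubic_form P"
  then obtain T where "\<And>x. P x = (\<Sum>i\<in>UNIV. \<Sum>j\<in>UNIV. \<Sum>k\<in>UNIV. T i j k * (x $ i * x $ j * x $ k))"
    unfolding cubic_form_def by blast
  then have "P = (\<lambda>x. \<Sum>i\<in>UNIV. \<Sum>j\<in>UNIV. \<Sum>k\<in>UNIV. T i j k * (x $ i * x $ j * x $ k))" by blast
  then show ?thesis by (simp only:) (intro continuous_intros)
qed

lemma num_lines_cmult: "r \<noteq> 0 \<Longrightarrow> num_lines (\<lambda>x. r * P x) = num_lines P"
  by (simp add: num_lines_def proj_zero_set_def)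

theorem theorem1:
  fixes M :: "'w measure"
    and H3 :: "16 \<Rightarrow> real ^ 4 \<Rightarrow> real" and H1 :: "4 \<Rightarrow> real ^ 4 \<Rightarrow> real"
    and \<xi>3 :: "16 \<Rightarrow> 'w \<Rightarrow> real" and \<xi>1 :: "4 \<Rightarrow> 'w \<Rightarrow> real"
  assumes M: "prob_space M"
    and H3_basis: "fun_basis (harmonic_poly 3) H3"
    and H1_basis: "fun_basis (harmonic_poly 1) H1"
    and H3_orthonormal: "L2_orthonormal H3"
    and H1_orthonormal: "L2_orthonormal (\<lambda>j x. (norm x)\<^sup>2 * H1 j x)"
    and \<xi>3_gaussian: "\<And>j. distributed M lborel (\<xi>3 j) std_normal_density"
    and \<xi>1_gaussian: "\<And>j. distributed M lborel (\<xi>1 j) std_normal_density"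
    and indep: "prob_space.indep_vars M (\<lambda>_. borel) (case_sum \<xi>3 \<xi>1) UNIV"
  shows "(\<forall>l\<in>{0..1}. (\<lambda>\<omega>. num_lines (random_cubic H3 H1 \<xi>3 \<xi>1 l \<omega>)) \<in> borel_measurable M) \<and>
    (\<forall>l\<in>{0<..1}. expected_lines M (random_cubic H3 H1 \<xi>3 \<xi>1 l) = ennreal (lines_formula l)) \<and>
    ((\<lambda>l. expected_lines M (random_cubic H3 H1 \<xi>3 \<xi>1 l)) \<longlongrightarrow> ennreal (lines_formula 0)) (at_right 0)"
proof -
  define \<eta> where "\<eta> = (\<lambda>\<omega>. ((\<chi> j. \<xi>1 j \<omega>) :: real ^ 4, (\<chi> j. \<xi>3 j \<omega>) :: real ^ 16))"
  \<comment> \<open>The weights \<open>l\<close> and \<open>1 - l\<close> are put into the feature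
    map, so that the coefficient vector \<eta> is standard Gaussian for every
    \<open>l\<close>.\<close>
  define \<phi> where "\<phi> l x = ((\<chi> j. (1 - l) * ((norm x)\<^sup>2 * H1 j x)) :: real ^ 4, (\<chi> j. l * H3 j x) :: real ^ 16)" for l x
  have inner_\<phi>: "(u, v) \<bullet> \<phi> l x = (\<Sum>j\<in>UNIV. (u $ j * (1 - l)) * ((norm x)\<^sup>2 * H1 j x)) + (\<Sum>j\<in>UNIV. (v $ j * l) * H3 j x)" for u v l x
    by (simp add: \<phi>_def inner_vec_def mult.assoc)
  have random: "random_cubic H3 H1 \<xi>3 \<xi>1 l \<omega> = (\<lambda>x. \<eta> \<omega> \<bullet> \<phi> l x)" for l \<omega>
    unfolding random_cubic_def[abs_def] \<eta>_def inner_\<phi> sum_distrib_left by (simp add: mult_ac add.commute)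
  have \<eta>[measurable]: "\<eta> \<in> borel_measurable M"
    and law: "distr M borel \<eta> = density lborel (\<lambda>x. ennreal (exp (- (norm x)\<^sup>2 / 2) / sqrt (2 * pi) ^ 20))"
    using prob_space.gaussian_pair_law[OF M \<xi>3_gaussian \<xi>1_gaussian indep] unfolding \<eta>_def by simp_all
  have H3: "cubic_form (H3 j)" for j
    using H3_basis hom_poly_3_imp_cubic_form by (simp add: fun_basis_def harmonic_poly_def)
  have H1: "cubic_form (\<lambda>x. (norm x)\<^sup>2 * H1 j x)" for j
  proof -
    have cub3: "cubic_form (cub T)" for T unfolding cubic_form_def cub_def by blast
    have "H1 j \<in> hom_poly 1" using H1_basis by (simp add: fun_basis_def harmonic_poly_def)
    then obtain a where a: "\<And>x. H1 j x = a \<bullet> x" by (rule hom_poly_1_imp_linear) blast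
    have "(\<lambda>x. (norm x)\<^sup>2 * H1 j x) = cub (\<lambda>i j k. if i = j then a $ k else 0)"
      by (simp add: fun_eq_iff cub_radial a)
    then show ?thesis by (simp add: cub3)
  qed
  have cub: "cubic_form (\<lambda>x. u \<bullet> \<phi> l x)" for u l
    by (cases u, simp only: inner_\<phi>) (intro cubic_form_add cubic_form_sum cubic_form_cmult H1 H3)
  have cont: "continuous_on UNIV (\<phi> l)" for l
    unfolding \<phi>_def
    by (intro continuous_on_Pair continuous_on_vec_lambda continuous_on_mult_left cubic_form_continuous H1 H3)
  note meas = num_lines_measurable[OF cub cont]
  have measurable: "(\<lambda>\<omega>. num_lines (random_cubic H3 H1 \<xi>3 \<xi>1 l \<omega>)) \<in> borel_measurable M" for l
    using measurable_compose[OF \<eta> meas[of l]] unfolding random .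
  have expected: "expected_lines M (random_cubic H3 H1 \<xi>3 \<xi>1 l) = ennreal (lines_formula l)" if l: "l \<in> {0<..1}" for l
  proof -
    \<comment> \<open>Scaling does not change the zeros; it clears the denominators of the reproducing kernels.\<close>
    let ?\<psi> = "\<lambda>x. sqrt 96 *\<^sub>R \<phi> l x"
    have gram: "?\<psi> x \<bullet> ?\<psi> y = 8 * l\<^sup>2 * (x \<bullet> y) ^ 3 + ((1 - l)\<^sup>2 - 4 * l\<^sup>2) * (x \<bullet> x) * (y \<bullet> y) * (x \<bullet> y)" for x y
    proof -
      have "\<phi> l x \<bullet> \<phi> l y = (1 - l)\<^sup>2 * ((norm x)\<^sup>2 * (norm y)\<^sup>2 * (\<Sum>j\<in>UNIV. H1 j x * H1 j y)) + l\<^sup>2 * (\<Sum>j\<in>UNIV. H3 j x * H3 j y)"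
        by (simp add: \<phi>_def inner_vec_def sum_distrib_left power2_eq_square mult_ac)
      then have "\<phi> l x \<bullet> \<phi> l y = (1 - l)\<^sup>2 * ((x \<bullet> x) * (y \<bullet> y) * ((x \<bullet> y) / 96))
        + l\<^sup>2 * (((x \<bullet> y) ^ 3 - (x \<bullet> x) * (y \<bullet> y) * (x \<bullet> y) / 2) / 12)"
        unfolding harmonic_1_kernel[OF H1_basis H1_orthonormal] harmonic_3_kernel[OF H3_basis H3_orthonormal] power2_norm_eq_inner .
      moreover have "?\<psi> x \<bullet> ?\<psi> y = 96 * (\<phi> l x \<bullet> \<phi> l y)" by simp
      ultimately show ?thesis by (simp add: field_simps)
    qed
    have cub': "cubic_form (\<lambda>x. u \<bullet> ?\<psi> x)" for u
      unfolding inner_scaleR_right by (rule cubic_form_cmult[OF cub])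
    have cont': "continuous_on UNIV ?\<psi>" by (intro continuous_intros cont)
    have "expected_lines M (random_cubic H3 H1 \<xi>3 \<xi>1 l) = (\<integral>\<^sup>+\<xi>. num_lines (\<lambda>x. \<xi> \<bullet> \<phi> l x) \<partial>distr M borel \<eta>)"
      unfolding expected_lines_def random by (subst nn_integral_distr) (simp_all add: meas)
    also have "\<dots> = (\<integral>\<^sup>+\<xi>. num_lines (\<lambda>x. \<xi> \<bullet> ?\<psi> x) * ennreal (exp (- (norm \<xi>)\<^sup>2 / 2) / sqrt (2 * pi) ^ 20) \<partial>lborel)"
      unfolding law inner_scaleR_right using num_lines_cmult[of "sqrt 96"]
      by (subst nn_integral_density) (use meas[of l] in \<open>simp_all add: mult.commute[of "ennreal _"]\<close>)
    also have "\<dots> = ennreal (9 * (8 * l\<^sup>2 + (1 - l)\<^sup>2) / (2 * l\<^sup>2 + (1 - l)\<^sup>2) * (2 * l\<^sup>2 / (8 * l\<^sup>2 + (1 - l)\<^sup>2) - 1 / 3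
       + 2 / 3 * sqrt ((8 * l\<^sup>2 + (1 - l)\<^sup>2) / (20 * l\<^sup>2 + (1 - l)\<^sup>2))))"
      by (rule expected_num_lines_gaussian[OF _ _ cub' cont' _ gram]) (use l in simp_all)
    finally show ?thesis unfolding lines_formula_def .
  qed
  have "((\<lambda>l. expected_lines M (random_cubic H3 H1 \<xi>3 \<xi>1 l)) \<longlongrightarrow> ennreal (lines_formula 0)) (at_right 0)"
  proof (rule Lim_transform_eventually)
    \<comment> \<open>At \<open>l = 0\<close> the three denominators of \<open>lines_formula\<close>
      all equal 1.\<close>
    have "isCont lines_formula 0"
      unfolding lines_formula_def by (intro continuous_intros) auto
    then have "(lines_formula \<longlongrightarrow> lines_formula 0) (at_right 0)"
      unfolding isCont_def by (rule filterlim_mono[OF _ order_refl at_le]) simp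
    then show "((\<lambda>l. ennreal (lines_formula l)) \<longlongrightarrow> ennreal (lines_formula 0)) (at_right 0)"
      by (rule tendsto_ennrealI)
    show "\<forall>\<^sub>F l in at_right 0. ennreal (lines_formula l) = expected_lines M (random_cubic H3 H1 \<xi>3 \<xi>1 l)"
      by (rule eventually_at_rightI[of 0 1]) (simp_all add: expected)
  qed
  then show ?thesis using measurable expected by blast
qed

end
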